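(* Let $\hat\rho_0\in L^\infty(\mathbb{T}^d)$ be given by $\hat\rho_0(x):=1$ for $x_1\in(-L/2,0)$ and $\hat\rho_0(x):=-1$ for $x_1\in(0,L/2)$, and set $$\hat T_0:=E^{-\frac12}H_{max}\frac{\sqrt2\,\pi}{4},\qquad H_{max}:=\frac{L^{\frac{d+2}{2}}}{\sqrt{48}}.$$ For any $\varepsilon>0$ there exist infinitely many distributional solutions $(\rho_\varepsilon,v_\varepsilon)$ of $$\partial_t\rho+\mathrm{div}(\rho v)=0,\quad\mathrm{div}\,v=0\quad\text{on }(0,\hat T_0+\varepsilon)\times\mathbb{T}^d,\qquad\rho(0,\cdot)=\hat\rho_0,$$ satisfying $\|v_\varepsilon\|_{L^\infty(0,\hat T_0+\varepsilon;L^2(\mathbb{T}^d;\mathbb{R}^d))}\leq\sqrt E$ and $|\rho_\varepsilon|=1$ almost everywhere on $(0,\hat T_0+\varepsilon)\times\mathbb{T}^d$. Furthermore, $\|\rho_\varepsilon(t,\cdot)\|_{H^{-1}(\mathbb{T}^d)}\to0$ as $t\to\hat T_0+\varepsilon$.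
   Context: Fix $d\geq2$, $L>0$, $E>0$. $\mathbb{T}^d=(\mathbb{R}/L\mathbb{Z})^d$ is the flat torus with side length $L$, with points $x=(x_1,\dots,x_d)$. For $f\in L^2(\mathbb{T}^d)$ with zero average, $\|f\|_{H^{-1}(\mathbb{T}^d)}:=\|\nabla\varphi\|_{L^2(\mathbb{T}^d)}$ where $\Delta\varphi=f$. For $T>0$, a distributional solution on $(0,T)\times\mathbb{T}^d$ with initial data $\rho_0$ is a pair $\rho\in L^\infty((0,T)\times\mathbb{T}^d)$, $v\in L^\infty(0,T;L^2(\mathbb{T}^d;\mathbb{R}^d))$ such that for all $\psi\in\mathcal{C}^\infty_c([0,T)\times\mathbb{T}^d)$ $$\int_0^T\int_{\mathbb{T}^d}\rho\,\partial_t\psi+\rho\, v\cdot\nabla\psi\,dx\,dt+\int_{\mathbb{T}^d}\rho_0\,\psi(0,\cdot)\,dx=0,$$ and $\int_0^T\int_{\mathbb{T}^d}v\cdot\nabla\psi\,dx\,dt=0$ for all $\psi\in\mathcal{C}^\infty([0,T]\times\mathbb{T}^d)$. The density $\rho$ is taken in its representative in $\mathcal{C}^0([0,T);L^2_w(\mathbb{T}^d))$ (continuous in time with values in $L^2$ with the weak topology), so that $\|\rho(t,\cdot)\|_{H^{-1}(\mathbb{T}^d)}$ is well-defined for every $t\in[0,T)$. *)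

theory Defs
  imports "HOL-Analysis.Analysis"
begin

text \<open>
  The torus of side length \<open>L\<close> is represented by the fundamental cell \<open>[-L/2, L/2]^d\<close>, and functions
  on it by functions on \<open>real ^ 'n\<close>, \<open>d = CARD('n)\<close>, that are \<open>L\<close>-periodic in every coordinate.
  The opposite faces contained twice in the closed cell are null sets.
\<close>

definition torus_periodic :: "real \<Rightarrow> (real ^ 'n \<Rightarrow> 'b) \<Rightarrow> bool" where
  "torus_periodic L f \<longleftrightarrow> (\<forall>x i. f (x + L *\<^sub>R axis i 1) = f x)"

definition torus_cell :: "real \<Rightarrow> (real ^ 'n) set" where
  "torus_cell L = cbox (\<chi> i. - L / 2) (\<chi> i. L / 2)"

definition torus :: "real \<Rightarrow> (real ^ 'n) measure" where
  "torus L = lebesgue_on (torus_cell L)"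

definition spacetime :: "real \<Rightarrow> real \<Rightarrow> (real \<times> (real ^ 'n)) measure" where
  "spacetime L T = lebesgue_on ({0<..<T} \<times> torus_cell L)"

definition torus_L2 :: "real \<Rightarrow> (real ^ 'n \<Rightarrow> 'b::euclidean_space) \<Rightarrow> bool" where
  "torus_L2 L f \<longleftrightarrow> torus_periodic L f \<and> f \<in> borel_measurable (torus L) \<and>
     integrable (torus L) (\<lambda>x. (norm (f x))\<^sup>2)"

definition L2_norm :: "real \<Rightarrow> (real ^ 'n \<Rightarrow> 'b::euclidean_space) \<Rightarrow> real" where
  "L2_norm L f = sqrt (LINT x|torus L. (norm (f x))\<^sup>2)"

definition torus_Linf :: "real \<Rightarrow> (real ^ 'n \<Rightarrow> real) \<Rightarrow> bool" where
  "torus_Linf L f \<longleftrightarrow> torus_periodic L f \<and> f \<in> borel_measurable (torus L) \<and>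
     (\<exists>C. AE x in torus L. \<bar>f x\<bar> \<le> C)"

definition spacetime_Linf :: "real \<Rightarrow> real \<Rightarrow> (real \<Rightarrow> real ^ 'n \<Rightarrow> real) \<Rightarrow> bool" where
  "spacetime_Linf L T \<rho> \<longleftrightarrow> (\<lambda>(t, x). \<rho> t x) \<in> borel_measurable (spacetime L T) \<and>
     (\<exists>C. AE (t, x) in spacetime L T. \<bar>\<rho> t x\<bar> \<le> C)"

definition Linf_L2 :: "real \<Rightarrow> real \<Rightarrow> (real \<Rightarrow> real ^ 'n \<Rightarrow> real ^ 'n) \<Rightarrow> bool" where
  "Linf_L2 L T v \<longleftrightarrow> (\<lambda>(t, x). v t x) \<in> borel_measurable (spacetime L T) \<and>
     (AE t in lebesgue_on {0<..<T}. torus_L2 L (v t)) \<and>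
     (\<exists>C. AE t in lebesgue_on {0<..<T}. L2_norm L (v t) \<le> C)"

text \<open>The essential supremum of \<open>L2_norm L (v t)\<close>; meaningful only if \<open>Linf_L2 L T v\<close>.\<close>

definition Linf_L2_norm :: "real \<Rightarrow> real \<Rightarrow> (real \<Rightarrow> real ^ 'n \<Rightarrow> real ^ 'n) \<Rightarrow> real" where
  "Linf_L2_norm L T v = Inf {C. 0 \<le> C \<and> (AE t in lebesgue_on {0<..<T}. L2_norm L (v t) \<le> C)}"

definition weakly_continuous :: "real \<Rightarrow> real \<Rightarrow> (real \<Rightarrow> real ^ 'n \<Rightarrow> real) \<Rightarrow> bool" where
  "weakly_continuous L T \<rho> \<longleftrightarrow> (\<forall>t\<in>{0..<T}. torus_L2 L (\<rho> t)) \<and>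
     (\<forall>g. torus_L2 L g \<longrightarrow> continuous_on {0..<T} (\<lambda>t. LINT x|torus L. \<rho> t x * g x))"

text \<open>
  Differentiability is taken within \<open>S\<close>, so that one-sided time derivatives are used at the
  end points of \<open>[0,T)\<close> and \<open>[0,T]\<close>. In finite dimension, continuity of all directional
  derivatives amounts to continuity of the derivative.
\<close>

primrec Ck_on :: "nat \<Rightarrow> 'a::euclidean_space set \<Rightarrow> ('a \<Rightarrow> real) \<Rightarrow> bool" where
  "Ck_on 0 S f \<longleftrightarrow> continuous_on S f"
| "Ck_on (Suc k) S f \<longleftrightarrow> (\<exists>f'. (\<forall>x\<in>S. (f has_derivative f' x) (at x within S)) \<and>
     (\<forall>h. Ck_on k S (\<lambda>x. f' x h)))"

definition smooth_on :: "'a::euclidean_space set \<Rightarrow> ('a \<Rightarrow> real) \<Rightarrow> bool" where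
  "smooth_on S f \<longleftrightarrow> (\<forall>k. Ck_on k S f)"

definition grad :: "(real ^ 'n \<Rightarrow> real) \<Rightarrow> real ^ 'n \<Rightarrow> real ^ 'n" where
  "grad f x = (\<chi> i. frechet_derivative f (at x) (axis i 1))"

definition torus_smooth :: "real \<Rightarrow> (real ^ 'n \<Rightarrow> real) \<Rightarrow> bool" where
  "torus_smooth L \<psi> \<longleftrightarrow> torus_periodic L \<psi> \<and> smooth_on UNIV \<psi>"

text \<open>Smooth functions on \<open>I\<close> times the torus, for a time interval \<open>I\<close>.\<close>

definition torus_smooth_on :: "real \<Rightarrow> real set \<Rightarrow> (real \<Rightarrow> real ^ 'n \<Rightarrow> real) \<Rightarrow> bool" where
  "torus_smooth_on L I \<psi> \<longleftrightarrow> (\<forall>t\<in>I. torus_periodic L (\<psi> t)) \<and>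
     smooth_on (I \<times> UNIV) (\<lambda>(t, x). \<psi> t x)"

text \<open>As the torus is compact, compact support is a condition on the time variable only.\<close>

definition torus_test_function :: "real \<Rightarrow> real \<Rightarrow> (real \<Rightarrow> real ^ 'n \<Rightarrow> real) \<Rightarrow> bool" where
  "torus_test_function L T \<psi> \<longleftrightarrow> torus_smooth_on L {0..<T} \<psi> \<and>
     (\<exists>s<T. \<forall>t\<in>{0..<T}. s < t \<longrightarrow> (\<forall>x. \<psi> t x = 0))"

definition weak_gradient :: "real \<Rightarrow> (real ^ 'n \<Rightarrow> real) \<Rightarrow> (real ^ 'n \<Rightarrow> real ^ 'n) \<Rightarrow> bool" where
  "weak_gradient L \<phi> G \<longleftrightarrow> torus_L2 L \<phi> \<and> torus_L2 L G \<and>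
     (\<forall>\<psi>. torus_smooth L \<psi> \<longrightarrow>
        (LINT x|torus L. \<phi> x *\<^sub>R grad \<psi> x) = - (LINT x|torus L. \<psi> x *\<^sub>R G x))"

definition weak_divergence :: "real \<Rightarrow> (real ^ 'n \<Rightarrow> real ^ 'n) \<Rightarrow> (real ^ 'n \<Rightarrow> real) \<Rightarrow> bool" where
  "weak_divergence L G f \<longleftrightarrow> (\<forall>\<psi>. torus_smooth L \<psi> \<longrightarrow>
     (LINT x|torus L. G x \<bullet> grad \<psi> x) = - (LINT x|torus L. f x * \<psi> x))"

text \<open>
  The norm of \<open>\<nabla>\<phi>\<close>, where \<open>\<Delta>\<phi> = div \<nabla>\<phi> = f\<close> in the sense of distributions. For \<open>f\<close> in \<open>L\<^sup>2\<close> with zero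
  average, \<open>\<phi>\<close> exists and \<open>\<nabla>\<phi>\<close> is unique up to null sets; for other \<open>f\<close> the value is unspecified.
\<close>

definition Hminus1_norm :: "real \<Rightarrow> (real ^ 'n \<Rightarrow> real) \<Rightarrow> real" where
  "Hminus1_norm L f =
     (THE r. \<exists>\<phi> G. weak_gradient L \<phi> G \<and> weak_divergence L G f \<and> r = L2_norm L G)"

text \<open>
  Distributional solutions of \<open>\<partial>\<^sub>t\<rho> + div (\<rho> v) = 0\<close>, \<open>div v = 0\<close> with initial data \<open>\<rho>\<^sub>0\<close>; \<open>\<rho>\<close> is
  the representative that is weakly continuous in time.
\<close>

definition distributional_solution ::
    "real \<Rightarrow> real \<Rightarrow> (real ^ 'n \<Rightarrow> real) \<Rightarrow>
     (real \<Rightarrow> real ^ 'n \<Rightarrow> real) \<Rightarrow> (real \<Rightarrow> real ^ 'n \<Rightarrow> real ^ 'n) \<Rightarrow> bool" where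
  "distributional_solution L T \<rho>\<^sub>0 \<rho> v \<longleftrightarrow>
     spacetime_Linf L T \<rho> \<and> weakly_continuous L T \<rho> \<and> Linf_L2 L T v \<and>
     (\<forall>\<psi>. torus_test_function L T \<psi> \<longrightarrow>
        (LINT t|lebesgue_on {0<..<T}. LINT x|torus L.
           \<rho> t x * deriv (\<lambda>s. \<psi> s x) t + \<rho> t x * (v t x \<bullet> grad (\<psi> t) x))
        + (LINT x|torus L. \<rho>\<^sub>0 x * \<psi> 0 x) = 0) \<and>
     (\<forall>\<psi>. torus_smooth_on L {0..T} \<psi> \<longrightarrow>
        (LINT t|lebesgue_on {0<..<T}. LINT x|torus L. v t x \<bullet> grad (\<psi> t) x) = 0)"

text \<open>Equality of two pairs as elements of the Lebesgue spaces.\<close>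

definition same_solution ::
    "real \<Rightarrow> real \<Rightarrow>
     (real \<Rightarrow> real ^ 'n \<Rightarrow> real) \<times> (real \<Rightarrow> real ^ 'n \<Rightarrow> real ^ 'n) \<Rightarrow>
     (real \<Rightarrow> real ^ 'n \<Rightarrow> real) \<times> (real \<Rightarrow> real ^ 'n \<Rightarrow> real ^ 'n) \<Rightarrow> bool" where
  "same_solution L T p q \<longleftrightarrow>
     (AE (t, x) in spacetime L T. fst p t x = fst q t x \<and> snd p t x = snd q t x)"

definition H_max :: "real \<Rightarrow> nat \<Rightarrow> real" where
  "H_max L d = L powr ((real d + 2) / 2) / sqrt 48"

definition T0_hat :: "real \<Rightarrow> real \<Rightarrow> nat \<Rightarrow> real" where
  "T0_hat E L d = E powr (- 1 / 2) * H_max L d * (sqrt 2 * pi / 4)"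

end

theory Submission
  imports Defs
begin

text \<open>
The solutions are given by explicit formulas: the stripes on which the density is constant are
  broken up again and again, and the \<open>n\<close>-th refinement takes a time proportional to \<open>N^-n\<close>. All of
  this happens in two coordinate directions \<open>k\<close> and \<open>j\<close>; the other coordinates are spectators.

  A single stage transforms stripes of period \<open>L / N^n\<close> orthogonal to one of the two axes into
  stripes of period \<open>L / N^(n + 1)\<close> orthogonal to the other axis. Folding both coordinates
  (\<open>zig\<close>) reduces this to a reference flow in the square \<open>[-1, 1]\<^sup>2\<close>, depending on an angle
  \<open>p \<in> [0, pi/2]\<close> instead of time: the interface between the phases is the line \<open>x = 0\<close> for \<open>p = 0\<close> and
  the line \<open>y = 0\<close> for \<open>p = pi/2\<close>. In between each phase sends a finger into the other, and at angle \<open>p\<close>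
  the fluid moves precisely where \<open>\<bar>x\<bar> < sin\<^sup>2 p\<close>. A particle with label \<open>a\<close> rests at \<open>x = sin\<^sup>2 a\<close> until the
  tip of the finger reaches it at \<open>p = a\<close> and is carried along \<open>x = sin p * sin (2 * a - p)\<close> afterwards.
  The flow preserves area (\<open>distr_lab\<close>), and its horizontal velocity has mean square exactly
  \<open>(2/3) * sin^4 p\<close> (\<open>lab_energy1\<close>). Since vertical lengths are \<open>N\<close> times smaller than horizontal
  ones, the vertical velocity (\<open>lab_energy2\<close>) costs an amount of energy that vanishes as \<open>N\<close> tends to
  infinity. Running through the angles at the speed that makes the energy constant (\<open>clock_exists\<close>)
  therefore takes a time proportional to the integral of \<open>sqrt (2/3) * sin\<^sup>2 p\<close>, which is
  \<open>sqrt (2/3) * pi / 4\<close> up to \<open>O(1/N)\<close>. A stage is a rescaled copy of the reference flow, so stage \<open>n\<close>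
  costs the time \<open>N^-n\<close> times that of stage \<open>0\<close> for the same energy; summing the geometric series
  and letting \<open>N\<close> tend to infinity gives exactly \<open>T0_hat\<close> (\<open>T0_hat_eq\<close>, \<open>clock_total_limit\<close>).

  The velocity is discontinuous, and the weak form of the equations is checked in Lagrangian
  coordinates: the density is constant along almost every path, the paths are differentiable up to
  finitely many times, and they transport a fixed measure on the labels to Lebesgue measure
  (\<open>Lagrangian_transport\<close>). The same identity for the constant density \<open>1\<close> yields the
  incompressibility of the velocity. The density has values \<open>\<plusminus>1\<close> and changes its sign under a
  translation by half a period; pairing it with a test function thus only sees differences of the test
  function over a distance comparable to the period, and the \<open>H^-1\<close> norm is at most a multiple of the period
  (\<open>rho_dual_estimate\<close>). To use such a dual bound for \<open>Hminus1_norm\<close>, defined through the solution of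
  the Poisson equation, existence is obtained by minimising the Dirichlet energy
  (\<open>torus_Poisson_weak_solution\<close>) and uniqueness by testing with trigonometric polynomials
  (\<open>weak_gradient_unique\<close>).

  As \<open>T\<close> exceeds \<open>T0_hat\<close>, the fluid may rest for a while before the first stage. Different
  waiting times give different solutions (\<open>waiting_times_distinguish\<close>).
\<close>

section \<open>Replacing one coordinate of a vector\<close>

definition upd :: "'n::finite \<Rightarrow> real \<Rightarrow> real ^ 'n \<Rightarrow> real ^ 'n" where
  "upd k a z = (\<chi> i. if i = k then a else z $ i)"

lemma upd_nth [simp]: "upd k a z $ i = (if i = k then a else z $ i)"
  by (simp add: upd_def)

lemma upd_upd [simp]: "upd k a (upd k b z) = upd k a z"
  by (simp add: vec_eq_iff)

lemma upd_triv [simp]: "upd k (z $ k) z = z"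
  by (simp add: vec_eq_iff)

lemma borel_measurable_vec_nth [measurable]: "(\<lambda>z::real^'n. z $ i) \<in> borel_measurable borel"
  by (intro borel_measurable_continuous_onI continuous_intros)

lemma borel_measurable_vecI:
  fixes f :: "'a \<Rightarrow> real ^ 'n"
  assumes "\<And>i. (\<lambda>x. f x $ i) \<in> borel_measurable M"
  shows "f \<in> borel_measurable M"
  using assms by (subst borel_measurable_euclidean_space) (auto simp: Basis_vec_def inner_axis)

lemma borel_measurable_upd [measurable (raw)]:
  assumes [measurable]: "f \<in> borel_measurable M" "g \<in> borel_measurable M"
  shows "(\<lambda>x. upd k (f x) (g x)) \<in> borel_measurable M"
  by (rule borel_measurable_vecI) auto

lemma prod_Basis_vec: "(\<Prod>b\<in>Basis. g (b :: real^'n)) = (\<Prod>i\<in>UNIV. g (axis i 1))"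
proof -
  have B: "Basis = range (\<lambda>i::'n. axis i (1::real))" by (auto simp: Basis_vec_def)
  have inj: "inj (\<lambda>i::'n. axis i (1::real))" by (auto simp: inj_on_def axis_eq_axis)
  show ?thesis unfolding B prod.reindex[OF inj] o_def ..
qed

lemma emeasure_box_vec:
  fixes l u :: "real^'n"
  assumes "\<And>i. l $ i \<le> u $ i"
  shows "emeasure lborel (box l u) = ennreal (\<Prod>i\<in>UNIV. u $ i - l $ i)"
proof -
  have "emeasure lborel (box l u) = ennreal (\<Prod>b\<in>Basis. (u - l) \<bullet> b)"
    using assms by (intro emeasure_lborel_box) (auto simp: Basis_vec_def inner_axis)
  then show ?thesis unfolding prod_Basis_vec by (simp add: inner_axis)
qed

lemma all_index_split: "(\<forall>i. P i) \<longleftrightarrow> P k \<and> (\<forall>i. i \<noteq> k \<longrightarrow> P i)"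
  by metis

text \<open>Fubini's theorem for the single coordinate \<open>k\<close>, without splitting the type \<open>real^'n\<close> into a
product: draw a point \<open>z\<close> from a slab of width one in direction \<open>k\<close> and overwrite its \<open>k\<close>-th coordinate
by an independent \<open>a\<close>. The slab has width one so that the discarded coordinate contributes the factor one.\<close>

lemma lborel_vec_resample:
  "lborel = distr (density (lborel \<Otimes>\<^sub>M lborel) (\<lambda>(a, z). indicator {0<..<1} (z $ k))) borel
              (\<lambda>(a, z). upd k a (z :: real^'n))"
    (is "lborel = distr ?M borel ?f")
proof (rule lborel_eqI)
  fix l u :: "real^'n"
  assume lu: "\<And>b. b \<in> Basis \<Longrightarrow> l \<bullet> b \<le> u \<bullet> b"
  have lu': "l $ i \<le> u $ i" for i
    using lu[of "axis i 1"] by (auto simp: Basis_vec_def inner_axis)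
  \<comment> \<open>The box \<open>?B\<close> has side \<open>{0<..<1}\<close> in direction \<open>k\<close>; the preimage of a box is an interval times \<open>?B\<close>.\<close>
  let ?B = "box (upd k 0 l) (upd k 1 u)"
  have "emeasure (distr ?M borel ?f) (box l u) = emeasure ?M (?f -` box l u \<inter> space ?M)"
    by (subst emeasure_distr) auto
  also have "\<dots> = (\<integral>\<^sup>+p. (case p of (a, z) \<Rightarrow> indicator {0<..<1} (z $ k)) * indicator (?f -` box l u \<inter> space ?M) p \<partial>(lborel \<Otimes>\<^sub>M lborel))"
  proof (subst emeasure_density)
    show "?f -` box l u \<inter> space ?M \<in> sets (lborel \<Otimes>\<^sub>M lborel)"
      using measurable_sets[of ?f "lborel \<Otimes>\<^sub>M lborel" borel "box l u"] by simp
  qed (simp_all add: split_beta')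
  also have "\<dots> = (\<integral>\<^sup>+p. indicator ({l $ k <..< u $ k} \<times> ?B) p \<partial>(lborel \<Otimes>\<^sub>M lborel))"
  proof (intro nn_integral_cong)
    fix p :: "real \<times> (real^'n)"
    obtain a z where p: "p = (a, z)" by (cases p)
    have "upd k a z \<in> box l u \<longleftrightarrow> (l $ k < a \<and> a < u $ k) \<and> (\<forall>i. i \<noteq> k \<longrightarrow> l $ i < z $ i \<and> z $ i < u $ i)"
      unfolding mem_box_cart by (subst all_index_split[of _ k]) simp
    moreover have "z \<in> ?B \<longleftrightarrow> (0 < z $ k \<and> z $ k < 1) \<and> (\<forall>i. i \<noteq> k \<longrightarrow> l $ i < z $ i \<and> z $ i < u $ i)"
      unfolding mem_box_cart by (subst all_index_split[of _ k]) simp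
    ultimately have "upd k a z \<in> box l u \<and> z $ k \<in> {0<..<1} \<longleftrightarrow> a \<in> {l $ k <..< u $ k} \<and> z \<in> ?B"
      by auto
    then show "(case p of (a, z) \<Rightarrow> indicator {0<..<1} (z $ k)) * indicator (?f -` box l u \<inter> space ?M) p
       = (indicator ({l $ k <..< u $ k} \<times> ?B) p :: ennreal)"
      by (auto simp: p space_pair_measure split: split_indicator)
  qed
  also have "\<dots> = emeasure (lborel \<Otimes>\<^sub>M lborel) ({l $ k <..< u $ k} \<times> ?B)"
    by (rule nn_integral_indicator) simp
  also have "\<dots> = emeasure lborel {l $ k <..< u $ k} * emeasure lborel ?B"
    by (rule lborel.emeasure_pair_measure_Times) auto
  also have "\<dots> = ennreal (u $ k - l $ k) * ennreal (\<Prod>i\<in>UNIV. upd k 1 u $ i - upd k 0 l $ i)"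
    using lu' by (subst emeasure_box_vec) (auto simp: emeasure_lborel_Ioo)
  also have "\<dots> = ennreal (\<Prod>i\<in>UNIV. u $ i - l $ i)"
    using lu' by (subst (1 2) prod.remove[of _ k]) (auto simp: ennreal_mult[symmetric] prod_nonneg intro!: arg_cong[of _ _ ennreal] prod.cong)
  also have "\<dots> = ennreal (\<Prod>b\<in>Basis. (u - l) \<bullet> b)"
    by (simp add: prod_Basis_vec inner_axis)
  finally show "emeasure (distr ?M borel ?f) (box l u) = (\<Prod>b\<in>Basis. (u - l) \<bullet> b)" .
qed simp

lemma nn_integral_resample_slab:
  fixes F :: "real^'n \<Rightarrow> ennreal"
  assumes [measurable]: "F \<in> borel_measurable borel"
  shows "(\<integral>\<^sup>+x. F x \<partial>lborel) = (\<integral>\<^sup>+z. indicator {0<..<1} (z $ k) * (\<integral>\<^sup>+a. F (upd k a z) \<partial>lborel) \<partial>lborel)"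
proof -
  have "(\<integral>\<^sup>+x. F x \<partial>lborel) = (\<integral>\<^sup>+p. F (case p of (a, z) \<Rightarrow> upd k a z) \<partial>density (lborel \<Otimes>\<^sub>M lborel) (\<lambda>(a, z). indicator {0<..<1} (z $ k)))"
    by (subst lborel_vec_resample[of k], subst nn_integral_distr) auto
  also have "\<dots> = (\<integral>\<^sup>+p. (case p of (a, z) \<Rightarrow> indicator {0<..<1} (z $ k) * F (upd k a z)) \<partial>(lborel \<Otimes>\<^sub>M lborel))"
    by (subst nn_integral_density) (auto simp: split_beta')
  also have "\<dots> = (\<integral>\<^sup>+z. \<integral>\<^sup>+a. indicator {0<..<1} (z $ k) * F (upd k a z) \<partial>lborel \<partial>lborel)"
    by (subst lborel_pair.nn_integral_snd[symmetric]) auto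
  also have "\<dots> = (\<integral>\<^sup>+z. indicator {0<..<1} (z $ k) * (\<integral>\<^sup>+a. F (upd k a z) \<partial>lborel) \<partial>lborel)"
    by (intro nn_integral_cong nn_integral_cmult) auto
  finally show ?thesis .
qed

lemma torus_cell_iff: "x \<in> torus_cell L \<longleftrightarrow> (\<forall>i. - L / 2 \<le> x $ i \<and> x $ i \<le> L / 2)"
  by (simp add: torus_cell_def mem_box_cart)

lemma torus_cell_measurable [measurable]: "torus_cell L \<in> sets borel"
  by (simp add: torus_cell_def)

lemma torus_cell_lmeasurable: "torus_cell L \<in> lmeasurable"
  by (simp add: torus_cell_def)

lemma nn_integral_torus_lborel:
  assumes "f \<in> borel_measurable borel"
  shows "(\<integral>\<^sup>+x. f x \<partial>torus L) = (\<integral>\<^sup>+x. indicator (torus_cell L) x * f x \<partial>lborel)"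
  using assms unfolding torus_def
  by (simp add: nn_integral_restrict_space nn_integral_completion mult.commute)

lemma indicator_cell_upd:
  "(indicator (torus_cell L) (upd k a z) :: ennreal) =
     indicator {- L / 2 .. L / 2} a * indicator (torus_cell L) (upd k 0 z)" if "L > 0"
  using that by (auto simp: torus_cell_iff indicator_def)

text \<open>The form of Fubini's theorem used throughout: averaging over one coordinate and then over the whole
torus. The factor \<open>L\<close> is the length of the coordinate that is integrated twice.\<close>

theorem nn_integral_torus_resample:
  fixes F :: "real^'n \<Rightarrow> ennreal"
  assumes L: "L > 0" and [measurable]: "F \<in> borel_measurable borel"
  shows "ennreal L * (\<integral>\<^sup>+x. F x \<partial>torus L) =
     (\<integral>\<^sup>+z. (\<integral>\<^sup>+a. indicator {- L / 2 .. L / 2} a * F (upd k a z) \<partial>lborel) \<partial>torus L)"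
proof -
  define I :: "real \<Rightarrow> ennreal" where "I = indicator {- L / 2 .. L / 2}"
  define C :: "real^'n \<Rightarrow> ennreal" where "C z = indicator (torus_cell L) (upd k 0 z)" for z
  define G where "G z = (\<integral>\<^sup>+a. I a * F (upd k a z) \<partial>lborel)" for z
  have IM [measurable]: "I \<in> borel_measurable borel" by (simp add: I_def)
  have IM': "I \<in> borel_measurable lborel" by (simp add: I_def)
  have CM [measurable]: "C \<in> borel_measurable borel" unfolding C_def by measurable
  have GM [measurable]: "G \<in> borel_measurable borel" unfolding G_def by measurable
  have GU: "G (upd k b z) = G z" and CU: "C (upd k b z) = C z" for b z by (simp_all add: G_def C_def)
  have IC: "indicator (torus_cell L) (upd k a z) = I a * C z" for a z
    unfolding I_def C_def by (rule indicator_cell_upd[OF L])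
  have I1: "(\<integral>\<^sup>+b. I b \<partial>lborel) = ennreal L" using L by (simp add: I_def)
  have "(\<integral>\<^sup>+z. G z \<partial>torus L) = (\<integral>\<^sup>+z. indicator {0<..<1} (z $ k) * (\<integral>\<^sup>+b. (I b * C z) * G z \<partial>lborel) \<partial>lborel)"
    unfolding nn_integral_torus_lborel[OF GM]
    by (subst nn_integral_resample_slab[where k = k]) (simp_all only: IC GU, measurable)
  also have "\<dots> = (\<integral>\<^sup>+z. ennreal L * (indicator {0<..<1} (z $ k) * (C z * G z)) \<partial>lborel)"
  proof (intro nn_integral_cong)
    fix z
    have "(\<integral>\<^sup>+b. (I b * C z) * G z \<partial>lborel) = ennreal L * (C z * G z)"
      by (simp only: mult.assoc nn_integral_multc[OF IM'] I1)
    then show "indicator {0<..<1} (z $ k) * (\<integral>\<^sup>+b. (I b * C z) * G z \<partial>lborel)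
        = ennreal L * (indicator {0<..<1} (z $ k) * (C z * G z))"
      by (simp only: mult.left_commute)
  qed
  also have "\<dots> = ennreal L * (\<integral>\<^sup>+z. indicator {0<..<1} (z $ k) * (C z * G z) \<partial>lborel)"
    by (rule nn_integral_cmult) measurable
  also have "(\<integral>\<^sup>+z. indicator {0<..<1} (z $ k) * (C z * G z) \<partial>lborel)
      = (\<integral>\<^sup>+z. indicator {0<..<1} (z $ k) * (\<integral>\<^sup>+b. (I b * C z) * F (upd k b z) \<partial>lborel) \<partial>lborel)"
  proof (intro nn_integral_cong arg_cong2[where f = times] refl)
    fix z
    have "C z * G z = (\<integral>\<^sup>+b. C z * (I b * F (upd k b z)) \<partial>lborel)"
      unfolding G_def by (rule nn_integral_cmult[symmetric]) measurable
    then show "C z * G z = (\<integral>\<^sup>+b. (I b * C z) * F (upd k b z) \<partial>lborel)"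
      by (simp add: ac_simps)
  qed
  also have "\<dots> = (\<integral>\<^sup>+x. F x \<partial>torus L)"
    unfolding nn_integral_torus_lborel[OF assms(2)]
    by (subst (2) nn_integral_resample_slab[where k = k]) (simp_all only: IC, measurable)
  finally show ?thesis by (simp add: G_def I_def)
qed

section \<open>Translations of the torus\<close>

lemma periodic_int_shift:
  fixes f :: "real \<Rightarrow> 'b"
  assumes "\<And>x. f (x + L) = f x"
  shows "f (x + of_int m * L) = f x"
proof -
  have nat: "f (x + real n * L) = f x" for n x
  proof (induction n)
    case (Suc n)
    have "f (x + real (Suc n) * L) = f (x + real n * L + L)" by (simp add: algebra_simps)
    then show ?case using assms Suc by simp
  qed simp
  show ?thesis
  proof (cases "m \<ge> 0")
    case True
    then show ?thesis using nat[of x "nat m"] by simp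
  next
    case False
    then show ?thesis using nat[of "x + of_int m * L" "nat (- m)"] by (simp add: algebra_simps)
  qed
qed

text \<open>Shift \<open>c\<close> into \<open>{0..<L}\<close> by a multiple of the period; the piece beyond \<open>L\<close> is then moved to the left by
one period.\<close>

lemma nn_integral_periodic_interval:
  fixes f :: "real \<Rightarrow> ennreal"
  assumes L: "L > 0" and [measurable]: "f \<in> borel_measurable borel" and per: "\<And>x. f (x + L) = f x"
  shows "(\<integral>\<^sup>+x. indicator {c..<c+L} x * f x \<partial>lborel) = (\<integral>\<^sup>+x. indicator {0..<L} x * f x \<partial>lborel)"
proof -
  define m where "m = \<lfloor>c / L\<rfloor>"
  define d where "d = c - of_int m * L"
  have d: "0 \<le> d" "d < L" and c: "c = d + of_int m * L"
    unfolding d_def m_def using L floor_divide_lower[of L c] floor_divide_upper[of L c] by (auto simp: algebra_simps)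
  have "(\<integral>\<^sup>+x. indicator {c..<c+L} x * f x \<partial>lborel) = (\<integral>\<^sup>+x. indicator {c..<c+L} (of_int m * L + x) * f (of_int m * L + x) \<partial>lborel)"
    using nn_integral_real_affine[of "\<lambda>x. indicator {c..<c+L} x * f x" 1 "of_int m * L"] by simp
  also have "\<dots> = (\<integral>\<^sup>+x. indicator {d..<d+L} x * f x \<partial>lborel)"
    using periodic_int_shift[of f L, OF per]
    by (intro nn_integral_cong) (auto simp: c indicator_def add.commute)
  also have "\<dots> = (\<integral>\<^sup>+x. indicator {d..<L} x * f x + indicator {L..<d+L} x * f x \<partial>lborel)"
    using d by (intro nn_integral_cong) (auto simp: indicator_def)
  also have "\<dots> = (\<integral>\<^sup>+x. indicator {d..<L} x * f x \<partial>lborel) + (\<integral>\<^sup>+x. indicator {L..<d+L} x * f x \<partial>lborel)"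
    by (rule nn_integral_add) auto
  also have "(\<integral>\<^sup>+x. indicator {L..<d+L} x * f x \<partial>lborel) = (\<integral>\<^sup>+x. indicator {L..<d+L} (L + x) * f (L + x) \<partial>lborel)"
    using nn_integral_real_affine[of "\<lambda>x. indicator {L..<d+L} x * f x" 1 L] by simp
  also have "\<dots> = (\<integral>\<^sup>+x. indicator {0..<d} x * f x \<partial>lborel)"
    using per by (intro nn_integral_cong) (auto simp: indicator_def add.commute)
  also have "(\<integral>\<^sup>+x. indicator {d..<L} x * f x \<partial>lborel) + (\<integral>\<^sup>+x. indicator {0..<d} x * f x \<partial>lborel)
     = (\<integral>\<^sup>+x. indicator {d..<L} x * f x + indicator {0..<d} x * f x \<partial>lborel)"
    by (rule nn_integral_add[symmetric]) auto
  also have "\<dots> = (\<integral>\<^sup>+x. indicator {0..<L} x * f x \<partial>lborel)"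
    using d by (intro nn_integral_cong) (auto simp: indicator_def)
  finally show ?thesis .
qed

lemma nn_integral_indicator_Icc_eq:
  fixes f :: "real \<Rightarrow> ennreal"
  shows "(\<integral>\<^sup>+x. indicator {a..b} x * f x \<partial>lborel) = (\<integral>\<^sup>+x. indicator {a..<b} x * f x \<partial>lborel)"
proof (rule nn_integral_cong_AE)
  have "AE x in lborel. x \<noteq> b" by (rule AE_lborel_singleton)
  then show "AE x in lborel. indicator {a..b} x * f x = indicator {a..<b} x * f x"
    by eventually_elim (auto simp: indicator_def)
qed

lemma nn_integral_periodic_Icc:
  fixes f :: "real \<Rightarrow> ennreal"
  assumes L: "L > 0" and [measurable]: "f \<in> borel_measurable borel" and per: "\<And>x. f (x + L) = f x"
  shows "(\<integral>\<^sup>+x. indicator {c..c+L} x * f x \<partial>lborel) = (\<integral>\<^sup>+x. indicator {c'..c'+L} x * f x \<partial>lborel)"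
  using nn_integral_periodic_interval[OF assms, of c] nn_integral_periodic_interval[OF assms, of c']
  by (simp add: nn_integral_indicator_Icc_eq)

lemma torus_periodicD: "torus_periodic L f \<Longrightarrow> f (x + L *\<^sub>R axis i 1) = f x"
  by (auto simp: torus_periodic_def)

lemma upd_eq_add: "upd k a z = z + (a - z $ k) *\<^sub>R axis k 1"
  by (simp add: vec_eq_iff axis_def)

lemma torus_periodic_upd: "torus_periodic L f \<Longrightarrow> f (upd k (a + L) z) = f (upd k a z)"
  using torus_periodicD[of L f "upd k a z" k] by (simp add: upd_eq_add algebra_simps)

lemma torus_periodic_shift: "torus_periodic L f \<Longrightarrow> torus_periodic L (\<lambda>x. f (x + h))"
  unfolding torus_periodic_def by (metis add.assoc add.commute)

lemma nn_integral_torus_translation_axis: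
  fixes F :: "real^'n \<Rightarrow> ennreal"
  assumes L: "L > 0" and [measurable]: "F \<in> borel_measurable borel" and per: "torus_periodic L F"
  shows "(\<integral>\<^sup>+x. F (x + s *\<^sub>R axis k 1) \<partial>torus L) = (\<integral>\<^sup>+x. F x \<partial>torus L)"
proof -
  have "ennreal L * (\<integral>\<^sup>+x. F (x + s *\<^sub>R axis k 1) \<partial>torus L) = ennreal L * (\<integral>\<^sup>+x. F x \<partial>torus L)"
  proof -
    have eq: "(\<integral>\<^sup>+a. indicator {- L / 2..L / 2} a * F (upd k a z + s *\<^sub>R axis k 1) \<partial>lborel)
       = (\<integral>\<^sup>+a. indicator {- L / 2..L / 2} a * F (upd k a z) \<partial>lborel)" for z
    proof -
    let ?f = "\<lambda>a. F (upd k a z)"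
    have per': "?f (a + L) = ?f a" for a by (rule torus_periodic_upd[OF per])
    have "(\<integral>\<^sup>+a. indicator {- L / 2..L / 2} a * F (upd k a z + s *\<^sub>R axis k 1) \<partial>lborel)
        = (\<integral>\<^sup>+a. indicator {s - L / 2..s - L / 2 + L} (s + 1 * a) * ?f (s + 1 * a) \<partial>lborel)"
      by (intro nn_integral_cong) (auto simp: upd_eq_add algebra_simps indicator_def)
    also have "\<dots> = (\<integral>\<^sup>+a. indicator {s - L / 2..s - L / 2 + L} a * ?f a \<partial>lborel)"
      by (subst nn_integral_real_affine[of _ 1 s]) auto
    also have "\<dots> = (\<integral>\<^sup>+a. indicator {- L / 2..- L / 2 + L} a * ?f a \<partial>lborel)"
      by (rule nn_integral_periodic_Icc[of L "?f"]) (use L per' in auto)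
    finally show "(\<integral>\<^sup>+a. indicator {- L / 2..L / 2} a * F (upd k a z + s *\<^sub>R axis k 1) \<partial>lborel)
       = (\<integral>\<^sup>+a. indicator {- L / 2..L / 2} a * ?f a \<partial>lborel)" by simp
    qed
    have "ennreal L * (\<integral>\<^sup>+x. F (x + s *\<^sub>R axis k 1) \<partial>torus L)
      = (\<integral>\<^sup>+z. (\<integral>\<^sup>+a. indicator {- L / 2..L / 2} a * F (upd k a z + s *\<^sub>R axis k 1) \<partial>lborel) \<partial>torus L)"
      by (rule nn_integral_torus_resample[OF L]) simp
    also have "\<dots> = ennreal L * (\<integral>\<^sup>+x. F x \<partial>torus L)"
      unfolding eq by (rule nn_integral_torus_resample[OF L, symmetric]) simp
    finally show ?thesis .
  qed
  then show ?thesis using L by (simp add: ennreal_mult_cancel_left)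
qed

text \<open>A translation is a composition of translations along the axes, each of which is harmless by
periodicity in that coordinate.\<close>

lemma nn_integral_torus_translation:
  fixes F :: "real^'n \<Rightarrow> ennreal"
  assumes L: "L > 0" and [measurable]: "F \<in> borel_measurable borel" and per: "torus_periodic L F"
  shows "(\<integral>\<^sup>+x. F (x + h) \<partial>torus L) = (\<integral>\<^sup>+x. F x \<partial>torus L)"
proof -
  have "(\<integral>\<^sup>+x. F (x + (\<Sum>i\<in>A. h $ i *\<^sub>R axis i 1)) \<partial>torus L) = (\<integral>\<^sup>+x. F x \<partial>torus L)" if "finite A" for A
    using that
  proof (induction A)
    case (insert i A)
    let ?G = "\<lambda>x. F (x + (\<Sum>i\<in>A. h $ i *\<^sub>R axis i 1))"
    have "(\<integral>\<^sup>+x. ?G (x + h $ i *\<^sub>R axis i 1) \<partial>torus L) = (\<integral>\<^sup>+x. ?G x \<partial>torus L)"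
      by (rule nn_integral_torus_translation_axis[OF L _ torus_periodic_shift[OF per]]) simp
    then show ?case using insert by (simp add: add.assoc)
  qed simp
  from this[of UNIV] show ?thesis
    by (simp add: basis_expansion[of h, unfolded scalar_mult_eq_scaleR])
qed

lemma measurable_torusI: "f \<in> borel_measurable borel \<Longrightarrow> f \<in> borel_measurable (torus L)"
  unfolding torus_def by (intro measurable_restrict_space1 measurable_completion) simp

lemma measurable_torus_id [measurable]: "(\<lambda>x. x) \<in> torus L \<rightarrow>\<^sub>M borel"
  by (rule measurable_torusI) simp

lemma space_torus [simp]: "space (torus L) = torus_cell L"
  by (simp add: torus_def space_restrict_space)

lemma emeasure_torus_space: "L > 0 \<Longrightarrow> emeasure (torus L :: (real^'n) measure) (torus_cell L) = ennreal (L ^ CARD('n))"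
proof -
  assume L: "L > 0"
  have "cbox (\<chi> i. - L / 2) (\<chi> i. L / 2) \<noteq> ({} :: (real^'n) set)"
    using L by (auto simp: interval_ne_empty_cart)
  then show ?thesis
    by (simp add: torus_def emeasure_restrict_space torus_cell_def emeasure_lborel_cbox_eq
        content_cbox_cart emeasure_eq_measure2)
qed

lemma finite_measure_torus: "finite_measure (torus L)"
proof
  show "emeasure (torus L) (space (torus L)) \<noteq> \<infinity>"
    using torus_cell_lmeasurable[of L] by (simp add: torus_def emeasure_restrict_space fmeasurable_def less_top)
qed

lemma measure_torus_space: "L > 0 \<Longrightarrow> measure (torus L :: (real^'n) measure) (torus_cell L) = L ^ CARD('n)"
  by (simp add: measure_def emeasure_torus_space)

lemma integral_torus_translation:
  fixes F :: "real^'n \<Rightarrow> real"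
  assumes L: "L > 0" and [measurable]: "F \<in> borel_measurable borel" and per: "torus_periodic L F"
    and int: "integrable (torus L) F"
  shows "integrable (torus L) (\<lambda>x. F (x + h))"
    and "(LINT x|torus L. F (x + h)) = (LINT x|torus L. F x)"
proof -
  have *: "(\<integral>\<^sup>+x. ennreal (g (F (x + h))) \<partial>torus L) = (\<integral>\<^sup>+x. ennreal (g (F x)) \<partial>torus L)"
    if [measurable]: "g \<in> borel_measurable borel" for g
    by (rule nn_integral_torus_translation[OF L, of "\<lambda>x. ennreal (g (F x))"])
       (use per in \<open>auto simp: torus_periodic_def\<close>)
  have m: "(\<lambda>x. F (x + h)) \<in> borel_measurable (torus L)" by (rule measurable_torusI) simp
  show 1: "integrable (torus L) (\<lambda>x. F (x + h))"
    using int *[of abs] m by (simp add: integrable_iff_bounded)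
  show "(LINT x|torus L. F (x + h)) = (LINT x|torus L. F x)"
    using *[of "\<lambda>x. x"] *[of uminus] by (simp add: real_lebesgue_integral_def[OF 1] real_lebesgue_integral_def[OF int])
qed

lemma integrable_torus_continuous:
  fixes f :: "real^'n \<Rightarrow> 'b::euclidean_space"
  shows "continuous_on (torus_cell L) f \<Longrightarrow> integrable (torus L) f"
  unfolding torus_def torus_cell_def by (rule continuous_imp_integrable)

section \<open>Smooth functions and difference quotients\<close>

lemma Ck_on_1D:
  fixes f :: "real^'n \<Rightarrow> real"
  assumes "Ck_on (Suc 0) UNIV f"
  shows "(f has_derivative (\<lambda>v. grad f x \<bullet> v)) (at x)" and "continuous_on UNIV (grad f)"
proof -
  from assms obtain f' where f': "\<And>x. (f has_derivative f' x) (at x)" and c: "\<And>h. continuous_on UNIV (\<lambda>x. f' x h)"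
    by auto
  have g: "grad f x $ i = f' x (axis i 1)" for x i
    using frechet_derivative_at[OF f'[of x]] by (simp add: grad_def)
  have "f' x v = grad f x \<bullet> v" for x v
  proof -
    interpret linear "f' x" using f' has_derivative_linear by blast
    have "f' x v = f' x (\<Sum>i\<in>UNIV. v $ i *\<^sub>R axis i 1)"
      by (simp add: basis_expansion[of v, unfolded scalar_mult_eq_scaleR])
    then show ?thesis by (simp add: sum scale inner_vec_def g mult.commute)
  qed
  then show "(f has_derivative (\<lambda>v. grad f x \<bullet> v)) (at x)" using f'[of x] by (metis (no_types, lifting) ext)
  have "continuous_on UNIV (\<lambda>x. \<chi> i. grad f x $ i)"
    unfolding g by (intro continuous_on_vec_lambda c)
  then show "continuous_on UNIV (grad f)" by simp
qed

lemma torus_smooth_C1: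
  assumes "torus_smooth L f"
  shows "(f has_derivative (\<lambda>v. grad f x \<bullet> v)) (at x)" and "continuous_on UNIV (grad f)"
  using assms Ck_on_1D[of f] unfolding torus_smooth_def smooth_on_def by auto

lemma grad_eqI: "(f has_derivative (\<lambda>v. G \<bullet> v)) (at x) \<Longrightarrow> grad f x = G"
  by (simp add: grad_def vec_eq_iff frechet_derivative_at[symmetric] inner_axis)

lemma torus_periodic_grad:
  fixes f :: "real^'n \<Rightarrow> real"
  assumes "torus_periodic L f" and "\<And>x. (f has_derivative (\<lambda>v. grad f x \<bullet> v)) (at x)"
  shows "torus_periodic L (grad f)"
  unfolding torus_periodic_def
proof (intro allI)
  fix x :: "real^'n" and i :: 'n
  have "((\<lambda>y. f (y + L *\<^sub>R axis i 1)) has_derivative (\<lambda>v. grad f (x + L *\<^sub>R axis i 1) \<bullet> v)) (at x)"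
    by (rule has_derivative_compose[OF _ assms(2)]) (auto intro!: derivative_eq_intros)
  then have "(f has_derivative (\<lambda>v. grad f (x + L *\<^sub>R axis i 1) \<bullet> v)) (at x)"
    using assms(1) by (simp add: torus_periodic_def)
  then show "grad f (x + L *\<^sub>R axis i 1) = grad f x" by (rule grad_eqI[symmetric])
qed

lemma L2_norm_sq: "(L2_norm L f)\<^sup>2 = (LINT x|torus L. (norm (f x))\<^sup>2)"
  by (simp add: L2_norm_def)

lemma L2_norm_nonneg: "0 \<le> L2_norm L f"
  by (simp add: L2_norm_def)

lemma measurable_torus_pairI:
  assumes "f \<in> borel_measurable (borel \<Otimes>\<^sub>M borel)"
    and that: "(\<lambda>x. x) \<in> M1 \<rightarrow>\<^sub>M borel" "(\<lambda>x. x) \<in> M2 \<rightarrow>\<^sub>M borel"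
  shows "f \<in> borel_measurable (M1 \<Otimes>\<^sub>M M2)"
proof -
  have "(\<lambda>p. (fst p, snd p)) \<in> M1 \<Otimes>\<^sub>M M2 \<rightarrow>\<^sub>M borel \<Otimes>\<^sub>M borel"
    by (intro measurable_Pair measurable_compose[OF measurable_fst that(1)] measurable_compose[OF measurable_snd that(2)])
  from measurable_compose[OF this assms(1)] show ?thesis by simp
qed

text \<open>Jensen's inequality for the square, from \<open>0 \<le> integral of (g - mean)\<^sup>2\<close>.\<close>

lemma sq_integral_unit_le:
  fixes g :: "real \<Rightarrow> real"
  assumes "continuous_on {0..1} g"
  shows "(integral {0..1} g)\<^sup>2 \<le> integral {0..1} (\<lambda>r. (g r)\<^sup>2)"
proof -
  let ?m = "integral {0..1} g"
  have i: "g integrable_on {0..1}" "(\<lambda>r. (g r)\<^sup>2) integrable_on {0..1}"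
    using assms by (auto intro!: integrable_continuous_real continuous_intros)
  have "0 \<le> integral {0..1} (\<lambda>r. (g r - ?m)\<^sup>2)"
    by (rule integral_nonneg) (auto intro!: integrable_continuous_real continuous_intros assms)
  also have "integral {0..1} (\<lambda>r. (g r - ?m)\<^sup>2) = integral {0..1} (\<lambda>r. ((g r)\<^sup>2 - (2 * ?m) * g r) + ?m\<^sup>2)"
    by (simp add: power2_eq_square algebra_simps)
  also have "\<dots> = integral {0..1} (\<lambda>r. (g r)\<^sup>2) - (2 * ?m) * ?m + ?m\<^sup>2"
  proof -
    have mg: "(\<lambda>r. (2 * ?m) * g r) integrable_on {0..1}" using i(1) by (rule integrable_on_mult_right)
    show ?thesis
      using i mg by (simp only: integral_add integrable_diff integrable_const_ivl integral_diff integral_mult_right) simp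
  qed
  finally show ?thesis by (simp add: power2_eq_square)
qed

text \<open>The mean value estimate in \<open>L\<^sup>2\<close>: a difference is the integral of the gradient along the segment
from \<open>x\<close> to \<open>x + h\<close>, and each translate of the gradient has the same norm.\<close>

lemma torus_difference_L2:
  fixes \<psi> :: "real^'n \<Rightarrow> real"
  assumes L: "L > 0" and per: "torus_periodic L \<psi>"
    and der: "\<And>x. (\<psi> has_derivative (\<lambda>v. grad \<psi> x \<bullet> v)) (at x)" and cont: "continuous_on UNIV (grad \<psi>)"
  shows "(LINT x|torus L. (\<psi> (x + h) - \<psi> x)\<^sup>2) \<le> (norm h)\<^sup>2 * (L2_norm L (grad \<psi>))\<^sup>2"
proof -
  have cpsi: "continuous_on UNIV \<psi>"
    by (rule has_derivative_continuous_on) (use der in auto)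
  let ?U = "restrict_space lborel {0..1::real}"
  let ?N = "\<lambda>x. (norm (grad \<psi> x))\<^sup>2"
  have Nc: "continuous_on UNIV ?N" by (intro continuous_intros cont)
  have N [measurable]: "?N \<in> borel_measurable borel" by (rule borel_measurable_continuous_onI[OF Nc])
  have Ni: "integrable (torus L) ?N" by (rule integrable_torus_continuous[OF continuous_on_subset[OF Nc]]) simp
  have Nper: "torus_periodic L ?N" using torus_periodic_grad[OF per der] by (simp add: torus_periodic_def)
  have pt: "(\<psi> (x + h) - \<psi> x)\<^sup>2 \<le> (norm h)\<^sup>2 * integral {0..1} (\<lambda>r. ?N (x + r *\<^sub>R h))" for x
  proof -
    let ?g = "\<lambda>r. grad \<psi> (x + r *\<^sub>R h) \<bullet> h"
    have cg: "continuous_on {0..1} ?g"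
      by (intro continuous_intros continuous_on_compose2[OF cont]) auto
    have "((\<lambda>r. \<psi> (x + r *\<^sub>R h)) has_vector_derivative ?g r) (at r within {0..1})" for r
    proof -
      have "((\<lambda>r. \<psi> (x + r *\<^sub>R h)) has_derivative (\<lambda>s. grad \<psi> (x + r *\<^sub>R h) \<bullet> (s *\<^sub>R h))) (at r within {0..1})"
        by (rule has_derivative_compose[OF _ der]) (auto intro!: derivative_eq_intros)
      then show ?thesis by (simp add: has_vector_derivative_def)
    qed
    then have "(?g has_integral (\<psi> (x + 1 *\<^sub>R h) - \<psi> (x + 0 *\<^sub>R h))) {0..1}"
      by (intro fundamental_theorem_of_calculus) auto
    then have "(\<psi> (x + h) - \<psi> x)\<^sup>2 = (integral {0..1} ?g)\<^sup>2" by (simp add: integral_unique)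
    also have "\<dots> \<le> integral {0..1} (\<lambda>r. (?g r)\<^sup>2)" by (rule sq_integral_unit_le[OF cg])
    also have "\<dots> \<le> integral {0..1} (\<lambda>r. (norm h)\<^sup>2 * ?N (x + r *\<^sub>R h))"
    proof (rule integral_le)
      show "(\<lambda>r. (?g r)\<^sup>2) integrable_on {0..1}"
        by (intro integrable_continuous_real continuous_intros cg)
      show "(\<lambda>r. (norm h)\<^sup>2 * ?N (x + r *\<^sub>R h)) integrable_on {0..1}"
        by (intro integrable_continuous_real continuous_intros continuous_on_compose2[OF cont]) auto
      show "(?g r)\<^sup>2 \<le> (norm h)\<^sup>2 * ?N (x + r *\<^sub>R h)" for r
        using Cauchy_Schwarz_ineq[of "grad \<psi> (x + r *\<^sub>R h)" h] by (simp add: dot_square_norm mult.commute)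
    qed
    finally show ?thesis by simp
  qed
  have fin: "finite_measure ?U" by (rule finite_measureI) (simp add: emeasure_restrict_space)
  interpret U: finite_measure ?U by (rule fin)
  interpret T: finite_measure "torus L" by (rule finite_measure_torus)
  interpret P: pair_sigma_finite "torus L" ?U ..
  have Uint: "integral {0..1} f = (LINT r|?U. f r)" if "continuous_on {0..1} f" for f :: "real \<Rightarrow> real"
  proof -
    have "set_integrable lborel {0..1} f" using that by (rule borel_integrable_atLeastAtMost') 
    from set_borel_integral_eq_integral(2)[OF this] show ?thesis
      by (simp add: integral_restrict_space set_lebesgue_integral_def)
  qed
  have Uid: "(\<lambda>x. x) \<in> ?U \<rightarrow>\<^sub>M borel" by (simp add: measurable_restrict_space1)
  have cF: "continuous_on UNIV (\<lambda>p. ?N (fst p + snd p *\<^sub>R h))"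
    by (intro continuous_intros continuous_on_compose2[OF cont]) auto
  have mF: "(\<lambda>p. ?N (fst p + snd p *\<^sub>R h)) \<in> borel_measurable (torus L \<Otimes>\<^sub>M ?U)"
    by (rule measurable_torus_pairI[OF _ measurable_torus_id Uid]) simp
  have "compact (torus_cell L \<times> {0..1::real})" by (auto simp: torus_cell_def intro!: compact_Times)
  from compact_imp_bounded[OF compact_continuous_image[OF continuous_on_subset[OF cF] this]]
  obtain B where B: "\<And>x r. x \<in> torus_cell L \<Longrightarrow> r \<in> {0..1} \<Longrightarrow> \<bar>?N (x + r *\<^sub>R h)\<bar> \<le> B"
    by (force simp: bounded_iff)
  interpret PP: finite_measure "torus L \<Otimes>\<^sub>M ?U" by (intro finite_measure_pair_measure fin finite_measure_torus)
  have iF: "integrable (torus L \<Otimes>\<^sub>M ?U) (\<lambda>(x, r). ?N (x + r *\<^sub>R h))"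
    using mF B by (intro PP.integrable_const_bound[of _ B] AE_I2) (auto simp: split_beta' space_pair_measure space_restrict_space)
  have "(LINT x|torus L. (\<psi> (x + h) - \<psi> x)\<^sup>2) \<le> (LINT x|torus L. (norm h)\<^sup>2 * (LINT r|?U. ?N (x + r *\<^sub>R h)))"
  proof (rule integral_mono)
    show "integrable (torus L) (\<lambda>x. (\<psi> (x + h) - \<psi> x)\<^sup>2)"
      by (intro integrable_torus_continuous continuous_intros continuous_on_compose2[OF cpsi]) auto
    show "integrable (torus L) (\<lambda>x. (norm h)\<^sup>2 * (LINT r|?U. ?N (x + r *\<^sub>R h)))"
      using P.integrable_fst'[OF iF] by (intro integrable_mult_right) simp
    show "(\<psi> (x + h) - \<psi> x)\<^sup>2 \<le> (norm h)\<^sup>2 * (LINT r|?U. ?N (x + r *\<^sub>R h))" for x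
      using pt[of x] by (subst (asm) Uint) (auto intro!: continuous_intros continuous_on_compose2[OF cont])
  qed
  also have "\<dots> = (norm h)\<^sup>2 * (LINT r|?U. LINT x|torus L. ?N (x + r *\<^sub>R h))"
    by (simp add: P.Fubini_integral[OF iF])
  also have "\<dots> = (norm h)\<^sup>2 * (LINT r|?U. (L2_norm L (grad \<psi>))\<^sup>2)"
    by (simp add: integral_torus_translation(2)[OF L N Nper Ni] L2_norm_sq)
  also have "\<dots> = (norm h)\<^sup>2 * (L2_norm L (grad \<psi>))\<^sup>2"
    by (simp add: measure_restrict_space space_restrict_space)
  finally show ?thesis .
qed

section \<open>Integration by parts\<close>

lemma torus_periodic_int_axis:
  "torus_periodic L f \<Longrightarrow> f (x + (of_int m * L) *\<^sub>R axis i 1) = f x"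
  using periodic_int_shift[of "\<lambda>a. f (x + a *\<^sub>R axis i 1)" L 0 m]
    torus_periodicD[of L f "x + _ *\<^sub>R axis i 1" i]
  by (simp add: scaleR_add_left add.assoc)

lemma torus_periodic_lattice:
  fixes f :: "real^'n \<Rightarrow> 'b"
  assumes per: "torus_periodic L f"
  shows "f (x + L *\<^sub>R (\<chi> i. of_int (m i))) = f x"
proof -
  have "f (x + (\<Sum>i\<in>A. (of_int (m i) * L) *\<^sub>R axis i 1)) = f x" if "finite A" for A
    using that
  proof (induction A)
    case (insert i A)
    then show ?case
      using torus_periodic_int_axis[OF per, of "x + (\<Sum>i\<in>A. (of_int (m i) * L) *\<^sub>R axis i 1)" "m i" i]
      by (simp add: ac_simps)
  qed simp
  from this[of UNIV] show ?thesis
    using basis_expansion[of "L *\<^sub>R (\<chi> i. of_int (m i)) :: real^'n", unfolded scalar_mult_eq_scaleR]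
    by (simp add: mult.commute)
qed

text \<open>A single \<open>y\<close> serves all periodic functions with values in a given type, since it differs from \<open>x\<close> by a
lattice vector.\<close>

lemma torus_representative:
  fixes x :: "real^'n"
  assumes "L > 0"
  obtains y where "y \<in> torus_cell L" "\<And>f :: real^'n \<Rightarrow> 'b. torus_periodic L f \<Longrightarrow> f y = f x"
proof
  define m where "m i = - \<lfloor>x $ i / L + 1/2\<rfloor>" for i
  let ?y = "x + L *\<^sub>R (\<chi> i. of_int (m i)) :: real^'n"
  show "?y \<in> torus_cell L"
    unfolding torus_cell_iff
  proof
    fix i
    have "of_int \<lfloor>x $ i / L + 1/2\<rfloor> * L \<le> (x $ i / L + 1/2) * L" "(x $ i / L + 1/2) * L \<le> (of_int \<lfloor>x $ i / L + 1/2\<rfloor> + 1) * L"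
      using assms by (intro mult_right_mono; linarith)+
    then show "- L / 2 \<le> ?y $ i \<and> ?y $ i \<le> L / 2"
      using assms by (simp add: m_def algebra_simps)
  qed
  show "f ?y = f x" if "torus_periodic L f" for f :: "real^'n \<Rightarrow> 'b"
    by (rule torus_periodic_lattice[OF that])
qed

lemma torus_periodic_bounded:
  fixes f :: "real^'n \<Rightarrow> 'b::real_normed_vector"
  assumes L: "L > 0" and per: "torus_periodic L f" and cont: "continuous_on (torus_cell L) f"
  obtains B where "\<And>x. norm (f x) \<le> B" "B > 0"
proof -
  have "compact (torus_cell L :: (real^'n) set)" by (simp add: torus_cell_def)
  from compact_imp_bounded[OF compact_continuous_image[OF cont this]]
  obtain B where B: "B > 0" "\<And>y. y \<in> torus_cell L \<Longrightarrow> norm (f y) \<le> B"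
    by (auto simp: bounded_pos)
  have "norm (f x) \<le> B" for x
    using torus_representative[OF L, of x] per B(2) by metis
  with B(1) show ?thesis using that by blast
qed

text \<open>The integral of a difference quotient vanishes by translation invariance; let the increment tend to zero.\<close>

lemma integral_torus_directional_derivative:
  fixes h :: "real^'n \<Rightarrow> real"
  assumes L: "L > 0" and per: "torus_periodic L h"
    and der: "\<And>x. (h has_derivative (\<lambda>v. G x \<bullet> v)) (at x)" and cont: "continuous_on UNIV G"
  shows "(LINT x|torus L. G x \<bullet> v) = 0"
proof -
  interpret T: finite_measure "torus L" by (rule finite_measure_torus)
  have G: "G = grad h" using grad_eqI[OF der] by auto
  have perG: "torus_periodic L G" unfolding G by (rule torus_periodic_grad[OF per]) (use der G in auto)
  obtain B where B: "\<And>x. norm (G x) \<le> B" "B > 0"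
    using torus_periodic_bounded[OF L perG continuous_on_subset[OF cont]] by auto
  have ch: "continuous_on UNIV h"
    by (rule has_derivative_continuous_on) (use der in auto)
  have hm [measurable]: "h \<in> borel_measurable borel" by (rule borel_measurable_continuous_onI[OF ch])
  have Gm [measurable]: "G \<in> borel_measurable borel" by (rule borel_measurable_continuous_onI[OF cont])
  have ih: "integrable (torus L) h" by (rule integrable_torus_continuous[OF continuous_on_subset[OF ch]]) simp
  define q where "q n x = real (Suc n) * (h (x + (1 / real (Suc n)) *\<^sub>R v) - h x)" for n x
  have "(\<lambda>n. LINT x|torus L. q n x) \<longlonglongrightarrow> (LINT x|torus L. G x \<bullet> v)"
  proof (rule integral_dominated_convergence[where w = "\<lambda>_. B * norm v"])
    show "AE x in torus L. (\<lambda>n. q n x) \<longlonglongrightarrow> G x \<bullet> v"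
    proof (rule AE_I2)
      fix x
      have "((\<lambda>r. h (x + r *\<^sub>R v)) has_derivative (\<lambda>s. G (x + 0 *\<^sub>R v) \<bullet> (s *\<^sub>R v))) (at 0)"
        by (rule has_derivative_compose[OF _ der]) (auto intro!: derivative_eq_intros)
      then have "((\<lambda>r. h (x + r *\<^sub>R v)) has_real_derivative (G x \<bullet> v)) (at 0)"
        by (simp add: has_field_derivative_def mult_commute_abs)
      then have "((\<lambda>r. (h (x + r *\<^sub>R v) - h x) / r) \<longlongrightarrow> G x \<bullet> v) (at 0)"
        by (simp add: DERIV_def)
      moreover have "filterlim (\<lambda>n. 1 / real (Suc n)) (at 0) sequentially"
        using LIMSEQ_inverse_real_of_nat unfolding filterlim_at by (auto simp: inverse_eq_divide)
      ultimately show "(\<lambda>n. q n x) \<longlonglongrightarrow> G x \<bullet> v"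
        using filterlim_compose by (fastforce simp: q_def mult.commute)
    qed
    show "AE x in torus L. norm (q n x) \<le> B * norm v" for n
    proof (rule AE_I2)
      fix x
      have "norm (h (x + (1 / real (Suc n)) *\<^sub>R v) - h x) \<le> B * norm ((x + (1 / real (Suc n)) *\<^sub>R v) - x)"
      proof (rule differentiable_bound[of UNIV h "\<lambda>x v. G x \<bullet> v"])
        show "onorm ((\<bullet>) (G y)) \<le> B" for y
        proof (rule onorm_le)
          fix w
          show "norm (G y \<bullet> w) \<le> B * norm w"
            using Cauchy_Schwarz_ineq2[of "G y" w] mult_right_mono[OF B(1)[of y] norm_ge_zero[of w]] by simp
        qed
      qed (use der in auto)
      then have "real (Suc n) * \<bar>h (x + (1 / real (Suc n)) *\<^sub>R v) - h x\<bar> \<le> real (Suc n) * (B * ((1 / real (Suc n)) * norm v))"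
        by (intro mult_left_mono) (simp_all only: real_norm_def add_diff_cancel_left' norm_scaleR, simp_all)
      then show "norm (q n x) \<le> B * norm v" by (simp only: q_def real_norm_def abs_mult) simp
    qed
  qed (simp_all add: q_def measurable_torusI)
  moreover have "(LINT x|torus L. q n x) = 0" for n
    using integral_torus_translation[OF L hm per ih, of "(1 / real (Suc n)) *\<^sub>R v"] ih by (simp add: q_def)
  ultimately show ?thesis by (simp add: LIMSEQ_const_iff)
qed

lemma Ck_on_const: "Ck_on k S (\<lambda>x. c)"
proof (induction k arbitrary: c)
  case (Suc k)
  then show ?case by (auto intro!: exI[of _ "\<lambda>x h. 0"] derivative_eq_intros)
qed simp

lemma Ck_on_add: "Ck_on k S f \<Longrightarrow> Ck_on k S g \<Longrightarrow> Ck_on k S (\<lambda>x. f x + g x)"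
proof (induction k arbitrary: f g)
  case (Suc k)
  then obtain f' g' where "\<forall>x\<in>S. (f has_derivative f' x) (at x within S)" "\<forall>h. Ck_on k S (\<lambda>x. f' x h)"
    "\<forall>x\<in>S. (g has_derivative g' x) (at x within S)" "\<forall>h. Ck_on k S (\<lambda>x. g' x h)" by auto
  then show ?case using Suc.IH
    by (auto intro!: exI[of _ "\<lambda>x h. f' x h + g' x h"] has_derivative_add)
qed (auto intro: continuous_intros)

lemma Ck_on_scale: "Ck_on k S f \<Longrightarrow> Ck_on k S (\<lambda>x. c * f x)"
proof (induction k arbitrary: f)
  case (Suc k)
  then obtain f' where "\<forall>x\<in>S. (f has_derivative f' x) (at x within S)" "\<forall>h. Ck_on k S (\<lambda>x. f' x h)" by auto
  then show ?case using Suc.IH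
    by (auto intro!: exI[of _ "\<lambda>x h. c * f' x h"] has_derivative_mult_right)
qed (auto intro: continuous_intros)

lemma torus_smooth_const: "torus_smooth L (\<lambda>x. c)"
  by (simp add: torus_smooth_def torus_periodic_def smooth_on_def Ck_on_const)

lemma torus_smooth_add: "torus_smooth L f \<Longrightarrow> torus_smooth L g \<Longrightarrow> torus_smooth L (\<lambda>x. f x + g x)"
  by (simp add: torus_smooth_def torus_periodic_def smooth_on_def Ck_on_add)

lemma torus_smooth_scale: "torus_smooth L f \<Longrightarrow> torus_smooth L (\<lambda>x. c * f x)"
  by (simp add: torus_smooth_def torus_periodic_def smooth_on_def Ck_on_scale)

lemma torus_smooth_continuous:
  assumes "torus_smooth L f" shows "continuous_on S f"
proof -
  have "continuous_on UNIV f" by (rule has_derivative_continuous_on) (use torus_smooth_C1[OF assms] in auto)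
  then show ?thesis by (rule continuous_on_subset) simp
qed

lemma torus_smooth_grad_continuous:
  assumes "torus_smooth L f" shows "continuous_on S (grad f)"
  using torus_smooth_C1(2)[OF assms] by (rule continuous_on_subset) simp

lemma grad_lincomb:
  assumes "torus_smooth L f" "torus_smooth L g"
  shows "grad (\<lambda>x. a * f x + b * g x) x = a *\<^sub>R grad f x + b *\<^sub>R grad g x"
  by (rule grad_eqI)
    (auto intro!: derivative_eq_intros torus_smooth_C1(1)[OF assms(1)] torus_smooth_C1(1)[OF assms(2)] simp: inner_add_left)

lemma torus_integration_by_parts:
  fixes f g :: "real^'n \<Rightarrow> real"
  assumes L: "L > 0" and f: "torus_smooth L f" and g: "torus_smooth L g"
  shows "(LINT x|torus L. f x *\<^sub>R grad g x) = - (LINT x|torus L. g x *\<^sub>R grad f x)"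
proof -
  have i: "integrable (torus L) (\<lambda>x. f x *\<^sub>R grad g x)" if "torus_smooth L f" "torus_smooth L g" for f g :: "real^'n \<Rightarrow> real"
    using that by (intro integrable_torus_continuous continuous_intros torus_smooth_continuous torus_smooth_grad_continuous)
  let ?I = "(LINT x|torus L. f x *\<^sub>R grad g x + g x *\<^sub>R grad f x)"
  have "?I \<bullet> v = 0" for v
  proof -
    have "(LINT x|torus L. (f x *\<^sub>R grad g x + g x *\<^sub>R grad f x) \<bullet> v) = 0"
    proof (rule integral_torus_directional_derivative[OF L, of "\<lambda>x. f x * g x"])
      show "torus_periodic L (\<lambda>x. f x * g x)" using f g by (simp add: torus_smooth_def torus_periodic_def)
      show "((\<lambda>x. f x * g x) has_derivative (\<bullet>) (f x *\<^sub>R grad g x + g x *\<^sub>R grad f x)) (at x)" for x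
        using torus_smooth_C1(1)[OF f, of x] torus_smooth_C1(1)[OF g, of x]
        by (auto intro!: derivative_eq_intros simp: fun_eq_iff inner_add_left mult.commute)
      show "continuous_on UNIV (\<lambda>x. f x *\<^sub>R grad g x + g x *\<^sub>R grad f x)"
        by (intro continuous_intros torus_smooth_continuous[OF f] torus_smooth_continuous[OF g]
            torus_smooth_grad_continuous[OF f] torus_smooth_grad_continuous[OF g])
    qed
    then show ?thesis using i[OF f g] i[OF g f] by (simp only: integral_inner_left Bochner_Integration.integrable_add)
  qed
  then have "?I = 0" using inner_eq_zero_iff by blast
  then show ?thesis using i[OF f g] i[OF g f] by (simp add: eq_neg_iff_add_eq_0)
qed

section \<open>Square integrable functions\<close>

lemma norm_sq_le_twice: "(norm (a + b))\<^sup>2 \<le> 2 * (norm a)\<^sup>2 + 2 * (norm (b::'b::real_normed_vector))\<^sup>2"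
proof -
  have "(norm (a + b))\<^sup>2 \<le> (norm a + norm b)\<^sup>2" by (intro power_mono norm_triangle_ineq) simp
  also have "\<dots> \<le> 2 * (norm a)\<^sup>2 + 2 * (norm b)\<^sup>2"
    using zero_le_power2[of "norm a - norm b"] unfolding power2_sum power2_diff by linarith
  finally show ?thesis .
qed

lemma L2_integrable_diff:
  fixes f g :: "'a \<Rightarrow> 'b::euclidean_space"
  assumes [measurable]: "f \<in> borel_measurable M" "g \<in> borel_measurable M"
    and i: "integrable M (\<lambda>x. (norm (f x))\<^sup>2)" "integrable M (\<lambda>x. (norm (g x))\<^sup>2)"
  shows "integrable M (\<lambda>x. (norm (f x - g x))\<^sup>2)"
proof (rule Bochner_Integration.integrable_bound[where f = "\<lambda>x. 2 * (norm (f x))\<^sup>2 + 2 * (norm (g x))\<^sup>2"])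
  show "AE x in M. norm ((norm (f x - g x))\<^sup>2) \<le> norm (2 * (norm (f x))\<^sup>2 + 2 * (norm (g x))\<^sup>2)"
  proof (rule AE_I2)
    fix x
    show "norm ((norm (f x - g x))\<^sup>2) \<le> norm (2 * (norm (f x))\<^sup>2 + 2 * (norm (g x))\<^sup>2)"
      using norm_sq_le_twice[of "f x" "- g x"] by simp
  qed
qed (use i in auto)

text \<open>The limit is named explicitly as the pointwise limit of a subsequence so that it inherits periodicity
from the sequence.\<close>

theorem L2_complete:
  fixes f :: "nat \<Rightarrow> 'a \<Rightarrow> 'b::euclidean_space"
  assumes m: "\<And>n. f n \<in> borel_measurable M"
    and sq: "\<And>n. integrable M (\<lambda>x. (norm (f n x))\<^sup>2)"
    and cauchy: "\<And>e. e > 0 \<Longrightarrow> \<exists>N. \<forall>m\<ge>N. \<forall>n\<ge>N. (LINT x|M. (norm (f m x - f n x))\<^sup>2) < e"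
  obtains r where "(\<lambda>x. lim (\<lambda>k. f (r k) x)) \<in> borel_measurable M"
    "integrable M (\<lambda>x. (norm (lim (\<lambda>k. f (r k) x)))\<^sup>2)"
    "(\<lambda>n. LINT x|M. (norm (f n x - lim (\<lambda>k. f (r k) x)))\<^sup>2) \<longlonglongrightarrow> 0"
proof -
  note m [measurable]
  have di: "integrable M (\<lambda>x. (norm (f i x - f j x))\<^sup>2)" for i j
    by (rule L2_integrable_diff[OF m m sq sq])
  have nn: "(\<integral>\<^sup>+x. ennreal ((norm (f i x - f j x))\<^sup>2) \<partial>M) = ennreal (LINT x|M. (norm (f i x - f j x))\<^sup>2)" for i j
    by (rule nn_integral_eq_integral[OF di]) simp
  have "\<exists>N. \<forall>k. \<forall>i\<ge>N k. \<forall>j\<ge>N k. (LINT x|M. (norm (f i x - f j x))\<^sup>2) < (1/8)^k"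
    by (intro choice allI cauchy) simp
  then obtain N where N: "\<And>k i j. i \<ge> N k \<Longrightarrow> j \<ge> N k \<Longrightarrow> (LINT x|M. (norm (f i x - f j x))\<^sup>2) < (1/8)^k"
    by blast
  \<comment> \<open>The sum of the thresholds is a monotone majorant of them.\<close>
  define r where "r k = (\<Sum>i\<le>k. N i)" for k
  have rN: "r i \<ge> N k" if "i \<ge> k" for i k
    using that unfolding r_def by (intro member_le_sum) auto
  define F where "F x = lim (\<lambda>k. f (r k) x)" for x
  have [measurable]: "F \<in> borel_measurable M" unfolding F_def by measurable
  \<comment> \<open>The weight \<open>4^k\<close> makes the increments eventually smaller than \<open>2^-k\<close> pointwise, while the bounds \<open>8^-k\<close> keep the sum of the integrals finite.\<close>
  have "AE x in M. (\<Sum>k. ennreal (4^k * (norm (f (r (Suc k)) x - f (r k) x))\<^sup>2)) \<noteq> \<infinity>"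
  proof (rule nn_integral_PInf_AE)
    have "(\<integral>\<^sup>+x. (\<Sum>k. ennreal (4^k * (norm (f (r (Suc k)) x - f (r k) x))\<^sup>2)) \<partial>M)
        = (\<Sum>k. \<integral>\<^sup>+x. ennreal (4^k * (norm (f (r (Suc k)) x - f (r k) x))\<^sup>2) \<partial>M)"
      by (rule nn_integral_suminf) simp
    also have "\<dots> \<le> (\<Sum>k. ennreal ((1/2)^k))"
    proof (rule suminf_le)
      fix k
      have "(\<integral>\<^sup>+x. ennreal (4^k * (norm (f (r (Suc k)) x - f (r k) x))\<^sup>2) \<partial>M)
         = ennreal (4^k) * ennreal (LINT x|M. (norm (f (r (Suc k)) x - f (r k) x))\<^sup>2)"
        by (simp add: ennreal_mult nn_integral_cmult nn)
      also have "\<dots> \<le> ennreal (4^k) * ennreal ((1/8)^k)"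
        using N[of k "r (Suc k)" "r k"] rN by (intro mult_left_mono ennreal_leI) auto
      also have "\<dots> = ennreal ((1/2)^k)" by (simp add: ennreal_mult[symmetric] power_mult_distrib[symmetric])
      finally show "(\<integral>\<^sup>+x. ennreal (4^k * (norm (f (r (Suc k)) x - f (r k) x))\<^sup>2) \<partial>M) \<le> ennreal ((1/2)^k)" .
    qed auto
    also have "\<dots> = ennreal 2"
      using suminf_geometric[of "1/2::real"] by (subst suminf_ennreal2) (auto simp: summable_geometric)
    finally show "(\<integral>\<^sup>+x. (\<Sum>k. ennreal (4^k * (norm (f (r (Suc k)) x - f (r k) x))\<^sup>2)) \<partial>M) \<noteq> \<infinity>"
      by (auto simp: top_unique)
  qed simp
  then have conv: "AE x in M. (\<lambda>k. f (r k) x) \<longlonglongrightarrow> F x"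
  proof eventually_elim
    case (elim x)
    let ?d = "\<lambda>k. norm (f (r (Suc k)) x - f (r k) x)"
    have s: "summable (\<lambda>k. 4^k * (?d k)\<^sup>2)"
      using elim by (intro summable_suminf_not_top) auto
    have "eventually (\<lambda>k. 4^k * (?d k)\<^sup>2 < 1) sequentially"
      using summable_LIMSEQ_zero[OF s] by (rule order_tendstoD) simp
    then have "eventually (\<lambda>k. norm (?d k) \<le> (1/2)^k) sequentially"
    proof eventually_elim
      case (elim k)
      have "(2::real)^k * 2^k = (2 * 2)^k" by (rule power_mult_distrib[symmetric])
      then have four: "((2::real)^k)\<^sup>2 = 4^k" unfolding power2_eq_square by simp
      have "(?d k * 2^k)\<^sup>2 = 4^k * (?d k)\<^sup>2" unfolding power_mult_distrib four by (rule mult.commute)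
      then have "(?d k * 2^k)\<^sup>2 \<le> 1\<^sup>2" using elim by simp
      then have "?d k * 2^k \<le> 1" by (rule power2_le_imp_le) simp
      then show ?case by (simp add: field_simps power_divide)
    qed
    then have "summable ?d"
      by (rule summable_comparison_test_ev) (rule summable_geometric, simp)
    then have "summable (\<lambda>k. f (r (Suc k)) x - f (r k) x)" by (rule summable_norm_cancel)
    then have "convergent (\<lambda>k. f (r k) x)"
      unfolding summable_iff_convergent sum_lessThan_telescope[of "\<lambda>k. f (r k) x"] by (simp only: convergent_diff_const_right_iff)
    then show ?case unfolding F_def by (simp add: convergent_LIMSEQ_iff)
  qed
  have bound: "(\<integral>\<^sup>+x. ennreal ((norm (f n x - F x))\<^sup>2) \<partial>M) \<le> ennreal ((1/8)^k)" if "n \<ge> N k" for n k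
  proof -
    have "(\<integral>\<^sup>+x. ennreal ((norm (f n x - F x))\<^sup>2) \<partial>M)
        = (\<integral>\<^sup>+x. liminf (\<lambda>i. ennreal ((norm (f n x - f (r i) x))\<^sup>2)) \<partial>M)"
    proof (rule nn_integral_cong_AE, use conv in eventually_elim)
      case (elim x)
      have "(\<lambda>i. ennreal ((norm (f n x - f (r i) x))\<^sup>2)) \<longlonglongrightarrow> ennreal ((norm (f n x - F x))\<^sup>2)"
        by (intro tendsto_intros elim)
      then show ?case using lim_imp_Liminf[of sequentially] by fastforce
    qed
    also have "\<dots> \<le> liminf (\<lambda>i. \<integral>\<^sup>+x. ennreal ((norm (f n x - f (r i) x))\<^sup>2) \<partial>M)"
      by (rule nn_integral_liminf) simp
    also have "\<dots> \<le> ennreal ((1/8)^k)"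
    proof (rule Liminf_le)
      show "\<forall>\<^sub>F i in sequentially. (\<integral>\<^sup>+x. ennreal ((norm (f n x - f (r i) x))\<^sup>2) \<partial>M) \<le> ennreal ((1/8)^k)"
        using eventually_ge_at_top[of k]
        by eventually_elim (use N[of k n "r _"] rN that in \<open>auto simp: nn intro!: ennreal_leI less_imp_le\<close>)
    qed simp
    finally show ?thesis .
  qed
  have int_d: "integrable M (\<lambda>x. (norm (f n x - F x))\<^sup>2)" if "n \<ge> N k" for n k
    using bound[OF that] by (simp add: integrable_iff_bounded le_less_trans)
  have int_F: "integrable M (\<lambda>x. (norm (F x))\<^sup>2)"
    using L2_integrable_diff[of "f (N 0)" M "\<lambda>x. f (N 0) x - F x"] sq int_d[of 0 "N 0"] by simp
  have "(\<lambda>n. LINT x|M. (norm (f n x - F x))\<^sup>2) \<longlonglongrightarrow> 0"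
  proof (rule LIMSEQ_I)
    fix e :: real assume "e > 0"
    then obtain k where k: "(1/8)^k < e" using real_arch_pow_inv[of e "1/8"] by auto
    have "norm ((LINT x|M. (norm (f n x - F x))\<^sup>2) - 0) < e" if "n \<ge> N k" for n
    proof -
      have "(LINT x|M. (norm (f n x - F x))\<^sup>2) \<le> (1/8)^k"
        by (rule integral_real_bounded[OF _ bound[OF that]]) simp
      then show ?thesis using k by (simp add: integral_nonneg_AE)
    qed
    then show "\<exists>no. \<forall>n\<ge>no. norm ((LINT x|M. (norm (f n x - F x))\<^sup>2) - 0) < e" by blast
  qed
  with int_F show ?thesis using that[of r] by (simp add: F_def)
qed

definition L2fun :: "'a measure \<Rightarrow> ('a \<Rightarrow> 'b::euclidean_space) \<Rightarrow> bool" where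
  "L2fun M f \<longleftrightarrow> f \<in> borel_measurable M \<and> integrable M (\<lambda>x. (norm (f x))\<^sup>2)"

lemma L2fun_scale: "L2fun M f \<Longrightarrow> L2fun M (\<lambda>x. c *\<^sub>R f x)"
  by (auto simp: L2fun_def power_mult_distrib)

lemma L2fun_diff: "L2fun M f \<Longrightarrow> L2fun M g \<Longrightarrow> L2fun M (\<lambda>x. f x - g x)"
  by (auto simp: L2fun_def intro: L2_integrable_diff)

lemma L2fun_integrable_inner:
  assumes "L2fun M f" "L2fun M g"
  shows "integrable M (\<lambda>x. f x \<bullet> g x)"
proof (rule Bochner_Integration.integrable_bound[where f = "\<lambda>x. (norm (f x))\<^sup>2 + (norm (g x))\<^sup>2"])
  show "AE x in M. norm (f x \<bullet> g x) \<le> norm ((norm (f x))\<^sup>2 + (norm (g x))\<^sup>2)"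
  proof (rule AE_I2)
    fix x
    have "\<bar>f x \<bullet> g x\<bar> \<le> norm (f x) * norm (g x)" by (rule Cauchy_Schwarz_ineq2)
    moreover have "2 * (norm (f x) * norm (g x)) \<le> (norm (f x))\<^sup>2 + (norm (g x))\<^sup>2"
      using sum_squares_bound[of "norm (f x)" "norm (g x)"] by simp
    moreover have "0 \<le> norm (f x) * norm (g x)" by simp
    ultimately have "\<bar>f x \<bullet> g x\<bar> \<le> (norm (f x))\<^sup>2 + (norm (g x))\<^sup>2" by linarith
    then show "norm (f x \<bullet> g x) \<le> norm ((norm (f x))\<^sup>2 + (norm (g x))\<^sup>2)" by simp
  qed
qed (use assms in \<open>auto simp: L2fun_def\<close>)

lemma L2fun_norm_add:
  assumes f: "L2fun M f" and g: "L2fun M g"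
  shows "(LINT x|M. (norm (f x + s *\<^sub>R g x))\<^sup>2) =
    (LINT x|M. (norm (f x))\<^sup>2) + 2 * s * (LINT x|M. f x \<bullet> g x) + s\<^sup>2 * (LINT x|M. (norm (g x))\<^sup>2)"
proof -
  have "(norm (f x + s *\<^sub>R g x))\<^sup>2 = (norm (f x))\<^sup>2 + ((2 * s) * (f x \<bullet> g x) + s\<^sup>2 * (norm (g x))\<^sup>2)" for x
    unfolding power2_norm_eq_inner inner_add_left inner_add_right inner_scaleR_left inner_scaleR_right
      inner_commute[of "g x" "f x"] by algebra
  then show ?thesis
    using L2fun_integrable_inner[OF f g] f g by (simp add: L2fun_def)
qed

lemma L2fun_Cauchy_Schwarz:
  assumes f: "L2fun M f" and g: "L2fun M g"
  shows "(LINT x|M. f x \<bullet> g x)\<^sup>2 \<le> (LINT x|M. (norm (f x))\<^sup>2) * (LINT x|M. (norm (g x))\<^sup>2)"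
proof -
  let ?U = "LINT x|M. (norm (f x))\<^sup>2" and ?P = "LINT x|M. f x \<bullet> g x" and ?V = "LINT x|M. (norm (g x))\<^sup>2"
  have nn: "0 \<le> ?U + 2 * s * ?P + s\<^sup>2 * ?V" for s
    unfolding L2fun_norm_add[OF f g, symmetric] by (intro integral_nonneg_AE) auto
  have V: "0 \<le> ?V" and U: "0 \<le> ?U" by (intro integral_nonneg_AE; simp)+
  show ?thesis
  proof (cases "?V = 0")
    case True
    have "?P = 0"
    proof (rule ccontr)
      assume "?P \<noteq> 0"
      then show False using nn[of "- (?U + 1) / (2 * ?P)"] True by (simp add: field_simps)
    qed
    with True show ?thesis by simp
  next
    case False
    with V have "?V > 0" by (metis less_eq_real_def)
    then show ?thesis using nn[of "- ?P / ?V"] by (simp add: field_simps power2_eq_square)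
  qed
qed

lemma L2fun_tendsto_inner:
  assumes u: "\<And>n. L2fun M (u n)" and U: "L2fun M U" and g: "L2fun M g"
    and lim: "(\<lambda>n. LINT x|M. (norm (u n x - U x))\<^sup>2) \<longlonglongrightarrow> 0"
  shows "(\<lambda>n. LINT x|M. u n x \<bullet> g x) \<longlonglongrightarrow> (LINT x|M. U x \<bullet> g x)"
proof -
  let ?d = "\<lambda>n. (LINT x|M. (u n x - U x) \<bullet> g x)"
  have "(\<lambda>n. (?d n)\<^sup>2) \<longlonglongrightarrow> 0"
  proof (rule tendsto_sandwich[of "\<lambda>_. 0"])
    show "(\<lambda>n. (LINT x|M. (norm (u n x - U x))\<^sup>2) * (LINT x|M. (norm (g x))\<^sup>2)) \<longlonglongrightarrow> 0"
      using tendsto_mult_right[OF lim] by simp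
  qed (auto intro!: always_eventually L2fun_Cauchy_Schwarz L2fun_diff u U g)
  then have "(\<lambda>n. sqrt ((?d n)\<^sup>2)) \<longlonglongrightarrow> sqrt 0" by (rule tendsto_real_sqrt)
  then have "?d \<longlonglongrightarrow> 0" by (simp add: tendsto_rabs_zero_iff)
  moreover have "?d n = (LINT x|M. u n x \<bullet> g x) - (LINT x|M. U x \<bullet> g x)" for n
    using L2fun_integrable_inner[OF u g] L2fun_integrable_inner[OF U g] by (simp add: inner_diff_left)
  ultimately show ?thesis by (simp add: LIM_zero_iff)
qed

lemma L2fun_tendsto_norm:
  assumes u: "\<And>n. L2fun M (u n)" and U: "L2fun M U"
    and lim: "(\<lambda>n. LINT x|M. (norm (u n x - U x))\<^sup>2) \<longlonglongrightarrow> 0"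
  shows "(\<lambda>n. LINT x|M. (norm (u n x))\<^sup>2) \<longlonglongrightarrow> (LINT x|M. (norm (U x))\<^sup>2)"
proof -
  have "(LINT x|M. (norm (u n x))\<^sup>2) = 2 * (LINT x|M. u n x \<bullet> U x) - (LINT x|M. (norm (U x))\<^sup>2) + (LINT x|M. (norm (u n x - U x))\<^sup>2)" for n
    using L2fun_norm_add[OF u U, of n "-1"] by simp
  moreover have "(\<lambda>n. 2 * (LINT x|M. u n x \<bullet> U x) - (LINT x|M. (norm (U x))\<^sup>2) + (LINT x|M. (norm (u n x - U x))\<^sup>2))
     \<longlonglongrightarrow> 2 * (LINT x|M. U x \<bullet> U x) - (LINT x|M. (norm (U x))\<^sup>2) + 0"
    by (intro tendsto_intros L2fun_tendsto_inner u U lim)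
  ultimately show ?thesis by (simp add: power2_norm_eq_inner)
qed

lemma L2fun_torus_continuous:
  fixes f :: "real^'n \<Rightarrow> 'b::euclidean_space"
  assumes "continuous_on UNIV f" shows "L2fun (torus L) f"
  unfolding L2fun_def
proof
  show "f \<in> borel_measurable (torus L)" by (intro measurable_torusI borel_measurable_continuous_onI assms)
  show "integrable (torus L) (\<lambda>x. (norm (f x))\<^sup>2)"
    by (intro integrable_torus_continuous continuous_intros continuous_on_subset[OF assms]) simp
qed

lemma torus_L2_iff: "torus_L2 L f \<longleftrightarrow> torus_periodic L f \<and> L2fun (torus L) f"
  by (simp add: torus_L2_def L2fun_def)

section \<open>The Poisson equation\<close>

lemma norm_sq_torus_cell: "h \<in> torus_cell L \<Longrightarrow> (norm (h :: real^'n))\<^sup>2 \<le> real CARD('n) * L\<^sup>2"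
proof -
  assume h: "h \<in> torus_cell L"
  have "(h $ i)\<^sup>2 \<le> L\<^sup>2" for i
  proof -
    have "\<bar>h $ i\<bar> \<le> \<bar>L\<bar>" using h[unfolded torus_cell_iff, rule_format, of i] by linarith
    then show ?thesis by (simp add: abs_le_square_iff)
  qed
  then have "(\<Sum>i\<in>UNIV. (h $ i)\<^sup>2) \<le> (\<Sum>i\<in>(UNIV::'n set). L\<^sup>2)" by (intro sum_mono)
  then show ?thesis by (simp add: norm_vec_def L2_set_def sum_nonneg)
qed

text \<open>Averaging the difference estimate over all translations \<open>h\<close> in the cell: the cross term of
\<open>(\<psi> (x + h) - \<psi> x)\<^sup>2\<close> integrates to the square of the mean, which is zero.\<close>

lemma torus_Poincare:
  fixes \<psi> :: "real^'n \<Rightarrow> real"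
  assumes L: "L > 0" and s: "torus_smooth L \<psi>" and mean: "(LINT x|torus L. \<psi> x) = 0"
  shows "(LINT x|torus L. (\<psi> x)\<^sup>2) \<le> real CARD('n) * L\<^sup>2 * (LINT x|torus L. (norm (grad \<psi> x))\<^sup>2)"
proof -
  let ?T = "torus L :: (real^'n) measure"
  interpret T: finite_measure ?T by (rule finite_measure_torus)
  interpret P: pair_sigma_finite ?T ?T ..
  let ?V = "measure ?T (torus_cell L)" and ?K = "real CARD('n) * L\<^sup>2" and ?D = "LINT x|torus L. (norm (grad \<psi> x))\<^sup>2"
  have V: "?V > 0" using L by (simp add: measure_torus_space)
  have per: "torus_periodic L \<psi>" using s by (simp add: torus_smooth_def)
  have c: "continuous_on S \<psi>" for S by (rule torus_smooth_continuous[OF s])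
  have ci: "continuous_on S f \<Longrightarrow> continuous_on S (\<lambda>x. \<psi> (f x))" for S and f :: "'z::topological_space \<Rightarrow> _"
    by (rule continuous_on_compose2[OF c]) auto
  have pm: "\<psi> \<in> borel_measurable borel" by (rule borel_measurable_continuous_onI[OF c])
  have pi: "integrable ?T \<psi>" by (rule integrable_torus_continuous[OF c])
  have sqm: "(\<lambda>x. (\<psi> x)\<^sup>2) \<in> borel_measurable borel" using pm by simp
  have sqi: "integrable ?T (\<lambda>x. (\<psi> x)\<^sup>2)" by (intro integrable_torus_continuous continuous_intros c)
  have sqp: "torus_periodic L (\<lambda>x. (\<psi> x)\<^sup>2)" using per by (simp add: torus_periodic_def)
  obtain B where B: "\<And>x. norm (\<psi> x) \<le> B" "B > 0" using torus_periodic_bounded[OF L per c] by blast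
  \<comment> \<open>The autocorrelation of \<open>\<psi>\<close>; its mean over all \<open>h\<close> is the square of the mean of \<open>\<psi>\<close>.\<close>
  define q where "q h = (LINT x|?T. \<psi> x * \<psi> (x + h))" for h
  have expand: "(LINT x|?T. (\<psi> (x + h) - \<psi> x)\<^sup>2) = 2 * (LINT x|?T. (\<psi> x)\<^sup>2) - 2 * q h" for h
  proof -
    have i1: "integrable ?T (\<lambda>x. \<psi> x * \<psi> (x + h))"
      by (intro integrable_torus_continuous continuous_intros c ci)
    have "(LINT x|?T. (\<psi> (x + h) - \<psi> x)\<^sup>2) = (LINT x|?T. (\<psi> (x + h))\<^sup>2 + (\<psi> x)\<^sup>2 - 2 * (\<psi> x * \<psi> (x + h)))"
      by (intro Bochner_Integration.integral_cong refl) (simp add: power2_diff)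
    also have "\<dots> = (LINT x|?T. (\<psi> (x + h))\<^sup>2) + (LINT x|?T. (\<psi> x)\<^sup>2) - 2 * q h"
      using integral_torus_translation(1)[OF L sqm sqp sqi, of h] sqi i1 by (simp add: q_def)
    also have "(LINT x|?T. (\<psi> (x + h))\<^sup>2) = (LINT x|?T. (\<psi> x)\<^sup>2)"
      by (rule integral_torus_translation(2)[OF L sqm sqp sqi])
    finally show ?thesis by simp
  qed
  have upper: "2 * (LINT x|?T. (\<psi> x)\<^sup>2) - 2 * q h \<le> ?K * ?D" if "h \<in> torus_cell L" for h
  proof -
    have "2 * (LINT x|?T. (\<psi> x)\<^sup>2) - 2 * q h \<le> (norm h)\<^sup>2 * (L2_norm L (grad \<psi>))\<^sup>2"
      unfolding expand[symmetric] by (rule torus_difference_L2[OF L per torus_smooth_C1[OF s]])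
    also have "\<dots> \<le> ?K * ?D"
      unfolding L2_norm_sq by (intro mult_right_mono norm_sq_torus_cell that integral_nonneg_AE) auto
    finally show ?thesis .
  qed
  have m: "(\<lambda>(x, h). \<psi> x * \<psi> (x + h)) \<in> borel_measurable (?T \<Otimes>\<^sub>M ?T)"
    by (rule measurable_torus_pairI[OF _ measurable_torus_id measurable_torus_id]) (use pm in measurable)
  interpret PP: finite_measure "?T \<Otimes>\<^sub>M ?T" by (intro finite_measure_pair_measure finite_measure_torus)
  have iF: "integrable (?T \<Otimes>\<^sub>M ?T) (\<lambda>(x, h). \<psi> x * \<psi> (x + h))"
    using m B by (intro PP.integrable_const_bound[of _ "B * B"] AE_I2) (auto simp: abs_mult intro!: mult_mono)
  have iq: "integrable ?T q"
    using P.integrable_snd[OF iF] by (simp add: q_def[abs_def])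
  have "(LINT h|?T. q h) = (LINT x|?T. LINT h|?T. \<psi> x * \<psi> (x + h))"
    unfolding q_def by (rule P.Fubini_integral[OF iF])
  also have "\<dots> = 0"
    using integral_torus_translation(2)[OF L pm per pi] mean by (simp add: add.commute)
  finally have q0: "(LINT h|?T. q h) = 0" .
  have "2 * (LINT x|?T. (\<psi> x)\<^sup>2) * ?V = (LINT h|?T. 2 * (LINT x|?T. (\<psi> x)\<^sup>2) - 2 * q h)"
    using iq q0 by simp
  also have "\<dots> \<le> (LINT h|?T. ?K * ?D)"
    by (rule integral_mono) (use iq upper in auto)
  also have "\<dots> = ?K * ?D * ?V" by simp
  finally have "2 * (LINT x|?T. (\<psi> x)\<^sup>2) \<le> ?K * ?D" using V by (simp add: mult_le_cancel_right)
  moreover have "0 \<le> (LINT x|?T. (\<psi> x)\<^sup>2)" by (intro integral_nonneg_AE) auto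
  ultimately show ?thesis by linarith
qed

lemma L2fun_grad: "torus_smooth L \<psi> \<Longrightarrow> L2fun (torus L) (grad \<psi>)"
  by (intro L2fun_torus_continuous torus_smooth_grad_continuous)

lemma L2fun_smooth: "torus_smooth L \<psi> \<Longrightarrow> L2fun (torus L) \<psi>"
  by (intro L2fun_torus_continuous torus_smooth_continuous)

text \<open>The direct method: minimise \<open>J \<psi> = \<parallel>grad \<psi>\<parallel>\<^sup>2 / 2 + \<integral> f \<psi>\<close> over smooth functions of mean zero. The dual
bound on \<open>f\<close> makes \<open>J\<close> bounded below, convexity makes the gradients of a minimising sequence a
Cauchy sequence, and the Poincare inequality does the same for the functions themselves. The limit
satisfies the Euler-Lagrange equation, and testing this equation with the minimising sequence
gives the bound on its gradient.\<close>

theorem torus_Poisson_weak_solution: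
  fixes f :: "real^'n \<Rightarrow> real"
  assumes L: "L > 0" and f: "torus_L2 L f"
    and C: "\<And>\<psi>. torus_smooth L \<psi> \<Longrightarrow> \<bar>LINT x|torus L. f x * \<psi> x\<bar> \<le> C * L2_norm L (grad \<psi>)" "C \<ge> 0"
  obtains \<phi> G where "weak_gradient L \<phi> G" "weak_divergence L G f" "L2_norm L G \<le> C"
proof -
  let ?T = "torus L :: (real^'n) measure"
  interpret T: finite_measure ?T by (rule finite_measure_torus)
  let ?V = "measure ?T (torus_cell L)" and ?K = "real CARD('n) * L\<^sup>2"
  have V: "?V > 0" using L by (simp add: measure_torus_space)
  have fL2: "L2fun ?T f" using f by (simp add: torus_L2_iff)
  have fi: "integrable ?T (\<lambda>x. f x * \<psi> x)" if "torus_smooth L \<psi>" for \<psi>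
    using L2fun_integrable_inner[OF fL2 L2fun_smooth[OF that]] by simp
  define l where "l \<psi> = (LINT x|?T. f x * \<psi> x)" for \<psi>
  define D where "D \<psi> = (LINT x|?T. (norm (grad \<psi> x))\<^sup>2)" for \<psi>
  define E where "E \<psi> \<theta> = (LINT x|?T. grad \<psi> x \<bullet> grad \<theta> x)" for \<psi> \<theta>
  define J where "J \<psi> = D \<psi> / 2 + l \<psi>" for \<psi>
  have D0: "0 \<le> D \<psi>" for \<psi> unfolding D_def by (intro integral_nonneg_AE) auto
  have grad_add: "grad (\<lambda>x. \<psi> x + s * \<theta> x) = (\<lambda>x. grad \<psi> x + s *\<^sub>R grad \<theta> x)"
    if "torus_smooth L \<psi>" "torus_smooth L \<theta>" for \<psi> \<theta> s
    using grad_lincomb[OF that, of 1 s] by auto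
  have D_add: "D (\<lambda>x. \<psi> x + s * \<theta> x) = D \<psi> + 2 * s * E \<psi> \<theta> + s\<^sup>2 * D \<theta>"
    if "torus_smooth L \<psi>" "torus_smooth L \<theta>" for \<psi> \<theta> s
    unfolding D_def E_def grad_add[OF that] by (rule L2fun_norm_add) (use that L2fun_grad in auto)
  have l_add: "l (\<lambda>x. \<psi> x + s * \<theta> x) = l \<psi> + s * l \<theta>"
    if "torus_smooth L \<psi>" "torus_smooth L \<theta>" for \<psi> \<theta> s
    using fi[OF that(1)] fi[OF that(2)] by (simp add: l_def algebra_simps)
  have sm_add: "torus_smooth L (\<lambda>x. \<psi> x + s * \<theta> x)" if "torus_smooth L \<psi>" "torus_smooth L \<theta>" for \<psi> \<theta> s
    by (intro torus_smooth_add torus_smooth_scale that)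
  have J_add: "J (\<lambda>x. \<psi> x + s * \<theta> x) = J \<psi> + s * (E \<psi> \<theta> + l \<theta>) + s\<^sup>2 * D \<theta> / 2"
    if "torus_smooth L \<psi>" "torus_smooth L \<theta>" for \<psi> \<theta> s
    unfolding J_def D_add[OF that] l_add[OF that] by (simp add: algebra_simps)
  have J_lower: "- C\<^sup>2 / 2 \<le> J \<psi>" if "torus_smooth L \<psi>" for \<psi>
  proof -
    let ?a = "L2_norm L (grad \<psi>)"
    have "D \<psi> = ?a\<^sup>2" by (simp add: D_def L2_norm_sq)
    moreover have "- (C * ?a) \<le> l \<psi>" using C(1)[OF that] by (simp add: l_def abs_le_iff)
    moreover have "2 * (C * ?a) \<le> C\<^sup>2 + ?a\<^sup>2" using sum_squares_bound[of C ?a] by simp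
    ultimately show ?thesis unfolding J_def by linarith
  qed
  define m where "m = Inf (J ` {\<psi>. torus_smooth L \<psi>})"
  have bdd: "bdd_below (J ` {\<psi>. torus_smooth L \<psi>})" using J_lower by (auto intro!: bdd_belowI)
  have ne: "J ` {\<psi>. torus_smooth L \<psi>} \<noteq> {}" using torus_smooth_const by auto
  have m_le: "m \<le> J \<psi>" if "torus_smooth L \<psi>" for \<psi>
    unfolding m_def by (intro cInf_lower bdd imageI) (simp add: that)
  \<comment> \<open>The dual bound forces \<open>f\<close> to have mean zero, so that \<open>J\<close> does not see constants.\<close>
  have l_const: "l (\<lambda>x. c) = 0" for c :: real
  proof -
    have "grad (\<lambda>x. c) = (\<lambda>x::real^'n. 0)" by (intro ext grad_eqI) simp
    then show ?thesis using C(1)[OF torus_smooth_const, of c] by (simp add: l_def L2_norm_def)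
  qed
  have ex: "\<exists>\<psi>. torus_smooth L \<psi> \<and> J \<psi> \<le> m + 1 / real (Suc n) \<and> (LINT x|?T. \<psi> x) = 0" for n
  proof -
    have "m < m + 1 / real (Suc n)" by simp
    then obtain \<psi> where \<psi>: "torus_smooth L \<psi>" "J \<psi> < m + 1 / real (Suc n)"
      using cInf_less_iff[OF ne bdd, of "m + 1 / real (Suc n)"] unfolding m_def by auto
    let ?c = "(LINT x|?T. \<psi> x) / ?V"
    let ?\<psi> = "\<lambda>x. \<psi> x + (-1) * ?c"
    have "grad (\<lambda>x. ?c) = (\<lambda>x::real^'n. 0)" by (intro ext grad_eqI) simp
    then have "D (\<lambda>x. ?c) = 0" "E \<psi> (\<lambda>x. ?c) = 0" by (simp_all add: D_def E_def)
    then have "J ?\<psi> = J \<psi>" using J_add[OF \<psi>(1) torus_smooth_const, of "-1" ?c] l_const by simp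
    moreover have "torus_smooth L ?\<psi>" by (rule sm_add[OF \<psi>(1) torus_smooth_const])
    moreover have "(LINT x|?T. ?\<psi> x) = 0"
      using V integrable_torus_continuous[OF torus_smooth_continuous[OF \<psi>(1)]] by simp
    ultimately show ?thesis using \<psi>(2) by (intro exI[of _ ?\<psi>]) auto
  qed
  then obtain u where u: "\<And>n. torus_smooth L (u n)" and uJ: "\<And>n. J (u n) \<le> m + 1 / real (Suc n)"
    and u0: "\<And>n. (LINT x|?T. u n x) = 0" by metis
  \<comment> \<open>The parallelogram identity: the value of \<open>J\<close> at the midpoint is at least the infimum.\<close>
  have Ddiff: "D (\<lambda>x. u i x + (-1) * u j x) \<le> 4 / real (Suc i) + 4 / real (Suc j)" for i j
  proof -
    have mid: "m \<le> J (\<lambda>x. (1/2) * u i x + (1/2) * u j x)"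
      by (intro m_le sm_add torus_smooth_scale u)
    have "J (\<lambda>x. (1/2) * u i x + (1/2) * u j x) = J (\<lambda>x. u i x + (1/2) * (u j x + (-1) * u i x))"
      by (simp add: algebra_simps)
    also have "\<dots> = J (u i) + (1/2) * (E (u i) (\<lambda>x. u j x + (-1) * u i x) + l (\<lambda>x. u j x + (-1) * u i x)) + (1/2)\<^sup>2 * D (\<lambda>x. u j x + (-1) * u i x) / 2"
      by (intro J_add u sm_add)
    finally have e1: "m \<le> J (u i) + (1/2) * (E (u i) (\<lambda>x. u j x + (-1) * u i x) + l (\<lambda>x. u j x + (-1) * u i x)) + D (\<lambda>x. u j x + (-1) * u i x) / 8"
      using mid by (simp add: power2_eq_square)
    have "J (u j) = J (\<lambda>x. u i x + 1 * (u j x + (-1) * u i x))" by simp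
    also have "\<dots> = J (u i) + 1 * (E (u i) (\<lambda>x. u j x + (-1) * u i x) + l (\<lambda>x. u j x + (-1) * u i x)) + 1\<^sup>2 * D (\<lambda>x. u j x + (-1) * u i x) / 2"
      by (intro J_add u sm_add)
    finally have e2: "J (u j) = J (u i) + (E (u i) (\<lambda>x. u j x + (-1) * u i x) + l (\<lambda>x. u j x + (-1) * u i x)) + D (\<lambda>x. u j x + (-1) * u i x) / 2" by simp
    have "D (\<lambda>x. u i x + (-1) * u j x) = D (\<lambda>x. u j x + (-1) * u i x)"
      unfolding D_def grad_add[OF u u] by (simp add: norm_minus_commute)
    moreover have "d \<le> 4 * p + 4 * q" if "m \<le> Ji + (1/2) * a + d / 8" "Jj = Ji + a + d / 2" "Ji \<le> m + p" "Jj \<le> m + q"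
      for Ji Jj a d p q :: real
      using that by linarith
    note this[OF e1 e2 uJ[of i] uJ[of j]]
    ultimately show ?thesis by simp
  qed
  have small: "\<exists>N. \<forall>i\<ge>N. \<forall>j\<ge>N. c * D (\<lambda>x. u i x + (-1) * u j x) < e" if "e > 0" "c \<ge> 0" for c e
  proof -
    obtain N where N: "8 * c / e < real N" using reals_Archimedean2 by blast
    have "c * D (\<lambda>x. u i x + (-1) * u j x) < e" if "i \<ge> N" "j \<ge> N" for i j
    proof -
      have "4 / real (Suc i) + 4 / real (Suc j) \<le> 4 / real (Suc N) + 4 / real (Suc N)"
        using that by (intro add_mono divide_left_mono) auto
      then have "c * D (\<lambda>x. u i x + (-1) * u j x) \<le> c * (8 / real (Suc N))"
        using Ddiff[of i j] \<open>c \<ge> 0\<close> by (intro mult_left_mono) auto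
      also have "\<dots> < e" using N \<open>e > 0\<close> by (simp add: field_simps)
      finally show ?thesis .
    qed
    then show ?thesis by blast
  qed
  have uG: "\<And>n. L2fun ?T (grad (u n))" and uL: "\<And>n. L2fun ?T (u n)" by (rule L2fun_grad[OF u], rule L2fun_smooth[OF u])
  have gd: "(LINT x|?T. (norm (grad (u i) x - grad (u j) x))\<^sup>2) = D (\<lambda>x. u i x + (-1) * u j x)" for i j
    unfolding D_def grad_add[OF u u] by simp
  have pd: "(LINT x|?T. (norm (u i x - u j x))\<^sup>2) \<le> ?K * D (\<lambda>x. u i x + (-1) * u j x)" for i j
  proof -
    have "(LINT x|?T. u i x + (-1) * u j x) = 0"
      using u0 integrable_torus_continuous[OF torus_smooth_continuous[OF u]] by simp
    from torus_Poincare[OF L sm_add[OF u u] this] show ?thesis by (simp add: D_def)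
  qed
  obtain r where G: "(\<lambda>x. lim (\<lambda>k. grad (u (r k)) x)) \<in> borel_measurable ?T"
    "integrable ?T (\<lambda>x. (norm (lim (\<lambda>k. grad (u (r k)) x)))\<^sup>2)"
    "(\<lambda>n. LINT x|?T. (norm (grad (u n) x - lim (\<lambda>k. grad (u (r k)) x)))\<^sup>2) \<longlonglongrightarrow> 0"
    by (rule L2_complete[of "\<lambda>n. grad (u n)" ?T]) (use uG small[of _ 1] in \<open>auto simp: L2fun_def gd\<close>)
  obtain r' where P: "(\<lambda>x. lim (\<lambda>k. u (r' k) x)) \<in> borel_measurable ?T"
    "integrable ?T (\<lambda>x. (norm (lim (\<lambda>k. u (r' k) x)))\<^sup>2)"
    "(\<lambda>n. LINT x|?T. (norm (u n x - lim (\<lambda>k. u (r' k) x)))\<^sup>2) \<longlonglongrightarrow> 0"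
  proof (rule L2_complete[of u ?T])
    fix e :: real assume "e > 0"
    from small[OF this, of ?K] obtain N where "\<forall>i\<ge>N. \<forall>j\<ge>N. ?K * D (\<lambda>x. u i x + (-1) * u j x) < e" by auto
    then show "\<exists>N. \<forall>m\<ge>N. \<forall>n\<ge>N. (LINT x|?T. (norm (u m x - u n x))\<^sup>2) < e" using pd by (meson le_less_trans)
  qed (use uL in \<open>auto simp: L2fun_def\<close>)
  define G where "G x = lim (\<lambda>k. grad (u (r k)) x)" for x
  define \<phi> where "\<phi> x = lim (\<lambda>k. u (r' k) x)" for x
  have GL: "L2fun ?T G" and PL: "L2fun ?T \<phi>" using G P by (simp_all add: L2fun_def G_def[abs_def] \<phi>_def[abs_def])
  have Glim: "(\<lambda>n. LINT x|?T. (norm (grad (u n) x - G x))\<^sup>2) \<longlonglongrightarrow> 0"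
    and Plim: "(\<lambda>n. LINT x|?T. (norm (u n x - \<phi> x))\<^sup>2) \<longlonglongrightarrow> 0" using G P by (simp_all add: G_def \<phi>_def)
  have per: "torus_periodic L G" "torus_periodic L \<phi>"
    using u torus_periodic_grad[OF _ torus_smooth_C1(1)[OF u]] by (simp_all add: G_def \<phi>_def torus_periodic_def torus_smooth_def)
  have EL: "(LINT x|?T. G x \<bullet> grad \<psi> x) = - l \<psi>" if \<psi>: "torus_smooth L \<psi>" for \<psi>
  proof -
    define e where "e = (LINT x|?T. G x \<bullet> grad \<psi> x) + l \<psi>"
    have lim: "(\<lambda>n. E (u n) \<psi> + l \<psi>) \<longlonglongrightarrow> e"
      unfolding E_def e_def by (intro tendsto_intros L2fun_tendsto_inner[OF uG GL L2fun_grad[OF \<psi>] Glim])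
    \<comment> \<open>The first variation in direction \<open>\<psi>\<close>, for steps \<open>s\<close> of both signs.\<close>
    have nn: "0 \<le> s * e + s\<^sup>2 * D \<psi> / 2" for s
    proof (rule LIMSEQ_le_const)
      have "(\<lambda>n. s * (E (u n) \<psi> + l \<psi>) + s\<^sup>2 * D \<psi> / 2 + 1 / real (Suc n)) \<longlonglongrightarrow> s * e + s\<^sup>2 * D \<psi> / 2 + 0"
        using LIMSEQ_inverse_real_of_nat by (intro tendsto_intros lim) (simp add: inverse_eq_divide)
      then show "(\<lambda>n. s * (E (u n) \<psi> + l \<psi>) + s\<^sup>2 * D \<psi> / 2 + 1 / real (Suc n)) \<longlonglongrightarrow> s * e + s\<^sup>2 * D \<psi> / 2" by simp
      have "0 \<le> s * (E (u n) \<psi> + l \<psi>) + s\<^sup>2 * D \<psi> / 2 + 1 / real (Suc n)" for n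
        using m_le[OF sm_add[OF u \<psi>], of n s] uJ[of n] unfolding J_add[OF u \<psi>] by linarith
      then show "\<exists>N. \<forall>n\<ge>N. 0 \<le> s * (E (u n) \<psi> + l \<psi>) + s\<^sup>2 * D \<psi> / 2 + 1 / real (Suc n)" by blast
    qed
    have "e = 0"
    proof (rule ccontr)
      assume "e \<noteq> 0"
      let ?s = "- e / (D \<psi> + 1)"
      have pos: "D \<psi> + 1 > 0" using D0[of \<psi>] by simp
      have "?s * e + ?s\<^sup>2 * D \<psi> / 2 = - (e\<^sup>2 / (D \<psi> + 1)) * (1 - (D \<psi> / (D \<psi> + 1)) / 2)"
        by (simp add: power2_eq_square algebra_simps)
      moreover have "D \<psi> / (D \<psi> + 1) \<le> 1" using D0[of \<psi>] by simp
      moreover have "e\<^sup>2 / (D \<psi> + 1) > 0" using pos \<open>e \<noteq> 0\<close> by simp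
      moreover have "- p * (1 - q / 2) < 0" if "q \<le> 1" "p > 0" for p q :: real
        using that by (intro mult_neg_pos) auto
      ultimately have "?s * e + ?s\<^sup>2 * D \<psi> / 2 < 0" by metis
      then show False using nn[of ?s] by simp
    qed
    then show ?thesis by (simp add: e_def)
  qed
  have "weak_divergence L G f" unfolding weak_divergence_def using EL by (simp add: l_def)
  moreover have "weak_gradient L \<phi> G"
    unfolding weak_gradient_def
  proof (intro conjI allI impI)
    show "torus_L2 L \<phi>" "torus_L2 L G" using GL PL per by (simp_all add: torus_L2_iff)
    fix \<psi> :: "real^'n \<Rightarrow> real" assume \<psi>: "torus_smooth L \<psi>"
    have i1: "integrable ?T (\<lambda>x. h x *\<^sub>R grad \<psi> x)" if "L2fun ?T h" for h :: "real^'n \<Rightarrow> real"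
    proof (rule Bochner_Integration.integrable_bound[OF L2fun_integrable_inner[of ?T "\<lambda>x. \<bar>h x\<bar>" "\<lambda>x. norm (grad \<psi> x)"]])
      show "L2fun ?T (\<lambda>x. \<bar>h x\<bar>)" using that by (auto simp: L2fun_def)
      show "L2fun ?T (\<lambda>x. norm (grad \<psi> x))" using L2fun_grad[OF \<psi>] by (auto simp: L2fun_def)
      show "(\<lambda>x. h x *\<^sub>R grad \<psi> x) \<in> borel_measurable ?T" using that L2fun_grad[OF \<psi>] by (auto simp: L2fun_def)
    qed auto
    have i2: "integrable ?T (\<lambda>x. \<psi> x *\<^sub>R h x)" if "L2fun ?T h" for h :: "real^'n \<Rightarrow> real^'n"
    proof (rule Bochner_Integration.integrable_bound[OF L2fun_integrable_inner[of ?T "\<lambda>x. \<bar>\<psi> x\<bar>" "\<lambda>x. norm (h x)"]])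
      show "L2fun ?T (\<lambda>x. norm (h x))" using that by (auto simp: L2fun_def)
      show "L2fun ?T (\<lambda>x. \<bar>\<psi> x\<bar>)" using L2fun_smooth[OF \<psi>] by (auto simp: L2fun_def)
      show "(\<lambda>x. \<psi> x *\<^sub>R h x) \<in> borel_measurable ?T" using that L2fun_smooth[OF \<psi>] by (auto simp: L2fun_def)
    qed auto
    have "(LINT x|?T. \<phi> x *\<^sub>R grad \<psi> x) \<bullet> v = (- (LINT x|?T. \<psi> x *\<^sub>R G x)) \<bullet> v" for v
    proof -
      have gv: "L2fun ?T (\<lambda>x. grad \<psi> x \<bullet> v)"
        by (intro L2fun_torus_continuous continuous_intros torus_smooth_grad_continuous[OF \<psi>])
      have pv: "L2fun ?T (\<lambda>x. \<psi> x *\<^sub>R v)"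
        by (intro L2fun_torus_continuous continuous_intros torus_smooth_continuous[OF \<psi>])
      have 1: "(\<lambda>n. LINT x|?T. u n x * (grad \<psi> x \<bullet> v)) \<longlonglongrightarrow> (LINT x|?T. \<phi> x * (grad \<psi> x \<bullet> v))"
        using L2fun_tendsto_inner[OF uL PL gv Plim] by simp
      have 2: "(\<lambda>n. LINT x|?T. grad (u n) x \<bullet> (\<psi> x *\<^sub>R v)) \<longlonglongrightarrow> (LINT x|?T. G x \<bullet> (\<psi> x *\<^sub>R v))"
        by (rule L2fun_tendsto_inner[OF uG GL pv Glim])
      have "(LINT x|?T. u n x * (grad \<psi> x \<bullet> v)) = - (LINT x|?T. grad (u n) x \<bullet> (\<psi> x *\<^sub>R v))" for n
      proof -
        have "(LINT x|?T. u n x *\<^sub>R grad \<psi> x) \<bullet> v = (- (LINT x|?T. \<psi> x *\<^sub>R grad (u n) x)) \<bullet> v"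
          by (simp only: torus_integration_by_parts[OF L u \<psi>])
        then show ?thesis using i1[OF uL] i2[OF uG]
          by (simp add: integral_inner_left[symmetric] del: integral_inner_left)
      qed
      then have "(LINT x|?T. \<phi> x * (grad \<psi> x \<bullet> v)) = - (LINT x|?T. G x \<bullet> (\<psi> x *\<^sub>R v))"
        using LIMSEQ_unique[OF 1] tendsto_minus[OF 2] by simp
      then show ?thesis using i1[OF PL] i2[OF GL]
        by (simp add: integral_inner_left[symmetric] del: integral_inner_left)
    qed
    then show "(LINT x|?T. \<phi> x *\<^sub>R grad \<psi> x) = - (LINT x|?T. \<psi> x *\<^sub>R G x)"
      using vector_eq_rdot by blast
  qed
  moreover have "L2_norm L G \<le> C"
  proof -
    let ?g = "L2_norm L G"
    have 1: "(\<lambda>n. (L2_norm L (grad (u n)))\<^sup>2) \<longlonglongrightarrow> ?g\<^sup>2"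
      unfolding L2_norm_sq by (rule L2fun_tendsto_norm[OF uG GL Glim])
    then have 2: "(\<lambda>n. L2_norm L (grad (u n))) \<longlonglongrightarrow> ?g"
      using tendsto_real_sqrt[OF 1] by (simp add: L2_norm_nonneg)
    have 3: "(\<lambda>n. LINT x|?T. grad (u n) x \<bullet> G x) \<longlonglongrightarrow> (LINT x|?T. G x \<bullet> G x)"
      by (rule L2fun_tendsto_inner[OF uG GL GL Glim])
    have "(LINT x|?T. grad (u n) x \<bullet> G x) \<le> C * L2_norm L (grad (u n))" for n
      using EL[OF u, of n] C(1)[OF u, of n] by (simp add: inner_commute l_def abs_le_iff)
    then have "(LINT x|?T. G x \<bullet> G x) \<le> C * ?g"
      using LIMSEQ_le[OF 3 tendsto_mult_left[OF 2]] by blast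
    then have "?g * ?g \<le> C * ?g" by (simp add: L2_norm_sq[unfolded power2_eq_square] dot_square_norm power2_eq_square)
    then show ?thesis using C(2) L2_norm_nonneg[of L G] by (cases "?g = 0") auto
  qed
  ultimately show ?thesis using that by blast
qed

section \<open>Trigonometric polynomials and the negative Sobolev norm\<close>

text \<open>The frequencies of the \<open>L\<close>-periodic plane waves.\<close>

definition wavevec :: "real \<Rightarrow> ('n::finite \<Rightarrow> int) \<Rightarrow> real ^ 'n" where
  "wavevec L m = (2 * pi / L) *\<^sub>R (\<chi> i. of_int (m i))"

inductive trig :: "real \<Rightarrow> (real ^ 'n \<Rightarrow> real) \<Rightarrow> bool" for L where
  cos: "trig L (\<lambda>x. cos (wavevec L m \<bullet> x))"
| sin: "trig L (\<lambda>x. sin (wavevec L m \<bullet> x))"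
| add: "trig L f \<Longrightarrow> trig L g \<Longrightarrow> trig L (\<lambda>x. f x + g x)"
| scale: "trig L f \<Longrightarrow> trig L (\<lambda>x. c * f x)"

lemma Ck_on_cos_sin:
  "Ck_on k S (\<lambda>x::'a::euclidean_space. cos (a \<bullet> x)) \<and> Ck_on k S (\<lambda>x. sin (a \<bullet> x))"
proof (induction k)
  case 0
  then show ?case by (auto intro!: continuous_intros)
next
  case (Suc k)
  then have c: "Ck_on k S (\<lambda>x::'a. c * cos (a \<bullet> x))" and s: "Ck_on k S (\<lambda>x::'a. c * sin (a \<bullet> x))" for c
    by (auto intro: Ck_on_scale)
  have "((\<lambda>x. cos (a \<bullet> x)) has_derivative (\<lambda>h. - (a \<bullet> h) * sin (a \<bullet> x))) (at x within S)"
    "((\<lambda>x. sin (a \<bullet> x)) has_derivative (\<lambda>h. (a \<bullet> h) * cos (a \<bullet> x))) (at x within S)" for x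
    by (auto intro!: derivative_eq_intros)
  then show ?case unfolding Ck_on.simps using c s
    by (intro conjI exI[of _ "\<lambda>x h. - (a \<bullet> h) * sin (a \<bullet> x)"] exI[of _ "\<lambda>x h. (a \<bullet> h) * cos (a \<bullet> x)"] ballI allI)
qed

lemma wavevec_shift: "L \<noteq> 0 \<Longrightarrow> wavevec L m \<bullet> (x + L *\<^sub>R axis i 1) = wavevec L m \<bullet> x + 2 * pi * of_int (m i)"
  by (simp add: wavevec_def inner_add_right inner_axis)

lemma trig_smooth:
  assumes "trig L f" and L: "L > 0"
  shows "torus_smooth L f"
  using assms(1)
proof induction
  case (cos m)
  then show ?case using L
    by (simp add: torus_smooth_def smooth_on_def Ck_on_cos_sin torus_periodic_def wavevec_shift cos_add)
next
  case (sin m)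
  then show ?case using L
    by (simp add: torus_smooth_def smooth_on_def Ck_on_cos_sin torus_periodic_def wavevec_shift sin_add)
qed (auto intro: torus_smooth_add torus_smooth_scale)

lemma trig_const: "trig L (\<lambda>x::real^'n. c)"
proof -
  have "trig L (\<lambda>x::real^'n. c * cos (wavevec L (\<lambda>i. 0) \<bullet> x))" by (intro trig.intros)
  moreover have "wavevec L (\<lambda>i. 0) = (0 :: real^'n)" by (simp add: wavevec_def vec_eq_iff)
  ultimately show ?thesis by simp
qed

lemma trig_sum: "finite A \<Longrightarrow> (\<And>i. i \<in> A \<Longrightarrow> trig L (f i)) \<Longrightarrow> trig L (\<lambda>x. \<Sum>i\<in>A. f i x)"
  by (induction A rule: finite_induct) (auto intro: trig_const trig.add)

lemma wavevec_add: "wavevec L m \<bullet> x + wavevec L p \<bullet> x = wavevec L (\<lambda>i. m i + p i) \<bullet> x"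
  unfolding inner_add_left[symmetric]
  by (rule arg_cong[where f = "\<lambda>w. w \<bullet> x"]) (simp add: wavevec_def vec_eq_iff distrib_left add_divide_distrib)

lemma wavevec_diff: "wavevec L m \<bullet> x - wavevec L p \<bullet> x = wavevec L (\<lambda>i. m i - p i) \<bullet> x"
  unfolding inner_diff_left[symmetric]
  by (rule arg_cong[where f = "\<lambda>w. w \<bullet> x"]) (simp add: wavevec_def vec_eq_iff right_diff_distrib diff_divide_distrib)

text \<open>The product formulas for sine and cosine turn products into sums; this makes \<open>trig\<close> an algebra, as
the Stone-Weierstrass theorem requires.\<close>

lemma trig_mult:
  assumes "trig L f" "trig L g"
  shows "trig L (\<lambda>x. f x * g x)"
  using assms(1)
proof induction
  case (cos m)
  show ?case using assms(2)
  proof induction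
    case (cos p)
    have "trig L (\<lambda>x. (1/2) * (cos (wavevec L (\<lambda>i. m i - p i) \<bullet> x) + cos (wavevec L (\<lambda>i. m i + p i) \<bullet> x)))"
      by (intro trig.intros)
    then show ?case by (simp add: cos_times_cos wavevec_add wavevec_diff)
  next
    case (sin p)
    have "trig L (\<lambda>x. (1/2) * (sin (wavevec L (\<lambda>i. m i + p i) \<bullet> x) + (- 1) * sin (wavevec L (\<lambda>i. m i - p i) \<bullet> x)))"
      by (intro trig.intros)
    then show ?case by (simp add: cos_times_sin wavevec_add wavevec_diff)
  next
    case (add f g)
    then show ?case by (auto simp: distrib_left intro: trig.add)
  next
    case (scale f c)
    then show ?case using trig.scale by (fastforce simp: mult.left_commute)
  qed
next
  case (sin m)
  show ?case using assms(2)
  proof induction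
    case (cos p)
    have "trig L (\<lambda>x. (1/2) * (sin (wavevec L (\<lambda>i. m i + p i) \<bullet> x) + sin (wavevec L (\<lambda>i. m i - p i) \<bullet> x)))"
      by (intro trig.intros)
    then show ?case by (simp add: sin_times_cos wavevec_add wavevec_diff)
  next
    case (sin p)
    have "trig L (\<lambda>x. (1/2) * (cos (wavevec L (\<lambda>i. m i - p i) \<bullet> x) + (- 1) * cos (wavevec L (\<lambda>i. m i + p i) \<bullet> x)))"
      by (intro trig.intros)
    then show ?case by (simp add: sin_times_sin wavevec_add wavevec_diff)
  next
    case (add f g)
    then show ?case by (auto simp: distrib_left intro: trig.add)
  next
    case (scale f c)
    then show ?case using trig.scale by (fastforce simp: mult.left_commute)
  qed
next
  case (add f1 f2)
  then show ?case by (auto simp: distrib_right intro: trig.add)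
next
  case (scale f c)
  then show ?case using trig.scale by (fastforce simp: mult.assoc)
qed

text \<open>The embedding of the torus into a product of circles. It turns polynomials into trigonometric
polynomials, and injectivity on the cell, up to the boundary, lets continuous functions of
\<open>circle_map L x\<close> separate points.\<close>

definition circle_map :: "real \<Rightarrow> real ^ 'n \<Rightarrow> complex ^ 'n" where
  "circle_map L x = (\<chi> i. cis (2 * pi / L * x $ i))"

lemma continuous_on_circle_map: "continuous_on S (circle_map L)"
  unfolding circle_map_def by (intro continuous_on_vec_lambda continuous_intros)

lemma trig_real_polynomial:
  fixes p :: "complex ^ 'n \<Rightarrow> real"
  assumes "real_polynomial_function p"
  shows "trig L (\<lambda>x. p (circle_map L x))"
  using assms
proof induction
  case (linear f)
  then interpret bounded_linear f .
  have w: "wavevec L (\<lambda>j. if j = i then 1 else 0) \<bullet> x = 2 * pi / L * x $ i" for i :: 'n and x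
  proof -
    have "wavevec L (\<lambda>j. if j = i then 1 else 0) = (2 * pi / L) *\<^sub>R axis i 1"
      by (simp add: wavevec_def vec_eq_iff axis_def)
    then show ?thesis by (simp add: inner_axis')
  qed
  have eq: "f z = (\<Sum>i\<in>UNIV. f (axis i 1) * Re (z $ i) + f (axis i \<i>) * Im (z $ i))" for z
  proof -
    have "z = (\<Sum>i\<in>UNIV. Re (z $ i) *\<^sub>R axis i 1 + Im (z $ i) *\<^sub>R axis i \<i>)"
      by (simp add: vec_eq_iff axis_def if_distrib[of "\<lambda>x. _ *\<^sub>R x"] sum.distrib complex_eq_iff cong: if_cong)
    then have "f z = f (\<Sum>i\<in>UNIV. Re (z $ i) *\<^sub>R axis i 1 + Im (z $ i) *\<^sub>R axis i \<i>)" by simp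
    then show ?thesis by (simp add: sum add scaleR mult.commute)
  qed
  have "(\<lambda>x. f (circle_map L x)) = (\<lambda>x. \<Sum>i\<in>UNIV. f (axis i 1) * cos (wavevec L (\<lambda>j. if j = i then 1 else 0) \<bullet> x)
       + f (axis i \<i>) * sin (wavevec L (\<lambda>j. if j = i then 1 else 0) \<bullet> x))"
    by (rule ext, subst eq) (simp add: circle_map_def w)
  moreover have "trig L \<dots>" by (intro trig_sum trig.intros finite)
  ultimately show ?case by simp
qed (auto intro: trig_const trig.add trig_mult)

lemma circle_map_inj:
  fixes x y :: "real^'n"
  assumes L: "L > 0" and "x \<in> torus_cell L" "y \<in> box (\<chi> i. - L / 2) (\<chi> i. L / 2)" "circle_map L x = circle_map L y"
  shows "x = y"
proof (rule vec_eq_iff[THEN iffD2], rule allI)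
  fix i
  have b: "\<bar>x $ i - y $ i\<bar> < L"
    using assms(2)[unfolded torus_cell_iff, rule_format, of i] assms(3)[unfolded mem_box_cart, rule_format, of i] by auto
  have "cis (2 * pi / L * x $ i) = cis (2 * pi / L * y $ i)"
    using assms(4) by (simp add: circle_map_def vec_eq_iff)
  then have "cos (2 * pi / L * x $ i - 2 * pi / L * y $ i) = 1"
    by (simp add: cis.ctr cos_diff complex_eq_iff)
  then obtain n :: int where n: "2 * pi / L * x $ i - 2 * pi / L * y $ i = of_int n * 2 * pi"
    using cos_one_2pi_int by blast
  have "2 * pi / L * x $ i - 2 * pi / L * y $ i = (2 * pi / L) * (x $ i - y $ i)" by (simp add: right_diff_distrib)
  then have "(2 * pi / L) * (x $ i - y $ i) = (2 * pi / L) * (of_int n * L)" using n L by simp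
  then have e: "x $ i - y $ i = of_int n * L" using L by (subst (asm) mult_left_cancel) auto
  then have "\<bar>of_int n :: real\<bar> < 1" using b L by (simp add: abs_mult)
  then have "n = 0" by linarith
  then show "x $ i = y $ i" using e by simp
qed

lemma real_le_all_multiples_imp_nonpos:
  fixes a I :: real
  assumes "0 \<le> I" and "\<And>e. e > 0 \<Longrightarrow> a \<le> e * I"
  shows "a \<le> 0"
proof (rule ccontr)
  assume "\<not> a \<le> 0"
  then have "a / (2 * (I + 1)) > 0" using assms(1) by simp
  from assms(2)[OF this] have "a \<le> (a / 2) * (I / (I + 1))" by (simp add: field_simps)
  also have "\<dots> \<le> (a / 2) * 1" using \<open>\<not> a \<le> 0\<close> assms(1) by (intro mult_left_mono) auto
  finally show False using \<open>\<not> a \<le> 0\<close> by simp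
qed

text \<open>By the Stone-Weierstrass theorem \<open>h\<close> is orthogonal to every continuous function of \<open>circle_map L x\<close>, and
the indicator function of a compact set in the open cell is a bounded pointwise limit of those.\<close>

lemma trig_orthogonal_compact:
  fixes h :: "real^'n \<Rightarrow> real"
  assumes L: "L > 0" and h: "integrable (torus L) h"
    and orth: "\<And>\<psi>. trig L \<psi> \<Longrightarrow> (LINT x|torus L. \<psi> x * h x) = 0"
    and C: "compact C" "C \<subseteq> box (\<chi> i. - L / 2) (\<chi> i. L / 2)"
  shows "(LINT x|torus L. indicator C x * h x) = 0"
proof -
  let ?K = "circle_map L ` (torus_cell L :: (real^'n) set)"
  have K: "compact ?K" by (intro compact_continuous_image continuous_on_circle_map) (simp add: torus_cell_def)
  have EC: "compact (circle_map L ` C)" by (intro compact_continuous_image continuous_on_circle_map C)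
  have hm [measurable]: "h \<in> borel_measurable (torus L)" using h by auto
  have cm [measurable]: "circle_map L \<in> borel_measurable (torus L)"
    by (intro measurable_torusI borel_measurable_continuous_onI continuous_on_circle_map)
  \<comment> \<open>Uniform approximation of \<open>F\<close> by polynomials on the image of the cell.\<close>
  have F0: "(LINT x|torus L. F (circle_map L x) * h x) = 0" if F: "continuous_on UNIV F" for F :: "complex^'n \<Rightarrow> real"
  proof -
    have Fm [measurable]: "F \<in> borel_measurable borel" by (rule borel_measurable_continuous_onI[OF F])
    have FK: "continuous_on ?K F" using F by (rule continuous_on_subset) simp
    obtain B where B: "\<And>w. w \<in> ?K \<Longrightarrow> \<bar>F w\<bar> \<le> B"
      using compact_imp_bounded[OF compact_continuous_image[OF FK K]] by (auto simp: bounded_iff)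
    have Fi: "integrable (torus L) (\<lambda>x. F (circle_map L x) * h x)"
      by (rule Bochner_Integration.integrable_bound[OF integrable_mult_right[OF h, of B]])
        (use B in \<open>auto simp: abs_mult intro!: AE_I2 mult_mono order_trans[OF B abs_ge_self]\<close>)
    have "\<bar>LINT x|torus L. F (circle_map L x) * h x\<bar> \<le> e * (LINT x|torus L. \<bar>h x\<bar>)" if "e > 0" for e
    proof -
      obtain p where p: "real_polynomial_function p" "\<And>w. w \<in> ?K \<Longrightarrow> \<bar>F w - p w\<bar> < e"
        using Stone_Weierstrass_real_polynomial_function[OF K FK \<open>e > 0\<close>] by blast
      have t: "trig L (\<lambda>x. p (circle_map L x))" by (rule trig_real_polynomial[OF p(1)])
      have pm [measurable]: "(\<lambda>x. p (circle_map L x)) \<in> borel_measurable (torus L)"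
        by (intro measurable_torusI borel_measurable_continuous_onI torus_smooth_continuous[OF trig_smooth[OF t L]])
      have di: "integrable (torus L) (\<lambda>x. (F (circle_map L x) - p (circle_map L x)) * h x)"
        by (rule Bochner_Integration.integrable_bound[OF integrable_mult_right[OF h, of e]])
          (use p(2) \<open>e > 0\<close> in \<open>auto simp: abs_mult less_imp_le intro!: AE_I2 mult_right_mono\<close>)
      have "integrable (torus L) (\<lambda>x. p (circle_map L x) * h x)"
        using Bochner_Integration.integrable_diff[OF Fi di] by (simp add: algebra_simps)
      then have "(LINT x|torus L. F (circle_map L x) * h x) = (LINT x|torus L. (F (circle_map L x) - p (circle_map L x)) * h x)"
        using Fi orth[OF t] by (simp add: left_diff_distrib)
      also have "\<bar>\<dots>\<bar> \<le> (LINT x|torus L. \<bar>(F (circle_map L x) - p (circle_map L x)) * h x\<bar>)"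
        by (rule integral_abs_bound)
      also have "\<dots> \<le> (LINT x|torus L. e * \<bar>h x\<bar>)"
      proof (rule integral_mono[OF integrable_abs[OF di]])
        show "\<bar>(F (circle_map L x) - p (circle_map L x)) * h x\<bar> \<le> e * \<bar>h x\<bar>" if "x \<in> space (torus L)" for x
          using p(2)[of "circle_map L x"] that by (auto simp: abs_mult less_imp_le intro!: mult_right_mono)
      qed (use h in simp)
      finally show ?thesis by simp
    qed
    note le = this
    have "0 \<le> (LINT x|torus L. \<bar>h x\<bar>)" by (intro integral_nonneg_AE) auto
    from real_le_all_multiples_imp_nonpos[OF this le] show ?thesis by simp
  qed
  show ?thesis
  proof (cases "C = {}")
    case False
    \<comment> \<open>Continuous functions decreasing to the indicator function of the image of \<open>C\<close>.\<close>
    define F where "F j w = max 0 (1 - real j * infdist w (circle_map L ` C))" for j and w :: "complex^'n"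
    have Fc: "continuous_on UNIV (F j)" for j
      unfolding F_def by (intro continuous_intros)
    have Fm [measurable]: "F j \<in> borel_measurable borel" for j by (rule borel_measurable_continuous_onI[OF Fc])
    have "(\<lambda>j. LINT x|torus L. F j (circle_map L x) * h x) \<longlonglongrightarrow> (LINT x|torus L. indicator C x * h x)"
    proof (rule integral_dominated_convergence[where w = "\<lambda>x. \<bar>h x\<bar>"])
      show "(\<lambda>x. indicator C x * h x) \<in> borel_measurable (torus L)"
        by (intro borel_measurable_times hm measurable_torusI borel_measurable_indicator borel_compact C(1))
      show "AE x in torus L. (\<lambda>j. F j (circle_map L x) * h x) \<longlonglongrightarrow> indicator C x * h x"
      proof (rule AE_I2, intro tendsto_intros)
        fix x assume "x \<in> space (torus L :: (real^'n) measure)"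
        then have x: "x \<in> torus_cell L" by simp
        show "(\<lambda>j. F j (circle_map L x)) \<longlonglongrightarrow> indicator C x"
        proof (cases "x \<in> C")
          case True
          then have "infdist (circle_map L x) (circle_map L ` C) = 0" by (intro infdist_zero) auto
          then show ?thesis using True by (simp add: F_def)
        next
          case out: False
          have "circle_map L x \<notin> circle_map L ` C"
            using circle_map_inj[OF L x] C(2) out by blast
          then have d: "infdist (circle_map L x) (circle_map L ` C) > 0"
            using in_closed_iff_infdist_zero[OF compact_imp_closed[OF EC], of "circle_map L x"] False infdist_nonneg[of "circle_map L x"]
            by (metis image_is_empty order_le_imp_less_or_eq)
          obtain N where N: "1 / infdist (circle_map L x) (circle_map L ` C) < real N" using reals_Archimedean2 by blast
          have "F j (circle_map L x) = 0" if "j \<ge> N" for j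
          proof -
            have "1 / infdist (circle_map L x) (circle_map L ` C) < real j" using N that by linarith
            then have "1 < real j * infdist (circle_map L x) (circle_map L ` C)" using d by (simp add: divide_less_eq)
            then show ?thesis unfolding F_def by linarith
          qed
          then have "eventually (\<lambda>j. F j (circle_map L x) = 0) sequentially"
            unfolding eventually_sequentially by blast
          then show ?thesis using out by (simp add: tendsto_eventually)
        qed
      qed
      show "AE x in torus L. norm (F j (circle_map L x) * h x) \<le> \<bar>h x\<bar>" for j
      proof (rule AE_I2)
        fix x
        have "0 \<le> real j * infdist (circle_map L x) (circle_map L ` C)" by (simp add: infdist_nonneg)
        then have "\<bar>F j (circle_map L x)\<bar> \<le> 1" unfolding F_def by linarith
        then show "norm (F j (circle_map L x) * h x) \<le> \<bar>h x\<bar>" by (simp add: abs_mult mult_left_le_one_le)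
      qed
    qed (use h in auto)
    then show ?thesis using F0[OF Fc] by (simp add: LIMSEQ_const_iff)
  qed simp
qed

lemma AE_torus_iff: "(AE x in torus L. P x) \<longleftrightarrow> (AE x in lebesgue. x \<in> torus_cell L \<longrightarrow> P x)"
  unfolding torus_def by (rule AE_restrict_space_iff) (simp add: torus_cell_lmeasurable fmeasurableD)

text \<open>Otherwise \<open>h\<close> or \<open>- h\<close> is positive on a set of positive measure, hence on a compact set of positive
measure, where its integral is zero.\<close>

lemma trig_orthogonal_imp_AE_zero:
  fixes h :: "real^'n \<Rightarrow> real"
  assumes L: "L > 0" and h: "integrable (torus L) h"
    and orth: "\<And>\<psi>. trig L \<psi> \<Longrightarrow> (LINT x|torus L. \<psi> x * h x) = 0"
  shows "AE x in torus L. h x = 0"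
proof -
  let ?B = "box (\<chi> i. - L / 2) (\<chi> i. L / 2) :: (real^'n) set"
  have sub: "?B \<subseteq> torus_cell L" unfolding torus_cell_def by (rule box_subset_cbox)
  have bdry: "AE x in lebesgue. x \<in> torus_cell L \<longrightarrow> x \<in> ?B"
  proof -
    have "negligible (torus_cell L - ?B)" unfolding torus_cell_def by (rule negligible_frontier_interval)
    then have "torus_cell L - ?B \<in> null_sets lebesgue" by (simp add: negligible_iff_null_sets)
    from AE_not_in[OF this] show ?thesis by eventually_elim auto
  qed
  have le: "AE x in torus L. h x \<le> 0"
    if h: "integrable (torus L) h" and orth: "\<And>\<psi>. trig L \<psi> \<Longrightarrow> (LINT x|torus L. \<psi> x * h x) = 0" for h :: "real^'n \<Rightarrow> real"
  proof -
    have hm: "h \<in> borel_measurable (torus L)" using h by auto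
    define P where "P = {x \<in> ?B. h x > 0}"
    have "{x \<in> space (torus L). h x > 0} \<in> sets (torus L)" using hm by measurable
    then have "{x \<in> torus_cell L. h x > 0} \<in> sets lebesgue"
      by (simp add: torus_def sets_restrict_space_iff torus_cell_lmeasurable fmeasurableD)
    then have "{x \<in> torus_cell L. h x > 0} \<inter> ?B \<in> sets lebesgue" by auto
    also have "{x \<in> torus_cell L. h x > 0} \<inter> ?B = P" using sub by (auto simp: P_def)
    finally have P: "P \<in> sets lebesgue" .
    have Pl: "P \<in> lmeasurable"
      by (rule bounded_set_imp_lmeasurable[OF _ P]) (auto simp: P_def intro: bounded_subset[OF bounded_box])
    have "measure lebesgue P = 0"
    proof (rule ccontr)
      assume "measure lebesgue P \<noteq> 0"
      then have pos: "measure lebesgue P > 0" by (simp add: less_le)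
      obtain T where T: "closed T" "T \<subseteq> P" "P - T \<in> lmeasurable" "emeasure lebesgue (P - T) < ennreal (measure lebesgue P)"
        using sets_lebesgue_inner_closed[OF P pos] by metis
      have TB: "T \<subseteq> ?B" using T(2) by (auto simp: P_def)
      have Tc: "compact T" using T(1) TB by (meson bounded_box bounded_subset compact_eq_bounded_closed)
      have Tl: "T \<in> lmeasurable" by (rule lmeasurable_compact[OF Tc])
      have z: "(LINT x|torus L. indicator T x * h x) = 0"
        by (rule trig_orthogonal_compact[OF L h orth Tc TB])
      have "T \<in> sets (torus L)"
        using T(1) TB sub by (auto simp: torus_def sets_restrict_space_iff torus_cell_lmeasurable fmeasurableD)
      then have i: "integrable (torus L) (\<lambda>x. indicator T x * h x)"
        using integrable_real_mult_indicator[of T "torus L" h] h by (simp add: mult.commute)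
      have nn: "AE x in torus L. 0 \<le> indicator T x * h x"
        by (rule AE_I2) (use T(2) in \<open>auto simp: P_def indicator_def less_imp_le\<close>)
      have "AE x in torus L. indicator T x * h x = 0"
        using z unfolding integral_nonneg_eq_0_iff_AE[OF i nn] .
      then have "AE x in torus L. x \<notin> T"
        by eventually_elim (use T(2) in \<open>auto simp: P_def indicator_def\<close>)
      then have "AE x in lebesgue. x \<in> torus_cell L \<longrightarrow> x \<notin> T"
        unfolding AE_torus_iff .
      then have "AE x in lebesgue. x \<notin> T" by eventually_elim (use TB sub in auto)
      then have "emeasure lebesgue T = 0" using Tl by (simp add: AE_iff_null_sets fmeasurableD null_setsD1)
      then have "emeasure lebesgue (P - T) = emeasure lebesgue P"
        using T(2) Pl Tl by (subst emeasure_Diff) (auto simp: fmeasurableD)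
      then show False using T(4) Pl by (simp add: emeasure_eq_measure2)
    qed
    then have "P \<in> null_sets lebesgue" using Pl P by (auto simp: null_sets_def emeasure_eq_measure2)
    from AE_not_in[OF this] bdry have "AE x in lebesgue. x \<in> torus_cell L \<longrightarrow> h x \<le> 0"
      by eventually_elim (auto simp: P_def)
    then show ?thesis unfolding AE_torus_iff .
  qed
  have "AE x in torus L. h x \<le> 0" by (rule le[OF h orth])
  moreover have "AE x in torus L. - h x \<le> 0" by (rule le) (use h orth in auto)
  ultimately show ?thesis by eventually_elim auto
qed

text \<open>For a plane wave of frequency \<open>w\<close> the vector \<open>\<integral> \<psi> G\<close> is a multiple of \<open>w\<close> because \<open>G\<close> is a gradient, and
orthogonal to \<open>w\<close> because \<open>G\<close> is free of divergence.\<close>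

lemma weak_gradient_orthogonal_trig:
  fixes G :: "real^'n \<Rightarrow> real^'n"
  assumes L: "L > 0"
    and grad: "\<And>\<psi>. torus_smooth L \<psi> \<Longrightarrow> (LINT x|torus L. \<phi> x *\<^sub>R grad \<psi> x) = - (LINT x|torus L. \<psi> x *\<^sub>R G x)"
    and div: "\<And>\<psi>. torus_smooth L \<psi> \<Longrightarrow> (LINT x|torus L. G x \<bullet> grad \<psi> x) = 0"
    and GL: "L2fun (torus L) G" and PL: "L2fun (torus L) \<phi>" and t: "trig L \<psi>"
  shows "(LINT x|torus L. \<psi> x *\<^sub>R G x) = 0"
proof -
  have int: "integrable (torus L) (\<lambda>x. \<psi> x *\<^sub>R G x)" if "torus_smooth L \<psi>" for \<psi>
  proof (rule Bochner_Integration.integrable_bound[OF L2fun_integrable_inner[of "torus L" "\<lambda>x. \<bar>\<psi> x\<bar>" "\<lambda>x. norm (G x)"]])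
    show "L2fun (torus L) (\<lambda>x. norm (G x))" using GL by (auto simp: L2fun_def)
    show "L2fun (torus L) (\<lambda>x. \<bar>\<psi> x\<bar>)" using L2fun_smooth[OF that] by (auto simp: L2fun_def)
    show "(\<lambda>x. \<psi> x *\<^sub>R G x) \<in> borel_measurable (torus L)" using GL L2fun_smooth[OF that] by (auto simp: L2fun_def)
  qed auto
  have main: "V = 0" if c: "V = c *\<^sub>R w" and w: "V \<bullet> w = 0" for V w :: "real^'n" and c
    using that by auto
  show ?thesis using t
  proof induction
    case (cos m)
    let ?w = "wavevec L m :: real^'n"
    let ?c = "\<lambda>x. cos (?w \<bullet> x)" and ?s = "\<lambda>x. sin (?w \<bullet> x)"
    have sm: "torus_smooth L ?c" "torus_smooth L ?s" by (intro trig_smooth trig.intros L)+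
    have g: "grad ?c x = - ?s x *\<^sub>R ?w" "grad ?s x = ?c x *\<^sub>R ?w" for x
      by (rule grad_eqI; auto intro!: derivative_eq_intros simp: fun_eq_iff)+
    show ?case
    proof (rule main)
      show "(LINT x|torus L. ?c x *\<^sub>R G x) = (LINT x|torus L. \<phi> x * ?s x) *\<^sub>R ?w"
        using grad[OF sm(1)] L2fun_integrable_inner[OF PL L2fun_smooth[OF sm(2)]] by (simp add: g)
      show "(LINT x|torus L. ?c x *\<^sub>R G x) \<bullet> ?w = 0"
        using div[OF sm(2)] int[OF sm(1)] by (simp add: g integral_inner_left[symmetric] mult.commute del: integral_inner_left)
    qed
  next
    case (sin m)
    let ?w = "wavevec L m :: real^'n"
    let ?c = "\<lambda>x. cos (?w \<bullet> x)" and ?s = "\<lambda>x. sin (?w \<bullet> x)"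
    have sm: "torus_smooth L ?c" "torus_smooth L ?s" by (intro trig_smooth trig.intros L)+
    have g: "grad ?c x = - ?s x *\<^sub>R ?w" "grad ?s x = ?c x *\<^sub>R ?w" for x
      by (rule grad_eqI; auto intro!: derivative_eq_intros simp: fun_eq_iff)+
    show ?case
    proof (rule main)
      show "(LINT x|torus L. ?s x *\<^sub>R G x) = - (LINT x|torus L. \<phi> x * ?c x) *\<^sub>R ?w"
        using grad[OF sm(2)] L2fun_integrable_inner[OF PL L2fun_smooth[OF sm(1)]] by (simp add: g minus_equation_iff)
      show "(LINT x|torus L. ?s x *\<^sub>R G x) \<bullet> ?w = 0"
        using div[OF sm(1)] int[OF sm(2)] by (simp add: g integral_inner_left[symmetric] mult.commute del: integral_inner_left)
    qed
  next
    case (add f g)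
    then show ?case using int[OF trig_smooth[OF _ L]] by (simp add: scaleR_add_left)
  next
    case (scale f c)
    then show ?case by (simp flip: scaleR_scaleR)
  qed
qed

text \<open>The difference of two solutions has a gradient that is orthogonal to all trigonometric polynomials.\<close>

lemma weak_gradient_unique:
  fixes f :: "real^'n \<Rightarrow> real"
  assumes L: "L > 0"
    and 1: "weak_gradient L \<phi>1 G1" "weak_divergence L G1 f"
    and 2: "weak_gradient L \<phi>2 G2" "weak_divergence L G2 f"
  shows "AE x in torus L. G1 x = G2 x"
proof -
  let ?\<phi> = "\<lambda>x. \<phi>1 x - \<phi>2 x" and ?G = "\<lambda>x. G1 x - G2 x"
  have L2: "L2fun (torus L) \<phi>1" "L2fun (torus L) \<phi>2" "L2fun (torus L) G1" "L2fun (torus L) G2"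
    using 1 2 by (simp_all add: weak_gradient_def torus_L2_iff)
  have GL: "L2fun (torus L) ?G" by (intro L2fun_diff L2)
  have i1: "integrable (torus L) (\<lambda>x. h x *\<^sub>R g x)" if "L2fun (torus L) h" "L2fun (torus L) g"
    for h :: "real^'n \<Rightarrow> real" and g :: "real^'n \<Rightarrow> real^'n"
  proof (rule Bochner_Integration.integrable_bound[OF L2fun_integrable_inner[of "torus L" "\<lambda>x. \<bar>h x\<bar>" "\<lambda>x. norm (g x)"]])
    show "L2fun (torus L) (\<lambda>x. \<bar>h x\<bar>)" using that by (auto simp: L2fun_def)
    show "L2fun (torus L) (\<lambda>x. norm (g x))" using that by (auto simp: L2fun_def)
    show "(\<lambda>x. h x *\<^sub>R g x) \<in> borel_measurable (torus L)" using that by (auto simp: L2fun_def)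
  qed auto
  have orth: "(LINT x|torus L. \<psi> x *\<^sub>R ?G x) = 0" if "trig L \<psi>" for \<psi>
  proof (rule weak_gradient_orthogonal_trig[OF L _ _ GL L2fun_diff[OF L2(1,2)] that])
    fix \<psi> :: "real^'n \<Rightarrow> real" assume \<psi>: "torus_smooth L \<psi>"
    note p = L2fun_smooth[OF \<psi>] L2fun_grad[OF \<psi>]
    show "(LINT x|torus L. ?\<phi> x *\<^sub>R grad \<psi> x) = - (LINT x|torus L. \<psi> x *\<^sub>R ?G x)"
      using 1(1) 2(1) \<psi> i1[OF L2(1) p(2)] i1[OF L2(2) p(2)] i1[OF p(1) L2(3)] i1[OF p(1) L2(4)]
      by (simp add: weak_gradient_def scaleR_diff_left scaleR_diff_right)
    show "(LINT x|torus L. ?G x \<bullet> grad \<psi> x) = 0"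
      using 1(2) 2(2) \<psi> L2fun_integrable_inner[OF L2(3) p(2)] L2fun_integrable_inner[OF L2(4) p(2)]
      by (simp add: weak_divergence_def inner_diff_left)
  qed
  interpret T: finite_measure "torus L" by (rule finite_measure_torus)
  have one: "L2fun (torus L) (\<lambda>x. axis i 1 :: real^'n)" for i by (simp add: L2fun_def)
  have "AE x in torus L. ?G x \<bullet> axis i 1 = 0" for i
  proof (rule trig_orthogonal_imp_AE_zero[OF L L2fun_integrable_inner[OF GL one]])
    fix \<psi> :: "real^'n \<Rightarrow> real" assume t: "trig L \<psi>"
    have "(LINT x|torus L. (\<psi> x *\<^sub>R ?G x) \<bullet> axis i 1) = (LINT x|torus L. \<psi> x *\<^sub>R ?G x) \<bullet> axis i 1"
      by (rule integral_inner_left) (use i1[OF L2fun_smooth[OF trig_smooth[OF t L]] GL] in blast)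
    then show "(LINT x|torus L. \<psi> x * (?G x \<bullet> axis i 1)) = 0" using orth[OF t] by simp
  qed
  then have "AE x in torus L. \<forall>i. ?G x \<bullet> axis i 1 = 0" by (simp add: AE_all_countable)
  then show ?thesis by eventually_elim (simp add: inner_axis vec_eq_iff)
qed

text \<open>A dual characterisation, one direction only: a solution with gradient bounded by \<open>C\<close> exists, and by
uniqueness it is the one whose norm is taken.\<close>

theorem Hminus1_norm_le:
  fixes f :: "real^'n \<Rightarrow> real"
  assumes L: "L > 0" and f: "torus_L2 L f"
    and C: "\<And>\<psi>. torus_smooth L \<psi> \<Longrightarrow> \<bar>LINT x|torus L. f x * \<psi> x\<bar> \<le> C * L2_norm L (grad \<psi>)" "C \<ge> 0"
  shows "0 \<le> Hminus1_norm L f" and "Hminus1_norm L f \<le> C"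
proof -
  obtain \<phi> G where G: "weak_gradient L \<phi> G" "weak_divergence L G f" "L2_norm L G \<le> C"
    by (rule torus_Poisson_weak_solution[OF assms]) auto
  have "Hminus1_norm L f = L2_norm L G"
    unfolding Hminus1_norm_def
  proof (rule the_equality)
    show "\<exists>\<phi>' G'. weak_gradient L \<phi>' G' \<and> weak_divergence L G' f \<and> L2_norm L G = L2_norm L G'" using G by blast
    fix r assume "\<exists>\<phi> G. weak_gradient L \<phi> G \<and> weak_divergence L G f \<and> r = L2_norm L G"
    then obtain \<phi>' G' where G': "weak_gradient L \<phi>' G'" "weak_divergence L G' f" "r = L2_norm L G'" by blast
    have "AE x in torus L. G' x = G x" by (rule weak_gradient_unique[OF L G'(1,2) G(1,2)])
    then have "(LINT x|torus L. (norm (G' x))\<^sup>2) = (LINT x|torus L. (norm (G x))\<^sup>2)"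
      using G(1) G'(1) by (intro integral_cong_AE) (auto simp: weak_gradient_def torus_L2_def)
    then show "r = L2_norm L G" using G'(3) by (simp add: L2_norm_def)
  qed
  then show "0 \<le> Hminus1_norm L f" "Hminus1_norm L f \<le> C" using G(3) L2_norm_nonneg[of L G] by auto
qed

section \<open>Folding the torus onto a square\<close>

text \<open>The zigzag line of period \<open>4\<close> with \<open>zig x = x\<close> for \<open>\<bar>x\<bar> \<le> 1\<close>, and its slope \<open>zag\<close>. Composing with \<open>zig\<close> in each
coordinate continues functions from the square \<open>[-1, 1]\<^sup>2\<close> to the plane by reflection at its sides.\<close>

definition zig :: "real \<Rightarrow> real" where "zig u = 2 / pi * arcsin (sin (pi * u / 2))"
definition zag :: "real \<Rightarrow> real" where "zag u = sgn (cos (pi * u / 2))"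

lemma sin_borel [measurable]: "(sin :: real \<Rightarrow> real) \<in> borel_measurable borel"
  and cos_borel [measurable]: "(cos :: real \<Rightarrow> real) \<in> borel_measurable borel"
  by (intro borel_measurable_continuous_onI continuous_intros)+

lemma borel_measurable_sin_raw [measurable (raw)]: "f \<in> borel_measurable M \<Longrightarrow> (\<lambda>x. sin (f x :: real)) \<in> borel_measurable M"
  by (rule measurable_compose[OF _ sin_borel])

lemma continuous_on_zig [continuous_intros]: "continuous_on (S :: 'a::t2_space set) f \<Longrightarrow> continuous_on S (\<lambda>x. zig (f x))"
  unfolding zig_def by (intro continuous_intros) auto

lemma zig_borel [measurable]: "zig \<in> borel_measurable borel"
  by (rule borel_measurable_continuous_onI) (intro continuous_intros)

lemma zag_borel [measurable]: "zag \<in> borel_measurable borel"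
  unfolding zag_def[abs_def] by measurable

lemma abs_zig_le: "\<bar>zig u\<bar> \<le> 1"
proof -
  have "\<bar>arcsin (sin (pi * u / 2))\<bar> \<le> pi / 2"
    using arcsin_bounded[of "sin (pi * u / 2)"] by (intro abs_leI) auto
  then have "2 / pi * \<bar>arcsin (sin (pi * u / 2))\<bar> \<le> 2 / pi * (pi / 2)" by (intro mult_left_mono) auto
  then show ?thesis by (simp add: zig_def abs_mult)
qed

lemma zig_id: "\<bar>x\<bar> \<le> 1 \<Longrightarrow> zig x = x"
proof -
  assume "\<bar>x\<bar> \<le> 1"
  then have "pi * \<bar>x\<bar> \<le> pi * 1" by (intro mult_left_mono) auto
  then have "\<bar>pi * x\<bar> \<le> pi" by (simp add: abs_mult)
  then have "- (pi / 2) \<le> pi * x / 2" "pi * x / 2 \<le> pi / 2" by linarith+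
  then show ?thesis by (simp add: zig_def arcsin_sin)
qed

lemma zag_id: "\<bar>x\<bar> < 1 \<Longrightarrow> zag x = 1"
proof -
  assume "\<bar>x\<bar> < 1"
  then have "pi * \<bar>x\<bar> < pi * 1" by (intro mult_strict_left_mono) auto
  then have "\<bar>pi * x\<bar> < pi" by (simp add: abs_mult)
  then have "- (pi / 2) < pi * x / 2" "pi * x / 2 < pi / 2" by linarith+
  then show ?thesis by (simp add: zag_def cos_gt_zero_pi)
qed

lemma zig_shift2: "zig (u + 2) = - zig u" and zag_shift2: "zag (u + 2) = - zag u"
proof -
  have e: "pi * (u + 2) / 2 = pi * u / 2 + pi" by (simp add: field_simps)
  show "zig (u + 2) = - zig u" unfolding zig_def e by (simp add: arcsin_minus)
  show "zag (u + 2) = - zag u" unfolding zag_def e by (simp add: sgn_minus)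
qed

lemma zig_minus: "zig (- u) = - zig u"
  by (simp add: zig_def arcsin_minus)

lemma zig_shift_even: "zig (u + 2 * real i) = (-1)^i * zig u"
  and zag_shift_even: "zag (u + 2 * real i) = (-1)^i * zag u"
proof (induction i)
  case (Suc i)
  { case 1 show ?case using zig_shift2[of "u + 2 * real i"] Suc by (simp add: algebra_simps) }
  { case 2 show ?case using zag_shift2[of "u + 2 * real i"] Suc by (simp add: algebra_simps) }
qed simp_all

lemma zig_fold: "\<bar>x\<bar> \<le> 1 \<Longrightarrow> zig (2 * real i + (-1)^i * x) = x"
  using zig_shift_even[of "(-1)^i * x" i] zig_id[of x]
  by (cases "even i") (auto simp: zig_minus add.commute)

lemma zag_fold: "\<bar>x\<bar> < 1 \<Longrightarrow> zag (2 * real i + (-1)^i * x) = (-1)^i"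
  using zag_shift_even[of "(-1)^i * x" i] zag_id[of "(-1)^i * x"]
  by (cases "even i") (auto simp: add.commute)

lemma zig_pos: "0 < u \<Longrightarrow> u < 2 \<Longrightarrow> zig u > 0"
proof -
  assume u: "0 < u" "u < 2"
  have "0 < sin (pi * u / 2)" using u by (intro sin_gt_zero) auto
  then have "arcsin 0 < arcsin (sin (pi * u / 2))" by (intro arcsin_less_arcsin) auto
  then show ?thesis by (simp add: zig_def)
qed

text \<open>An interval of length \<open>L\<close> consists of \<open>2 * P\<close> intervals of length \<open>2 * l\<close>; the \<open>i\<close>-th one is parametrised by
\<open>[-1, 1]\<close>, with orientation \<open>(-1)^i\<close> so that \<open>zig\<close> inverts the parametrisation.\<close>

lemma nn_integral_fold:
  fixes f :: "real \<Rightarrow> ennreal"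
  assumes L: "L > 0" and P: "P > 0" and [measurable]: "f \<in> borel_measurable borel" and per: "\<And>x. f (x + L) = f x"
    and l: "l = L / (4 * real P)"
  shows "(\<integral>\<^sup>+x. indicator {- L / 2..L / 2} x * f x \<partial>lborel)
    = (\<Sum>i<2 * P. ennreal l * (\<integral>\<^sup>+x. indicator {-1..1} x * f (l * (2 * real i + (-1)^i * x)) \<partial>lborel))"
proof -
  have l0: "l > 0" using L P l by simp
  have piece: "ennreal l * (\<integral>\<^sup>+x. indicator {-1..1} x * f (l * (2 * real i + (-1)^i * x)) \<partial>lborel)
     = (\<integral>\<^sup>+x. indicator {l * (2 * real i - 1)..<l * (2 * real i + 1)} x * f x \<partial>lborel)" for i
  proof -
    have c: "(-1)^i * l \<noteq> 0" "\<bar>(-1)^i * l\<bar> = l" using l0 by (auto simp: abs_mult)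
    have "(\<integral>\<^sup>+x. indicator {l * (2 * real i - 1)..l * (2 * real i + 1)} x * f x \<partial>lborel)
       = ennreal l * (\<integral>\<^sup>+x. indicator {l * (2 * real i - 1)..l * (2 * real i + 1)} (2 * l * real i + ((-1)^i * l) * x)
            * f (2 * l * real i + ((-1)^i * l) * x) \<partial>lborel)"
      using nn_integral_real_affine[OF _ c(1), of "\<lambda>x. indicator {l * (2 * real i - 1)..l * (2 * real i + 1)} x * f x" "2 * l * real i"]
      unfolding c(2) by simp
    also have "\<dots> = ennreal l * (\<integral>\<^sup>+x. indicator {-1..1} x * f (l * (2 * real i + (-1)^i * x)) \<partial>lborel)"
    proof -
      have "l * (2 * real i - 1) \<le> 2 * l * real i + ((-1)^i * l) * x \<and> 2 * l * real i + ((-1)^i * l) * x \<le> l * (2 * real i + 1) \<longleftrightarrow> -1 \<le> x \<and> x \<le> 1" for x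
      proof -
        have e: "((-1)^i * l) * x = l * ((-1)^i * x)" "l * (2 * real i - 1) = 2 * l * real i + l * (-1)"
          "l * (2 * real i + 1) = 2 * l * real i + l * 1" by (simp_all add: algebra_simps)
        have "l * (2 * real i - 1) \<le> 2 * l * real i + ((-1)^i * l) * x \<longleftrightarrow> l * (-1) \<le> l * ((-1)^i * x)"
          unfolding e by (rule add_le_cancel_left)
        moreover have "2 * l * real i + ((-1)^i * l) * x \<le> l * (2 * real i + 1) \<longleftrightarrow> l * ((-1)^i * x) \<le> l * 1"
          unfolding e by (rule add_le_cancel_left)
        ultimately show ?thesis using l0 unfolding mult_le_cancel_left_pos[OF l0] by (cases "even i") auto
      qed
      moreover have "2 * l * real i + ((-1)^i * l) * x = l * (2 * real i + (-1)^i * x)" for x by (simp add: algebra_simps)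
      ultimately show ?thesis by (simp add: indicator_def)
    qed
    finally show ?thesis unfolding nn_integral_indicator_Icc_eq by simp
  qed
  have "(\<Sum>i<m. ennreal l * (\<integral>\<^sup>+x. indicator {-1..1} x * f (l * (2 * real i + (-1)^i * x)) \<partial>lborel))
      = (\<integral>\<^sup>+x. indicator {- l..<l * (2 * real m - 1)} x * f x \<partial>lborel)" for m
  proof (induction m)
    case 0
    then show ?case by simp
  next
    case (Suc m)
    have "(\<integral>\<^sup>+x. indicator {- l..<l * (2 * real m - 1)} x * f x \<partial>lborel)
        + (\<integral>\<^sup>+x. indicator {l * (2 * real m - 1)..<l * (2 * real m + 1)} x * f x \<partial>lborel)
       = (\<integral>\<^sup>+x. indicator {- l..<l * (2 * real m - 1)} x * f x + indicator {l * (2 * real m - 1)..<l * (2 * real m + 1)} x * f x \<partial>lborel)"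
      by (rule nn_integral_add[symmetric]) auto
    also have "\<dots> = (\<integral>\<^sup>+x. indicator {- l..<l * (2 * real (Suc m) - 1)} x * f x \<partial>lborel)"
    proof (intro nn_integral_cong)
      fix x
      have E: "l * (2 * real (Suc m) - 1) = l * (2 * real m + 1)" by (simp add: algebra_simps)
      have "- l \<le> l * (2 * real m - 1)" using l0 by (simp add: algebra_simps)
      moreover have "l * (2 * real m - 1) \<le> l * (2 * real m + 1)" using l0 by simp
      ultimately show "indicator {- l..<l * (2 * real m - 1)} x * f x + indicator {l * (2 * real m - 1)..<l * (2 * real m + 1)} x * f x
         = indicator {- l..<l * (2 * real (Suc m) - 1)} x * f x"
        unfolding E by (auto simp: indicator_def)
    qed
    finally show ?case using Suc piece by simp
  qed
  from this[of "2 * P"] have "(\<Sum>i<2 * P. ennreal l * (\<integral>\<^sup>+x. indicator {-1..1} x * f (l * (2 * real i + (-1)^i * x)) \<partial>lborel))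
      = (\<integral>\<^sup>+x. indicator {- l..<l * (4 * real P - 1)} x * f x \<partial>lborel)" by simp
  also have "l * (4 * real P - 1) = - l + L" using P by (simp add: l field_simps)
  also have "(\<integral>\<^sup>+x. indicator {- l..<- l + L} x * f x \<partial>lborel) = (\<integral>\<^sup>+x. indicator {- L / 2..- L / 2 + L} x * f x \<partial>lborel)"
    using nn_integral_periodic_Icc[of L f "- l" "- L / 2"] L per by (simp add: nn_integral_indicator_Icc_eq)
  finally show ?thesis by simp
qed

section \<open>The two phases in the reference square\<close>

text \<open>Its sign distinguishes the two phases at angle \<open>p\<close>: it is \<open>x\<close> for \<open>p = 0\<close>, and \<open>x * \<bar>y\<bar> + y\<close>, of the sign of \<open>y\<close> if \<open>\<bar>x\<bar> < 1\<close>,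
for \<open>p = pi/2\<close>. In between the zero set within the square is the curve of \<open>phase_interface\<close>. A
formula that is continuous in all variables keeps the density measurable and continuous in time.\<close>

definition phase :: "real \<Rightarrow> real \<Rightarrow> real \<Rightarrow> real" where
  "phase p x y = x * sqrt ((cos p)\<^sup>2 + (y * sin p)\<^sup>2) + y * (sin p)\<^sup>2"

lemma phase_odd: "phase p (- x) (- y) = - phase p x y"
  by (simp add: phase_def)

lemma continuous_on_phase [continuous_intros]:
  "continuous_on (S :: 'a::t2_space set) f \<Longrightarrow> continuous_on S g \<Longrightarrow> continuous_on S h \<Longrightarrow> continuous_on S (\<lambda>t. phase (f t) (g t) (h t))"
  unfolding phase_def by (intro continuous_intros)

lemma phase_measurable [measurable (raw)]:
  assumes [measurable]: "f \<in> borel_measurable M" "g \<in> borel_measurable M" "h \<in> borel_measurable M"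
  shows "(\<lambda>t. phase (f t) (g t) (h t)) \<in> borel_measurable M"
  unfolding phase_def by measurable

lemma sqrt_sum_squares_lipschitz: "\<bar>sqrt (c\<^sup>2 + u\<^sup>2) - sqrt (c\<^sup>2 + v\<^sup>2)\<bar> \<le> \<bar>u - v\<bar>"
proof -
  have "sqrt (c\<^sup>2 + u\<^sup>2) \<le> sqrt (c\<^sup>2 + v\<^sup>2) + \<bar>u - v\<bar>" for u v
    using real_sqrt_sum_squares_triangle_ineq[of c 0 v "u - v"] by simp
  from this[of u v] this[of v u] show ?thesis by linarith
qed

text \<open>The square root is Lipschitz in \<open>y\<close> with constant \<open>sin p\<close>, so that the term \<open>y * sin\<^sup>2 p\<close> dominates if \<open>\<bar>x\<bar> < sin p\<close>.\<close>

lemma phase_strict_mono: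
  assumes s: "sin p > 0" and x: "\<bar>x\<bar> < sin p" and y: "y1 < y2"
  shows "phase p x y1 < phase p x y2"
proof -
  let ?q = "\<lambda>y. sqrt ((cos p)\<^sup>2 + (y * sin p)\<^sup>2)"
  have "\<bar>?q y2 - ?q y1\<bar> \<le> \<bar>y2 * sin p - y1 * sin p\<bar>" by (rule sqrt_sum_squares_lipschitz)
  also have "\<dots> = sin p * (y2 - y1)" using s y by (simp add: left_diff_distrib[symmetric] abs_mult mult.commute)
  finally have "\<bar>x\<bar> * \<bar>?q y2 - ?q y1\<bar> \<le> \<bar>x\<bar> * (sin p * (y2 - y1))" by (intro mult_left_mono) auto
  also have "\<dots> < sin p * (sin p * (y2 - y1))" using x s y by (intro mult_strict_right_mono) auto
  finally have "\<bar>x * (?q y2 - ?q y1)\<bar> < sin p * (sin p * (y2 - y1))" by (simp add: abs_mult)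
  then have "0 < x * (?q y2 - ?q y1) + sin p * (sin p * (y2 - y1))" by linarith
  also have "\<dots> = phase p x y2 - phase p x y1" by (simp add: phase_def algebra_simps power2_eq_square)
  finally show ?thesis by simp
qed

lemma phase_pos_outside:
  assumes c: "cos p > 0" and x: "(sin p)\<^sup>2 \<le> x" "x > 0" and y: "\<bar>y\<bar> < 1"
  shows "phase p x y > 0"
proof -
  let ?q = "sqrt ((cos p)\<^sup>2 + (y * sin p)\<^sup>2)"
  have y2: "y\<^sup>2 < 1" using y by (simp add: abs_square_less_1)
  have "(cos p)\<^sup>2 + (y * sin p)\<^sup>2 - y\<^sup>2 = (cos p)\<^sup>2 * (1 - y\<^sup>2)"
    using sin_cos_squared_add[of p] by algebra
  then have "y\<^sup>2 < (cos p)\<^sup>2 + (y * sin p)\<^sup>2" using c y2 by (smt (verit) mult_pos_pos zero_less_power)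
  then have "\<bar>y\<bar> < ?q" by (intro real_less_rsqrt) simp
  then have "x * \<bar>y\<bar> < x * ?q" using x by simp
  moreover have "(sin p)\<^sup>2 * \<bar>y\<bar> \<le> x * \<bar>y\<bar>" using x by (intro mult_right_mono) auto
  moreover have "- (y * (sin p)\<^sup>2) \<le> (sin p)\<^sup>2 * \<bar>y\<bar>" using mult_left_mono[of "- y" "\<bar>y\<bar>" "(sin p)\<^sup>2"] by (simp add: mult.commute)
  ultimately show ?thesis unfolding phase_def by linarith
qed

text \<open>The interface is parametrised by \<open>b\<close>, where \<open>x = sin p * sin b\<close>; particles that have been overtaken by
the finger have \<open>b = 2 * a - p\<close>.\<close>

lemma phase_interface:
  assumes c: "cos p \<ge> 0" and s: "sin p > 0" and b: "cos b > 0"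
  shows "phase p (sin p * sin b) (- (cos p * sin b) / (sin p * cos b)) = 0"
proof -
  have "(cos p)\<^sup>2 + (- (cos p * sin b) / (sin p * cos b) * sin p)\<^sup>2 = (cos p / cos b)\<^sup>2"
  proof -
    have "- (cos p * sin b) / (sin p * cos b) * sin p = - (cos p * sin b) / cos b" using s by simp
    then have "(cos p)\<^sup>2 + (- (cos p * sin b) / (sin p * cos b) * sin p)\<^sup>2 = (cos p)\<^sup>2 + (- (cos p * sin b) / cos b)\<^sup>2" by simp
    also have "\<dots> = ((cos p)\<^sup>2 * ((cos b)\<^sup>2 + (sin b)\<^sup>2)) / (cos b)\<^sup>2"
      using b by (simp add: power_divide power_mult_distrib distrib_left add_divide_distrib del: sin_cos_squared_add sin_cos_squared_add2)
    finally show ?thesis by (simp add: power_divide)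
  qed
  then have "sqrt ((cos p)\<^sup>2 + (- (cos p * sin b) / (sin p * cos b) * sin p)\<^sup>2) = cos p / cos b"
    using b c by simp
  then show ?thesis unfolding phase_def using s b by (simp add: field_simps power2_eq_square)
qed

section \<open>Particle labels\<close>

text \<open>The horizontal position at angle \<open>p\<close> of a particle of the positive phase with label \<open>(a, e)\<close>: it rests
until \<open>p = a\<close>. The particles of the negative phase are their reflections at the origin. The vertical
distance to the side \<open>y = 1\<close> is \<open>e\<close> at rest and is compressed by the factor \<open>labJ\<close> afterwards, which is the
inverse of the horizontal stretching relative to the density \<open>sin (2 * a)\<close> of labels.\<close>

definition labX :: "real \<Rightarrow> real \<Rightarrow> real" where
  "labX p a = (if p \<le> a then (sin a)\<^sup>2 else sin p * sin (2 * a - p))"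

definition labJ :: "real \<Rightarrow> real \<Rightarrow> real" where
  "labJ p a = (if p \<le> a then 1 else sin (2 * a) / (2 * sin p * cos (2 * a - p)))"

definition labY :: "real \<Rightarrow> real \<Rightarrow> real \<Rightarrow> real" where
  "labY p a e = 1 - e * labJ p a"

text \<open>At \<open>p = 0\<close> a label sits at \<open>(sin\<^sup>2 a, 1 - e)\<close>; the density \<open>sin (2 * a)\<close> is the Jacobian of this map.\<close>

definition lab :: "(real \<times> real) measure" where
  "lab = density (lborel \<Otimes>\<^sub>M lborel)
     (\<lambda>(a, e). indicator {0<..<pi/2} a * ennreal (sin (2 * a)) * indicator {0<..<2} e)"

lemma measurable_labX [measurable]: "(\<lambda>a. labX p a) \<in> borel_measurable borel"
  unfolding labX_def by measurable

lemma measurable_labJ [measurable]: "(\<lambda>a. labJ p a) \<in> borel_measurable borel"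
  unfolding labJ_def by measurable

lemma measurable_labY [measurable]: "(\<lambda>z. labY p (fst z) (snd z)) \<in> borel_measurable (borel \<Otimes>\<^sub>M borel)"
  unfolding labY_def by measurable

lemma cos_2a_p_pos: "0 < a \<Longrightarrow> a < p \<Longrightarrow> p \<le> pi / 2 \<Longrightarrow> cos (2 * a - p) > 0"
  by (rule cos_gt_zero_pi) auto

lemma sin_p_pos: "0 < p \<Longrightarrow> p \<le> pi / 2 \<Longrightarrow> sin p > 0"
  by (rule sin_gt_zero) (use pi_gt_zero in linarith)+

lemma labJ_bounds:
  assumes "0 < a" "a < pi / 2" "0 \<le> p" "p \<le> pi / 2"
  shows "0 < labJ p a" "labJ p a \<le> 1"
proof -
  have "0 < labJ p a \<and> labJ p a \<le> 1"
  proof (cases "p \<le> a")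
    case False
    then have p: "a < p" "0 < p" using assms by auto
    have s: "sin p > 0" and c: "cos (2 * a - p) > 0" using p assms sin_p_pos cos_2a_p_pos by auto
    have s2: "sin (2 * a) > 0" using assms by (intro sin_gt_zero) auto
    have "sin (2 * p - 2 * a) \<ge> 0" using p assms by (intro sin_ge_zero) auto
    moreover have "sin (2 * p - 2 * a) = sin p * cos (2 * a - p) - cos p * sin (2 * a - p)"
      using sin_diff[of p "2 * a - p"] by (simp add: algebra_simps)
    moreover have "sin (2 * a) = sin p * cos (2 * a - p) + cos p * sin (2 * a - p)"
      using sin_add[of p "2 * a - p"] by simp
    ultimately have "sin (2 * a) \<le> 2 * sin p * cos (2 * a - p)" by linarith
    then show ?thesis using False s c s2 by (simp add: labJ_def)
  qed (simp add: labJ_def)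
  then show "0 < labJ p a" "labJ p a \<le> 1" by auto
qed

text \<open>The particles with \<open>e = 2\<close>, initially on the side \<open>y = -1\<close>, form the interface.\<close>

lemma labJ_interface:
  assumes "0 < a" "a < p" "p \<le> pi / 2"
  shows "1 - 2 * labJ p a = - (cos p * sin (2 * a - p)) / (sin p * cos (2 * a - p))"
proof -
  have s: "sin p > 0" and c: "cos (2 * a - p) > 0" using assms sin_p_pos cos_2a_p_pos by auto
  have "sin (2 * a) = sin p * cos (2 * a - p) + cos p * sin (2 * a - p)"
    using sin_add[of p "2 * a - p"] by simp
  then show ?thesis using s c assms by (simp add: labJ_def field_simps)
qed

lemma labX_bounds:
  assumes "0 < a" "a < pi / 2" "0 \<le> p" "p \<le> pi / 2"
  shows "\<bar>labX p a\<bar> < 1" and "a < p \<Longrightarrow> \<bar>labX p a\<bar> < (sin p)\<^sup>2" and "p \<le> a \<Longrightarrow> (sin p)\<^sup>2 \<le> labX p a"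
proof -
  show 1: "\<bar>labX p a\<bar> < (sin p)\<^sup>2" if "a < p"
  proof -
    have s: "sin p > 0" using that assms by (intro sin_p_pos) auto
    have "sin (2 * a - p) < sin p" using that assms by (intro sin_monotone_2pi) auto
    moreover have "sin (- p) < sin (2 * a - p)" using that assms by (intro sin_monotone_2pi) auto
    ultimately have "\<bar>sin (2 * a - p)\<bar> < sin p" by auto
    then show ?thesis using s that by (simp add: labX_def abs_mult power2_eq_square)
  qed
  show 2: "(sin p)\<^sup>2 \<le> labX p a" if "p \<le> a"
  proof -
    have "0 \<le> sin p" using assms by (intro sin_ge_zero) auto
    moreover have "sin p \<le> sin a" using assms that by (intro sin_monotone_2pi_le) auto
    ultimately show ?thesis using that by (auto simp: labX_def intro: power_mono)
  qed
  show "\<bar>labX p a\<bar> < 1"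
  proof (cases "p \<le> a")
    case True
    have "sin a < sin (pi / 2)" using assms by (intro sin_monotone_2pi) auto
    moreover have "0 < sin a" using assms by (intro sin_gt_zero) auto
    ultimately show ?thesis using True by (simp add: labX_def abs_square_less_1)
  next
    case False
    have "(sin p)\<^sup>2 \<le> 1" by (simp add: abs_square_le_1)
    then show ?thesis using 1 False by simp
  qed
qed

lemma labY_bounds:
  assumes "0 < a" "a < pi / 2" "0 \<le> p" "p \<le> pi / 2" "0 < e" "e < 2"
  shows "\<bar>labY p a e\<bar> < 1"
proof -
  note J = labJ_bounds[OF assms(1-4)]
  have "0 < e * labJ p a" using J assms by simp
  moreover have "e * labJ p a \<le> e * 1" using J assms by (intro mult_left_mono) auto
  ultimately show ?thesis using assms(6) unfolding labY_def by linarith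
qed

text \<open>Behind the tip, \<open>e < 2\<close> keeps the particle strictly above the interface of \<open>labJ_interface\<close>; ahead of
the tip the whole column is positive.\<close>

lemma phase_lab_pos:
  assumes "0 < a" "a < pi / 2" "0 \<le> p" "p \<le> pi / 2" "0 < e" "e < 2"
  shows "phase p (labX p a) (labY p a e) > 0"
proof (cases "p \<le> a")
  case True
  have "sin a > 0" using assms by (intro sin_gt_zero) auto
  then have "labX p a > 0" using True by (simp add: labX_def)
  moreover have "cos p > 0" using True assms by (intro cos_gt_zero_pi) auto
  ultimately show ?thesis
    using True labX_bounds(3)[OF assms(1-4)] labY_bounds[OF assms] by (intro phase_pos_outside) auto
next
  case False
  then have p: "a < p" "0 < p" using assms by auto
  have s: "sin p > 0" and c: "cos (2 * a - p) > 0" using p assms sin_p_pos cos_2a_p_pos by auto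
  have cp: "cos p \<ge> 0" using assms by (intro cos_ge_zero) auto
  have sle: "(sin p)\<^sup>2 \<le> sin p" using s by (simp add: power2_eq_square mult_left_le)
  have "0 = phase p (labX p a) (1 - 2 * labJ p a)"
    unfolding labJ_interface[OF assms(1) p(1) assms(4)]
    using phase_interface[OF cp s c] False by (simp add: labX_def)
  also have "\<dots> < phase p (labX p a) (labY p a e)"
    using labX_bounds(2)[OF assms(1-4) p(1)] sle labJ_bounds[OF assms(1-4)] assms
    by (intro phase_strict_mono[OF s]) (auto simp: labY_def)
  finally show ?thesis .
qed

lemma phase_gt_0_iff_inside:
  assumes p: "0 < p" "p \<le> pi / 2" and x: "\<bar>x\<bar> < (sin p)\<^sup>2"
  defines "B \<equiv> - (cos p * x) / (sin p * sqrt ((sin p)\<^sup>2 - x\<^sup>2))"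
  shows "phase p x y > 0 \<longleftrightarrow> B < y" and "phase p x y = 0 \<longleftrightarrow> y = B" and "\<bar>B\<bar> \<le> 1"
proof -
  have s: "sin p > 0" using p by (rule sin_p_pos)
  have cp: "cos p \<ge> 0" using p by (intro cos_ge_zero) auto
  have sle: "(sin p)\<^sup>2 \<le> sin p" using s by (simp add: power2_eq_square mult_left_le)
  then have xs: "\<bar>x\<bar> < sin p" using x by simp
  define b where "b = arcsin (x / sin p)"
  have "\<bar>x / sin p\<bar> < 1" using xs s by (simp add: abs_divide)
  then have xb: "- 1 \<le> x / sin p" "x / sin p \<le> 1" unfolding abs_less_iff by linarith+
  have sb: "sin b = x / sin p" using xb unfolding b_def by (intro sin_arcsin)
  have "sqrt (1 - (x / sin p)\<^sup>2) = cos b" using xb unfolding b_def by (subst cos_arcsin) auto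
  moreover have "1 - (x / sin p)\<^sup>2 = ((sin p)\<^sup>2 - x\<^sup>2) / (sin p)\<^sup>2" using s by (simp add: field_simps)
  ultimately have cb: "sqrt ((sin p)\<^sup>2 - x\<^sup>2) = sin p * cos b" using s by (simp add: real_sqrt_divide field_simps)
  have "x\<^sup>2 < (sin p)\<^sup>2" using power_strict_mono[OF xs, of 2] by simp
  then have r: "sqrt ((sin p)\<^sup>2 - x\<^sup>2) > 0" by simp
  then have c: "cos b > 0" using cb s by (simp add: zero_less_mult_iff)
  have "phase p x B = 0"
    using phase_interface[OF cp s c] s by (simp add: sb cb B_def)
  moreover have "y1 < y2 \<Longrightarrow> phase p x y1 < phase p x y2" for y1 y2 by (rule phase_strict_mono[OF s xs])
  ultimately show "phase p x y > 0 \<longleftrightarrow> B < y" "phase p x y = 0 \<longleftrightarrow> y = B"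
    by (metis less_irrefl linorder_neqE_linordered_idom order_less_trans)+
  have "x\<^sup>2 \<le> ((sin p)\<^sup>2)\<^sup>2" using power_mono[OF less_imp_le[OF x] abs_ge_zero, of 2] by simp
  then have "(cos p)\<^sup>2 * x\<^sup>2 \<le> (sin p)\<^sup>2 * ((sin p)\<^sup>2 - x\<^sup>2)"
  proof -
    have "(sin p)\<^sup>2 * ((sin p)\<^sup>2 - x\<^sup>2) - (cos p)\<^sup>2 * x\<^sup>2 = ((sin p)\<^sup>2)\<^sup>2 - x\<^sup>2"
      using sin_cos_squared_add[of p] by algebra
    then show ?thesis using \<open>x\<^sup>2 \<le> ((sin p)\<^sup>2)\<^sup>2\<close> by linarith
  qed
  then have "(cos p * x)\<^sup>2 \<le> (sin p * sqrt ((sin p)\<^sup>2 - x\<^sup>2))\<^sup>2" using r by (simp add: power_mult_distrib)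
  then have "\<bar>cos p * x\<bar> \<le> \<bar>sin p * sqrt ((sin p)\<^sup>2 - x\<^sup>2)\<bar>" by (simp only: abs_le_square_iff)
  then show "\<bar>B\<bar> \<le> 1" using s r by (simp add: B_def abs_divide abs_mult)
qed

lemma phase_neg_outside:
  assumes "cos p > 0" "x \<le> - (sin p)\<^sup>2" "x < 0" "\<bar>y\<bar> < 1"
  shows "phase p x y < 0"
  using phase_pos_outside[of p "- x" "- y"] assms by (simp add: phase_odd)

text \<open>Incompressibility: at every angle the particles fill their phase with density one. On each
vertical line the particles fill the segment above the interface uniformly; horizontally
the substitution is \<open>x = sin p * sin (2 * a - p)\<close> behind the tip of the finger and \<open>x = sin\<^sup>2 a\<close> ahead of it.\<close>

lemma distr_lab:
  assumes p: "0 \<le> p" "p \<le> pi / 2"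
  shows "distr lab borel (\<lambda>(a, e). (labX p a, labY p a e)) =
    density lborel (\<lambda>(x, y). indicator ({-1<..<1} \<times> {-1<..<1}) (x, y) * indicator {0<..} (phase p x y))"
    (is "distr lab borel ?F = density lborel ?d")
proof (rule measure_eqI)
  fix A assume "A \<in> sets (distr lab borel ?F)"
  then have A [measurable]: "A \<in> sets (borel :: (real \<times> real) measure)" by simp
  then have A' [measurable]: "A \<in> sets (borel \<Otimes>\<^sub>M borel)" unfolding borel_prod .
  let ?s = "(sin p)\<^sup>2"
  \<comment> \<open>The height of the interface above \<open>x\<close>, and the size of the section of \<open>A\<close> above a height \<open>b\<close>.\<close>
  define B where "B x = - (cos p * x) / (sin p * sqrt (?s - x\<^sup>2))" for x
  define g where "g x b = (\<integral>\<^sup>+y. indicator {b<..<1} y * indicator A (x, y) \<partial>lborel)" for x b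
  have [measurable]: "B \<in> borel_measurable borel" unfolding B_def by measurable
  have gm: "(\<lambda>x. g x (f x)) \<in> borel_measurable borel" if [measurable]: "f \<in> borel_measurable borel" for f
  proof -
    have [measurable]: "(\<lambda>z. indicator {f (fst z)<..<1} (snd z) :: ennreal) \<in> borel_measurable (borel \<Otimes>\<^sub>M borel)"
    proof -
      have "(\<lambda>z. indicator {f (fst z)<..<1} (snd z)) = (\<lambda>z. if f (fst z) < snd z \<and> snd z < 1 then 1 else 0 :: ennreal)"
        by (auto simp: indicator_def)
      then show ?thesis by simp
    qed
    show ?thesis unfolding g_def by measurable
  qed
  have g2: "g x b \<le> ennreal (1 - b)" if "b \<le> 1" for x b
  proof -
    have "g x b \<le> (\<integral>\<^sup>+y. indicator {b<..<1} y \<partial>lborel)" unfolding g_def by (intro nn_integral_mono) (auto simp: indicator_def)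
    also have "\<dots> = ennreal (1 - b)" using that by simp
    finally show ?thesis .
  qed
  have gfin: "ennreal (enn2real (g x b)) = g x b" for x b
  proof (cases "b \<le> 1")
    case True
    then show ?thesis using g2[OF True, of x] by (intro ennreal_enn2real) (auto simp: less_top[symmetric] top_unique)
  next
    case False
    then have "g x b = 0" unfolding g_def by (simp add: nn_integral_0_iff_AE)
    then show ?thesis by simp
  qed
  \<comment> \<open>The derivative of \<open>labX p\<close> with respect to the label; the factor \<open>labJ\<close> relates it to the label density.\<close>
  define W where "W a = (if p \<le> a then sin (2 * a) else 2 * sin p * cos (2 * a - p))" for a
  have [measurable]: "W \<in> borel_measurable borel" unfolding W_def by measurable
  have Q [measurable]: "{-1<..<1} \<times> {-1<..<1} \<in> sets (borel :: (real \<times> real) measure)" by (intro borel_open open_Times) auto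
  have [measurable]: "(\<lambda>z. phase p (fst z) (snd z)) \<in> borel_measurable (borel :: (real \<times> real) measure)"
    by (intro borel_measurable_continuous_onI continuous_intros)
  have dm: "?d \<in> borel_measurable (borel :: (real \<times> real) measure)" unfolding split_beta' prod.collapse by measurable
  have Fm: "?F \<in> borel_measurable (borel \<Otimes>\<^sub>M borel)" unfolding split_beta' by (intro borel_measurable_Pair) measurable
  have "emeasure (distr lab borel ?F) A = (\<integral>\<^sup>+z. indicator A (?F z) \<partial>lab)"
    using Fm by (subst nn_integral_indicator[symmetric], simp, subst nn_integral_distr) (auto simp: lab_def)
  also have "\<dots> = (\<integral>\<^sup>+z. (case z of (a, e) \<Rightarrow> indicator {0<..<pi/2} a * ennreal (sin (2 * a)) * indicator {0<..<2} e) * indicator A (?F z) \<partial>(lborel \<Otimes>\<^sub>M lborel))"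
    unfolding lab_def using Fm by (subst nn_integral_density) (auto simp: split_beta')
  also have "\<dots> = (\<integral>\<^sup>+a. \<integral>\<^sup>+e. indicator {0<..<pi/2} a * ennreal (sin (2 * a)) * indicator {0<..<2} e * indicator A (labX p a, labY p a e) \<partial>lborel \<partial>lborel)"
    using Fm by (subst lborel.nn_integral_fst[symmetric]) (auto simp: split_beta')
  also have "\<dots> = (\<integral>\<^sup>+a. indicator {0<..<pi/2} a * (ennreal (W a) * g (labX p a) (1 - 2 * labJ p a)) \<partial>lborel)"
  proof (intro nn_integral_cong)
    fix a
    show "(\<integral>\<^sup>+e. indicator {0<..<pi/2} a * ennreal (sin (2 * a)) * indicator {0<..<2} e * indicator A (labX p a, labY p a e) \<partial>lborel)
       = indicator {0<..<pi/2} a * (ennreal (W a) * g (labX p a) (1 - 2 * labJ p a))"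
    proof (cases "a \<in> {0<..<pi/2}")
      case True
      then have a: "0 < a" "a < pi / 2" by auto
      let ?J = "labJ p a"
      have J: "?J > 0" using labJ_bounds[OF a p] by simp
      have W0: "W a \<ge> 0"
        using a p sin_gt_zero[of "2 * a"] cos_2a_p_pos[of a p] sin_p_pos[of p] by (auto simp: W_def intro!: mult_nonneg_nonneg)
      have sW: "sin (2 * a) = W a * ?J"
        using a p cos_2a_p_pos[of a p] sin_p_pos[of p] by (auto simp: W_def labJ_def)
      have "g (labX p a) (1 - 2 * ?J) = ennreal ?J * (\<integral>\<^sup>+e. indicator {1 - 2 * ?J<..<1} (1 + (- ?J) * e) * indicator A (labX p a, 1 + (- ?J) * e) \<partial>lborel)"
        unfolding g_def using J by (subst nn_integral_real_affine[of _ "- ?J" 1]) auto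
      also have "\<dots> = ennreal ?J * (\<integral>\<^sup>+e. indicator {0<..<2} e * indicator A (labX p a, labY p a e) \<partial>lborel)"
      proof -
        have "indicator {1 - 2 * ?J<..<1} (1 + (- ?J) * e) = (indicator {0<..<2} e :: ennreal)" for e
        proof -
          have "1 - 2 * ?J < 1 + (- ?J) * e \<longleftrightarrow> ?J * e < ?J * 2" by (simp add: algebra_simps)
          moreover have "1 + (- ?J) * e < 1 \<longleftrightarrow> ?J * 0 < ?J * e" by simp
          ultimately show ?thesis unfolding mult_less_cancel_left_pos[OF J] by (auto simp: indicator_def)
        qed
        then show ?thesis by (simp add: labY_def mult.commute)
      qed
      finally have g: "g (labX p a) (1 - 2 * ?J) = ennreal ?J * (\<integral>\<^sup>+e. indicator {0<..<2} e * indicator A (labX p a, labY p a e) \<partial>lborel)" .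
      have "(\<integral>\<^sup>+e. indicator {0<..<pi/2} a * ennreal (sin (2 * a)) * indicator {0<..<2} e * indicator A (labX p a, labY p a e) \<partial>lborel)
        = ennreal (sin (2 * a)) * (\<integral>\<^sup>+e. indicator {0<..<2} e * indicator A (labX p a, labY p a e) \<partial>lborel)"
      proof (subst nn_integral_cmult[symmetric])
        have "(\<lambda>e. (labX p a, labY p a e)) \<in> borel \<rightarrow>\<^sub>M borel \<Otimes>\<^sub>M borel" unfolding labY_def by measurable
        from measurable_compose[OF this borel_measurable_indicator[OF A']]
        have m: "(\<lambda>e. indicator A (labX p a, labY p a e) :: ennreal) \<in> borel_measurable borel" .
        show "(\<lambda>e. indicator {0<..<2} e * indicator A (labX p a, labY p a e) :: ennreal) \<in> borel_measurable lborel"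
          by (rule borel_measurable_times_ennreal) (use m in simp_all)
      qed (use True in \<open>simp add: mult.assoc\<close>)
      then show ?thesis using True W0 J unfolding g sW by (simp add: ennreal_mult mult.assoc)
    qed simp
  qed
  also have "\<dots> = (\<integral>\<^sup>+a. indicator {0<..<p} a * (ennreal (W a) * g (labX p a) (B (labX p a)))
       + indicator {p..pi/2} a * (ennreal (W a) * g (labX p a) (- 1)) \<partial>lborel)"
  proof (rule nn_integral_cong_AE)
    have "AE a in lborel. a \<noteq> (0::real)" "AE a in lborel. a \<noteq> (pi/2::real)" by (rule AE_lborel_singleton)+
    then show "AE a in lborel. indicator {0<..<pi/2} a * (ennreal (W a) * g (labX p a) (1 - 2 * labJ p a)) =
        indicator {0<..<p} a * (ennreal (W a) * g (labX p a) (B (labX p a))) + indicator {p..pi/2} a * (ennreal (W a) * g (labX p a) (- 1))"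
    proof eventually_elim
      case (elim a)
      have "B (labX p a) = 1 - 2 * labJ p a" if a: "0 < a" "a < p"
      proof -
        have s: "sin p > 0" and c: "cos (2 * a - p) > 0" using a p sin_p_pos cos_2a_p_pos by auto
        have "?s - (labX p a)\<^sup>2 = ?s * (1 - (sin (2 * a - p))\<^sup>2)" using a by (simp add: labX_def power_mult_distrib algebra_simps)
        also have "\<dots> = (sin p * cos (2 * a - p))\<^sup>2" by (simp add: cos_squared_eq[symmetric] power_mult_distrib)
        finally have "sqrt (?s - (labX p a)\<^sup>2) = sin p * cos (2 * a - p)" using s c by simp
        then show ?thesis unfolding labJ_interface[OF a p(2)] using a s by (simp add: B_def labX_def)
      qed
      moreover have "1 - 2 * labJ p a = - 1" if "p \<le> a" using that by (simp add: labJ_def)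
      ultimately show ?case using p elim by (cases "a < p") (auto simp: indicator_def)
    qed
  qed
  also have "\<dots> = (\<integral>\<^sup>+a. indicator {0<..<p} a * (ennreal (W a) * g (labX p a) (B (labX p a))) \<partial>lborel)
       + (\<integral>\<^sup>+a. indicator {p..pi/2} a * (ennreal (W a) * g (labX p a) (- 1)) \<partial>lborel)"
  proof (rule nn_integral_add)
    have m: "(\<lambda>a. g (labX p a) (f (labX p a))) \<in> borel_measurable borel" if "f \<in> borel_measurable borel" for f
      by (rule measurable_compose[OF measurable_labX gm[OF that]])
    show "(\<lambda>a. indicator {0<..<p} a * (ennreal (W a) * g (labX p a) (B (labX p a)))) \<in> borel_measurable lborel"
      using m[of B] by simp
    show "(\<lambda>a. indicator {p..pi/2} a * (ennreal (W a) * g (labX p a) (- 1))) \<in> borel_measurable lborel"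
      using m[of "\<lambda>x. - 1"] by simp
  qed
  also have "(\<integral>\<^sup>+a. indicator {0<..<p} a * (ennreal (W a) * g (labX p a) (B (labX p a))) \<partial>lborel)
      = (\<integral>\<^sup>+x. indicator {- ?s..?s} x * g x (B x) \<partial>lborel)"
  proof -
    let ?f = "\<lambda>x. enn2real (g x (B x))"
    have fm: "?f \<in> borel_measurable borel" using gm[of B] by simp
    have "(\<integral>\<^sup>+x. ennreal (?f x * indicator {sin p * sin (2 * 0 - p)..sin p * sin (2 * p - p)} x) \<partial>lborel)
      = (\<integral>\<^sup>+a. ennreal (?f (sin p * sin (2 * a - p)) * (2 * sin p * cos (2 * a - p)) * indicator {0..p} a) \<partial>lborel)"
    proof (rule nn_integral_substitution[where g = "\<lambda>a. sin p * sin (2 * a - p)"])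
      show "set_borel_measurable borel {sin p * sin (2 * 0 - p)..sin p * sin (2 * p - p)} ?f"
        using fm by (simp add: set_borel_measurable_def)
      show "((\<lambda>a. sin p * sin (2 * a - p)) has_real_derivative 2 * sin p * cos (2 * a - p)) (at a)" for a
        by (auto intro!: derivative_eq_intros)
      show "continuous_on {0..p} (\<lambda>a. 2 * sin p * cos (2 * a - p))" by (intro continuous_intros)
      show "0 \<le> 2 * sin p * cos (2 * a - p)" if "a \<in> {0..p}" for a
        using that p by (intro mult_nonneg_nonneg sin_ge_zero cos_ge_zero) auto
    qed (use p in simp)
    also have "\<dots> = (\<integral>\<^sup>+a. indicator {0<..<p} a * (ennreal (W a) * g (labX p a) (B (labX p a))) \<partial>lborel)"
    proof (rule nn_integral_cong_AE)
      have "AE a in lborel. a \<noteq> (0::real)" "AE a in lborel. a \<noteq> p" by (rule AE_lborel_singleton)+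
      then show "AE a in lborel. ennreal (?f (sin p * sin (2 * a - p)) * (2 * sin p * cos (2 * a - p)) * indicator {0..p} a)
         = indicator {0<..<p} a * (ennreal (W a) * g (labX p a) (B (labX p a)))"
      proof eventually_elim
        case (elim a)
        show ?case
        proof (cases "a \<in> {0<..<p}")
          case True
          have "0 \<le> 2 * sin p * cos (2 * a - p)"
            using True p by (intro mult_nonneg_nonneg sin_ge_zero cos_ge_zero) auto
          then show ?thesis using True by (simp add: W_def labX_def ennreal_mult gfin mult.commute)
        next
          case False
          then have "a \<notin> {0..p}" using elim by auto
          then show ?thesis using False by simp
        qed
      qed
    qed
    finally show ?thesis by (simp add: ennreal_mult' gfin power2_eq_square ennreal_indicator mult.commute)
  qed
  also have "(\<integral>\<^sup>+a. indicator {p..pi/2} a * (ennreal (W a) * g (labX p a) (- 1)) \<partial>lborel)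
      = (\<integral>\<^sup>+x. indicator {?s..1} x * g x (- 1) \<partial>lborel)"
  proof -
    let ?f = "\<lambda>x. enn2real (g x (- 1))"
    have fm: "?f \<in> borel_measurable borel" using gm[of "\<lambda>x. -1"] by simp
    have "(\<integral>\<^sup>+x. ennreal (?f x * indicator {(sin p)\<^sup>2..(sin (pi / 2))\<^sup>2} x) \<partial>lborel)
      = (\<integral>\<^sup>+a. ennreal (?f ((sin a)\<^sup>2) * sin (2 * a) * indicator {p..pi/2} a) \<partial>lborel)"
    proof (rule nn_integral_substitution[where g = "\<lambda>a. (sin a)\<^sup>2"])
      show "set_borel_measurable borel {(sin p)\<^sup>2..(sin (pi / 2))\<^sup>2} ?f"
        using fm by (simp add: set_borel_measurable_def)
      show "((\<lambda>a. (sin a)\<^sup>2) has_real_derivative sin (2 * a)) (at a)" for a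
        by (auto intro!: derivative_eq_intros simp: sin_double)
      show "continuous_on {p..pi/2} (\<lambda>a. sin (2 * a))" by (intro continuous_intros)
      show "0 \<le> sin (2 * a)" if "a \<in> {p..pi/2}" for a
        using that p by (intro sin_ge_zero) auto
    qed (use p in simp)
    also have "\<dots> = (\<integral>\<^sup>+a. indicator {p..pi/2} a * (ennreal (W a) * g (labX p a) (- 1)) \<partial>lborel)"
    proof (rule nn_integral_cong)
      fix a
      show "ennreal (?f ((sin a)\<^sup>2) * sin (2 * a) * indicator {p..pi/2} a) = indicator {p..pi/2} a * (ennreal (W a) * g (labX p a) (- 1))"
      proof (cases "a \<in> {p..pi/2}")
        case True
        then have "0 \<le> sin (2 * a)" using p by (intro sin_ge_zero) auto
        then show ?thesis using True by (simp add: W_def labX_def ennreal_mult gfin mult.commute)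
      qed simp
    qed
    finally show ?thesis by (simp add: ennreal_mult' gfin ennreal_indicator mult.commute)
  qed
  also have "(\<integral>\<^sup>+x. indicator {- ?s..?s} x * g x (B x) \<partial>lborel) + (\<integral>\<^sup>+x. indicator {?s..1} x * g x (- 1) \<partial>lborel)
     = (\<integral>\<^sup>+x. indicator {- ?s..?s} x * g x (B x) + indicator {?s..1} x * g x (- 1) \<partial>lborel)"
    using gm[of B] gm[of "\<lambda>x. -1"] by (intro nn_integral_add[symmetric]) auto
  also have "\<dots> = (\<integral>\<^sup>+x. \<integral>\<^sup>+y. ?d (x, y) * indicator A (x, y) \<partial>lborel \<partial>lborel)"
  proof (rule nn_integral_cong_AE)
    have "AE x in lborel. x \<noteq> ?s" "AE x in lborel. x \<noteq> - ?s" "AE x in lborel. x \<noteq> (1::real)" by (rule AE_lborel_singleton)+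
    then show "AE x in lborel. indicator {- ?s..?s} x * g x (B x) + indicator {?s..1} x * g x (- 1)
       = (\<integral>\<^sup>+y. ?d (x, y) * indicator A (x, y) \<partial>lborel)"
    proof eventually_elim
      case (elim x)
      have s1: "?s \<le> 1" by (simp add: abs_square_le_1)
      consider "\<bar>x\<bar> < ?s" | "?s < x" "x < 1" | "x > 1" | "x < - ?s"
        using elim by linarith
      then show ?case
      proof cases
        case 1
        then have "p > 0" using p by (cases "p = 0") auto
        note B = phase_gt_0_iff_inside[OF this p(2) 1, folded B_def]
        have "?d (x, y) = indicator {B x<..<1} y" for y
          using 1 s1 B(3) by (auto simp: B(1) indicator_def)
        then show ?thesis using 1 by (simp add: g_def abs_less_iff indicator_def)
      next
        case 2
        then have "cos p \<noteq> 0" using sin_cos_squared_add[of p] by (auto simp: power2_eq_square)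
        then have "cos p > 0" using cos_ge_zero[of p] p by linarith
        moreover have "0 < x" using 2 zero_le_power2[of "sin p"] by linarith
        ultimately have "?d (x, y) = indicator {-1<..<1} y" for y
          using 2 phase_pos_outside[of p x y] \<open>0 < x\<close> by (auto simp: indicator_def abs_less_iff)
        then show ?thesis using 2 by (simp add: g_def indicator_def)
      next
        case 3
        then show ?thesis using s1 by (simp add: indicator_def)
      next
        case 4
        have d0: "?d (x, y) = 0" for y
        proof (cases "-1 < x \<and> \<bar>y\<bar> < 1")
          case True
          then have "?s < 1" using 4 by linarith
          then have "cos p \<noteq> 0" using sin_cos_squared_add[of p] by (auto simp: power2_eq_square)
          then have "cos p > 0" using cos_ge_zero[of p] p by linarith
          moreover have "x < 0" using 4 zero_le_power2[of "sin p"] by linarith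
          ultimately have "phase p x y < 0" using 4 True by (intro phase_neg_outside) auto
          then show ?thesis by (simp add: indicator_def)
        qed (auto simp: indicator_def abs_less_iff)
        have "\<not> ?s \<le> x" using 4 zero_le_power2[of "sin p"] by linarith
        then show ?thesis using 4 unfolding d0 by (simp add: indicator_def)
      qed
    qed
  qed
  also have "\<dots> = (\<integral>\<^sup>+z. ?d z * indicator A z \<partial>(lborel \<Otimes>\<^sub>M lborel))"
    using dm by (subst lborel.nn_integral_fst) (auto simp: lborel_prod)
  also have "\<dots> = emeasure (density lborel ?d) A"
    using dm by (subst emeasure_density) (auto simp: lborel_prod)
  finally show "emeasure (distr lab borel ?F) A = emeasure (density lborel ?d) A" .
qed simp

lemma nn_integral_lab:
  assumes p: "0 \<le> p" "p \<le> pi / 2" and [measurable]: "h \<in> borel_measurable (borel :: (real \<times> real) measure)"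
  shows "(\<integral>\<^sup>+z. h (labX p (fst z), labY p (fst z) (snd z)) \<partial>lab)
    = (\<integral>\<^sup>+z. indicator ({-1<..<1} \<times> {-1<..<1}) z * indicator {0<..} (phase p (fst z) (snd z)) * h z \<partial>lborel)"
proof -
  have [measurable]: "h \<in> borel_measurable (borel \<Otimes>\<^sub>M borel)" by (simp add: borel_prod)
  have m: "(\<lambda>(a, e). (labX p a, labY p a e)) \<in> lab \<rightarrow>\<^sub>M borel"
    unfolding split_beta' lab_def by (simp add: borel_prod[symmetric]) measurable
  have "(\<integral>\<^sup>+z. h z \<partial>distr lab borel (\<lambda>(a, e). (labX p a, labY p a e))) = (\<integral>\<^sup>+z. h (labX p (fst z), labY p (fst z) (snd z)) \<partial>lab)"
    by (subst nn_integral_distr[OF m]) (auto simp: split_beta')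
  moreover have "(\<integral>\<^sup>+z. h z \<partial>density lborel (\<lambda>(x, y). indicator ({-1<..<1} \<times> {-1<..<1}) (x, y) * indicator {0<..} (phase p x y)))
      = (\<integral>\<^sup>+z. indicator ({-1<..<1} \<times> {-1<..<1}) z * indicator {0<..} (phase p (fst z) (snd z)) * h z \<partial>lborel)"
    by (subst nn_integral_density) (auto simp: split_beta' borel_prod[symmetric])
  ultimately show ?thesis unfolding distr_lab[OF p] by simp
qed

lemma AE_phase_nonzero:
  assumes p: "0 \<le> p" "p \<le> pi / 2"
  shows "AE z in lborel. z \<in> {-1<..<1} \<times> {-1<..<1} \<longrightarrow> phase p (fst z) (snd z) \<noteq> 0"
proof -
  have "AE x in lborel. AE y in lborel. (x, y) \<in> {-1<..<1} \<times> {-1<..<1} \<longrightarrow> phase p x y \<noteq> 0"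
  proof -
    let ?s = "(sin p)\<^sup>2"
    have "AE x in lborel. x \<noteq> ?s" "AE x in lborel. x \<noteq> - ?s" by (rule AE_lborel_singleton)+
    then show ?thesis
    proof eventually_elim
      case (elim x)
      show ?case
      proof (cases "\<bar>x\<bar> < ?s")
        case True
        then have "p > 0" using p by (cases "p = 0") auto
        note B = phase_gt_0_iff_inside(2)[OF this p(2) True]
        show ?thesis unfolding B using AE_lborel_singleton by eventually_elim auto
      next
        case False
        have "phase p x y \<noteq> 0" if "-1 < x" "x < 1" "\<bar>y\<bar> < 1" for y
        proof -
          have "?s < \<bar>x\<bar>" using False elim by linarith
          then have "?s < 1" using that by linarith
          then have "cos p \<noteq> 0" using sin_cos_squared_add[of p] by (auto simp: power2_eq_square)
          then have "cos p > 0" using cos_ge_zero[of p] p by linarith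
          then show ?thesis using phase_pos_outside[of p x y] phase_neg_outside[of p x y] \<open>?s < \<bar>x\<bar>\<close> zero_le_power2[of "sin p"] that
            by (cases "x > 0") force+
        qed
        then show ?thesis by (auto simp: abs_less_iff)
      qed
    qed
  qed
  then have "AE z in lborel \<Otimes>\<^sub>M lborel. z \<in> {-1<..<1} \<times> {-1<..<1} \<longrightarrow> phase p (fst z) (snd z) \<noteq> 0"
  proof (intro lborel_pair.AE_pair_measure)
    show "{z \<in> space (lborel \<Otimes>\<^sub>M lborel). z \<in> {-1<..<1} \<times> {-1<..<1} \<longrightarrow> phase p (fst z) (snd z) \<noteq> 0} \<in> sets (lborel \<Otimes>\<^sub>M lborel)"
      by measurable
  qed simp
  then show ?thesis unfolding lborel_prod .
qed

lemma nn_integral_lborel_uminus2: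
  fixes h :: "real \<times> real \<Rightarrow> ennreal"
  assumes "h \<in> borel_measurable borel"
  shows "(\<integral>\<^sup>+z. h (- z) \<partial>lborel) = (\<integral>\<^sup>+z. h z \<partial>lborel)"
proof -
  have hm [measurable]: "h \<in> borel_measurable (borel \<Otimes>\<^sub>M borel)" using assms by (simp add: borel_prod)
  have "(\<lambda>z. h (- z)) \<in> borel_measurable borel" using assms by measurable
  then have hm2: "(\<lambda>z. h (- z)) \<in> borel_measurable (borel \<Otimes>\<^sub>M borel)" by (simp add: borel_prod)
  have neg: "(\<integral>\<^sup>+x. f (- x) \<partial>lborel) = (\<integral>\<^sup>+x. f x \<partial>lborel)" if "f \<in> borel_measurable borel" for f :: "real \<Rightarrow> ennreal"
    using nn_integral_real_affine[OF that, of "-1" 0] by simp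
  have "(\<integral>\<^sup>+z. h (- z) \<partial>(lborel \<Otimes>\<^sub>M lborel)) = (\<integral>\<^sup>+x. \<integral>\<^sup>+y. h (- x, - y) \<partial>lborel \<partial>lborel)"
    using hm2 by (subst lborel.nn_integral_fst[symmetric]) auto
  also have "\<dots> = (\<integral>\<^sup>+x. \<integral>\<^sup>+y. h (- x, y) \<partial>lborel \<partial>lborel)"
    by (intro nn_integral_cong neg) measurable
  also have "\<dots> = (\<integral>\<^sup>+x. \<integral>\<^sup>+y. h (x, y) \<partial>lborel \<partial>lborel)"
    by (rule neg) measurable
  also have "\<dots> = (\<integral>\<^sup>+z. h z \<partial>(lborel \<Otimes>\<^sub>M lborel))"
    by (subst lborel.nn_integral_fst) auto
  finally show ?thesis unfolding lborel_prod .
qed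

text \<open>The two phases together fill the square up to the interface, which is a null set.\<close>

theorem nn_integral_square:
  fixes h :: "real \<times> real \<Rightarrow> ennreal"
  assumes p: "0 \<le> p" "p \<le> pi / 2" and hm [measurable]: "h \<in> borel_measurable borel"
  shows "(\<integral>\<^sup>+z. indicator ({-1<..<1} \<times> {-1<..<1}) z * h z \<partial>lborel) =
    (\<Sum>\<sigma>\<in>{1, -1}. \<integral>\<^sup>+z. h (\<sigma> * labX p (fst z), \<sigma> * labY p (fst z) (snd z)) \<partial>lab)"
proof -
  let ?Q = "{-1<..<1} \<times> {-1<..<1} :: (real \<times> real) set"
  have Q: "- z \<in> ?Q \<longleftrightarrow> z \<in> ?Q" for z by (cases z) auto
  have [measurable]: "(\<lambda>z. phase p (fst z) (snd z)) \<in> borel_measurable (borel :: (real \<times> real) measure)"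
    by (intro borel_measurable_continuous_onI continuous_intros)
  have [measurable]: "?Q \<in> sets borel" by (intro borel_open open_Times) auto
  have hm' [measurable]: "(\<lambda>z. h (- z)) \<in> borel_measurable borel" by measurable
  have neg: "(\<integral>\<^sup>+z. h (- labX p (fst z), - labY p (fst z) (snd z)) \<partial>lab)
     = (\<integral>\<^sup>+z. indicator ?Q z * indicator {0<..} (- phase p (fst z) (snd z)) * h z \<partial>lborel)"
  proof -
    have "(\<integral>\<^sup>+z. h (- labX p (fst z), - labY p (fst z) (snd z)) \<partial>lab) = (\<integral>\<^sup>+z. (\<lambda>z. h (- z)) (labX p (fst z), labY p (fst z) (snd z)) \<partial>lab)"
      by simp
    also have "\<dots> = (\<integral>\<^sup>+z. indicator ?Q z * indicator {0<..} (phase p (fst z) (snd z)) * h (- z) \<partial>lborel)"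
      by (rule nn_integral_lab[OF p hm'])
    also have "\<dots> = (\<integral>\<^sup>+z. (\<lambda>z. indicator ?Q z * indicator {0<..} (- phase p (fst z) (snd z)) * h z) (- z) \<partial>lborel)"
      by (intro nn_integral_cong) (simp add: phase_odd indicator_def Q del: mem_Times_iff)
    also have "\<dots> = (\<integral>\<^sup>+z. indicator ?Q z * indicator {0<..} (- phase p (fst z) (snd z)) * h z \<partial>lborel)"
      by (rule nn_integral_lborel_uminus2) measurable
    finally show ?thesis .
  qed
  have pos: "(\<integral>\<^sup>+z. h (labX p (fst z), labY p (fst z) (snd z)) \<partial>lab)
     = (\<integral>\<^sup>+z. indicator ?Q z * indicator {0<..} (phase p (fst z) (snd z)) * h z \<partial>lborel)"
    by (rule nn_integral_lab[OF p hm])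
  have "(\<Sum>\<sigma>\<in>{1, -1}. \<integral>\<^sup>+z. h (\<sigma> * labX p (fst z), \<sigma> * labY p (fst z) (snd z)) \<partial>lab)
     = (\<integral>\<^sup>+z. h (labX p (fst z), labY p (fst z) (snd z)) \<partial>lab) + (\<integral>\<^sup>+z. h (- labX p (fst z), - labY p (fst z) (snd z)) \<partial>lab)"
    by simp
  also have "\<dots> = (\<integral>\<^sup>+z. indicator ?Q z * indicator {0<..} (phase p (fst z) (snd z)) * h z
       + indicator ?Q z * indicator {0<..} (- phase p (fst z) (snd z)) * h z \<partial>lborel)"
    unfolding pos neg by (rule nn_integral_add[symmetric]) measurable
  also have "\<dots> = (\<integral>\<^sup>+z. indicator ?Q z * h z \<partial>lborel)"
    by (rule nn_integral_cong_AE, use AE_phase_nonzero[OF p] in eventually_elim) (auto simp: indicator_def)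
  finally show ?thesis by simp
qed

section \<open>Energy of the reference flow\<close>

lemma nn_integral_FTC_nonneg:
  fixes f F :: "real \<Rightarrow> real"
  assumes "f \<in> borel_measurable borel" and "\<And>x. x \<in> {a..b} \<Longrightarrow> (F has_real_derivative f x) (at x)"
    and "\<And>x. x \<in> {a..b} \<Longrightarrow> 0 \<le> f x" and "a \<le> b"
  shows "(\<integral>\<^sup>+x. indicator {a..b} x * ennreal (f x) \<partial>lborel) = ennreal (F b - F a)"
  using nn_integral_FTC_Icc[of f a b F] assms by (simp add: mult.commute)

text \<open>The derivatives of \<open>labX\<close> and \<open>labY\<close> with respect to the angle.\<close>

definition labV1 :: "real \<Rightarrow> real \<Rightarrow> real" where
  "labV1 p a = (if p \<le> a then 0 else - sin (2 * (p - a)))"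

definition labV2 :: "real \<Rightarrow> real \<Rightarrow> real \<Rightarrow> real" where
  "labV2 p a e = (if p \<le> a then 0 else e * labJ p a * (cos p / sin p + tan (2 * a - p)))"

lemma nn_integral_lab_prod:
  assumes [measurable]: "f \<in> borel_measurable borel" "g \<in> borel_measurable borel"
    and "\<And>x. 0 \<le> f x" "\<And>x. 0 \<le> g x"
  shows "(\<integral>\<^sup>+z. ennreal (f (fst z) * g (snd z)) \<partial>lab) =
    (\<integral>\<^sup>+a. indicator {0<..<pi/2} a * ennreal (sin (2 * a) * f a) \<partial>lborel) * (\<integral>\<^sup>+e. indicator {0<..<2} e * ennreal (g e) \<partial>lborel)"
proof -
  have "(\<integral>\<^sup>+z. ennreal (f (fst z) * g (snd z)) \<partial>lab)
     = (\<integral>\<^sup>+z. (indicator {0<..<pi/2} (fst z) * ennreal (sin (2 * fst z) * f (fst z))) * (indicator {0<..<2} (snd z) * ennreal (g (snd z))) \<partial>(lborel \<Otimes>\<^sub>M lborel))"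
  proof -
    have "ennreal (sin (2 * a) * f a) = ennreal (sin (2 * a)) * ennreal (f a)" "ennreal (f a * g e) = ennreal (f a) * ennreal (g e)" for a e
      by (intro ennreal_mult'' assms)+
    then show ?thesis unfolding lab_def
      by (subst nn_integral_density) (auto simp: split_beta' mult.assoc mult.left_commute intro!: nn_integral_cong)
  qed
  also have "\<dots> = (\<integral>\<^sup>+a. \<integral>\<^sup>+e. (indicator {0<..<pi/2} a * ennreal (sin (2 * a) * f a)) * (indicator {0<..<2} e * ennreal (g e)) \<partial>lborel \<partial>lborel)"
    by (subst lborel.nn_integral_fst[symmetric]) auto
  also have "\<dots> = (\<integral>\<^sup>+a. (indicator {0<..<pi/2} a * ennreal (sin (2 * a) * f a)) * (\<integral>\<^sup>+e. indicator {0<..<2} e * ennreal (g e) \<partial>lborel) \<partial>lborel)"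
    by (intro nn_integral_cong nn_integral_cmult) auto
  also have "\<dots> = (\<integral>\<^sup>+a. indicator {0<..<pi/2} a * ennreal (sin (2 * a) * f a) \<partial>lborel) * (\<integral>\<^sup>+e. indicator {0<..<2} e * ennreal (g e) \<partial>lborel)"
    by (rule nn_integral_multc) auto
  finally show ?thesis .
qed

text \<open>This exact value is what determines the optimal constant: the sum over both phases is
\<open>(8/3) * sin^4 p\<close>, or \<open>(2/3) * sin^4 p\<close> after division by the area of the square.\<close>

lemma lab_energy1:
  assumes p: "0 \<le> p" "p \<le> pi / 2"
  shows "(\<integral>\<^sup>+z. ennreal ((labV1 p (fst z))\<^sup>2) \<partial>lab) \<le> ennreal (4 / 3 * (sin p)^4)"
proof -
  have [measurable]: "(\<lambda>a. labV1 p a) \<in> borel_measurable borel" unfolding labV1_def by measurable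
  let ?f = "\<lambda>a. (sin (2 * (p - a)))\<^sup>2 * sin (2 * a)"
  let ?F = "\<lambda>a. - cos (2 * a) / 4 - cos (4 * p - 2 * a) / 8 + cos (6 * a - 4 * p) / 24"
  have "(\<integral>\<^sup>+z. ennreal ((labV1 p (fst z))\<^sup>2 * 1) \<partial>lab)
      = (\<integral>\<^sup>+a. indicator {0<..<pi/2} a * ennreal (sin (2 * a) * (labV1 p a)\<^sup>2) \<partial>lborel) * (\<integral>\<^sup>+e. indicator {0<..<2::real} e * ennreal 1 \<partial>lborel)"
    by (rule nn_integral_lab_prod) auto
  also have "\<dots> = 2 * (\<integral>\<^sup>+a. indicator {0<..<pi/2} a * ennreal (sin (2 * a) * (labV1 p a)\<^sup>2) \<partial>lborel)"
    by (simp add: mult.commute)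
  also have "\<dots> \<le> 2 * (\<integral>\<^sup>+a. indicator {0..p} a * ennreal (?f a) \<partial>lborel)"
    using p by (intro mult_left_mono nn_integral_mono) (auto simp: labV1_def indicator_def mult.commute)
  also have "(\<integral>\<^sup>+a. indicator {0..p} a * ennreal (?f a) \<partial>lborel) = ennreal (?F p - ?F 0)"
  proof (rule nn_integral_FTC_nonneg)
    fix a assume a: "a \<in> {0..p}"
    show "0 \<le> ?f a" using a p by (intro mult_nonneg_nonneg sin_ge_zero) auto
    have der: "(?F has_real_derivative (sin (2 * a) / 2 - sin (4 * p - 2 * a) / 4 - sin (6 * a - 4 * p) / 4)) (at a)"
      by (auto intro!: derivative_eq_intros)
    have sum: "sin (4 * p - 2 * a) + sin (6 * a - 4 * p) = 2 * sin (2 * a) * cos (4 * (p - a))"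
    proof -
      have e: "4 * p - 2 * a = 2 * a + 4 * (p - a)" "6 * a - 4 * p = 2 * a - 4 * (p - a)" by simp_all
      show ?thesis unfolding e sin_add sin_diff by simp
    qed
    have dbl: "cos (4 * (p - a)) = 1 - 2 * (sin (2 * (p - a)))\<^sup>2"
      using cos_double_sin[of "2 * (p - a)"] by (simp add: algebra_simps)
    have "S / 2 - A / 4 - B / 4 = Q * S" if "A + B = 2 * S * C" "C = 1 - 2 * Q" for A B S C Q :: real
      using that by algebra
    from this[OF sum dbl] show "(?F has_real_derivative ?f a) (at a)" using der by (simp only:)
  qed (use p in auto)
  also have "?F p - ?F 0 = 2 / 3 * (sin p)^4"
  proof -
    have c4: "cos (4 * p) = 2 * (cos (2 * p))\<^sup>2 - 1" using cos_double_cos[of "2 * p"] by simp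
    have "?F p - ?F 0 = 1/4 - cos (2 * p) / 3 + cos (4 * p) / 12" by (simp add: algebra_simps)
    also have "\<dots> = (1 - cos (2 * p))\<^sup>2 / 6" unfolding c4 by (simp add: power2_eq_square field_simps)
    also have "1 - cos (2 * p) = 2 * (sin p)\<^sup>2" by (simp add: cos_double_sin)
    finally show ?thesis by (simp add: power_mult_distrib)
  qed
  also have "2 * ennreal (2 / 3 * (sin p)^4) = ennreal (4 / 3 * (sin p)^4)"
    by (simp add: ennreal_mult'[symmetric] ennreal_numeral[symmetric] del: ennreal_numeral)
  finally show ?thesis by simp
qed

lemma ln_le_two_sqrt: "x > 0 \<Longrightarrow> ln x \<le> 2 * sqrt (x::real)"
proof -
  assume x: "x > 0"
  have "ln x = 2 * ln (sqrt x)" using x by (simp add: ln_sqrt)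
  also have "\<dots> \<le> 2 * (sqrt x - 1)" using x by (intro mult_left_mono ln_le_minus_one) auto
  finally show ?thesis by simp
qed

text \<open>Near the sides of the finger the vertical velocity behaves like \<open>1 / cos (2 * a - p)\<close>, whose square is
integrable against the label density up to a logarithm of \<open>cos p\<close>; the logarithm is then estimated by a
power.\<close>

lemma lab_energy2:
  assumes p: "0 \<le> p" "p < pi / 2"
  shows "(\<integral>\<^sup>+z. ennreal ((labV2 p (fst z) (snd z))\<^sup>2) \<partial>lab) \<le> ennreal (43 / sqrt (cos p))"
proof (cases "p = 0")
  case True
  have "AE z in lab. labV2 p (fst z) (snd z) = 0"
    unfolding lab_def by (subst AE_density) (auto simp: split_beta' labV2_def True indicator_def)
  then have "(\<integral>\<^sup>+z. ennreal ((labV2 p (fst z) (snd z))\<^sup>2) \<partial>lab) = (\<integral>\<^sup>+z. 0 \<partial>lab)"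
    by (intro nn_integral_cong_AE) auto
  then show ?thesis by simp
next
  case False
  then have p0: "p > 0" using p by simp
  have s: "sin p > 0" using p p0 by (intro sin_p_pos) auto
  have c: "cos p > 0" using p by (intro cos_gt_zero_pi) auto
  let ?t = "cos p / sin p"
  define w where "w a = (if p \<le> a then 0 else labJ p a * (?t + tan (2 * a - p)))" for a
  have [measurable]: "w \<in> borel_measurable borel" unfolding w_def tan_def by measurable
  have cb: "cos (2 * a - p) > 0" if "a \<in> {0..p}" for a
    using that p by (intro cos_gt_zero_pi) auto
  let ?U = "\<lambda>a. 4 * sin p * ?t\<^sup>2 * cos (2 * a - p) + 4 / cos (2 * a - p)"
  let ?F = "\<lambda>a. 2 * sin p * ?t\<^sup>2 * sin (2 * a - p) + 2 * (ln (1 + sin (2 * a - p)) - ln (cos (2 * a - p)))"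
  have "(\<integral>\<^sup>+z. ennreal ((labV2 p (fst z) (snd z))\<^sup>2) \<partial>lab) = (\<integral>\<^sup>+z. ennreal ((w (fst z))\<^sup>2 * (snd z)\<^sup>2) \<partial>lab)"
    by (intro nn_integral_cong) (simp add: labV2_def w_def power_mult_distrib mult_ac)
  also have "\<dots> = (\<integral>\<^sup>+a. indicator {0<..<pi/2} a * ennreal (sin (2 * a) * (w a)\<^sup>2) \<partial>lborel) * (\<integral>\<^sup>+e. indicator {0<..<2} e * ennreal (e\<^sup>2) \<partial>lborel)"
    by (rule nn_integral_lab_prod) auto
  also have "\<dots> \<le> (\<integral>\<^sup>+a. indicator {0..p} a * ennreal (?U a) \<partial>lborel) * (\<integral>\<^sup>+e. indicator {0..2} e * ennreal (e\<^sup>2) \<partial>lborel)"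
  proof (rule mult_mono, rule nn_integral_mono)
    fix a
    show "indicator {0<..<pi/2} a * ennreal (sin (2 * a) * (w a)\<^sup>2) \<le> indicator {0..p} a * ennreal (?U a)"
    proof (cases "0 < a \<and> a < p")
      case True
      note b = cb[of a]
      let ?J = "labJ p a" and ?c = "cos (2 * a - p)" and ?s = "sin (2 * a - p)"
      have J: "0 < ?J" "?J \<le> 1" using labJ_bounds[of a p] True p by auto
      have cpos: "?c > 0" using b True by simp
      have s2: "sin (2 * a) = 2 * ?J * (sin p * ?c)" using True s cpos by (simp add: labJ_def)
      have "sin (2 * a) * (w a)\<^sup>2 = 2 * (sin p * ?c) * (?J^3 * (?t + ?s / ?c)\<^sup>2)"
        using True unfolding s2 w_def by (simp add: tan_def power_mult_distrib power2_eq_square power3_eq_cube mult_ac)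
      also have "\<dots> \<le> 2 * (sin p * ?c) * (1 * (2 * ?t\<^sup>2 + 2 * (?s / ?c)\<^sup>2))"
      proof (intro mult_left_mono mult_mono)
        show "?J^3 \<le> 1" using J by (intro power_le_one) auto
        show "(?t + ?s / ?c)\<^sup>2 \<le> 2 * ?t\<^sup>2 + 2 * (?s / ?c)\<^sup>2" using norm_sq_le_twice[of ?t "?s / ?c"] by (simp only: real_norm_def power2_abs)
      qed (use s cpos J in auto)
      also have "\<dots> = 4 * sin p * ?t\<^sup>2 * ?c + 4 * (sin p * ?s\<^sup>2) / ?c"
        using cpos by (simp add: power2_eq_square field_simps)
      also have "\<dots> \<le> 4 * sin p * ?t\<^sup>2 * ?c + 4 / ?c"
      proof -
        have "sin p * ?s\<^sup>2 \<le> 1 * 1" using s by (intro mult_mono) (auto simp: abs_square_le_1)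
        then show ?thesis using cpos by (simp add: divide_right_mono)
      qed
      finally show ?thesis using True by (simp add: indicator_def ennreal_leI)
    next
      case False
      then show ?thesis by (auto simp: indicator_def w_def labJ_def)
    qed
  qed (auto simp: indicator_def intro!: nn_integral_mono)
  also have "(\<integral>\<^sup>+e. indicator {0..2} e * ennreal (e\<^sup>2) \<partial>lborel) = ennreal (2^3 / 3 - 0^3 / 3)"
    by (rule nn_integral_FTC_nonneg) (auto intro!: derivative_eq_intros)
  also have "(\<integral>\<^sup>+a. indicator {0..p} a * ennreal (?U a) \<partial>lborel) = ennreal (?F p - ?F 0)"
  proof (rule nn_integral_FTC_nonneg)
    fix a assume a: "a \<in> {0..p}"
    have cpos: "cos (2 * a - p) > 0" using cb[OF a] .
    then show "0 \<le> ?U a" using s by simp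
    have "sin (2 * a - p) \<noteq> - 1"
    proof
      assume "sin (2 * a - p) = - 1"
      then show False using cpos sin_cos_squared_add[of "2 * a - p"] by simp
    qed
    then have spos: "1 + sin (2 * a - p) > 0" using sin_ge_minus_one[of "2 * a - p"] by linarith
    have "2 * (2 * C / (1 + S) - (- (2 * S)) / C) = 4 / C" if "C\<^sup>2 = 1 - S\<^sup>2" "C > 0" "1 + S > 0" for C S :: real
    proof -
      have "C / (1 + S) = (1 - S) / C"
        using that by (subst frac_eq_eq) (auto simp: power2_eq_square algebra_simps)
      then have "2 * C / (1 + S) = 2 * (1 - S) / C" by (metis times_divide_eq_right)
      then show ?thesis using that(2) by (simp add: field_simps)
    qed
    from this[OF cos_squared_eq cpos spos]
    have e: "2 * (2 * cos (2 * a - p) / (1 + sin (2 * a - p)) - (- (2 * sin (2 * a - p))) / cos (2 * a - p)) = 4 / cos (2 * a - p)" .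
    have "(?F has_real_derivative 2 * sin p * ?t\<^sup>2 * (2 * cos (2 * a - p)) + 2 * (2 * cos (2 * a - p) / (1 + sin (2 * a - p)) - (- (2 * sin (2 * a - p))) / cos (2 * a - p))) (at a)"
      using cpos spos by (auto intro!: derivative_eq_intros)
    then show "(?F has_real_derivative ?U a) (at a)" unfolding e by (simp add: mult_ac)
  qed (use p in auto)
  also have "ennreal (?F p - ?F 0) * ennreal (2^3 / 3 - 0^3 / 3) \<le> ennreal (16 / sqrt (cos p)) * ennreal (8 / 3)"
  proof (intro mult_mono ennreal_leI)
    have s1: "sin p < 1" using sin_cos_squared_add[of p] c by (smt (verit) power2_eq_square zero_less_power sin_le_one one_power2)
    have "?F p - ?F 0 = 4 * (sin p * ?t)\<^sup>2 + 2 * (ln (1 + sin p) - ln (1 - sin p))"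
      by (simp add: power2_eq_square)
    also have "ln (1 + sin p) - ln (1 - sin p) = 2 * ln ((1 + sin p) / cos p)"
    proof -
      have "1 - sin p = (cos p)\<^sup>2 / (1 + sin p)"
        using s by (simp add: cos_squared_eq field_simps power2_eq_square)
      then show ?thesis using s c by (simp add: ln_div ln_realpow)
    qed
    also have "4 * (sin p * ?t)\<^sup>2 + 2 * (2 * ln ((1 + sin p) / cos p)) \<le> 4 + 4 * (2 * sqrt (2 / cos p))"
    proof -
      have "(sin p * ?t)\<^sup>2 \<le> 1" using s by (simp add: abs_square_le_1)
      moreover have "ln ((1 + sin p) / cos p) \<le> ln (2 / cos p)"
        using s c s1 by (intro ln_mono divide_right_mono) auto
      moreover have "ln (2 / cos p) \<le> 2 * sqrt (2 / cos p)" using c by (intro ln_le_two_sqrt) auto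
      ultimately show ?thesis by linarith
    qed
    also have "\<dots> \<le> 16 / sqrt (cos p)"
    proof -
      have "sqrt 2 \<le> 3 / 2" by (rule real_le_lsqrt) (auto simp: power2_eq_square)
      then have "4 * (2 * sqrt (2 / cos p)) \<le> 12 / sqrt (cos p)" using c by (simp add: real_sqrt_divide divide_right_mono)
      moreover have "sqrt (cos p) \<le> 1" by simp
      then have "4 \<le> 4 / sqrt (cos p)" using c by (simp add: field_simps)
      ultimately show ?thesis by linarith
    qed
    finally show "?F p - ?F 0 \<le> 16 / sqrt (cos p)" .
  qed auto
  also have "\<dots> = ennreal (128 / 3 / sqrt (cos p))" using c by (subst ennreal_mult[symmetric]) auto
  \<comment> \<open>The factor \<open>128 / 3\<close> is rounded up.\<close>
  also have "\<dots> \<le> ennreal (43 / sqrt (cos p))" using c by (intro ennreal_leI divide_right_mono) auto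
  finally show ?thesis .
qed

section \<open>Transport along particle paths\<close>

text \<open>The identity for non-negative functions, applied to the positive and the negative part.\<close>

lemma push_forward_integral:
  fixes G :: "real^'n \<Rightarrow> real"
  assumes push: "\<And>F :: real^'n \<Rightarrow> ennreal. F \<in> borel_measurable borel \<Longrightarrow> torus_periodic L F \<Longrightarrow>
      (\<integral>\<^sup>+x. F x \<partial>torus L) = ennreal c * (\<integral>\<^sup>+l. F (\<Phi> l) \<partial>M)"
    and c: "c > 0" and m: "\<Phi> \<in> borel_measurable M"
    and G [measurable]: "G \<in> borel_measurable borel" and per: "torus_periodic L G" and int: "integrable (torus L) G"
  shows "integrable M (\<lambda>l. G (\<Phi> l))" and "(LINT x|torus L. G x) = c * (LINT l|M. G (\<Phi> l))"
proof -
  have *: "(\<integral>\<^sup>+x. ennreal (g (G x)) \<partial>torus L) = ennreal c * (\<integral>\<^sup>+l. ennreal (g (G (\<Phi> l))) \<partial>M)"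
    if [measurable]: "g \<in> borel_measurable borel" for g
    by (rule push) (use per in \<open>auto simp: torus_periodic_def\<close>)
  have Gm: "(\<lambda>l. G (\<Phi> l)) \<in> borel_measurable M" using m by measurable
  have "ennreal c * (\<integral>\<^sup>+l. ennreal \<bar>G (\<Phi> l)\<bar> \<partial>M) < \<infinity>"
    using int *[of abs] by (simp add: integrable_iff_bounded)
  then have "(\<integral>\<^sup>+l. ennreal \<bar>G (\<Phi> l)\<bar> \<partial>M) < \<infinity>" using c by (auto simp: ennreal_mult_less_top)
  then show i: "integrable M (\<lambda>l. G (\<Phi> l))" using Gm by (simp add: integrable_iff_bounded)
  have "enn2real (ennreal c * x) = c * enn2real x" for x using c by (simp add: enn2real_mult)
  then show "(LINT x|torus L. G x) = c * (LINT l|M. G (\<Phi> l))"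
    using *[of "\<lambda>x. x"] *[of uminus]
    by (simp add: real_lebesgue_integral_def[OF int] real_lebesgue_integral_def[OF i] right_diff_distrib)
qed

text \<open>Integrating over labels turns the weak form into the fundamental theorem of calculus along each
path: the integrand is the derivative of \<open>\<rho> t (\<Phi> t l) * \<psi> t (\<Phi> t l)\<close>, in which the first factor is constant.
The energy bound makes the integrand integrable, so that the integrals over time and labels
can be exchanged.\<close>

theorem Lagrangian_transport:
  fixes \<Phi> :: "real \<Rightarrow> 'l \<Rightarrow> real^'n" and v :: "real \<Rightarrow> real^'n \<Rightarrow> real^'n" and \<rho> \<psi> D1 :: "real \<Rightarrow> real^'n \<Rightarrow> real"
    and D2 :: "real \<Rightarrow> real^'n \<Rightarrow> real^'n"
  assumes ab: "a \<le> b" and M: "finite_measure M" and c: "c > 0"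
    and \<Phi>m [measurable]: "(\<lambda>p. \<Phi> (fst p) (snd p)) \<in> borel_measurable (borel \<Otimes>\<^sub>M M)"
    and push: "\<And>t F. t \<in> {a..b} \<Longrightarrow> F \<in> borel_measurable borel \<Longrightarrow> torus_periodic L F \<Longrightarrow>
      (\<integral>\<^sup>+x. F x \<partial>torus L) = ennreal c * (\<integral>\<^sup>+l. F (\<Phi> t l) \<partial>M)"
    and path_cont: "\<And>l. l \<in> space M \<Longrightarrow> continuous_on {a..b} (\<lambda>t. \<Phi> t l)"
    and path_deriv: "\<And>l. l \<in> space M \<Longrightarrow> \<exists>S. finite S \<and> (\<forall>t\<in>{a<..<b} - S. ((\<lambda>t. \<Phi> t l) has_vector_derivative v t (\<Phi> t l)) (at t))"
    and \<rho>: "\<And>t l. t \<in> {a..b} \<Longrightarrow> l \<in> space M \<Longrightarrow> \<rho> t (\<Phi> t l) = s l"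
    and \<rho>1: "\<And>t x. \<bar>\<rho> t x\<bar> \<le> 1"
    and \<rho>m [measurable]: "(\<lambda>p. \<rho> (fst p) (snd p)) \<in> borel_measurable (borel \<Otimes>\<^sub>M borel)"
    and \<rho>p: "\<And>t. torus_periodic L (\<rho> t)"
    and vm [measurable]: "(\<lambda>p. v (fst p) (snd p)) \<in> borel_measurable (borel \<Otimes>\<^sub>M borel)"
    and vp: "\<And>t. torus_periodic L (v t)"
    and vE: "\<And>t. t \<in> {a<..<b} \<Longrightarrow> (\<integral>\<^sup>+x. ennreal ((norm (v t x))\<^sup>2) \<partial>torus L) \<le> ennreal K" and K: "K \<ge> 0"
    and \<psi>p: "\<And>t. t \<in> {a..b} \<Longrightarrow> torus_periodic L (\<psi> t)"
    and D1p: "\<And>t. t \<in> {a<..<b} \<Longrightarrow> torus_periodic L (D1 t)" and D2p: "\<And>t. t \<in> {a<..<b} \<Longrightarrow> torus_periodic L (D2 t)"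
    and psic: "continuous_on ({a..b} \<times> UNIV) (\<lambda>p. \<psi> (fst p) (snd p))"
    and der: "\<And>t x. t \<in> {a<..<b} \<Longrightarrow> ((\<lambda>p. \<psi> (fst p) (snd p)) has_derivative (\<lambda>h. fst h * D1 t x + D2 t x \<bullet> snd h)) (at (t, x))"
    and D1m [measurable]: "(\<lambda>p. D1 (fst p) (snd p)) \<in> borel_measurable (borel \<Otimes>\<^sub>M borel)"
    and D2m [measurable]: "(\<lambda>p. D2 (fst p) (snd p)) \<in> borel_measurable (borel \<Otimes>\<^sub>M borel)"
    and bnd: "\<And>t x. t \<in> {a<..<b} \<Longrightarrow> \<bar>D1 t x\<bar> \<le> B" "\<And>t x. t \<in> {a<..<b} \<Longrightarrow> norm (D2 t x) \<le> B" and B: "B \<ge> 0"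
  shows "integrable lborel (\<lambda>t. indicator {a<..<b} t * (LINT x|torus L. \<rho> t x * D1 t x + \<rho> t x * (v t x \<bullet> D2 t x))) \<and>
    (LINT t|lborel. indicator {a<..<b} t * (LINT x|torus L. \<rho> t x * D1 t x + \<rho> t x * (v t x \<bullet> D2 t x))) =
      (LINT x|torus L. \<rho> b x * \<psi> b x) - (LINT x|torus L. \<rho> a x * \<psi> a x)"
proof -
  interpret M: finite_measure M by (rule M)
  interpret T: finite_measure "torus L :: (real^'n) measure" by (rule finite_measure_torus)
  interpret P: pair_sigma_finite lborel M ..
  have \<Phi>t: "\<Phi> t \<in> borel_measurable M" for t
    using measurable_compose[OF measurable_Pair[OF measurable_const[of t borel M] measurable_ident] \<Phi>m] by (simp add: id_def)
  have \<rho>t [measurable]: "\<rho> t \<in> borel_measurable borel" for t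
    using measurable_compose[OF measurable_Pair[OF measurable_const[of t borel borel] measurable_ident] \<rho>m] by (simp add: id_def)
  have vt [measurable]: "v t \<in> borel_measurable borel" for t
    using measurable_compose[OF measurable_Pair[OF measurable_const[of t borel borel] measurable_ident] vm] by (simp add: id_def)
  have D1t [measurable]: "D1 t \<in> borel_measurable borel" for t
    using measurable_compose[OF measurable_Pair[OF measurable_const[of t borel borel] measurable_ident] D1m] by (simp add: id_def)
  have D2t [measurable]: "D2 t \<in> borel_measurable borel" for t
    using measurable_compose[OF measurable_Pair[OF measurable_const[of t borel borel] measurable_ident] D2m] by (simp add: id_def)
  define G where "G t x = \<rho> t x * D1 t x + \<rho> t x * (v t x \<bullet> D2 t x)" for t x
  define h where "h t l = indicator {a<..<b} t * G t (\<Phi> t l)" for t l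
  have Gm [measurable]: "(\<lambda>p. G (fst p) (snd p)) \<in> borel_measurable (borel \<Otimes>\<^sub>M borel)" unfolding G_def by measurable
  have Gt [measurable]: "G t \<in> borel_measurable borel" for t unfolding G_def by measurable
  have Gp: "torus_periodic L (G t)" if "t \<in> {a<..<b}" for t
    using \<rho>p vp D1p[OF that] D2p[OF that] by (simp add: G_def torus_periodic_def)
  have pm: "(\<lambda>p. (fst p, \<Phi> (fst p) (snd p))) \<in> borel \<Otimes>\<^sub>M M \<rightarrow>\<^sub>M borel \<Otimes>\<^sub>M borel" by measurable
  have "(\<lambda>p. G (fst p) (\<Phi> (fst p) (snd p))) \<in> borel_measurable (borel \<Otimes>\<^sub>M M)"
    using measurable_compose[OF pm Gm] by simp
  then have hm: "(\<lambda>p. h (fst p) (snd p)) \<in> borel_measurable (lborel \<Otimes>\<^sub>M M)"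
    unfolding h_def by (simp cong: measurable_cong_sets sets_pair_measure_cong)
  have Gbd: "\<bar>G t x\<bar> \<le> B * (2 + (norm (v t x))\<^sup>2)" if "t \<in> {a<..<b}" for t x
  proof -
    have nv: "norm (v t x) \<le> 1 + (norm (v t x))\<^sup>2"
      using sum_squares_bound[of 1 "norm (v t x)"] zero_le_power2[of "norm (v t x)"] norm_ge_zero[of "v t x"] unfolding one_power2 by linarith
    have "\<bar>v t x \<bullet> D2 t x\<bar> \<le> norm (v t x) * norm (D2 t x)" by (rule Cauchy_Schwarz_ineq2)
    also have "\<dots> \<le> (1 + (norm (v t x))\<^sup>2) * B" using nv bnd(2)[OF that] by (intro mult_mono) auto
    finally have "\<bar>D1 t x + v t x \<bullet> D2 t x\<bar> \<le> B * (2 + (norm (v t x))\<^sup>2)" using bnd(1)[OF that, of x] by (simp add: algebra_simps)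
    moreover have "\<bar>G t x\<bar> \<le> 1 * \<bar>D1 t x + v t x \<bullet> D2 t x\<bar>"
      unfolding G_def distrib_left[symmetric] abs_mult by (intro mult_right_mono \<rho>1) auto
    ultimately show ?thesis by simp
  qed
  have Vt: "emeasure (torus L) (space (torus L :: (real^'n) measure)) < \<infinity>" using T.emeasure_finite by (metis infinity_ennreal_def less_top)
  define W where "W = (\<integral>\<^sup>+x. ennreal (B * (2 + 0)) \<partial>(torus L :: (real^'n) measure)) + ennreal B * ennreal K"
  have Wfin: "W < \<infinity>" using Vt by (simp add: W_def ennreal_mult_less_top)
  have Gnn: "(\<integral>\<^sup>+x. ennreal \<bar>G t x\<bar> \<partial>torus L) \<le> W" if "t \<in> {a<..<b}" for t
  proof -
    have "(\<integral>\<^sup>+x. ennreal \<bar>G t x\<bar> \<partial>torus L) \<le> (\<integral>\<^sup>+x. ennreal (B * (2 + 0)) + ennreal B * ennreal ((norm (v t x))\<^sup>2) \<partial>torus L)"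
    proof (intro nn_integral_mono)
      fix x
      have "ennreal \<bar>G t x\<bar> \<le> ennreal (B * (2 + (norm (v t x))\<^sup>2))" using Gbd[of t x] that by (intro ennreal_leI) auto
      also have "\<dots> = ennreal (B * (2 + 0)) + ennreal B * ennreal ((norm (v t x))\<^sup>2)"
        using B by (simp add: ennreal_mult[symmetric] ennreal_plus[symmetric] distrib_left del: ennreal_plus)
      finally show "ennreal \<bar>G t x\<bar> \<le> ennreal (B * (2 + 0)) + ennreal B * ennreal ((norm (v t x))\<^sup>2)" .
    qed
    also have "\<dots> = (\<integral>\<^sup>+x. ennreal (B * (2 + 0)) \<partial>(torus L :: (real^'n) measure)) + ennreal B * (\<integral>\<^sup>+x. ennreal ((norm (v t x))\<^sup>2) \<partial>torus L)"
    proof -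
      have vm': "(\<lambda>x. ennreal ((norm (v t x))\<^sup>2)) \<in> borel_measurable (torus L)" by (intro measurable_torusI) measurable
      then have "(\<integral>\<^sup>+x. ennreal (B * (2 + 0)) + ennreal B * ennreal ((norm (v t x))\<^sup>2) \<partial>torus L)
        = (\<integral>\<^sup>+x. ennreal (B * (2 + 0)) \<partial>(torus L :: (real^'n) measure)) + (\<integral>\<^sup>+x. ennreal B * ennreal ((norm (v t x))\<^sup>2) \<partial>torus L)"
        by (intro nn_integral_add borel_measurable_times_ennreal) simp_all
      then show ?thesis unfolding nn_integral_cmult[OF vm'] .
    qed
    also have "\<dots> \<le> W" unfolding W_def by (rule add_left_mono, rule mult_left_mono, rule vE[OF that]) simp
    finally show ?thesis .
  qed
  have Gi: "integrable (torus L) (G t)" if "t \<in> {a<..<b}" for t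
    using le_less_trans[OF Gnn[OF that] Wfin] measurable_torusI[OF Gt] by (simp add: integrable_iff_bounded)
  have push': "ennreal c * (\<integral>\<^sup>+l. ennreal \<bar>G t (\<Phi> t l)\<bar> \<partial>M) = (\<integral>\<^sup>+x. ennreal \<bar>G t x\<bar> \<partial>torus L)" if "t \<in> {a<..<b}" for t
    by (rule push[symmetric]) (use that Gp[of t] in \<open>auto simp: torus_periodic_def\<close>)
  have ih: "integrable (lborel \<Otimes>\<^sub>M M) (\<lambda>p. h (fst p) (snd p))"
  proof (subst integrable_iff_bounded, intro conjI hm)
    have "(\<integral>\<^sup>+p. ennreal (norm (h (fst p) (snd p))) \<partial>(lborel \<Otimes>\<^sub>M M)) = (\<integral>\<^sup>+t. \<integral>\<^sup>+l. ennreal (norm (h t l)) \<partial>M \<partial>lborel)"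
      using hm by (subst M.nn_integral_fst[symmetric]) auto
    also have "\<dots> \<le> (\<integral>\<^sup>+t. indicator {a<..<b} t * (ennreal (1 / c) * W) \<partial>lborel)"
    proof (intro nn_integral_mono)
      fix t
      show "(\<integral>\<^sup>+l. ennreal (norm (h t l)) \<partial>M) \<le> indicator {a<..<b} t * (ennreal (1 / c) * W)"
      proof (cases "t \<in> {a<..<b}")
        case True
        have "ennreal c * (\<integral>\<^sup>+l. ennreal \<bar>G t (\<Phi> t l)\<bar> \<partial>M) \<le> W" unfolding push'[OF True] by (rule Gnn[OF True])
        then have "ennreal (1 / c) * (ennreal c * (\<integral>\<^sup>+l. ennreal \<bar>G t (\<Phi> t l)\<bar> \<partial>M)) \<le> ennreal (1 / c) * W"
          by (intro mult_left_mono) auto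
        moreover have "ennreal (1 / c) * ennreal c = 1" using c by (simp add: ennreal_mult[symmetric])
        ultimately have "(\<integral>\<^sup>+l. ennreal \<bar>G t (\<Phi> t l)\<bar> \<partial>M) \<le> ennreal (1 / c) * W"
          by (metis mult.assoc mult_1)
        then show ?thesis using True by (simp add: h_def)
      qed (simp add: h_def)
    qed
    also have "\<dots> < \<infinity>" using Wfin c ab by (simp add: nn_integral_multc ennreal_mult_less_top)
    finally show "(\<integral>\<^sup>+p. ennreal (norm (h (fst p) (snd p))) \<partial>(lborel \<Otimes>\<^sub>M M)) < \<infinity>" .
  qed
  have ih': "integrable (lborel \<Otimes>\<^sub>M M) (case_prod h)" using ih by (simp add: split_beta')
  have Mh: "(LINT l|M. h t l) = (1 / c) * (indicator {a<..<b} t * (LINT x|torus L. G t x))" for t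
  proof (cases "t \<in> {a<..<b}")
    case True
    have "(LINT x|torus L. G t x) = c * (LINT l|M. G t (\<Phi> t l))"
      by (rule push_forward_integral(2)[OF push c \<Phi>t Gt Gp Gi]) (use True in auto)
    then show ?thesis using True c by (simp add: h_def)
  qed (simp add: h_def)
  have "integrable lborel (\<lambda>t. LINT l|M. h t l)" using P.integrable_fst[OF ih'] by simp
  then have i1: "integrable lborel (\<lambda>t. (1 / c) * (indicator {a<..<b} t * (LINT x|torus L. G t x)))" unfolding Mh .
  have "integrable lborel (\<lambda>t. c * ((1 / c) * (indicator {a<..<b} t * (LINT x|torus L. G t x))))"
    by (rule integrable_mult_right) (rule i1)
  then have i2: "integrable lborel (\<lambda>t. indicator {a<..<b} t * (LINT x|torus L. G t x))" using c by simp
  then have i3: "integrable lborel (\<lambda>t. indicator {a<..<b} t * (LINT x|torus L. \<rho> t x * D1 t x + \<rho> t x * (v t x \<bullet> D2 t x)))"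
    unfolding G_def .
  have path: "((\<lambda>t. G t (\<Phi> t l)) has_integral (\<rho> b (\<Phi> b l) * \<psi> b (\<Phi> b l) - \<rho> a (\<Phi> a l) * \<psi> a (\<Phi> a l))) {a..b}" if l: "l \<in> space M" for l
  proof -
    obtain S where S: "finite S" "\<And>t. t \<in> {a<..<b} - S \<Longrightarrow> ((\<lambda>t. \<Phi> t l) has_vector_derivative v t (\<Phi> t l)) (at t)"
      using path_deriv[OF l] by blast
    have cont: "continuous_on {a..b} (\<lambda>t. \<psi> t (\<Phi> t l))"
    proof -
      have "continuous_on {a..b} (\<lambda>t. (t, \<Phi> t l))" by (intro continuous_on_Pair continuous_on_id path_cont[OF l])
      from continuous_on_compose2[OF psic this] show ?thesis by auto
    qed
    have "((\<lambda>t. s l * \<psi> t (\<Phi> t l)) has_vector_derivative G t (\<Phi> t l)) (at t)" if t: "t \<in> {a<..<b} - S" for t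
    proof -
      have "((\<lambda>t. (t, \<Phi> t l)) has_derivative (\<lambda>h. (h, h *\<^sub>R v t (\<Phi> t l)))) (at t)"
        using S(2)[OF t] unfolding has_vector_derivative_def by (intro has_derivative_Pair has_derivative_ident)
      from has_derivative_compose[OF this, of "\<lambda>p. \<psi> (fst p) (snd p)" "\<lambda>h. fst h * D1 t (\<Phi> t l) + D2 t (\<Phi> t l) \<bullet> snd h"]
      have "((\<lambda>t. \<psi> t (\<Phi> t l)) has_derivative (\<lambda>h. h * D1 t (\<Phi> t l) + D2 t (\<Phi> t l) \<bullet> (h *\<^sub>R v t (\<Phi> t l)))) (at t)"
        using der[of t "\<Phi> t l"] t by simp
      then have "((\<lambda>t. s l * \<psi> t (\<Phi> t l)) has_derivative (\<lambda>h. s l * (h * D1 t (\<Phi> t l) + D2 t (\<Phi> t l) \<bullet> (h *\<^sub>R v t (\<Phi> t l))))) (at t)"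
        by (rule has_derivative_mult_right)
      moreover have "(\<lambda>h. s l * (h * D1 t (\<Phi> t l) + D2 t (\<Phi> t l) \<bullet> (h *\<^sub>R v t (\<Phi> t l)))) = (\<lambda>h. h *\<^sub>R G t (\<Phi> t l))"
        using \<rho>[of t l] t l by (auto simp: G_def fun_eq_iff algebra_simps inner_commute)
      ultimately show ?thesis by (simp add: has_vector_derivative_def)
    qed
    then have "((\<lambda>t. G t (\<Phi> t l)) has_integral (s l * \<psi> b (\<Phi> b l) - s l * \<psi> a (\<Phi> a l))) {a..b}"
      using cont by (intro fundamental_theorem_of_calculus_interior_strong[OF S(1) ab]) (auto intro: continuous_intros)
    then show ?thesis using \<rho>[OF _ l] ab by simp
  qed
  have sec: "AE l in M. (LINT t|lborel. h t l) = \<rho> b (\<Phi> b l) * \<psi> b (\<Phi> b l) - \<rho> a (\<Phi> a l) * \<psi> a (\<Phi> a l)"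
    using P.AE_integrable_snd[OF ih'] AE_space
  proof eventually_elim
    case (elim l)
    have "((\<lambda>t. h t l) has_integral (LINT t|lborel. h t l)) UNIV" by (rule has_integral_integral_lborel[OF elim(1)])
    moreover have "((\<lambda>t. if t \<in> {a<..<b} then G t (\<Phi> t l) else 0) has_integral (\<rho> b (\<Phi> b l) * \<psi> b (\<Phi> b l) - \<rho> a (\<Phi> a l) * \<psi> a (\<Phi> a l))) UNIV"
      unfolding has_integral_restrict_UNIV has_integral_Icc_iff_Ioo[symmetric] by (rule path[OF elim(2)])
    moreover have "(\<lambda>t. if t \<in> {a<..<b} then G t (\<Phi> t l) else 0) = (\<lambda>t. h t l)" by (auto simp: h_def)
    ultimately show ?case using has_integral_unique by metis
  qed
  have end_: "(LINT x|torus L. \<rho> t x * \<psi> t x) = c * (LINT l|M. \<rho> t (\<Phi> t l) * \<psi> t (\<Phi> t l)) \<and> integrable M (\<lambda>l. \<rho> t (\<Phi> t l) * \<psi> t (\<Phi> t l))" if t: "t \<in> {a..b}" for t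
  proof -
    have cont: "continuous_on UNIV (\<psi> t)"
    proof -
      have "continuous_on UNIV (\<lambda>x::real^'n. (t, x))" by (intro continuous_on_Pair continuous_on_id continuous_on_const)
      moreover have "range (Pair t) \<subseteq> {a..b} \<times> (UNIV :: (real^'n) set)" using t by auto
      ultimately show ?thesis using continuous_on_compose2[OF psic, of UNIV "Pair t"] by simp
    qed
    have pm: "\<psi> t \<in> borel_measurable borel" by (rule borel_measurable_continuous_onI[OF cont])
    have "integrable (torus L) (\<psi> t)" by (rule integrable_torus_continuous[OF continuous_on_subset[OF cont]]) simp
    then have i: "integrable (torus L) (\<lambda>x. \<rho> t x * \<psi> t x)"
    proof (rule Bochner_Integration.integrable_bound)
      show "(\<lambda>x. \<rho> t x * \<psi> t x) \<in> borel_measurable (torus L)" using pm by (intro measurable_torusI) measurable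
      show "AE x in torus L. norm (\<rho> t x * \<psi> t x) \<le> norm (\<psi> t x)"
        using mult_right_mono[OF \<rho>1 abs_ge_zero] by (auto simp: abs_mult)
    qed
    show ?thesis
      using push_forward_integral[OF push[OF t] c \<Phi>t, of "\<lambda>x. \<rho> t x * \<psi> t x"] pm i \<rho>p \<psi>p[OF t]
      by (auto simp: torus_periodic_def)
  qed
  have "(LINT t|lborel. indicator {a<..<b} t * (LINT x|torus L. G t x)) = c * (LINT t|lborel. (1 / c) * (indicator {a<..<b} t * (LINT x|torus L. G t x)))"
    using c by simp
  also have "\<dots> = c * (LINT t|lborel. LINT l|M. h t l)" unfolding Mh ..
  also have "\<dots> = c * (LINT l|M. LINT t|lborel. h t l)" by (simp only: P.Fubini_integral[OF ih'])
  also have "(LINT l|M. LINT t|lborel. h t l) = (LINT l|M. \<rho> b (\<Phi> b l) * \<psi> b (\<Phi> b l) - \<rho> a (\<Phi> a l) * \<psi> a (\<Phi> a l))"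
  proof (rule integral_cong_AE[OF _ _ sec])
    show "(\<lambda>l. LINT t|lborel. h t l) \<in> borel_measurable M" using P.integrable_snd[OF ih'] by auto
    show "(\<lambda>l. \<rho> b (\<Phi> b l) * \<psi> b (\<Phi> b l) - \<rho> a (\<Phi> a l) * \<psi> a (\<Phi> a l)) \<in> borel_measurable M"
      using end_[of a] end_[of b] ab by auto
  qed
  also have "c * \<dots> = (LINT x|torus L. \<rho> b x * \<psi> b x) - (LINT x|torus L. \<rho> a x * \<psi> a x)"
    using end_[of a] end_[of b] ab by (simp add: right_diff_distrib)
  finally have "(LINT t|lborel. indicator {a<..<b} t * (LINT x|torus L. \<rho> t x * D1 t x + \<rho> t x * (v t x \<bullet> D2 t x))) =
      (LINT x|torus L. \<rho> b x * \<psi> b x) - (LINT x|torus L. \<rho> a x * \<psi> a x)" unfolding G_def .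
  with i3 show ?thesis by blast
qed

section \<open>The Eulerian velocity and the particle paths\<close>

text \<open>The velocity with respect to the angle, as a function of position. Behind the tip one has
\<open>sqrt (sin\<^sup>2 p - x\<^sup>2) = sin p * cos (2 * a - p)\<close>, by which the label is eliminated from \<open>labV1\<close> and \<open>labV2\<close>; the sign
of \<open>phase\<close> selects between the two phases.\<close>

definition vel1 :: "real \<Rightarrow> real \<Rightarrow> real \<Rightarrow> real" where
  "vel1 p x y = (if \<bar>x\<bar> < (sin p)\<^sup>2 then cos p / sin p * x - sgn (phase p x y) * sqrt ((sin p)\<^sup>2 - x\<^sup>2) else 0)"

definition vel2 :: "real \<Rightarrow> real \<Rightarrow> real \<Rightarrow> real" where
  "vel2 p x y = (if \<bar>x\<bar> < (sin p)\<^sup>2 then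
     (sgn (phase p x y) - y) * (cos p / sin p + sgn (phase p x y) * x / sqrt ((sin p)\<^sup>2 - x\<^sup>2)) else 0)"

lemma vel_measurable [measurable (raw)]:
  assumes [measurable]: "f \<in> borel_measurable M" "g \<in> borel_measurable M" "h \<in> borel_measurable M"
  shows "(\<lambda>t. vel1 (f t) (g t) (h t)) \<in> borel_measurable M" "(\<lambda>t. vel2 (f t) (g t) (h t)) \<in> borel_measurable M"
  unfolding vel1_def vel2_def by measurable

lemma vel_label:
  assumes a: "0 < a" "a < pi / 2" and p: "0 \<le> p" "p \<le> pi / 2" and e: "0 < e" "e < 2" and \<sigma>: "\<sigma> \<in> {1, -1}"
  shows "vel1 p (\<sigma> * labX p a) (\<sigma> * labY p a e) = \<sigma> * labV1 p a"
    and "vel2 p (\<sigma> * labX p a) (\<sigma> * labY p a e) = \<sigma> * labV2 p a e"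
    and "sgn (phase p (\<sigma> * labX p a) (\<sigma> * labY p a e)) = \<sigma>"
proof -
  have pos: "phase p (labX p a) (labY p a e) > 0" by (rule phase_lab_pos[OF a p e])
  have sg: "sgn (phase p (\<sigma> * labX p a) (\<sigma> * labY p a e)) = \<sigma>" using \<sigma> pos by (auto simp: phase_odd)
  then show "sgn (phase p (\<sigma> * labX p a) (\<sigma> * labY p a e)) = \<sigma>" .
  have s\<sigma>: "\<bar>\<sigma> * x\<bar> = \<bar>x\<bar>" "\<sigma> * \<sigma> = 1" "(\<sigma> * x)\<^sup>2 = x\<^sup>2" for x using \<sigma> by auto
  have "vel1 p (\<sigma> * labX p a) (\<sigma> * labY p a e) = \<sigma> * labV1 p a \<and> vel2 p (\<sigma> * labX p a) (\<sigma> * labY p a e) = \<sigma> * labV2 p a e"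
  proof (cases "p \<le> a")
    case True
    then have "\<not> \<bar>labX p a\<bar> < (sin p)\<^sup>2" using labX_bounds(3)[OF a p] by auto
    then show ?thesis using True by (simp add: vel1_def vel2_def s\<sigma> labV1_def labV2_def)
  next
    case False
    then have ap: "a < p" "0 < p" using a by auto
    have lt: "\<bar>labX p a\<bar> < (sin p)\<^sup>2" using labX_bounds(2)[OF a p ap(1)] .
    have s: "sin p > 0" and c: "cos (2 * a - p) > 0" using ap a p sin_p_pos cos_2a_p_pos by auto
    have X: "labX p a = sin p * sin (2 * a - p)" using ap by (simp add: labX_def)
    have "(sin p)\<^sup>2 - (labX p a)\<^sup>2 = (sin p)\<^sup>2 * (1 - (sin (2 * a - p))\<^sup>2)" by (simp add: X power_mult_distrib algebra_simps)
    also have "\<dots> = (sin p * cos (2 * a - p))\<^sup>2" by (simp add: cos_squared_eq[symmetric] power_mult_distrib)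
    finally have r: "sqrt ((sin p)\<^sup>2 - (labX p a)\<^sup>2) = sin p * cos (2 * a - p)" using s c by simp
    have "vel1 p (\<sigma> * labX p a) (\<sigma> * labY p a e) = \<sigma> * (cos p / sin p * labX p a - sin p * cos (2 * a - p))"
      unfolding vel1_def s\<sigma> sg r using lt by (simp add: algebra_simps)
    also have "cos p / sin p * labX p a - sin p * cos (2 * a - p) = - sin (2 * (p - a))"
      using s sin_diff[of p "2 * a - p"] by (simp add: X algebra_simps)
    finally have 1: "vel1 p (\<sigma> * labX p a) (\<sigma> * labY p a e) = \<sigma> * labV1 p a" using ap by (simp add: labV1_def)
    have "vel2 p (\<sigma> * labX p a) (\<sigma> * labY p a e) = (\<sigma> - \<sigma> * labY p a e) * (cos p / sin p + (\<sigma> * \<sigma>) * labX p a / (sin p * cos (2 * a - p)))"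
      unfolding vel2_def s\<sigma>(1,3) sg r using lt by (simp add: mult.assoc)
    also have "\<dots> = \<sigma> * (e * labJ p a * (cos p / sin p + tan (2 * a - p)))"
      unfolding s\<sigma>(2) using s c by (simp add: X labY_def tan_def algebra_simps)
    finally show ?thesis using 1 ap by (simp add: labV2_def)
  qed
  then show "vel1 p (\<sigma> * labX p a) (\<sigma> * labY p a e) = \<sigma> * labV1 p a"
    "vel2 p (\<sigma> * labX p a) (\<sigma> * labY p a e) = \<sigma> * labV2 p a e" by auto
qed

lemma labX_deriv:
  assumes a: "0 < a" "a < pi / 2" and p: "0 < p" "p < pi / 2" "p \<noteq> a"
  shows "((\<lambda>p. labX p a) has_real_derivative labV1 p a) (at p)"
proof (cases "p < a")
  case True
  have "((\<lambda>p. (sin a)\<^sup>2) has_real_derivative 0) (at p)" by simp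
  then have "((\<lambda>p. labX p a) has_real_derivative 0) (at p)"
    by (rule DERIV_cong_ev[THEN iffD1, OF refl _ refl, rotated])
      (use True eventually_at_topological[of _ p UNIV] in \<open>auto simp: labX_def eventually_nhds intro!: exI[of _ "{..<a}"]\<close>)
  then show ?thesis using True by (simp add: labV1_def)
next
  case False
  then have ap: "a < p" using p by simp
  have "((\<lambda>p. sin p * sin (2 * a - p)) has_real_derivative labV1 p a) (at p)"
    using ap sin_diff[of p "2 * a - p"] by (auto intro!: derivative_eq_intros simp: labV1_def algebra_simps)
  then show ?thesis
    by (rule DERIV_cong_ev[THEN iffD1, OF refl _ refl, rotated])
      (use ap in \<open>auto simp: labX_def eventually_nhds intro!: exI[of _ "{a<..}"]\<close>)
qed

lemma labY_deriv:
  assumes a: "0 < a" "a < pi / 2" and p: "0 < p" "p < pi / 2" "p \<noteq> a"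
  shows "((\<lambda>p. labY p a e) has_real_derivative labV2 p a e) (at p)"
proof (cases "p < a")
  case True
  have "((\<lambda>p. 1 - e * 1) has_real_derivative 0) (at p)" by simp
  then have "((\<lambda>p. labY p a e) has_real_derivative 0) (at p)"
    by (rule DERIV_cong_ev[THEN iffD1, OF refl _ refl, rotated])
      (use True in \<open>auto simp: labY_def labJ_def eventually_nhds intro!: exI[of _ "{..<a}"]\<close>)
  then show ?thesis using True by (simp add: labV2_def)
next
  case False
  then have ap: "a < p" using p by simp
  have s: "sin p > 0" and c: "cos (2 * a - p) > 0" using ap a p sin_p_pos cos_2a_p_pos by auto
  let ?d = "2 * sin p * cos (2 * a - p)"
  have "((\<lambda>p. 1 - e * (sin (2 * a) / (2 * sin p * cos (2 * a - p)))) has_real_derivative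
     e * sin (2 * a) * (2 * cos p * cos (2 * a - p) + 2 * sin p * sin (2 * a - p)) / ?d\<^sup>2) (at p)"
    using s c by (auto intro!: derivative_eq_intros simp: power2_eq_square field_simps)
  moreover have "e * sin (2 * a) * (2 * cos p * cos (2 * a - p) + 2 * sin p * sin (2 * a - p)) / ?d\<^sup>2 = labV2 p a e"
    using ap s c by (simp add: labV2_def labJ_def tan_def power2_eq_square field_simps)
  ultimately have "((\<lambda>p. 1 - e * (sin (2 * a) / (2 * sin p * cos (2 * a - p)))) has_real_derivative labV2 p a e) (at p)" by simp
  then show ?thesis
    by (rule DERIV_cong_ev[THEN iffD1, OF refl _ refl, rotated])
      (use ap in \<open>auto simp: labY_def labJ_def eventually_nhds intro!: exI[of _ "{a<..}"]\<close>)
qed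

text \<open>The formulas for rest and for motion agree at \<open>p = a\<close>.\<close>

lemma continuous_on_lab_path:
  assumes a: "0 < a" "a < pi / 2"
  shows "continuous_on {0..pi/2} (\<lambda>p. labX p a)" and "continuous_on {0..pi/2} (\<lambda>p. labY p a e)"
proof -
  have U: "{0..pi/2} = {0..a} \<union> {a..pi/2}" using a by auto
  have sa: "sin a > 0" and ca: "cos a > 0" using a by (auto intro!: sin_gt_zero cos_gt_zero_pi)
  show "continuous_on {0..pi/2} (\<lambda>p. labX p a)"
    unfolding labX_def U
    by (rule continuous_on_If) (auto intro!: continuous_intros simp: power2_eq_square)
  have ne: "sin p \<noteq> 0" "cos (2 * a - p) \<noteq> 0" if "p \<in> {a..pi/2}" for p
  proof -
    show "sin p \<noteq> 0" using that a sin_p_pos[of p] by auto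
    have "cos (2 * a - p) > 0" using that a by (intro cos_gt_zero_pi) auto
    then show "cos (2 * a - p) \<noteq> 0" by simp
  qed
  have "continuous_on {0..pi/2} (\<lambda>p. labJ p a)"
    unfolding labJ_def U
    by (rule continuous_on_If) (use ne sa ca in \<open>auto intro!: continuous_intros simp: sin_double\<close>)
  then show "continuous_on {0..pi/2} (\<lambda>p. labY p a e)" unfolding labY_def by (intro continuous_intros)
qed

section \<open>The clock\<close>

text \<open>An upper bound for the root mean square velocity per unit of angle when \<open>q\<close> is the ratio of vertical
to horizontal lengths. The first term comes from \<open>lab_energy1\<close>; the second one absorbs \<open>lab_energy2\<close>,
with \<open>1 - 2 * p / pi \<le> cos p\<close> replacing the cosine so that the antiderivative is elementary.\<close>

definition clock_rate :: "real \<Rightarrow> real \<Rightarrow> real" where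
  "clock_rate q p = sqrt (2/3) * (sin p)\<^sup>2 + 5 * q / sqrt (1 - 2 * p / pi)"

text \<open>The integral of \<open>clock_rate q\<close> over \<open>[0, pi/2]\<close>.\<close>

definition clock_total :: "real \<Rightarrow> real" where
  "clock_total q = sqrt (2/3) * pi / 4 + 5 * q * pi"

text \<open>The angle \<open>\<phi>\<close> is the inverse function of the normalised antiderivative \<open>\<Theta>\<close> of \<open>clock_rate q\<close>. It makes
speed times rate constant, and thus the energy bound the same at all times of a stage.\<close>

lemma clock_exists:
  assumes q: "q > 0"
  obtains \<phi> where "continuous_on UNIV \<phi>" "\<And>\<theta>. \<theta> \<le> 0 \<Longrightarrow> \<phi> \<theta> = 0" "\<And>\<theta>. 1 \<le> \<theta> \<Longrightarrow> \<phi> \<theta> = pi / 2"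
    "\<And>\<theta>. 0 \<le> \<phi> \<theta> \<and> \<phi> \<theta> \<le> pi / 2"
    "\<And>\<theta>. 0 < \<theta> \<Longrightarrow> \<theta> < 1 \<Longrightarrow> 0 < \<phi> \<theta> \<and> \<phi> \<theta> < pi / 2"
    "\<And>\<theta>. 0 < \<theta> \<Longrightarrow> \<theta> < 1 \<Longrightarrow> (\<phi> has_real_derivative clock_total q / clock_rate q (\<phi> \<theta>)) (at \<theta>)"
proof -
  define Z where "Z = clock_total q"
  have Z: "Z > 0" unfolding Z_def clock_total_def using q by (intro add_nonneg_pos) auto
  define \<Theta> where "\<Theta> p = (sqrt (2/3) * (p - sin p * cos p) / 2 + 5 * q * pi * (1 - sqrt (1 - 2 * p / pi))) / Z" for p
  have rate: "clock_rate q p > 0" if "0 \<le> p" "p < pi / 2" for p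
    unfolding clock_rate_def using that q by (intro add_nonneg_pos divide_pos_pos) (auto simp: field_simps)
  have \<Theta>0: "\<Theta> 0 = 0" by (simp add: \<Theta>_def)
  have \<Theta>1: "\<Theta> (pi / 2) = 1" using Z by (simp add: \<Theta>_def Z_def clock_total_def)
  have cont: "continuous_on {0..pi/2} \<Theta>" unfolding \<Theta>_def by (intro continuous_intros) (use Z in auto)
  have der: "(\<Theta> has_real_derivative clock_rate q p / Z) (at p)" if p: "p < pi / 2" for p
  proof -
    have r: "1 - 2 * p / pi > 0" using p by (simp add: field_simps)
    have t: "1 - (cos p * cos p - sin p * sin p) = 2 * (sin p)\<^sup>2" using sin_cos_squared_add[of p] by (simp add: power2_eq_square)
    have "(\<Theta> has_real_derivative (sqrt (2/3) * (1 - (cos p * cos p - sin p * sin p)) / 2 + 5 * q * pi * (2 / pi / (2 * sqrt (1 - 2 * p / pi)))) / Z) (at p)"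
      unfolding \<Theta>_def using r Z by (auto intro!: derivative_eq_intros simp: divide_simps)
    moreover have "sqrt (2/3) * (1 - (cos p * cos p - sin p * sin p)) / 2 + 5 * q * pi * (2 / pi / (2 * sqrt (1 - 2 * p / pi))) = clock_rate q p"
      unfolding t clock_rate_def by simp
    ultimately show ?thesis by simp
  qed
  have mono: "\<Theta> x < \<Theta> y" if "0 \<le> x" "x < y" "y \<le> pi / 2" for x y
  proof (rule DERIV_pos_imp_increasing_open[OF that(2)])
    show "\<exists>d. (\<Theta> has_real_derivative d) (at z) \<and> 0 < d" if "x < z" "z < y" for z
      using der[of z] rate[of z] Z that \<open>0 \<le> x\<close> \<open>y \<le> pi / 2\<close> by (intro exI[of _ "clock_rate q z / Z"]) auto
    show "continuous_on {x..y} \<Theta>" using that by (intro continuous_on_subset[OF cont]) auto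
  qed
  have inj: "inj_on \<Theta> {0..pi/2}"
    by (rule linorder_inj_onI) (use mono in \<open>fastforce+\<close>)
  have im: "\<Theta> ` {0..pi/2} = {0..1}"
  proof
    show "\<Theta> ` {0..pi/2} \<subseteq> {0..1}"
    proof (rule image_subsetI)
      fix x assume x: "x \<in> {0..pi/2}"
      have "\<Theta> 0 \<le> \<Theta> x" using mono[of 0 x] x by (cases "x = 0") auto
      moreover have "\<Theta> x \<le> \<Theta> (pi/2)"
      proof (cases "x = pi/2")
        case True
        show ?thesis unfolding True by (rule order_refl)
      next
        case False
        then show ?thesis using x by (intro less_imp_le[OF mono]) auto
      qed
      ultimately show "\<Theta> x \<in> {0..1}" using \<Theta>0 \<Theta>1 by simp
    qed
    show "{0..1} \<subseteq> \<Theta> ` {0..pi/2}"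
    proof
      fix y :: real assume "y \<in> {0..1}"
      then show "y \<in> \<Theta> ` {0..pi/2}" using IVT'[of \<Theta> 0 y "pi/2"] \<Theta>0 \<Theta>1 cont by auto
    qed
  qed
  define g where "g = the_inv_into {0..pi/2} \<Theta>"
  have g\<Theta>: "g (\<Theta> p) = p" if "p \<in> {0..pi/2}" for p
    unfolding g_def by (rule the_inv_into_f_f[OF inj that])
  have \<Theta>g: "\<Theta> (g \<theta>) = \<theta>" if "\<theta> \<in> {0..1}" for \<theta>
    unfolding g_def by (rule f_the_inv_into_f[OF inj]) (use that im in simp)
  have gin: "g \<theta> \<in> {0..pi/2}" if "\<theta> \<in> {0..1}" for \<theta>
    unfolding g_def by (rule the_inv_into_into[OF inj]) (use that im in auto)
  have gc: "continuous_on {0..1} g"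
    unfolding im[symmetric] by (rule continuous_on_inv[OF cont]) (use g\<Theta> in auto)
  define \<phi> where "\<phi> \<theta> = g (min 1 (max 0 \<theta>))" for \<theta>
  have c: "min 1 (max 0 \<theta>) \<in> {0..1}" for \<theta> :: real by auto
  have g0: "g 0 = 0" using g\<Theta>[of 0] \<Theta>0 by simp
  have g1: "g 1 = pi / 2" using g\<Theta>[of "pi/2"] \<Theta>1 by simp
  have \<phi>c: "continuous_on UNIV \<phi>"
    unfolding \<phi>_def by (rule continuous_on_compose2[OF gc]) (auto intro!: continuous_intros)
  have strict: "0 < \<phi> \<theta> \<and> \<phi> \<theta> < pi / 2" if "0 < \<theta>" "\<theta> < 1" for \<theta>
  proof -
    have e: "\<Theta> (g \<theta>) = \<theta>" using that by (intro \<Theta>g) auto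
    have "g \<theta> \<noteq> 0" "g \<theta> \<noteq> pi / 2" using e \<Theta>0 \<Theta>1 that by (metis less_irrefl)+
    moreover have "0 \<le> g \<theta>" "g \<theta> \<le> pi / 2" using gin[of \<theta>] that by auto
    moreover have "\<phi> \<theta> = g \<theta>" using that by (simp add: \<phi>_def)
    ultimately show ?thesis by linarith
  qed
  show ?thesis
  proof (rule that[OF \<phi>c])
    show "\<phi> \<theta> = 0" if "\<theta> \<le> 0" for \<theta> using that g0 by (simp add: \<phi>_def)
    show "\<phi> \<theta> = pi / 2" if "1 \<le> \<theta>" for \<theta> using that g1 by (simp add: \<phi>_def)
    show "0 \<le> \<phi> \<theta> \<and> \<phi> \<theta> \<le> pi / 2" for \<theta> using gin[OF c, of \<theta>] by (simp add: \<phi>_def)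
    show "0 < \<phi> \<theta> \<and> \<phi> \<theta> < pi / 2" if "0 < \<theta>" "\<theta> < 1" for \<theta> by (rule strict[OF that])
    show "(\<phi> has_real_derivative clock_total q / clock_rate q (\<phi> \<theta>)) (at \<theta>)" if t: "0 < \<theta>" "\<theta> < 1" for \<theta>
    proof -
      have "(\<phi> has_real_derivative inverse (clock_rate q (\<phi> \<theta>) / Z)) (at \<theta>)"
      proof (rule DERIV_inverse_function[where a = 0 and b = 1])
        show "(\<Theta> has_real_derivative clock_rate q (\<phi> \<theta>) / Z) (at (\<phi> \<theta>))" using strict[OF t] by (intro der) simp
        show "clock_rate q (\<phi> \<theta>) / Z \<noteq> 0" using rate[of "\<phi> \<theta>"] strict[OF t] Z by simp
        show "\<Theta> (\<phi> y) = y" if "0 < y" "y < 1" for y using \<Theta>g[of y] that by (simp add: \<phi>_def)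
        show "isCont \<phi> \<theta>" using \<phi>c by (simp add: continuous_on_eq_continuous_at)
      qed (use t in auto)
      then show ?thesis by (simp add: Z_def inverse_eq_divide)
    qed
  qed
qed

text \<open>Concavity of the cosine on \<open>[0, pi/2]\<close>.\<close>

lemma cos_ge_linear:
  assumes p: "0 \<le> p" "p \<le> pi / 2"
  shows "1 - 2 * p / pi \<le> cos p"
proof (rule ccontr)
  let ?f = "\<lambda>p. cos p - (1 - 2 * p / pi)" and ?f' = "\<lambda>p. - sin p + 2 / pi"
  assume "\<not> 1 - 2 * p / pi \<le> cos p"
  then have neg: "?f p < 0" by simp
  have d: "(?f has_real_derivative ?f' z) (at z)" for z by (auto intro!: derivative_eq_intros)
  have p0: "0 < p" using p neg by (cases "p = 0") auto
  have p1: "p < pi / 2" using p neg by (cases "p = pi / 2") auto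
  obtain z1 where z1: "0 < z1" "z1 < p" "?f p - ?f 0 = (p - 0) * ?f' z1"
    using MVT2[OF p0, of ?f ?f'] d by blast
  obtain z2 where z2: "p < z2" "z2 < pi / 2" "?f (pi / 2) - ?f p = (pi / 2 - p) * ?f' z2"
    using MVT2[OF p1, of ?f ?f'] d by blast
  have "(p - 0) * ?f' z1 < 0" using z1(3) neg by simp
  then have "?f' z1 < 0" using p0 by (simp add: mult_less_0_iff)
  moreover have "0 < (pi / 2 - p) * ?f' z2" using z2(3) neg by simp
  then have "0 < ?f' z2" using p1 by (simp add: zero_less_mult_iff)
  moreover have "sin z1 < sin z2" using z1 z2 by (intro sin_monotone_2pi) auto
  ultimately show False by linarith
qed

lemma measurable_lab_raw [measurable (raw)]:
  assumes [measurable]: "f \<in> borel_measurable M" "g \<in> borel_measurable M" "h \<in> borel_measurable M"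
  shows "(\<lambda>x. labX (f x) (g x)) \<in> borel_measurable M" "(\<lambda>x. labY (f x) (g x) (h x)) \<in> borel_measurable M"
  unfolding labX_def labY_def labJ_def by measurable

section \<open>Labels for the whole torus\<close>

definition lab_dom :: "(real \<times> real) set" where "lab_dom = {0<..<pi/2} \<times> {0<..<2}"

lemma lab_dom_borel [measurable]: "lab_dom \<in> sets borel"
  unfolding lab_dom_def by (intro borel_open open_Times) auto

text \<open>The labels in the open rectangle, so that statements about all points of the space need no
exceptional set.\<close>

definition labr :: "(real \<times> real) measure" where "labr = restrict_space lab lab_dom"

lemma sets_lab [measurable_cong]: "sets lab = sets (borel \<Otimes>\<^sub>M borel)"
  by (simp add: lab_def cong: sets_pair_measure_cong)

lemma space_labr [simp]: "space labr = lab_dom"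
  by (simp add: labr_def space_restrict_space lab_def space_pair_measure)

lemma measurable_labr_id: "(\<lambda>w. w) \<in> labr \<rightarrow>\<^sub>M borel \<Otimes>\<^sub>M borel"
  unfolding labr_def by (intro measurable_restrict_space1) (simp cong: measurable_cong_sets add: sets_lab)

lemma nn_integral_labr:
  "f \<in> borel_measurable (borel \<Otimes>\<^sub>M borel) \<Longrightarrow> (\<integral>\<^sup>+w. f w \<partial>labr) = (\<integral>\<^sup>+w. f w \<partial>lab)"
proof -
  assume f: "f \<in> borel_measurable (borel \<Otimes>\<^sub>M borel)"
  have dom: "lab_dom \<in> sets (borel \<Otimes>\<^sub>M borel)" unfolding borel_prod by (rule lab_dom_borel)
  have "AE w in lab. w \<in> lab_dom"
    unfolding lab_def lab_dom_def by (subst AE_density) (auto simp: split_beta' indicator_def intro!: AE_I2)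
  then have "(\<integral>\<^sup>+w. f w * indicator lab_dom w \<partial>lab) = (\<integral>\<^sup>+w. f w \<partial>lab)"
    by (intro nn_integral_cong_AE) (auto elim!: eventually_mono)
  then show ?thesis using dom unfolding labr_def by (subst nn_integral_restrict_space) (auto simp: sets_lab)
qed

lemma finite_measure_labr: "finite_measure labr"
proof
  have "emeasure labr (space labr) = (\<integral>\<^sup>+w. 1 \<partial>labr)" by simp
  also have "\<dots> = (\<integral>\<^sup>+w. ennreal (1 * 1) \<partial>lab)" by (subst nn_integral_labr) auto
  also have "\<dots> = (\<integral>\<^sup>+a. indicator {0<..<pi/2} a * ennreal (sin (2 * a) * 1) \<partial>lborel) * (\<integral>\<^sup>+e. indicator {0<..<2::real} e * ennreal 1 \<partial>lborel)"
    by (rule nn_integral_lab_prod) auto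
  also have "\<dots> \<le> (\<integral>\<^sup>+a. indicator {0<..<pi/2} a \<partial>lborel) * (\<integral>\<^sup>+e. indicator {0<..<2::real} e * ennreal 1 \<partial>lborel)"
  proof (intro mult_right_mono nn_integral_mono)
    fix a :: real
    have "ennreal (sin (2 * a) * 1) \<le> ennreal 1" by (intro ennreal_leI) simp
    then show "indicator {0<..<pi/2} a * ennreal (sin (2 * a) * 1) \<le> indicator {0<..<pi/2} a" by (auto simp: indicator_def)
  qed simp
  also have "\<dots> < \<infinity>" by (simp add: ennreal_mult_less_top)
  finally show "emeasure labr (space labr) \<noteq> \<infinity>" by simp
qed

text \<open>The point with reference coordinates \<open>(x, y)\<close> in the folding cell \<open>(i, i')\<close>; the coordinates other than
\<open>k\<close> and \<open>j\<close> are those of \<open>z\<close>.\<close>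

definition emb :: "'n::finite \<Rightarrow> 'n \<Rightarrow> real \<Rightarrow> real \<Rightarrow> nat \<Rightarrow> nat \<Rightarrow> real^'n \<Rightarrow> real \<Rightarrow> real \<Rightarrow> real^'n" where
  "emb k j l l' i i' z x y = upd j (l' * (2 * real i' + (-1)^i' * y)) (upd k (l * (2 * real i + (-1)^i * x)) z)"

lemma emb_measurable [measurable (raw)]:
  assumes [measurable]: "f \<in> borel_measurable M" "g \<in> borel_measurable M" "h \<in> borel_measurable M"
  shows "(\<lambda>t. emb k j l l' i i' (f t) (g t) (h t)) \<in> borel_measurable M"
  unfolding emb_def by measurable

lemma nn_integral_torus_fold:
  fixes F :: "real^'n \<Rightarrow> ennreal"
  assumes L: "L > 0" and P: "P > 0" and [measurable]: "F \<in> borel_measurable borel" and per: "torus_periodic L F"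
    and l: "l = L / (4 * real P)"
  shows "ennreal L * (\<integral>\<^sup>+x. F x \<partial>torus L) =
    (\<Sum>i<2 * P. ennreal l * (\<integral>\<^sup>+z. (\<integral>\<^sup>+x. indicator {-1..1} x * F (upd k (l * (2 * real i + (-1)^i * x)) z) \<partial>lborel) \<partial>torus L))"
proof -
  have "ennreal L * (\<integral>\<^sup>+x. F x \<partial>torus L) = (\<integral>\<^sup>+z. (\<integral>\<^sup>+a. indicator {- L / 2 .. L / 2} a * F (upd k a z) \<partial>lborel) \<partial>torus L)"
    by (rule nn_integral_torus_resample[OF L]) simp
  also have "\<dots> = (\<integral>\<^sup>+z. (\<Sum>i<2 * P. ennreal l * (\<integral>\<^sup>+x. indicator {-1..1} x * F (upd k (l * (2 * real i + (-1)^i * x)) z) \<partial>lborel)) \<partial>torus L)"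
  proof (intro nn_integral_cong)
    fix z :: "real^'n"
    have "\<And>a. F (upd k (a + L) z) = F (upd k a z)" by (rule torus_periodic_upd[OF per])
    then show "(\<integral>\<^sup>+a. indicator {- L / 2 .. L / 2} a * F (upd k a z) \<partial>lborel)
        = (\<Sum>i<2 * P. ennreal l * (\<integral>\<^sup>+x. indicator {-1..1} x * F (upd k (l * (2 * real i + (-1)^i * x)) z) \<partial>lborel))"
      by (intro nn_integral_fold[of L P "\<lambda>a. F (upd k a z)" l] L P l) measurable
  qed
  also have "\<dots> = (\<Sum>i<2 * P. (\<integral>\<^sup>+z. ennreal l * (\<integral>\<^sup>+x. indicator {-1..1} x * F (upd k (l * (2 * real i + (-1)^i * x)) z) \<partial>lborel) \<partial>torus L))"
    by (rule nn_integral_sum) (intro measurable_torusI, measurable)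
  also have "\<dots> = (\<Sum>i<2 * P. ennreal l * (\<integral>\<^sup>+z. (\<integral>\<^sup>+x. indicator {-1..1} x * F (upd k (l * (2 * real i + (-1)^i * x)) z) \<partial>lborel) \<partial>torus L))"
    by (intro sum.cong refl nn_integral_cmult) (intro measurable_torusI, measurable)
  finally show ?thesis .
qed

lemma AE_square_open:
  "AE z in lborel. indicator {-1..1} (fst z) * indicator {-1..1} (snd z :: real) = (indicator ({-1<..<1::real} \<times> {-1<..<1}) z :: ennreal)"
proof -
  have "AE x in lborel. AE y in lborel. indicator {-1..1} (x::real) * indicator {-1..1} (y::real) = (indicator ({-1<..<1} \<times> {-1<..<1}) (x, y) :: ennreal)"
  proof -
    have A: "AE x in lborel. x \<noteq> (1::real)" "AE x in lborel. x \<noteq> (-1::real)" by (rule AE_lborel_singleton)+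
    show ?thesis
      using A
    proof eventually_elim
      case (elim x)
      show ?case using A by eventually_elim (use elim in \<open>auto simp: indicator_def\<close>)
    qed
  qed
  then have "AE z in lborel \<Otimes>\<^sub>M lborel. indicator {-1..1} (fst z :: real) * indicator {-1..1} (snd z :: real) = (indicator ({-1<..<1} \<times> {-1<..<1}) z :: ennreal)"
  proof (intro lborel_pair.AE_pair_measure)
    have "(\<lambda>z. indicator {-1..1} (fst z :: real) * indicator {-1..1} (snd z :: real) :: ennreal) \<in> borel_measurable (lborel \<Otimes>\<^sub>M lborel)"
      by (intro borel_measurable_times_ennreal) measurable
    moreover have "(indicator ({-1<..<1::real} \<times> {-1<..<1::real}) :: _ \<Rightarrow> ennreal) \<in> borel_measurable (lborel \<Otimes>\<^sub>M lborel)"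
      by (intro borel_measurable_indicator pair_measureI) auto
    ultimately show "{z \<in> space (lborel \<Otimes>\<^sub>M lborel). indicator {-1..1} (fst z :: real) * indicator {-1..1} (snd z :: real)
        = (indicator ({-1<..<1} \<times> {-1<..<1}) z :: ennreal)} \<in> sets (lborel \<Otimes>\<^sub>M lborel)"
      by (rule borel_measurable_eq)
  qed (simp only: fst_conv snd_conv)
  then show ?thesis unfolding lborel_prod .
qed

text \<open>A point of the torus is described by its folding cell, its phase, a label, and a spectator point
\<open>z\<close> of which only the coordinates other than \<open>k\<close> and \<open>j\<close> matter. The two factors \<open>L\<close> account for the two
overwritten coordinates.\<close>

theorem nn_integral_torus_labels:
  fixes F :: "real^'n \<Rightarrow> ennreal"
  assumes L: "L > 0" and P: "P > 0" "P' > 0" and kj: "k \<noteq> j" and F [measurable]: "F \<in> borel_measurable borel"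
    and per: "torus_periodic L F" and l: "l = L / (4 * real P)" "l' = L / (4 * real P')"
    and p: "0 \<le> p" "p \<le> pi / 2"
  shows "ennreal L * (ennreal L * (\<integral>\<^sup>+x. F x \<partial>torus L)) =
    ennreal (l * l') * (\<Sum>(i, i', \<sigma>)\<in>{..<2 * P} \<times> {..<2 * P'} \<times> {1, -1}.
      \<integral>\<^sup>+z. \<integral>\<^sup>+w. F (emb k j l l' i i' z (\<sigma> * labX p (fst w)) (\<sigma> * labY p (fst w) (snd w))) \<partial>labr \<partial>torus L)"
proof -
  have l0: "l \<ge> 0" "l' \<ge> 0" using L l by simp_all
  define H where "H i' z = (\<integral>\<^sup>+y. indicator {-1..1} y * F (upd j (l' * (2 * real i' + (-1)^i' * y)) z) \<partial>lborel)" for i' z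
  have [measurable]: "H i' \<in> borel_measurable borel" for i' unfolding H_def by measurable
  have Hp: "torus_periodic L (H i')" for i'
    unfolding torus_periodic_def
  proof (intro allI)
    fix x :: "real^'n" and m
    have "upd j b (x + L *\<^sub>R axis m 1) = (if m = j then upd j b x else upd j b x + L *\<^sub>R axis m 1)" for b
      by (auto simp: vec_eq_iff axis_def)
    then show "H i' (x + L *\<^sub>R axis m 1) = H i' x" using per by (cases "m = j") (simp_all add: H_def torus_periodic_def)
  qed
  have inner: "(\<integral>\<^sup>+x. indicator {-1..1} x * H i' (upd k (l * (2 * real i + (-1)^i * x)) z) \<partial>lborel)
     = (\<Sum>\<sigma>\<in>{1, -1}. \<integral>\<^sup>+w. F (emb k j l l' i i' z (\<sigma> * labX p (fst w)) (\<sigma> * labY p (fst w) (snd w))) \<partial>labr)" for i i' z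
  proof -
    let ?h = "\<lambda>xy. F (emb k j l l' i i' z (fst xy) (snd xy))"
    have hm: "?h \<in> borel_measurable (borel \<Otimes>\<^sub>M borel)" by measurable
    have hm': "?h \<in> borel_measurable borel" using hm by (simp add: borel_prod)
    have "(\<integral>\<^sup>+x. indicator {-1..1} x * H i' (upd k (l * (2 * real i + (-1)^i * x)) z) \<partial>lborel)
       = (\<integral>\<^sup>+x. \<integral>\<^sup>+y. indicator {-1..1} x * (indicator {-1..1} y * ?h (x, y)) \<partial>lborel \<partial>lborel)"
      unfolding H_def by (intro nn_integral_cong, subst nn_integral_cmult) (simp_all add: emb_def)
    also have "\<dots> = (\<integral>\<^sup>+xy. (indicator {-1..1} (fst xy) * indicator {-1..1} (snd xy)) * ?h xy \<partial>(lborel \<Otimes>\<^sub>M lborel))"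
      by (subst lborel.nn_integral_fst[symmetric]) (auto simp: mult.assoc)
    also have "\<dots> = (\<integral>\<^sup>+xy. (indicator {-1..1} (fst xy) * indicator {-1..1} (snd xy)) * ?h xy \<partial>lborel)"
      unfolding lborel_prod ..
    also have "\<dots> = (\<integral>\<^sup>+xy. indicator ({-1<..<1} \<times> {-1<..<1}) xy * ?h xy \<partial>lborel)"
      by (rule nn_integral_cong_AE, use AE_square_open in eventually_elim) simp
    also have "\<dots> = (\<Sum>\<sigma>\<in>{1, -1}. \<integral>\<^sup>+w. ?h (\<sigma> * labX p (fst w), \<sigma> * labY p (fst w) (snd w)) \<partial>lab)"
      by (rule nn_integral_square[OF p hm'])
    also have "\<dots> = (\<Sum>\<sigma>\<in>{1, -1}. \<integral>\<^sup>+w. ?h (\<sigma> * labX p (fst w), \<sigma> * labY p (fst w) (snd w)) \<partial>labr)"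
      by (intro sum.cong refl nn_integral_labr[symmetric]) measurable
    finally show ?thesis by simp
  qed
  have m2: "(\<lambda>z. \<integral>\<^sup>+w. F (emb k j l l' i i' z (\<sigma> * labX p (fst w)) (\<sigma> * labY p (fst w) (snd w))) \<partial>labr) \<in> borel_measurable (torus L)" for i i' \<sigma>
  proof -
    interpret labr: finite_measure labr by (rule finite_measure_labr)
    have A: "(\<lambda>q. F (emb k j l l' i i' (fst q) (\<sigma> * labX p (fst (snd q))) (\<sigma> * labY p (fst (snd q)) (snd (snd q))))) \<in> borel_measurable (borel \<Otimes>\<^sub>M (borel \<Otimes>\<^sub>M borel))"
      by measurable
    have B: "(\<lambda>q. (fst q, snd q)) \<in> borel \<Otimes>\<^sub>M labr \<rightarrow>\<^sub>M borel \<Otimes>\<^sub>M (borel \<Otimes>\<^sub>M borel)"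
      by (intro measurable_Pair measurable_fst measurable_compose[OF measurable_snd measurable_labr_id])
    have "(\<lambda>(z, w). F (emb k j l l' i i' z (\<sigma> * labX p (fst w)) (\<sigma> * labY p (fst w) (snd w)))) \<in> borel_measurable (borel \<Otimes>\<^sub>M labr)"
      using measurable_compose[OF B A] by (simp only: split_beta' fst_conv snd_conv)
    from labr.borel_measurable_nn_integral[OF this]
    show ?thesis by (rule measurable_torusI)
  qed
  have "ennreal L * (\<integral>\<^sup>+x. F x \<partial>torus L) = (\<Sum>i'<2 * P'. ennreal l' * (\<integral>\<^sup>+z. H i' z \<partial>torus L))"
    unfolding H_def by (rule nn_integral_torus_fold[OF L P(2) F per l(2)])
  then have "ennreal L * (ennreal L * (\<integral>\<^sup>+x. F x \<partial>torus L)) = (\<Sum>i'<2 * P'. ennreal l' * (ennreal L * (\<integral>\<^sup>+z. H i' z \<partial>torus L)))"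
    by (simp add: sum_distrib_left mult.left_commute)
  also have "\<dots> = (\<Sum>i'<2 * P'. ennreal l' * (\<Sum>i<2 * P. ennreal l * (\<integral>\<^sup>+z. (\<integral>\<^sup>+x. indicator {-1..1} x * H i' (upd k (l * (2 * real i + (-1)^i * x)) z) \<partial>lborel) \<partial>torus L)))"
    by (intro sum.cong refl arg_cong2[where f = times] nn_integral_torus_fold[OF L P(1) _ Hp l(1)]) simp
  also have "\<dots> = (\<Sum>i'<2 * P'. ennreal l' * (\<Sum>i<2 * P. ennreal l * (\<Sum>\<sigma>\<in>{1, -1}. \<integral>\<^sup>+z. \<integral>\<^sup>+w. F (emb k j l l' i i' z (\<sigma> * labX p (fst w)) (\<sigma> * labY p (fst w) (snd w))) \<partial>labr \<partial>torus L)))"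
    unfolding inner by (intro sum.cong refl arg_cong2[where f = times] nn_integral_sum m2)
  also have "\<dots> = ennreal (l * l') * (\<Sum>i'<2 * P'. \<Sum>i<2 * P. \<Sum>\<sigma>\<in>{1, -1}. \<integral>\<^sup>+z. \<integral>\<^sup>+w. F (emb k j l l' i i' z (\<sigma> * labX p (fst w)) (\<sigma> * labY p (fst w) (snd w))) \<partial>labr \<partial>torus L)"
    using l0 by (simp add: sum_distrib_left ennreal_mult mult_ac)
  also have "(\<Sum>i'<2 * P'. \<Sum>i<2 * P. \<Sum>\<sigma>\<in>{1, -1}. \<integral>\<^sup>+z. \<integral>\<^sup>+w. F (emb k j l l' i i' z (\<sigma> * labX p (fst w)) (\<sigma> * labY p (fst w) (snd w))) \<partial>labr \<partial>torus L)
     = (\<Sum>(i, i', \<sigma>)\<in>{..<2 * P} \<times> {..<2 * P'} \<times> {1, -1}. \<integral>\<^sup>+z. \<integral>\<^sup>+w. F (emb k j l l' i i' z (\<sigma> * labX p (fst w)) (\<sigma> * labY p (fst w) (snd w))) \<partial>labr \<partial>torus L)"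
    by (subst sum.swap) (simp only: sum.cartesian_product[symmetric] case_prod_conv)
  finally show ?thesis .
qed

section \<open>One stage of the refinement\<close>

text \<open>Time runs over \<open>[0, 1]\<close>; the angle is constant before and after.\<close>

definition is_clock :: "real \<Rightarrow> (real \<Rightarrow> real) \<Rightarrow> bool" where
  "is_clock q \<phi> \<longleftrightarrow> continuous_on UNIV \<phi> \<and> (\<forall>\<theta>\<le>0. \<phi> \<theta> = 0) \<and> (\<forall>\<theta>\<ge>1. \<phi> \<theta> = pi / 2) \<and>
    (\<forall>\<theta>. 0 \<le> \<phi> \<theta> \<and> \<phi> \<theta> \<le> pi / 2) \<and>
    (\<forall>\<theta>. 0 < \<theta> \<longrightarrow> \<theta> < 1 \<longrightarrow> 0 < \<phi> \<theta> \<and> \<phi> \<theta> < pi / 2 \<and>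
      (\<phi> has_real_derivative clock_total q / clock_rate q (\<phi> \<theta>)) (at \<theta>))"

lemma clock_rate_pos: "q > 0 \<Longrightarrow> 0 \<le> p \<Longrightarrow> p < pi / 2 \<Longrightarrow> clock_rate q p > 0"
  unfolding clock_rate_def by (intro add_nonneg_pos divide_pos_pos) (auto simp: field_simps)

lemma clock_total_pos: "q > 0 \<Longrightarrow> clock_total q > 0"
  unfolding clock_total_def by (intro add_nonneg_pos) auto

lemma clock_strict_mono:
  assumes c: "is_clock q \<phi>" and q: "q > 0" and t: "0 < x" "x < y" "y < 1"
  shows "\<phi> x < \<phi> y"
proof (rule DERIV_pos_imp_increasing[OF t(2)])
  fix z assume z: "x \<le> z" "z \<le> y"
  then have "0 < \<phi> z \<and> \<phi> z < pi / 2 \<and> (\<phi> has_real_derivative clock_total q / clock_rate q (\<phi> z)) (at z)"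
    using c t unfolding is_clock_def by auto
  then show "\<exists>d. (\<phi> has_real_derivative d) (at z) \<and> 0 < d"
    using clock_rate_pos[of q "\<phi> z"] clock_total_pos[of q] q
    by (intro exI[of _ "clock_total q / clock_rate q (\<phi> z)"]) auto
qed

definition stage_angle :: "(real \<Rightarrow> real) \<Rightarrow> real \<Rightarrow> real \<Rightarrow> real \<Rightarrow> real" where
  "stage_angle \<phi> ta tb t = \<phi> ((t - ta) / (tb - ta))"

definition stage_speed :: "real \<Rightarrow> (real \<Rightarrow> real) \<Rightarrow> real \<Rightarrow> real \<Rightarrow> real \<Rightarrow> real" where
  "stage_speed q \<phi> ta tb t = (if ta < t \<and> t < tb then clock_total q / clock_rate q (stage_angle \<phi> ta tb t) / (tb - ta) else 0)"

text \<open>With the minus sign the density is \<open>1\<close> where the first folded coordinate is negative, in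
agreement with the initial data.\<close>

definition stage_rho :: "'n::finite \<Rightarrow> 'n \<Rightarrow> real \<Rightarrow> real \<Rightarrow> (real \<Rightarrow> real) \<Rightarrow> real \<Rightarrow> real \<Rightarrow> real \<Rightarrow> real^'n \<Rightarrow> real" where
  "stage_rho k j l l' \<phi> ta tb t x = - sgn (phase (stage_angle \<phi> ta tb t) (zig (x $ k / l)) (zig (x $ j / l')))"

text \<open>By the chain rule the reference velocity is multiplied by the slope of the folding and by the size of
the cell in each coordinate.\<close>

definition stage_vel :: "real \<Rightarrow> 'n::finite \<Rightarrow> 'n \<Rightarrow> real \<Rightarrow> real \<Rightarrow> (real \<Rightarrow> real) \<Rightarrow> real \<Rightarrow> real \<Rightarrow> real \<Rightarrow> real^'n \<Rightarrow> real^'n" where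
  "stage_vel q k j l l' \<phi> ta tb t x = stage_speed q \<phi> ta tb t *\<^sub>R
     ((l * zag (x $ k / l) * vel1 (stage_angle \<phi> ta tb t) (zig (x $ k / l)) (zig (x $ j / l'))) *\<^sub>R axis k 1
    + (l' * zag (x $ j / l') * vel2 (stage_angle \<phi> ta tb t) (zig (x $ k / l)) (zig (x $ j / l'))) *\<^sub>R axis j 1)"

lemma emb_eq: "k \<noteq> j \<Longrightarrow> emb k j l l' i i' z x y =
   z + (l * (2 * real i + (-1)^i * x) - z $ k) *\<^sub>R axis k 1 + (l' * (2 * real i' + (-1)^i' * y) - z $ j) *\<^sub>R axis j 1"
  by (auto simp: emb_def vec_eq_iff axis_def)

lemma emb_nth:
  assumes "k \<noteq> j" "l \<noteq> 0" "l' \<noteq> 0"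
  shows "emb k j l l' i i' z x y $ k / l = 2 * real i + (-1)^i * x"
    and "emb k j l l' i i' z x y $ j / l' = 2 * real i' + (-1)^i' * y"
  using assms by (auto simp: emb_def)

lemma zig_periodic_cell: "l = L / (4 * real P) \<Longrightarrow> L > 0 \<Longrightarrow> P > 0 \<Longrightarrow> zig ((a + L) / l) = zig (a / l)"
  and zag_periodic_cell: "l = L / (4 * real P) \<Longrightarrow> L > 0 \<Longrightarrow> P > 0 \<Longrightarrow> zag ((a + L) / l) = zag (a / l)"
proof -
  assume h: "l = L / (4 * real P)" "L > 0" "P > 0"
  have e: "(a + L) / l = a / l + 2 * real (2 * P)"
  proof -
    have "L / l = 4 * real P" using h by simp
    then show ?thesis by (simp add: add_divide_distrib)
  qed
  show "zig ((a + L) / l) = zig (a / l)" "zag ((a + L) / l) = zag (a / l)"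
    unfolding e zig_shift_even zag_shift_even by simp_all
qed

text \<open>Stripes orthogonal to axis \<open>k\<close> of width \<open>2 * l\<close> become stripes orthogonal to axis \<open>j\<close> of width
\<open>2 * l'\<close> during the time interval from \<open>ta\<close> to \<open>tb\<close>.\<close>

locale stage =
  fixes L q :: real and k j :: "'n::finite" and P P' :: nat and l l' :: real and \<phi> :: "real \<Rightarrow> real" and ta tb :: real
  assumes L: "L > 0" and kj: "k \<noteq> j" and P: "P > 0" "P' > 0" and q: "q > 0"
    and l: "l = L / (4 * real P)" and l': "l' = L / (4 * real P')" and lq: "l' = q * l"
    and clock: "is_clock q \<phi>" and tab: "ta < tb"
begin

abbreviation "ang \<equiv> stage_angle \<phi> ta tb"
abbreviation "rho \<equiv> stage_rho k j l l' \<phi> ta tb"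
abbreviation "vel \<equiv> stage_vel q k j l l' \<phi> ta tb"
abbreviation "spd \<equiv> stage_speed q \<phi> ta tb"

lemma l_pos: "l > 0" "l' > 0" using L P l l' by simp_all

lemma ang_bounds: "0 \<le> ang t" "ang t \<le> pi / 2"
  using clock by (simp_all add: is_clock_def stage_angle_def)

lemma ang_cont: "continuous_on S ang"
proof -
  have "continuous_on UNIV \<phi>" using clock by (simp add: is_clock_def)
  then show ?thesis unfolding stage_angle_def
    by (rule continuous_on_compose2) (use tab in \<open>auto intro!: continuous_intros\<close>)
qed

lemma ang_before: "t \<le> ta \<Longrightarrow> ang t = 0"
  using clock tab by (simp add: is_clock_def stage_angle_def divide_nonpos_pos)

lemma ang_after: "tb \<le> t \<Longrightarrow> ang t = pi / 2"
  using clock tab by (simp add: is_clock_def stage_angle_def)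

lemma ang_inside:
  assumes "ta < t" "t < tb"
  shows "0 < ang t" "ang t < pi / 2" "(ang has_real_derivative spd t) (at t)"
proof -
  let ?\<theta> = "(t - ta) / (tb - ta)"
  have th: "0 < ?\<theta>" "?\<theta> < 1" using assms by auto
  then have c: "0 < \<phi> ?\<theta>" "\<phi> ?\<theta> < pi / 2" "(\<phi> has_real_derivative clock_total q / clock_rate q (\<phi> ?\<theta>)) (at ?\<theta>)"
    using clock unfolding is_clock_def by blast+
  show "0 < ang t" "ang t < pi / 2" using c by (simp_all add: stage_angle_def)
  have "((\<lambda>t. (t - ta) / (tb - ta)) has_real_derivative 1 / (tb - ta)) (at t)"
    using tab by (auto intro!: derivative_eq_intros)
  from DERIV_chain2[OF c(3) this] show "(ang has_real_derivative spd t) (at t)"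
    using assms by (simp add: stage_angle_def[abs_def] stage_speed_def)
qed

lemma ang_inj:
  assumes "ta < t" "t < tb" "ta < u" "u < tb" "ang t = ang u" shows "t = u"
proof -
  have "(t - ta) / (tb - ta) = (u - ta) / (tb - ta)"
  proof (rule ccontr)
    assume "(t - ta) / (tb - ta) \<noteq> (u - ta) / (tb - ta)"
    moreover have "0 < (t - ta) / (tb - ta)" "(t - ta) / (tb - ta) < 1" "0 < (u - ta) / (tb - ta)" "(u - ta) / (tb - ta) < 1"
      using assms by auto
    ultimately have "ang t \<noteq> ang u"
      using clock_strict_mono[OF clock q, of "(t - ta) / (tb - ta)" "(u - ta) / (tb - ta)"]
        clock_strict_mono[OF clock q, of "(u - ta) / (tb - ta)" "(t - ta) / (tb - ta)"]
      unfolding stage_angle_def by linarith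
    then show False using assms by simp
  qed
  then show ?thesis using tab by simp
qed

lemma ang_measurable [measurable]: "ang \<in> borel_measurable borel"
  by (rule borel_measurable_continuous_onI[OF ang_cont])

lemma spd_measurable [measurable]: "spd \<in> borel_measurable borel"
  unfolding stage_speed_def[abs_def] clock_rate_def by measurable

lemma rho_measurable [measurable]: "(\<lambda>p. rho (fst p) (snd p)) \<in> borel_measurable (borel \<Otimes>\<^sub>M borel)"
  unfolding stage_rho_def by measurable

lemma vel_measurable' [measurable]: "(\<lambda>p. vel (fst p) (snd p)) \<in> borel_measurable (borel \<Otimes>\<^sub>M borel)"
  unfolding stage_vel_def by measurable

lemma rho_le_1: "\<bar>rho t x\<bar> \<le> 1"
  by (simp add: stage_rho_def abs_sgn_eq)

lemma periodic_comp: "zig ((x + L *\<^sub>R axis i 1) $ k / l) = zig (x $ k / l)" "zag ((x + L *\<^sub>R axis i 1) $ k / l) = zag (x $ k / l)"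
  "zig ((x + L *\<^sub>R axis i 1) $ j / l') = zig (x $ j / l')" "zag ((x + L *\<^sub>R axis i 1) $ j / l') = zag (x $ j / l')"
  using zig_periodic_cell[OF l L P(1)] zag_periodic_cell[OF l L P(1)] zig_periodic_cell[OF l' L P(2)] zag_periodic_cell[OF l' L P(2)]
  by (simp_all add: axis_def)

lemma rho_periodic: "torus_periodic L (rho t)"
  unfolding torus_periodic_def stage_rho_def by (simp only: periodic_comp) simp

lemma vel_periodic: "torus_periodic L (vel t)"
  unfolding torus_periodic_def stage_vel_def by (simp only: periodic_comp) simp

definition I where "I = {..<2 * P} \<times> {..<2 * P'} \<times> {1, -1::real}"
definition M :: "((nat \<times> nat \<times> real) \<times> (real^'n) \<times> (real \<times> real)) measure" where
  "M = count_space I \<Otimes>\<^sub>M (torus L \<Otimes>\<^sub>M labr)"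
definition flow :: "real \<Rightarrow> (nat \<times> nat \<times> real) \<times> (real^'n) \<times> (real \<times> real) \<Rightarrow> real^'n" where
  "flow p m = emb k j l l' (fst (fst m)) (fst (snd (fst m))) (fst (snd m))
     (snd (snd (fst m)) * labX p (fst (snd (snd m)))) (snd (snd (fst m)) * labY p (fst (snd (snd m))) (snd (snd (snd m))))"

lemma finite_I: "finite I" by (simp add: I_def)

lemma M_finite: "finite_measure M"
proof -
  have c: "finite_measure (count_space I)" by (rule finite_measure_count_space[OF finite_I])
  show ?thesis unfolding M_def
    by (intro finite_measure_pair_measure c finite_measure_torus finite_measure_labr)
qed

lemma space_M: "space M = I \<times> torus_cell L \<times> lab_dom"
  by (simp add: M_def space_pair_measure)

lemma M_projections:
  "(\<lambda>m. f (fst m)) \<in> borel_measurable M" "(\<lambda>m. fst (snd m)) \<in> M \<rightarrow>\<^sub>M borel"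
  "(\<lambda>m. fst (snd (snd m))) \<in> M \<rightarrow>\<^sub>M borel" "(\<lambda>m. snd (snd (snd m))) \<in> M \<rightarrow>\<^sub>M borel"
  for f :: "nat \<times> nat \<times> real \<Rightarrow> real"
proof -
  have 1: "fst \<in> M \<rightarrow>\<^sub>M count_space I" unfolding M_def by (rule measurable_fst)
  show "(\<lambda>m. f (fst m)) \<in> borel_measurable M"
    by (rule measurable_compose[OF 1]) (simp add: measurable_count_space_eq1)
  have 2: "(\<lambda>m. fst (snd m)) \<in> M \<rightarrow>\<^sub>M torus L" unfolding M_def by measurable
  show "(\<lambda>m. fst (snd m)) \<in> M \<rightarrow>\<^sub>M borel" by (rule measurable_compose[OF 2 measurable_torus_id])
  have 3: "(\<lambda>m. snd (snd m)) \<in> M \<rightarrow>\<^sub>M labr" unfolding M_def by measurable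
  have 4: "(\<lambda>m. snd (snd m)) \<in> M \<rightarrow>\<^sub>M borel \<Otimes>\<^sub>M borel" by (rule measurable_compose[OF 3 measurable_labr_id])
  show "(\<lambda>m. fst (snd (snd m))) \<in> M \<rightarrow>\<^sub>M borel" by (rule measurable_compose[OF 4 measurable_fst])
  show "(\<lambda>m. snd (snd (snd m))) \<in> M \<rightarrow>\<^sub>M borel" by (rule measurable_compose[OF 4 measurable_snd])
qed

lemma flow_measurable: "(\<lambda>m. flow (ang (fst m)) (snd m)) \<in> borel_measurable (borel \<Otimes>\<^sub>M M)"
proof -
  note [measurable] = M_projections(2,3,4) M_projections(1)[of "\<lambda>x. snd (snd x)"] M_projections(1)[of "\<lambda>x. real (fst x)"]
    M_projections(1)[of "\<lambda>x. real (fst (snd x))"] M_projections(1)[of "\<lambda>x. (-1)^(fst x)"] M_projections(1)[of "\<lambda>x. (-1)^(fst (snd x))"]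
  show ?thesis unfolding flow_def emb_def by measurable
qed

lemma nn_integral_M:
  assumes Gm: "G \<in> borel_measurable M"
  shows "(\<integral>\<^sup>+m. G m \<partial>M) = (\<Sum>\<iota>\<in>I. \<integral>\<^sup>+z. \<integral>\<^sup>+w. G (\<iota>, z, w) \<partial>labr \<partial>torus L)"
proof -
  interpret labr: finite_measure labr by (rule finite_measure_labr)
  interpret T: finite_measure "torus L :: (real^'n) measure" by (rule finite_measure_torus)
  interpret TL: finite_measure "(torus L :: (real^'n) measure) \<Otimes>\<^sub>M labr" by (intro finite_measure_pair_measure finite_measure_torus finite_measure_labr)
  have "(\<integral>\<^sup>+m. G m \<partial>M) = (\<integral>\<^sup>+\<iota>. \<integral>\<^sup>+y. G (\<iota>, y) \<partial>(torus L \<Otimes>\<^sub>M labr) \<partial>count_space I)"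
    using Gm unfolding M_def by (subst TL.nn_integral_fst) auto
  also have "\<dots> = (\<Sum>\<iota>\<in>I. \<integral>\<^sup>+y. G (\<iota>, y) \<partial>(torus L \<Otimes>\<^sub>M labr))" by (rule nn_integral_count_space_finite[OF finite_I])
  also have "\<dots> = (\<Sum>\<iota>\<in>I. \<integral>\<^sup>+z. \<integral>\<^sup>+w. G (\<iota>, z, w) \<partial>labr \<partial>torus L)"
  proof (intro sum.cong refl)
    fix \<iota> assume "\<iota> \<in> I"
    then have "(\<lambda>y. (\<iota>, y)) \<in> (torus L \<Otimes>\<^sub>M labr) \<rightarrow>\<^sub>M M" unfolding M_def by (intro measurable_Pair1') simp
    then have "(\<lambda>y. G (\<iota>, y)) \<in> borel_measurable (torus L \<Otimes>\<^sub>M labr)" using Gm by (rule measurable_compose)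
    then show "(\<integral>\<^sup>+y. G (\<iota>, y) \<partial>(torus L \<Otimes>\<^sub>M labr)) = (\<integral>\<^sup>+z. \<integral>\<^sup>+w. G (\<iota>, z, w) \<partial>labr \<partial>torus L)"
      by (subst labr.nn_integral_fst) auto
  qed
  finally show ?thesis .
qed

text \<open>Incompressibility of the stage: the label space is carried to Lebesgue measure at every time.\<close>

lemma push:
  fixes F :: "real^'n \<Rightarrow> ennreal"
  assumes F: "F \<in> borel_measurable borel" and per: "torus_periodic L F"
  shows "(\<integral>\<^sup>+x. F x \<partial>torus L) = ennreal (l * l' / L\<^sup>2) * (\<integral>\<^sup>+m. F (flow (ang t) m) \<partial>M)"
proof -
  have "(\<lambda>m. flow (ang t) m) \<in> borel_measurable M"
    using measurable_compose[OF measurable_Pair[OF measurable_const[of t borel M] measurable_ident] flow_measurable] by (simp add: id_def)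
  then have Fm: "(\<lambda>m. F (flow (ang t) m)) \<in> borel_measurable M" using F by (rule measurable_compose)
  have "ennreal L * (ennreal L * (\<integral>\<^sup>+x. F x \<partial>torus L)) =
    ennreal (l * l') * (\<Sum>(i, i', \<sigma>)\<in>I. \<integral>\<^sup>+z. \<integral>\<^sup>+w. F (emb k j l l' i i' z (\<sigma> * labX (ang t) (fst w)) (\<sigma> * labY (ang t) (fst w) (snd w))) \<partial>labr \<partial>torus L)"
    unfolding I_def by (rule nn_integral_torus_labels[OF L P kj F per l l' ang_bounds])
  also have "(\<Sum>(i, i', \<sigma>)\<in>I. \<integral>\<^sup>+z. \<integral>\<^sup>+w. F (emb k j l l' i i' z (\<sigma> * labX (ang t) (fst w)) (\<sigma> * labY (ang t) (fst w) (snd w))) \<partial>labr \<partial>torus L)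
      = (\<integral>\<^sup>+m. F (flow (ang t) m) \<partial>M)"
    unfolding nn_integral_M[OF Fm] by (simp add: flow_def split_beta')
  finally have e: "ennreal (L * L) * (\<integral>\<^sup>+x. F x \<partial>torus L) = ennreal (l * l') * (\<integral>\<^sup>+m. F (flow (ang t) m) \<partial>M)"
    using L by (simp add: ennreal_mult mult.assoc)
  have "(\<integral>\<^sup>+x. F x \<partial>torus L) = ennreal (1 / (L * L)) * (ennreal (L * L) * (\<integral>\<^sup>+x. F x \<partial>torus L))"
    unfolding mult.assoc[symmetric] using L by (subst ennreal_mult[symmetric]) auto
  also have "\<dots> = ennreal (l * l' / L\<^sup>2) * (\<integral>\<^sup>+m. F (flow (ang t) m) \<partial>M)"
    unfolding e mult.assoc[symmetric] using L l_pos by (subst ennreal_mult[symmetric]) (auto simp: power2_eq_square)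
  finally show ?thesis .
qed

lemma flow_coords:
  assumes m: "m \<in> space M"
  shows "zig (flow (ang t) m $ k / l) = snd (snd (fst m)) * labX (ang t) (fst (snd (snd m)))"
    "zig (flow (ang t) m $ j / l') = snd (snd (fst m)) * labY (ang t) (fst (snd (snd m))) (snd (snd (snd m)))"
    "zag (flow (ang t) m $ k / l) = (-1) ^ fst (fst m)" "zag (flow (ang t) m $ j / l') = (-1) ^ fst (snd (fst m))"
    "snd (snd (fst m)) \<in> {1, -1}" "0 < fst (snd (snd m))" "fst (snd (snd m)) < pi / 2" "0 < snd (snd (snd m))" "snd (snd (snd m)) < 2"
proof -
  show s: "snd (snd (fst m)) \<in> {1, -1}" and a: "0 < fst (snd (snd m))" "fst (snd (snd m)) < pi / 2"
    and e: "0 < snd (snd (snd m))" "snd (snd (snd m)) < 2"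
    using m by (auto simp: space_M I_def lab_dom_def)
  have X: "\<bar>snd (snd (fst m)) * labX (ang t) (fst (snd (snd m)))\<bar> < 1"
    using labX_bounds(1)[OF a ang_bounds] s by auto
  have Y: "\<bar>snd (snd (fst m)) * labY (ang t) (fst (snd (snd m))) (snd (snd (snd m)))\<bar> < 1"
    using labY_bounds[OF a ang_bounds e] s by auto
  have n: "l \<noteq> 0" "l' \<noteq> 0" using l_pos by auto
  show "zig (flow (ang t) m $ k / l) = snd (snd (fst m)) * labX (ang t) (fst (snd (snd m)))"
    "zig (flow (ang t) m $ j / l') = snd (snd (fst m)) * labY (ang t) (fst (snd (snd m))) (snd (snd (snd m)))"
    "zag (flow (ang t) m $ k / l) = (-1) ^ fst (fst m)" "zag (flow (ang t) m $ j / l') = (-1) ^ fst (snd (fst m))"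
    unfolding flow_def emb_nth[OF kj n] by (intro zig_fold zag_fold less_imp_le X Y)+
qed

lemma rho_flow: "m \<in> space M \<Longrightarrow> rho t (flow (ang t) m) = - snd (snd (fst m))"
  unfolding stage_rho_def flow_coords
  using vel_label(3)[OF flow_coords(6,7)[of m] ang_bounds flow_coords(8,9,5)[of m]] by simp

lemma vel_flow:
  assumes m: "m \<in> space M"
  shows "vel t (flow (ang t) m) = spd t *\<^sub>R
    ((l * (-1) ^ fst (fst m) * (snd (snd (fst m)) * labV1 (ang t) (fst (snd (snd m))))) *\<^sub>R axis k 1
   + (l' * (-1) ^ fst (snd (fst m)) * (snd (snd (fst m)) * labV2 (ang t) (fst (snd (snd m))) (snd (snd (snd m))))) *\<^sub>R axis j 1)"
  unfolding stage_vel_def flow_coords[OF m]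
    vel_label[OF flow_coords(6,7)[OF m] ang_bounds flow_coords(8,9,5)[OF m]] ..

lemma flow_eq: "flow p m = fst (snd m) +
    (l * (2 * real (fst (fst m)) + (-1) ^ fst (fst m) * (snd (snd (fst m)) * labX p (fst (snd (snd m))))) - fst (snd m) $ k) *\<^sub>R axis k 1 +
    (l' * (2 * real (fst (snd (fst m))) + (-1) ^ fst (snd (fst m)) * (snd (snd (fst m)) * labY p (fst (snd (snd m))) (snd (snd (snd m))))) - fst (snd m) $ j) *\<^sub>R axis j 1"
  unfolding flow_def by (rule emb_eq[OF kj])

lemma flow_cont:
  assumes m: "m \<in> space M" shows "continuous_on S (\<lambda>t. flow (ang t) m)"
proof -
  have sub: "ang ` S \<subseteq> {0..pi/2}" using ang_bounds by auto
  note c = continuous_on_lab_path[OF flow_coords(6,7)[OF m]]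
  have "continuous_on S (\<lambda>t. labX (ang t) (fst (snd (snd m))))"
    "continuous_on S (\<lambda>t. labY (ang t) (fst (snd (snd m))) (snd (snd (snd m))))"
    by (rule continuous_on_compose2[OF c(1) ang_cont sub], rule continuous_on_compose2[OF c(2) ang_cont sub])
  then show ?thesis unfolding flow_eq by (intro continuous_intros)
qed

text \<open>A path fails to be differentiable at most at the beginning of the stage and at the time when the
finger reaches the particle, which is unique because the clock is strictly increasing.\<close>

lemma flow_deriv:
  assumes m: "m \<in> space M"
  shows "\<exists>S. finite S \<and> (\<forall>t\<in>{..<tb} - S. ((\<lambda>t. flow (ang t) m) has_vector_derivative vel t (flow (ang t) m)) (at t))"
proof -
  let ?a = "fst (snd (snd m))" and ?e = "snd (snd (snd m))" and ?s = "snd (snd (fst m))"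
  note a = flow_coords(6,7)[OF m]
  \<comment> \<open>The second set has at most one element by \<open>ang_inj\<close>.\<close>
  let ?S = "{ta} \<union> {t. ta < t \<and> t < tb \<and> ang t = ?a}"
  have "finite {t. ta < t \<and> t < tb \<and> ang t = ?a}"
  proof (cases "{t. ta < t \<and> t < tb \<and> ang t = ?a} = {}")
    case False
    then obtain u where "ta < u" "u < tb" "ang u = ?a" by auto
    then have "{t. ta < t \<and> t < tb \<and> ang t = ?a} \<subseteq> {u}" using ang_inj by auto
    then show ?thesis by (rule finite_subset) simp
  next
    case True
    show ?thesis unfolding True by (rule finite.emptyI)
  qed
  moreover have "((\<lambda>t. flow (ang t) m) has_vector_derivative vel t (flow (ang t) m)) (at t)" if t: "t \<in> {..<tb} - ?S" for t
  proof (cases "t < ta")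
    case True
    have "((\<lambda>t. flow 0 m) has_vector_derivative 0) (at t)" by (rule has_vector_derivative_const)
    then have "((\<lambda>t. flow (ang t) m) has_vector_derivative 0) (at t)"
      by (rule has_vector_derivative_transform_within_open[of _ _ _ "{..<ta}"]) (use True ang_before in auto)
    moreover have "spd t = 0" using True by (simp add: stage_speed_def)
    ultimately show ?thesis by (simp add: stage_vel_def)
  next
    case False
    then have t': "ta < t" "t < tb" "ang t \<noteq> ?a" using t by auto
    note an = ang_inside[OF t'(1,2)]
    have X: "((\<lambda>t. labX (ang t) ?a) has_real_derivative labV1 (ang t) ?a * spd t) (at t)"
      by (rule DERIV_chain2[OF labX_deriv[OF a an(1,2) t'(3)] an(3)])
    have Y: "((\<lambda>t. labY (ang t) ?a ?e) has_real_derivative labV2 (ang t) ?a ?e * spd t) (at t)"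
      by (rule DERIV_chain2[OF labY_deriv[OF a an(1,2) t'(3)] an(3)])
    have 1: "((\<lambda>t. l * (2 * real (fst (fst m)) + (-1) ^ fst (fst m) * (?s * labX (ang t) ?a)) - fst (snd m) $ k)
       has_real_derivative l * ((-1) ^ fst (fst m) * (?s * (labV1 (ang t) ?a * spd t)))) (at t)"
      using X by (auto intro!: derivative_eq_intros)
    have 2: "((\<lambda>t. l' * (2 * real (fst (snd (fst m))) + (-1) ^ fst (snd (fst m)) * (?s * labY (ang t) ?a ?e)) - fst (snd m) $ j)
       has_real_derivative l' * ((-1) ^ fst (snd (fst m)) * (?s * (labV2 (ang t) ?a ?e * spd t)))) (at t)"
      using Y by (auto intro!: derivative_eq_intros)
    have sc: "((\<lambda>t. f t *\<^sub>R axis i (1::real)) has_vector_derivative f' *\<^sub>R axis i 1) (at t)"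
      if "(f has_real_derivative f') (at t)" for f f' and i :: 'n
      using that has_vector_derivative_scaleR[OF that has_vector_derivative_const[of "axis i 1"]] by simp
    have "((\<lambda>t. flow (ang t) m) has_vector_derivative (0 + (l * ((-1) ^ fst (fst m) * (?s * (labV1 (ang t) ?a * spd t)))) *\<^sub>R axis k 1)
        + (l' * ((-1) ^ fst (snd (fst m)) * (?s * (labV2 (ang t) ?a ?e * spd t)))) *\<^sub>R axis j 1) (at t)"
      unfolding flow_eq by (intro has_vector_derivative_add has_vector_derivative_const sc 1 2)
    then show ?thesis unfolding vel_flow[OF m] by (simp add: scaleR_add_right mult_ac)
  qed
  ultimately show ?thesis by (intro exI[of _ ?S]) auto
qed

text \<open>The velocity at a labelled point has orthogonal components of squares \<open>(spd * l * labV1)\<^sup>2\<close> and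
\<open>(spd * l' * labV2)\<^sup>2\<close>; with \<open>l' = q * l\<close> the sum of the two energy estimates is below \<open>clock_rate\<^sup>2\<close>, and \<open>spd\<close>
was chosen inversely proportional to \<open>clock_rate\<close>.\<close>

lemma energy:
  "(\<integral>\<^sup>+x. ennreal ((norm (vel t x))\<^sup>2) \<partial>torus L) \<le> ennreal (L ^ CARD('n) * (l * clock_total q / (tb - ta))\<^sup>2)"
proof (cases "ta < t \<and> t < tb")
  case False
  then have "spd t = 0" by (auto simp: stage_speed_def)
  then show ?thesis by (simp add: stage_vel_def)
next
  case True
  note an = ang_inside[of t]
  let ?p = "ang t"
  have p: "0 < ?p" "?p < pi / 2" using an True by auto
  have c: "cos ?p > 0" using p by (intro cos_gt_zero_pi) auto
  have vt [measurable]: "vel t \<in> borel_measurable borel"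
    using measurable_compose[OF measurable_Pair[OF measurable_const[of t borel borel] measurable_ident] vel_measurable'] by (simp add: id_def)
  define d where "d = spd t"
  define A where "A = d\<^sup>2 * l\<^sup>2"
  define B where "B = d\<^sup>2 * l'\<^sup>2"
  have AB: "A \<ge> 0" "B \<ge> 0" by (simp_all add: A_def B_def)
  define Q where "Q = A * (4 / 3 * (sin ?p)^4) + B * (43 / sqrt (cos ?p))"
  have Q: "Q \<ge> 0" unfolding Q_def using AB c by (intro add_nonneg_nonneg mult_nonneg_nonneg) auto
  have vf: "(norm (vel t (flow ?p m)))\<^sup>2 = A * (labV1 ?p (fst (snd (snd m))))\<^sup>2 + B * (labV2 ?p (fst (snd (snd m))) (snd (snd (snd m))))\<^sup>2"
    if m: "m \<in> space M" for m
  proof -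
    have nrm: "(norm (x *\<^sub>R axis k 1 + y *\<^sub>R axis j (1::real)))\<^sup>2 = x\<^sup>2 + y\<^sup>2" for x y
      unfolding power2_norm_eq_inner inner_add_left inner_add_right inner_scaleR_left inner_scaleR_right inner_axis_axis
      using kj by (simp add: power2_eq_square)
    have "(snd (snd (fst m)))\<^sup>2 = 1" using flow_coords(5)[OF m] by auto
    then show ?thesis unfolding vel_flow[OF m] norm_scaleR power_mult_distrib nrm
      by (simp add: A_def B_def d_def power_mult_distrib algebra_simps flip: power_mult)
  qed
  have V1m [measurable]: "(\<lambda>w. labV1 ?p (fst w)) \<in> borel_measurable (borel \<Otimes>\<^sub>M borel)" unfolding labV1_def by measurable
  have V2m [measurable]: "(\<lambda>w. labV2 ?p (fst w) (snd w)) \<in> borel_measurable (borel \<Otimes>\<^sub>M borel)" unfolding labV2_def tan_def by measurable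
  have inner: "(\<integral>\<^sup>+w. ennreal ((norm (vel t (flow ?p (\<iota>, z, w))))\<^sup>2) \<partial>labr) \<le> ennreal Q" if "\<iota> \<in> I" "z \<in> torus_cell L" for \<iota> z
  proof -
    have "(\<integral>\<^sup>+w. ennreal ((norm (vel t (flow ?p (\<iota>, z, w))))\<^sup>2) \<partial>labr)
       = (\<integral>\<^sup>+w. ennreal A * ennreal ((labV1 ?p (fst w))\<^sup>2) + ennreal B * ennreal ((labV2 ?p (fst w) (snd w))\<^sup>2) \<partial>labr)"
    proof (intro nn_integral_cong)
      fix w assume "w \<in> space labr"
      then have "(\<iota>, z, w) \<in> space M" using that by (simp add: space_M)
      from vf[OF this] show "ennreal ((norm (vel t (flow ?p (\<iota>, z, w))))\<^sup>2) = ennreal A * ennreal ((labV1 ?p (fst w))\<^sup>2) + ennreal B * ennreal ((labV2 ?p (fst w) (snd w))\<^sup>2)"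
        using AB by (simp add: ennreal_mult)
    qed
    also have "\<dots> = (\<integral>\<^sup>+w. ennreal A * ennreal ((labV1 ?p (fst w))\<^sup>2) + ennreal B * ennreal ((labV2 ?p (fst w) (snd w))\<^sup>2) \<partial>lab)"
      by (rule nn_integral_labr) measurable
    also have "\<dots> = ennreal A * (\<integral>\<^sup>+w. ennreal ((labV1 ?p (fst w))\<^sup>2) \<partial>lab) + ennreal B * (\<integral>\<^sup>+w. ennreal ((labV2 ?p (fst w) (snd w))\<^sup>2) \<partial>lab)"
    proof -
      have "(\<lambda>w. ennreal ((labV1 ?p (fst w))\<^sup>2)) \<in> borel_measurable lab" "(\<lambda>w. ennreal ((labV2 ?p (fst w) (snd w))\<^sup>2)) \<in> borel_measurable lab"
        unfolding measurable_cong_sets[OF sets_lab refl] by measurable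
      then show ?thesis by (simp add: nn_integral_add nn_integral_cmult)
    qed
    also have "\<dots> \<le> ennreal A * ennreal (4 / 3 * (sin ?p)^4) + ennreal B * ennreal (43 / sqrt (cos ?p))"
      using p by (intro add_mono mult_left_mono lab_energy1 lab_energy2) auto
    also have "\<dots> = ennreal Q"
    proof -
      have "ennreal A * ennreal x + ennreal B * ennreal y = ennreal (A * x + B * y)" if "x \<ge> 0" "y \<ge> 0" for x y
        using AB that by (simp add: ennreal_mult)
      then show ?thesis unfolding Q_def using c by simp
    qed
    finally show ?thesis .
  qed
  have "(\<lambda>m. flow ?p m) \<in> borel_measurable M"
    using measurable_compose[OF measurable_Pair[OF measurable_const[of t borel M] measurable_ident] flow_measurable] by (simp add: id_def)
  then have Fm: "(\<lambda>m. ennreal ((norm (vel t (flow ?p m)))\<^sup>2)) \<in> borel_measurable M"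
    by (rule measurable_compose) measurable
  have card: "real (card I) = 8 * real P * real P'" by (simp add: I_def card_cartesian_product)
  have "(\<integral>\<^sup>+x. ennreal ((norm (vel t x))\<^sup>2) \<partial>torus L) = ennreal (l * l' / L\<^sup>2) * (\<integral>\<^sup>+m. ennreal ((norm (vel t (flow ?p m)))\<^sup>2) \<partial>M)"
    using push[of "\<lambda>x. ennreal ((norm (vel t x))\<^sup>2)" t] vel_periodic by (simp add: torus_periodic_def)
  also have "\<dots> \<le> ennreal (l * l' / L\<^sup>2) * (\<Sum>\<iota>\<in>I. \<integral>\<^sup>+z. ennreal Q \<partial>(torus L :: (real^'n) measure))"
    unfolding nn_integral_M[OF Fm] by (intro mult_left_mono sum_mono nn_integral_mono inner) auto
  also have "\<dots> = ennreal (l * l' / L\<^sup>2 * (real (card I) * (Q * L ^ CARD('n))))"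
  proof -
    have QL: "0 \<le> Q * L ^ CARD('n)" using Q L by simp
    have 1: "(\<integral>\<^sup>+z. ennreal Q \<partial>(torus L :: (real^'n) measure)) = ennreal (Q * L ^ CARD('n))"
      using L Q by (simp add: emeasure_torus_space ennreal_mult)
    have 2: "(\<Sum>\<iota>\<in>I. ennreal (Q * L ^ CARD('n))) = ennreal (real (card I) * (Q * L ^ CARD('n)))"
      using QL by (subst sum_ennreal) simp_all
    show ?thesis unfolding 1 2 using QL L l_pos by (intro ennreal_mult[symmetric]) auto
  qed
  also have "l * l' / L\<^sup>2 * (real (card I) * (Q * L ^ CARD('n))) = L ^ CARD('n) * (Q / 2)"
    unfolding card l l' using L P by (simp add: field_simps power2_eq_square)
  also have "ennreal (L ^ CARD('n) * (Q / 2)) \<le> ennreal (L ^ CARD('n) * (l * clock_total q / (tb - ta))\<^sup>2)"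
  proof (intro ennreal_leI mult_left_mono)
    define r where "r = 1 - 2 * ?p / pi"
    have r: "0 < r" "r \<le> 1" "r \<le> cos ?p" using p cos_ge_linear[of ?p] by (simp_all add: r_def field_simps)
    let ?R = "clock_rate q ?p"
    have R: "?R > 0" using clock_rate_pos[of q ?p] q p by simp
    have inv: "1 / sqrt (cos ?p) \<le> 1 / r"
    proof -
      have "r * r \<le> r * 1" using r by (intro mult_left_mono) auto
      then have "r\<^sup>2 \<le> cos ?p" using r unfolding power2_eq_square by linarith
      then have "r \<le> sqrt (cos ?p)" by (rule real_le_rsqrt)
      then show ?thesis using r by (intro divide_left_mono) auto
    qed
    \<comment> \<open>The factor \<open>5\<close> in \<open>clock_rate\<close> has its origin here: \<open>43 / 2 \<le> 5\<^sup>2\<close>.\<close>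
    have "43 / 2 * q\<^sup>2 * (1 / sqrt (cos ?p)) \<le> 25 * q\<^sup>2 * (1 / r)"
    proof (rule mult_mono)
      show "43 / 2 * q\<^sup>2 \<le> 25 * q\<^sup>2" using zero_le_power2[of q] by linarith
    qed (use c inv in auto)
    moreover have "?R\<^sup>2 = 2 / 3 * (sin ?p)^4 + 25 * q\<^sup>2 * (1 / r) + 2 * (sqrt (2/3) * (sin ?p)\<^sup>2) * (5 * q / sqrt r)"
      using r by (simp add: clock_rate_def r_def[symmetric] power2_sum power_mult_distrib power_divide)
    moreover have "0 \<le> 2 * (sqrt (2/3) * (sin ?p)\<^sup>2) * (5 * q / sqrt r)" using q r by simp
    ultimately have le: "2 / 3 * (sin ?p)^4 + 43 / 2 * q\<^sup>2 * (1 / sqrt (cos ?p)) \<le> ?R\<^sup>2" by linarith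
    have "Q / 2 = d\<^sup>2 * l\<^sup>2 * (2 / 3 * (sin ?p)^4 + 43 / 2 * q\<^sup>2 * (1 / sqrt (cos ?p)))"
      unfolding Q_def A_def B_def lq by (simp add: power_mult_distrib algebra_simps)
    also have "\<dots> \<le> d\<^sup>2 * l\<^sup>2 * ?R\<^sup>2" using le by (intro mult_left_mono) auto
    also have "\<dots> = (l * clock_total q / (tb - ta))\<^sup>2"
      using True R by (simp add: d_def stage_speed_def power_mult_distrib power_divide)
    finally show "Q / 2 \<le> (l * clock_total q / (tb - ta))\<^sup>2" .
  qed (use L in simp)
  finally show ?thesis .
qed

end

section \<open>Density, mixing scale and transport in one stage\<close>

context stage
begin

text \<open>Almost every point is the position of some particle.\<close>

lemma AE_torus_flow:
  fixes Pr :: "real^'n \<Rightarrow> bool"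
  assumes m: "{x. \<not> Pr x} \<in> sets borel" and per: "torus_periodic L Pr" and lab: "\<And>m. m \<in> space M \<Longrightarrow> Pr (flow (ang t) m)"
  shows "AE x in torus L. Pr x"
proof -
  have Fm: "(\<lambda>x. indicator {x. \<not> Pr x} x :: ennreal) \<in> borel_measurable borel" using m by simp
  have "(\<integral>\<^sup>+x. indicator {x. \<not> Pr x} x \<partial>torus L) = ennreal (l * l' / L\<^sup>2) * (\<integral>\<^sup>+m. indicator {x. \<not> Pr x} (flow (ang t) m) \<partial>M)"
    by (rule push[OF Fm]) (use per in \<open>simp add: torus_periodic_def indicator_def\<close>)
  also have "(\<integral>\<^sup>+m. indicator {x. \<not> Pr x} (flow (ang t) m) \<partial>M) = (\<integral>\<^sup>+m. 0 \<partial>M)"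
    by (intro nn_integral_cong) (simp add: lab)
  finally have "(\<integral>\<^sup>+x. indicator {x. \<not> Pr x} x \<partial>torus L) = 0" by simp
  then have "AE x in torus L. indicator {x. \<not> Pr x} x = (0::ennreal)"
    by (subst (asm) nn_integral_0_iff_AE) (use measurable_torusI[OF Fm] in auto)
  then show ?thesis by eventually_elim (auto simp: indicator_def)
qed

lemma rho_t_measurable [measurable]: "rho t \<in> borel_measurable borel"
  unfolding stage_rho_def[abs_def] by measurable

lemma vel_t_measurable [measurable]: "vel t \<in> borel_measurable borel"
  unfolding stage_vel_def[abs_def] by measurable

lemma AE_abs_rho: "AE x in torus L. \<bar>rho t x\<bar> = 1"
proof (rule AE_torus_flow[of _ t])
  show "{x. \<not> \<bar>rho t x\<bar> = 1} \<in> sets borel" by measurable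
  show "torus_periodic L (\<lambda>x. \<bar>rho t x\<bar> = 1)" using rho_periodic[of t] by (simp add: torus_periodic_def)
  show "\<bar>rho t (flow (ang t) m)\<bar> = 1" if "m \<in> space M" for m
    using rho_flow[OF that, of t] flow_coords(5)[OF that] by auto
qed

lemma sgn_add_small: "Z + Y \<noteq> 0 \<Longrightarrow> \<bar>Z\<bar> \<le> \<bar>Y\<bar> \<Longrightarrow> sgn (Z + Y) = sgn Y" for Y Z :: real
  by (auto simp: sgn_if abs_if split: if_splits)

text \<open>At the end \<open>phase\<close> is \<open>x * \<bar>y\<bar> + y\<close>, which has the sign of \<open>y\<close> where it is not zero.\<close>

lemma AE_rho_end: "AE x in torus L. rho tb x = - sgn (zig (x $ j / l'))"
proof (rule AE_torus_flow[of _ tb])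
  show "{x. \<not> rho tb x = - sgn (zig (x $ j / l'))} \<in> sets borel" by measurable
  show "torus_periodic L (\<lambda>x. rho tb x = - sgn (zig (x $ j / l')))"
    using rho_periodic[of tb] unfolding torus_periodic_def by (simp only: periodic_comp) simp
  fix m assume m: "m \<in> space M"
  let ?x = "flow (ang tb) m"
  define X Y where "X = zig (?x $ k / l)" and "Y = zig (?x $ j / l')"
  have "rho tb ?x \<noteq> 0" using rho_flow[OF m, of tb] flow_coords(5)[OF m] by auto
  moreover have "phase (ang tb) X Y = X * \<bar>Y\<bar> + Y" by (simp add: ang_after phase_def)
  ultimately have ne: "X * \<bar>Y\<bar> + Y \<noteq> 0" and r: "rho tb ?x = - sgn (X * \<bar>Y\<bar> + Y)" by (auto simp: stage_rho_def X_def Y_def)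
  have X: "\<bar>X\<bar> \<le> 1" by (simp add: X_def abs_zig_le)
  have "\<bar>X * \<bar>Y\<bar>\<bar> \<le> 1 * \<bar>Y\<bar>" unfolding abs_mult by (intro mult_mono X) auto
  then have "sgn (X * \<bar>Y\<bar> + Y) = sgn Y" using sgn_add_small[OF ne] by simp
  then show "rho tb ?x = - sgn (zig (?x $ j / l'))" unfolding r by (simp add: Y_def)
qed

lemma rho_before: "t \<le> ta \<Longrightarrow> rho t x = - sgn (zig (x $ k / l))"
  by (simp add: stage_rho_def ang_before phase_def)

text \<open>The sign of a continuous function is continuous wherever it is not zero.\<close>

lemma rho_continuous_AE:
  "AE x in torus L. ((\<lambda>t. rho t x) \<longlongrightarrow> rho t0 x) (at t0 within S)"
proof -
  have "AE x in torus L. phase (ang t0) (zig (x $ k / l)) (zig (x $ j / l')) \<noteq> 0"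
    using AE_abs_rho[of t0] by eventually_elim (auto simp: stage_rho_def)
  then show ?thesis
  proof eventually_elim
    case (elim x)
    have "continuous_on UNIV (\<lambda>t. phase (ang t) (zig (x $ k / l)) (zig (x $ j / l')))"
      by (intro continuous_intros ang_cont)
    then have "((\<lambda>t. phase (ang t) (zig (x $ k / l)) (zig (x $ j / l'))) \<longlongrightarrow> phase (ang t0) (zig (x $ k / l)) (zig (x $ j / l'))) (at t0 within S)"
      by (meson UNIV_I continuous_on_def subset_UNIV tendsto_within_subset)
    then show ?case unfolding stage_rho_def by (intro tendsto_minus tendsto_sgn elim)
  qed
qed

text \<open>Each folding changes its sign under a shift by half a period, and \<open>phase\<close> is odd.\<close>

lemma rho_half_period: "rho t (x + ((2 * l) *\<^sub>R axis k 1 + (2 * l') *\<^sub>R axis j 1)) = - rho t x"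
proof -
  have "(x + ((2 * l) *\<^sub>R axis k 1 + (2 * l') *\<^sub>R axis j 1)) $ k / l = x $ k / l + 2"
    "(x + ((2 * l) *\<^sub>R axis k 1 + (2 * l') *\<^sub>R axis j 1)) $ j / l' = x $ j / l' + 2"
    using kj l_pos by (simp_all add: axis_def field_simps)
  then show ?thesis unfolding stage_rho_def by (simp only: zig_shift2 phase_odd sgn_minus)
qed

text \<open>If \<open>\<rho> (x + h) = - \<rho> x\<close> then \<open>- 2 * \<integral> \<rho> \<psi> = \<integral> \<rho> * (\<psi> (x + h) - \<psi> x)\<close>, and the difference of \<open>\<psi>\<close> is at most
\<open>norm h\<close> times the norm of the gradient.\<close>

lemma rho_dual_estimate:
  assumes \<psi>: "torus_smooth L \<psi>"
  shows "\<bar>LINT x|torus L. rho t x * \<psi> x\<bar> \<le> sqrt (L ^ CARD('n)) * (l + l') * L2_norm L (grad \<psi>)"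
proof -
  let ?h = "(2 * l) *\<^sub>R axis k 1 + (2 * l') *\<^sub>R axis j (1::real) :: real^'n"
  interpret T: finite_measure "torus L :: (real^'n) measure" by (rule finite_measure_torus)
  have per: "torus_periodic L \<psi>" using \<psi> by (simp add: torus_smooth_def)
  have c: "continuous_on S \<psi>" for S by (rule torus_smooth_continuous[OF \<psi>])
  have pm [measurable]: "\<psi> \<in> borel_measurable borel" by (rule borel_measurable_continuous_onI[OF c])
  have ch: "continuous_on S (\<lambda>x. \<psi> (x + ?h))" for S
    by (rule continuous_on_compose2[OF c[of UNIV]]) (auto intro!: continuous_intros)
  have rL: "L2fun (torus L) (rho t)"
    unfolding L2fun_def
  proof
    show rm: "rho t \<in> borel_measurable (torus L)" by (intro measurable_torusI) measurable
    show "integrable (torus L) (\<lambda>x. (norm (rho t x))\<^sup>2)"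
      using rho_le_1 rm by (intro T.integrable_const_bound[of _ 1] AE_I2) (auto simp: abs_square_le_1)
  qed
  have dL: "L2fun (torus L) (\<lambda>x. \<psi> (x + ?h) - \<psi> x)" by (intro L2fun_torus_continuous continuous_intros ch c)
  have i1: "integrable (torus L) (\<lambda>x. rho t x * \<psi> x)"
    using L2fun_integrable_inner[OF rL L2fun_smooth[OF \<psi>]] by simp
  have i2: "integrable (torus L) (\<lambda>x. rho t x * \<psi> (x + ?h))"
    using L2fun_integrable_inner[OF rL L2fun_torus_continuous[OF ch]] by simp
  have "(LINT x|torus L. rho t x * \<psi> x) = (LINT x|torus L. rho t (x + ?h) * \<psi> (x + ?h))"
    by (rule integral_torus_translation(2)[OF L _ _ i1, symmetric])
      (use rho_periodic[of t] per in \<open>measurable, simp add: torus_periodic_def\<close>)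
  also have "\<dots> = - (LINT x|torus L. rho t x * \<psi> (x + ?h))" by (simp add: rho_half_period)
  finally have e: "(LINT x|torus L. rho t x * (\<psi> (x + ?h) - \<psi> x)) = - 2 * (LINT x|torus L. rho t x * \<psi> x)"
    using i1 i2 by (simp add: right_diff_distrib)
  have nh: "norm ?h \<le> 2 * (l + l')"
    using norm_triangle_ineq[of "(2 * l) *\<^sub>R axis k 1 :: real^'n" "(2 * l') *\<^sub>R axis j 1"] l_pos by simp
  have "(LINT x|torus L. rho t x * (\<psi> (x + ?h) - \<psi> x))\<^sup>2
     \<le> (LINT x|torus L. (norm (rho t x))\<^sup>2) * (LINT x|torus L. (norm (\<psi> (x + ?h) - \<psi> x))\<^sup>2)"
    using L2fun_Cauchy_Schwarz[OF rL dL] by simp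
  also have "\<dots> \<le> L ^ CARD('n) * ((2 * (l + l'))\<^sup>2 * (L2_norm L (grad \<psi>))\<^sup>2)"
  proof (intro mult_mono)
    have "(LINT x|torus L. (norm (rho t x))\<^sup>2) \<le> (LINT x|(torus L :: (real^'n) measure). 1)"
      using rL rho_le_1 by (intro integral_mono) (auto simp: L2fun_def abs_square_le_1)
    then show "(LINT x|torus L. (norm (rho t x))\<^sup>2) \<le> L ^ CARD('n)" using L by (simp add: measure_torus_space)
    have "(LINT x|torus L. (norm (\<psi> (x + ?h) - \<psi> x))\<^sup>2) \<le> (norm ?h)\<^sup>2 * (L2_norm L (grad \<psi>))\<^sup>2"
      using torus_difference_L2[OF L per torus_smooth_C1[OF \<psi>], of ?h] by simp
    also have "\<dots> \<le> (2 * (l + l'))\<^sup>2 * (L2_norm L (grad \<psi>))\<^sup>2" by (intro mult_right_mono power_mono nh) auto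
    finally show "(LINT x|torus L. (norm (\<psi> (x + ?h) - \<psi> x))\<^sup>2) \<le> (2 * (l + l'))\<^sup>2 * (L2_norm L (grad \<psi>))\<^sup>2" .
  qed (use L in \<open>auto intro!: integral_nonneg_AE\<close>)
  also have "\<dots> = (2 * (sqrt (L ^ CARD('n)) * (l + l') * L2_norm L (grad \<psi>)))\<^sup>2"
  proof -
    have "W * ((2 * y)\<^sup>2 * G\<^sup>2) = (2 * (sqrt W * y * G))\<^sup>2" if "W \<ge> 0" for W y G :: real
      using that by (simp add: power_mult_distrib)
    from this[of "L ^ CARD('n)" "l + l'" "L2_norm L (grad \<psi>)"] show ?thesis using L by simp
  qed
  finally have "\<bar>LINT x|torus L. rho t x * (\<psi> (x + ?h) - \<psi> x)\<bar> \<le> \<bar>2 * (sqrt (L ^ CARD('n)) * (l + l') * L2_norm L (grad \<psi>))\<bar>"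
    by (simp only: abs_le_square_iff)
  moreover have "0 \<le> sqrt (L ^ CARD('n)) * (l + l') * L2_norm L (grad \<psi>)"
    using L l_pos L2_norm_nonneg[of L "grad \<psi>"] by (intro mult_nonneg_nonneg) auto
  ultimately show ?thesis unfolding e by (simp add: abs_mult)
qed

end

text \<open>What the Lagrangian argument needs from a test function on \<open>[0, s]\<close>: its derivatives \<open>D1\<close> in time and
\<open>D2\<close> in space, extended measurably to all times.\<close>

locale test_data =
  fixes L s :: real and \<psi> D1 :: "real \<Rightarrow> real^'n \<Rightarrow> real" and D2 :: "real \<Rightarrow> real^'n \<Rightarrow> real^'n" and B :: real
  assumes \<psi>p: "\<And>t. t \<in> {0..s} \<Longrightarrow> torus_periodic L (\<psi> t)"
    and D1p: "\<And>t. t \<in> {0<..<s} \<Longrightarrow> torus_periodic L (D1 t)" and D2p: "\<And>t. t \<in> {0<..<s} \<Longrightarrow> torus_periodic L (D2 t)"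
    and psic: "continuous_on ({0..s} \<times> UNIV) (\<lambda>p. \<psi> (fst p) (snd p))"
    and der: "\<And>t x. t \<in> {0<..<s} \<Longrightarrow> ((\<lambda>p. \<psi> (fst p) (snd p)) has_derivative (\<lambda>h. fst h * D1 t x + D2 t x \<bullet> snd h)) (at (t, x))"
    and D1m: "(\<lambda>p. D1 (fst p) (snd p)) \<in> borel_measurable (borel \<Otimes>\<^sub>M borel)"
    and D2m: "(\<lambda>p. D2 (fst p) (snd p)) \<in> borel_measurable (borel \<Otimes>\<^sub>M borel)"
    and bnd: "\<And>t x. t \<in> {0<..<s} \<Longrightarrow> \<bar>D1 t x\<bar> \<le> B" "\<And>t x. t \<in> {0<..<s} \<Longrightarrow> norm (D2 t x) \<le> B" and B: "B \<ge> 0"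

text \<open>The case \<open>r = rho\<close> is the transport equation, the case \<open>r = (\<lambda>t x. 1)\<close> is incompressibility.\<close>

lemma (in stage) transport:
  fixes \<psi> :: "real \<Rightarrow> real^'n \<Rightarrow> real"
  assumes td: "test_data L s \<psi> D1 D2 B" and a: "0 \<le> a" "a \<le> b" "b \<le> s" "b \<le> tb"
    and r: "r = rho \<or> r = (\<lambda>t x. 1)"
  shows "integrable lborel (\<lambda>t. indicator {a<..<b} t * (LINT x|torus L. r t x * D1 t x + r t x * (vel t x \<bullet> D2 t x)))"
    and "(LINT t|lborel. indicator {a<..<b} t * (LINT x|torus L. r t x * D1 t x + r t x * (vel t x \<bullet> D2 t x))) =
      (LINT x|torus L. r b x * \<psi> b x) - (LINT x|torus L. r a x * \<psi> a x)"
proof -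
  interpret test_data L s \<psi> D1 D2 B by (rule td)
  have c: "l * l' / L\<^sup>2 > 0" using l_pos L by simp
  have K: "0 \<le> L ^ CARD('n) * (l * clock_total q / (tb - ta))\<^sup>2" using L by simp
  have sub: "t \<in> {0<..<s}" if "t \<in> {a<..<b}" for t using that a by auto
  have psic': "continuous_on ({a..b} \<times> UNIV) (\<lambda>p. \<psi> (fst p) (snd p))"
    by (rule continuous_on_subset[OF psic]) (use a in auto)
  have pd: "\<exists>S. finite S \<and> (\<forall>t\<in>{a<..<b} - S. ((\<lambda>t. flow (ang t) m) has_vector_derivative vel t (flow (ang t) m)) (at t))"
    if "m \<in> space M" for m
    using flow_deriv[OF that] a(4) by (meson DiffD1 DiffD2 DiffI greaterThanLessThan_iff lessThan_iff less_le_trans)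
  define \<sigma> where "\<sigma> m = (if r = rho then - snd (snd (fst m)) else 1)" for m :: "(nat \<times> nat \<times> real) \<times> (real^'n) \<times> (real \<times> real)"
  have r1: "r t (flow (ang t) m) = \<sigma> m" if "m \<in> space M" for t m
    using r rho_flow[OF that] by (auto simp: \<sigma>_def)
  have r2: "\<bar>r t x\<bar> \<le> 1" for t x using r rho_le_1 by auto
  have r3: "(\<lambda>p. r (fst p) (snd p)) \<in> borel_measurable (borel \<Otimes>\<^sub>M borel)" using r rho_measurable by auto
  have r4: "torus_periodic L (r t)" for t using r rho_periodic by (auto simp: torus_periodic_def)
  note args = a(2) M_finite c flow_measurable push flow_cont pd r1 r2 r3 r4 vel_measurable' vel_periodic energy K
  have all: "integrable lborel (\<lambda>t. indicator {a<..<b} t * (LINT x|torus L. r t x * D1 t x + r t x * (vel t x \<bullet> D2 t x))) \<and>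
    (LINT t|lborel. indicator {a<..<b} t * (LINT x|torus L. r t x * D1 t x + r t x * (vel t x \<bullet> D2 t x))) =
      (LINT x|torus L. r b x * \<psi> b x) - (LINT x|torus L. r a x * \<psi> a x)"
  proof (rule Lagrangian_transport[OF args])
    show "torus_periodic L (\<psi> t)" if "t \<in> {a..b}" for t using \<psi>p[of t] that a by auto
    show "torus_periodic L (D1 t)" if "t \<in> {a<..<b}" for t by (rule D1p[OF sub[OF that]])
    show "torus_periodic L (D2 t)" if "t \<in> {a<..<b}" for t by (rule D2p[OF sub[OF that]])
    show "((\<lambda>p. \<psi> (fst p) (snd p)) has_derivative (\<lambda>h. fst h * D1 t x + D2 t x \<bullet> snd h)) (at (t, x))" if "t \<in> {a<..<b}" for t x
      by (rule der[OF sub[OF that]])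
    show "\<bar>D1 t x\<bar> \<le> B" "norm (D2 t x) \<le> B" if "t \<in> {a<..<b}" for t x using bnd[OF sub[OF that]] by auto
  qed (assumption | rule psic' D1m D2m B)+
  then show "integrable lborel (\<lambda>t. indicator {a<..<b} t * (LINT x|torus L. r t x * D1 t x + r t x * (vel t x \<bullet> D2 t x)))"
    "(LINT t|lborel. indicator {a<..<b} t * (LINT x|torus L. r t x * D1 t x + r t x * (vel t x \<bullet> D2 t x))) =
      (LINT x|torus L. r b x * \<psi> b x) - (LINT x|torus L. r a x * \<psi> a x)" by auto
qed

text \<open>The derivatives are bounded because they are continuous on the compact set \<open>[0, s]\<close> times the cell and
periodic in space.\<close>

lemma test_data_exists:
  fixes \<psi> :: "real \<Rightarrow> real^'n \<Rightarrow> real"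
  assumes L: "L > 0" and \<psi>: "torus_smooth_on L I \<psi>" and I: "{0..s} \<subseteq> I" and s: "s > 0"
  obtains D1 D2 B where "test_data L s \<psi> D1 D2 B"
    "\<And>t x. t \<in> {0<..<s} \<Longrightarrow> D1 t x = deriv (\<lambda>s. \<psi> s x) t" "\<And>t x. t \<in> {0<..<s} \<Longrightarrow> D2 t x = grad (\<psi> t) x"
proof -
  let ?f = "\<lambda>p. \<psi> (fst p) (snd p)"
  have "Ck_on (Suc 0) (I \<times> UNIV) ?f" using \<psi> by (simp add: torus_smooth_on_def smooth_on_def split_beta')
  then obtain f' where f': "\<And>p. p \<in> I \<times> UNIV \<Longrightarrow> (?f has_derivative f' p) (at p within I \<times> UNIV)"
    and fc: "\<And>h. continuous_on (I \<times> UNIV) (\<lambda>p. f' p h)" by auto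
  have per: "torus_periodic L (\<psi> t)" if "t \<in> I" for t using \<psi> that by (simp add: torus_smooth_on_def)
  have at: "(?f has_derivative f' (t, x)) (at (t, x))" if t: "t \<in> {0<..<s}" for t x
  proof -
    have o: "open ({0<..<s} \<times> (UNIV :: (real^'n) set))" by (intro open_Times) auto
    have "(?f has_derivative f' (t, x)) (at (t, x) within {0<..<s} \<times> UNIV)"
      by (rule has_derivative_subset[OF f']) (use t I in auto)
    then show ?thesis using at_within_open[OF _ o, of "(t, x)"] t by simp
  qed
  define D1 where "D1 t x = (if t \<in> {0<..<s} then f' (t, x) (1, 0) else 0)" for t x
  define D2 where "D2 t x = (\<chi> i. if t \<in> {0<..<s} then f' (t, x) (0, axis i 1) else 0)" for t x
  have lin: "f' (t, x) h = fst h * D1 t x + D2 t x \<bullet> snd h" if t: "t \<in> {0<..<s}" for t x h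
  proof -
    interpret linear "f' (t, x)" using at[OF t] has_derivative_linear by blast
    have "h = fst h *\<^sub>R (1, 0) + (\<Sum>i\<in>UNIV. (snd h $ i) *\<^sub>R (0, axis i 1))"
      using basis_expansion[of "snd h", unfolded scalar_mult_eq_scaleR] by (simp add: prod_eq_iff fst_sum snd_sum)
    then have "f' (t, x) h = f' (t, x) (fst h *\<^sub>R (1, 0) + (\<Sum>i\<in>UNIV. (snd h $ i) *\<^sub>R (0, axis i 1)))" by simp
    also have "\<dots> = fst h * f' (t, x) (1, 0) + (\<Sum>i\<in>UNIV. snd h $ i * f' (t, x) (0, axis i 1))"
      by (simp only: add sum scale real_scaleR_def)
    finally show ?thesis using t by (simp add: D1_def D2_def inner_vec_def mult.commute)
  qed
  have der: "(?f has_derivative (\<lambda>h. fst h * D1 t x + D2 t x \<bullet> snd h)) (at (t, x))" if "t \<in> {0<..<s}" for t x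
    using at[OF that, of x] unfolding lin[OF that, of x, abs_def] .
  have dD1: "deriv (\<lambda>s. \<psi> s x) t = D1 t x" if t: "t \<in> {0<..<s}" for t x
  proof (rule DERIV_imp_deriv)
    have "((\<lambda>s. (s, x)) has_derivative (\<lambda>h. (h, 0))) (at t)" by (auto intro!: derivative_eq_intros)
    from has_derivative_compose[OF this der[OF t]]
    show "((\<lambda>s. \<psi> s x) has_real_derivative D1 t x) (at t)"
      by (simp add: has_field_derivative_def mult_commute_abs)
  qed
  have dD2: "grad (\<psi> t) x = D2 t x" if t: "t \<in> {0<..<s}" for t x
  proof (rule grad_eqI)
    have "((\<lambda>y. (t, y)) has_derivative (\<lambda>h. (0, h))) (at x)" by (auto intro!: derivative_eq_intros)
    from has_derivative_compose[OF this der[OF t]]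
    show "(\<psi> t has_derivative (\<bullet>) (D2 t x)) (at x)" by simp
  qed
  have D1p: "torus_periodic L (D1 t)" if t: "t \<in> {0<..<s}" for t
    unfolding torus_periodic_def
  proof (intro allI)
    fix x :: "real^'n" and i
    have "\<forall>\<^sub>F u in nhds t. \<psi> u (x + L *\<^sub>R axis i 1) = \<psi> u x"
      unfolding eventually_nhds using per I t
      by (intro exI[of _ "{0<..<s}"]) (auto simp: torus_periodic_def subset_iff)
    then have "deriv (\<lambda>u. \<psi> u (x + L *\<^sub>R axis i 1)) t = deriv (\<lambda>u. \<psi> u x) t" by (rule deriv_cong_ev) simp
    then show "D1 t (x + L *\<^sub>R axis i 1) = D1 t x" using dD1[OF t] by simp
  qed
  have D2p: "torus_periodic L (D2 t)" if t: "t \<in> {0<..<s}" for t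
  proof -
    have "torus_periodic L (grad (\<psi> t))"
    proof (rule torus_periodic_grad)
      have "t \<in> I" using t by (intro subsetD[OF I]) auto
      then show "torus_periodic L (\<psi> t)" by (rule per)
      show "(\<psi> t has_derivative (\<bullet>) (grad (\<psi> t) x)) (at x)" for x
      proof -
        have "((\<lambda>y. (t, y)) has_derivative (\<lambda>h. (0, h))) (at x)" by (auto intro!: derivative_eq_intros)
        from has_derivative_compose[OF this der[OF t]] show ?thesis using dD2[OF t] by simp
      qed
    qed
    moreover have "grad (\<psi> t) = D2 t" using dD2[OF t] by auto
    ultimately show ?thesis by simp
  qed
  have o: "{0<..<s} \<times> UNIV \<in> sets (borel :: (real \<times> (real^'n)) measure)" by (intro borel_open open_Times) auto
  have fm: "(\<lambda>p. if fst p \<in> {0<..<s} then f' (fst p, snd p) h else 0) \<in> borel_measurable (borel \<Otimes>\<^sub>M borel)" for h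
  proof -
    have "continuous_on ({0<..<s} \<times> UNIV) (\<lambda>p. f' p h)" by (rule continuous_on_subset[OF fc]) (use I in auto)
    from borel_measurable_continuous_on_indicator[OF o this]
    have "(\<lambda>p. indicator ({0<..<s} \<times> UNIV) p *\<^sub>R f' p h) \<in> borel_measurable borel" .
    moreover have "(\<lambda>p. indicator ({0<..<s} \<times> UNIV) p *\<^sub>R f' p h) = (\<lambda>p. if fst p \<in> {0<..<s} then f' (fst p, snd p) h else 0)"
      by (auto simp: indicator_def fun_eq_iff)
    ultimately show ?thesis by (simp add: borel_prod)
  qed
  have bd: "\<exists>C. \<forall>t\<in>{0<..<s}. \<forall>x\<in>torus_cell L. \<bar>f' (t, x) h\<bar> \<le> C" for h
  proof -
    have "compact ({0..s} \<times> (torus_cell L :: (real^'n) set))" by (auto simp: torus_cell_def intro!: compact_Times)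
    moreover have "continuous_on ({0..s} \<times> torus_cell L) (\<lambda>p. f' p h)" by (rule continuous_on_subset[OF fc]) (use I in auto)
    ultimately have "bounded ((\<lambda>p. f' p h) ` ({0..s} \<times> torus_cell L))"
      using compact_continuous_image compact_imp_bounded by blast
    then obtain C where "\<And>p. p \<in> {0..s} \<times> torus_cell L \<Longrightarrow> \<bar>f' p h\<bar> \<le> C" by (auto simp: bounded_iff)
    then show ?thesis by (intro exI[of _ C]) auto
  qed
  obtain C1 where C1: "\<And>t x. t \<in> {0<..<s} \<Longrightarrow> x \<in> torus_cell L \<Longrightarrow> \<bar>D1 t x\<bar> \<le> C1"
  proof -
    have "\<exists>C. \<forall>t\<in>{0<..<s}. \<forall>x\<in>torus_cell L. \<bar>D1 t x\<bar> \<le> C" using bd[of "(1, 0)"] by (simp add: D1_def)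
    then show thesis using that by blast
  qed
  have "\<exists>C. \<forall>i. \<forall>t\<in>{0<..<s}. \<forall>x\<in>torus_cell L. \<bar>f' (t, x) (0, axis i 1)\<bar> \<le> C i"
    by (intro choice allI bd)
  then obtain C2 where C2: "\<And>i t x. t \<in> {0<..<s} \<Longrightarrow> x \<in> torus_cell L \<Longrightarrow> \<bar>D2 t x $ i\<bar> \<le> C2 i"
  proof -
    assume *: "\<And>C2. (\<And>i t x. t \<in> {0<..<s} \<Longrightarrow> x \<in> torus_cell L \<Longrightarrow> \<bar>D2 t x $ i\<bar> \<le> C2 i) \<Longrightarrow> thesis"
    assume "\<exists>C. \<forall>i. \<forall>t\<in>{0<..<s}. \<forall>x\<in>torus_cell L. \<bar>f' (t, x) (0, axis i 1)\<bar> \<le> C i"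
    then obtain C where C: "\<forall>i. \<forall>t\<in>{0<..<s}. \<forall>x\<in>torus_cell L. \<bar>f' (t, x) (0, axis i 1)\<bar> \<le> C i" by blast
    show thesis by (rule *[of C]) (use C in \<open>simp add: D2_def\<close>)
  qed
  define B where "B = \<bar>C1\<bar> + \<bar>\<Sum>i\<in>UNIV. C2 i\<bar>"
  have b1: "\<bar>D1 t x\<bar> \<le> B" if t: "t \<in> {0<..<s}" for t x
  proof -
    obtain y where y: "y \<in> torus_cell L" "\<And>f :: real^'n \<Rightarrow> real. torus_periodic L f \<Longrightarrow> f y = f x"
      using torus_representative[OF L] by metis
    show ?thesis using C1[OF t y(1)] y(2)[OF D1p[OF t]] by (simp add: B_def)
  qed
  have b2: "norm (D2 t x) \<le> B" if t: "t \<in> {0<..<s}" for t x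
  proof -
    obtain y where y: "y \<in> torus_cell L" "\<And>f :: real^'n \<Rightarrow> real^'n. torus_periodic L f \<Longrightarrow> f y = f x"
      using torus_representative[OF L] by metis
    have "norm (D2 t y) \<le> (\<Sum>i\<in>UNIV. \<bar>D2 t y $ i\<bar>)" by (rule norm_le_l1_cart)
    also have "\<dots> \<le> (\<Sum>i\<in>UNIV. C2 i)" by (intro sum_mono C2 t y)
    finally show ?thesis using y(2)[OF D2p[OF t]] by (simp add: B_def)
  qed
  have "test_data L s \<psi> D1 D2 B"
  proof
    show "torus_periodic L (\<psi> t)" if "t \<in> {0..s}" for t using per I that by auto
    show "continuous_on ({0..s} \<times> UNIV) ?f"
    proof (rule continuous_on_subset)
      show "continuous_on (I \<times> UNIV) ?f" by (rule has_derivative_continuous_on) (use f' in auto)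
    qed (use I in auto)
    show "(\<lambda>p. D1 (fst p) (snd p)) \<in> borel_measurable (borel \<Otimes>\<^sub>M borel)" unfolding D1_def by (rule fm)
    show "(\<lambda>p. D2 (fst p) (snd p)) \<in> borel_measurable (borel \<Otimes>\<^sub>M borel)"
      unfolding D2_def by (rule borel_measurable_vecI) (simp only: vec_lambda_beta fm)
    show "B \<ge> 0" by (simp add: B_def)
  qed (fact D1p D2p der b1 b2)+
  then show ?thesis using that dD1 dD2 by metis
qed

section \<open>The cascade of stages\<close>

lemma measurable_lebesgue_onI:
  "f \<in> borel_measurable borel \<Longrightarrow> f \<in> borel_measurable (lebesgue_on S)"
  by (intro measurable_restrict_space1 measurable_completion) simp

text \<open>Fubini's theorem for null sets.\<close>

lemma AE_spacetimeI:
  fixes Pr :: "real \<Rightarrow> real^'n \<Rightarrow> bool"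
  assumes m: "{p. Pr (fst p) (snd p)} \<in> sets (borel \<Otimes>\<^sub>M borel)"
    and ae: "\<And>t. 0 < t \<Longrightarrow> t < T \<Longrightarrow> AE x in torus L. Pr t x"
  shows "AE (t, x) in spacetime L T. Pr t x"
proof -
  have c: "{0<..<T} \<times> torus_cell L \<in> sets (borel \<Otimes>\<^sub>M borel)" by simp
  have set: "{p. p \<in> {0<..<T} \<times> torus_cell L \<longrightarrow> Pr (fst p) (snd p)} \<in> sets (borel \<Otimes>\<^sub>M borel)"
  proof -
    have "{p. p \<in> {0<..<T} \<times> torus_cell L \<longrightarrow> Pr (fst p) (snd p)} = - ({0<..<T} \<times> torus_cell L) \<union> {p. Pr (fst p) (snd p)}" by auto
    moreover have "- ({0<..<T} \<times> (torus_cell L :: (real^'n) set)) \<in> sets (borel \<Otimes>\<^sub>M borel)"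
      using sets.compl_sets[OF c] by (simp add: space_pair_measure Compl_eq_Diff_UNIV)
    ultimately show ?thesis using m by auto
  qed
  have "AE t in lborel. AE x in lborel. (t, x) \<in> {0<..<T} \<times> torus_cell L \<longrightarrow> Pr t x"
  proof (rule AE_I2)
    fix t :: real
    show "AE x in lborel. (t, x) \<in> {0<..<T} \<times> torus_cell L \<longrightarrow> Pr t x"
    proof (cases "0 < t \<and> t < T")
      case True
      then have "AE x in lebesgue. x \<in> torus_cell L \<longrightarrow> Pr t x" using ae[of t] by (simp add: AE_torus_iff)
      then show ?thesis unfolding AE_completion_iff by eventually_elim auto
    qed auto
  qed
  then have "AE p in lborel \<Otimes>\<^sub>M lborel. p \<in> {0<..<T} \<times> torus_cell L \<longrightarrow> Pr (fst p) (snd p)"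
  proof (intro lborel_pair.AE_pair_measure)
    show "{p \<in> space (lborel \<Otimes>\<^sub>M lborel). p \<in> {0<..<T} \<times> torus_cell L \<longrightarrow> Pr (fst p) (snd p)} \<in> sets (lborel \<Otimes>\<^sub>M lborel)"
      using set by (simp add: space_pair_measure cong: sets_pair_measure_cong)
  qed simp
  then have "AE p in lebesgue. p \<in> {0<..<T} \<times> torus_cell L \<longrightarrow> Pr (fst p) (snd p)"
    unfolding lborel_prod AE_completion_iff .
  moreover have "{0<..<T} \<times> torus_cell L \<inter> space lebesgue \<in> sets (lebesgue :: (real \<times> (real^'n)) measure)"
    using c unfolding borel_prod by (intro sets_completionI_sets) simp
  ultimately show ?thesis unfolding spacetime_def split_beta' by (subst AE_restrict_space_iff) auto
qed

text \<open>The Lagrangian identity for a fluid at rest. Subtracting it from the identity for the constant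
density isolates the term that contains the velocity.\<close>

lemma static_transport:
  fixes \<psi> :: "real \<Rightarrow> real^'n \<Rightarrow> real"
  assumes td: "test_data L s \<psi> D1 D2 B" and b: "0 \<le> b" "b \<le> s"
  shows "integrable lborel (\<lambda>t. indicator {0<..<b} t * (LINT x|torus L. D1 t x))"
    and "(LINT t|lborel. indicator {0<..<b} t * (LINT x|torus L. D1 t x)) = (LINT x|torus L. \<psi> b x) - (LINT x|torus L. \<psi> 0 x)"
proof -
  interpret test_data L s \<psi> D1 D2 B by (rule td)
  have fm: "(\<lambda>p. snd p) \<in> borel_measurable (borel \<Otimes>\<^sub>M (torus L :: (real^'n) measure))"
    by (rule measurable_compose[OF measurable_snd measurable_torus_id])
  have all: "integrable lborel (\<lambda>t. indicator {0<..<b} t * (LINT x|torus L. 1 * D1 t x + 1 * ((0::real^'n) \<bullet> D2 t x))) \<and>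
    (LINT t|lborel. indicator {0<..<b} t * (LINT x|torus L. 1 * D1 t x + 1 * ((0::real^'n) \<bullet> D2 t x))) =
      (LINT x|torus L. 1 * \<psi> b x) - (LINT x|torus L. 1 * \<psi> 0 x)"
  proof (rule Lagrangian_transport[where c = 1 and M = "torus L" and \<Phi> = "\<lambda>t x. x" and v = "\<lambda>t x. 0" and \<rho> = "\<lambda>t x. 1" and s = "\<lambda>x. 1" and K = 0 and B = B])
    show "continuous_on ({0..b} \<times> UNIV) (\<lambda>p. \<psi> (fst p) (snd p))"
      by (rule continuous_on_subset[OF psic]) (use b in auto)
    show "\<exists>S. finite S \<and> (\<forall>t\<in>{0<..<b} - S. ((\<lambda>t. x) has_vector_derivative 0) (at t))" for x :: "real^'n"
      by (intro exI[of _ "{}"]) auto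
  qed (use b fm finite_measure_torus \<psi>p D1p D2p der D1m D2m bnd B in \<open>auto simp: torus_periodic_def\<close>)
  then show "integrable lborel (\<lambda>t. indicator {0<..<b} t * (LINT x|torus L. D1 t x))"
    "(LINT t|lborel. indicator {0<..<b} t * (LINT x|torus L. D1 t x)) = (LINT x|torus L. \<psi> b x) - (LINT x|torus L. \<psi> 0 x)" by simp_all
qed

text \<open>The total duration of the motion is \<open>D\<close>, preceded by the waiting time \<open>T - D\<close>. Stage \<open>n\<close> takes the time
\<open>D * (1 - 1/N) / N^n\<close>, so that all stages share the energy bound of stage \<open>0\<close>, which is \<open>energy_le\<close>.\<close>

locale cascade =
  fixes L E T D :: real and k j :: "'n::finite" and N :: nat and \<phi> :: "real \<Rightarrow> real"
  assumes L: "L > 0" and kj: "k \<noteq> j" and N: "N \<ge> 2" and D: "0 < D" "D \<le> T"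
    and clock: "is_clock (1 / real N) \<phi>" and E: "E \<ge> 0"
    and energy_le: "L ^ CARD('n) * (L * clock_total (1 / real N) / (4 * D * (1 - 1 / real N)))\<^sup>2 \<le> E"
begin

text \<open>The stages alternate between the two axes.\<close>

definition axs :: "nat \<Rightarrow> 'n" where "axs n = (if even n then k else j)"
definition len :: "nat \<Rightarrow> real" where "len n = L / (4 * real (N ^ n))"
definition tm :: "nat \<Rightarrow> real" where "tm n = T - D / real (N ^ n)"
text \<open>Stage \<open>0\<close> includes the waiting time; its clock has not started then.\<close>

definition start :: "nat \<Rightarrow> real" where "start n = (if n = 0 then 0 else tm n)"
definition idx :: "real \<Rightarrow> nat" where "idx t = (LEAST n. t < tm (Suc n))"
definition R :: "nat \<Rightarrow> real \<Rightarrow> real^'n \<Rightarrow> real" where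
  "R n = stage_rho (axs n) (axs (Suc n)) (len n) (len (Suc n)) \<phi> (tm n) (tm (Suc n))"
definition V :: "nat \<Rightarrow> real \<Rightarrow> real^'n \<Rightarrow> real^'n" where
  "V n = stage_vel (1 / real N) (axs n) (axs (Suc n)) (len n) (len (Suc n)) \<phi> (tm n) (tm (Suc n))"
definition rho :: "real \<Rightarrow> real^'n \<Rightarrow> real" where "rho t = R (idx t) t"
definition vel :: "real \<Rightarrow> real^'n \<Rightarrow> real^'n" where "vel t = V (idx t) t"

lemma N_pow: "real (N ^ n) > 0" using N by simp

lemma tm_diff: "tm (Suc n) - tm n = D / real (N ^ n) * (1 - 1 / real N)"
  using N by (simp add: tm_def field_simps)

lemma tm_less: "tm n < tm (Suc n)"
proof -
  have "D / real (N ^ n) * (1 - 1 / real N) > 0" using D N N_pow[of n] by (intro mult_pos_pos divide_pos_pos) auto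
  then show ?thesis using tm_diff[of n] by simp
qed

lemma tm_mono: "m \<le> n \<Longrightarrow> tm m \<le> tm n"
  by (rule lift_Suc_mono_le[of tm]) (use tm_less in \<open>auto intro: less_imp_le\<close>)

lemma tm_less_T: "tm n < T"
  using D N_pow[of n] by (simp add: tm_def)

lemma tm_0: "tm 0 = T - D" by (simp add: tm_def)

lemma tm_pos: "tm (Suc n) > 0"
  using tm_less[of 0] tm_mono[of 1 "Suc n"] tm_0 D by simp

lemma tm_reaches: "t < T \<Longrightarrow> \<exists>n. t < tm n"
proof -
  assume t: "t < T"
  obtain n where n: "D / (T - t) < real N ^ n" using real_arch_pow[of "real N" "D / (T - t)"] N by auto
  then have "D / real (N ^ n) < T - t" using t D N_pow[of n] by (simp add: field_simps)
  then have "t < tm n" by (simp add: tm_def)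
  then show ?thesis by blast
qed

lemma idx_upper: "t < T \<Longrightarrow> t < tm (Suc (idx t))"
proof -
  assume "t < T"
  then obtain n where "t < tm n" using tm_reaches by blast
  then have "t < tm (Suc n)" using tm_less[of n] by simp
  then show ?thesis unfolding idx_def by (rule LeastI)
qed

lemma idx_lower: "0 \<le> t \<Longrightarrow> start (idx t) \<le> t"
proof (cases "idx t")
  case (Suc m)
  then have "\<not> t < tm (Suc m)" unfolding idx_def by (metis lessI not_less_Least)
  then show ?thesis using Suc by (simp add: start_def)
qed (simp add: start_def)

lemma idx_eq: "n = 0 \<or> tm n \<le> t \<Longrightarrow> t < tm (Suc n) \<Longrightarrow> idx t = n"
  unfolding idx_def
proof (rule Least_equality)
  fix m assume h: "n = 0 \<or> tm n \<le> t" "t < tm (Suc m)"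
  show "n \<le> m"
  proof (rule ccontr)
    assume "\<not> n \<le> m"
    then have "tm (Suc m) \<le> tm n" "n \<noteq> 0" by (auto intro: tm_mono)
    then show False using h by simp
  qed
qed

lemma idx_ge: "tm n \<le> t \<Longrightarrow> t < T \<Longrightarrow> n \<le> idx t"
proof (rule ccontr)
  assume h: "tm n \<le> t" "t < T" "\<not> n \<le> idx t"
  then have "tm (Suc (idx t)) \<le> tm n" by (intro tm_mono) simp
  then show False using idx_upper[OF h(2)] h(1) by simp
qed

lemma stage_n: "stage L (1 / real N) (axs n) (axs (Suc n)) (N ^ n) (N ^ Suc n) (len n) (len (Suc n)) \<phi> (tm n) (tm (Suc n))"
  by unfold_locales (use L kj N clock tm_less in \<open>auto simp: axs_def len_def\<close>)

lemma idx_measurable: "idx \<in> measurable borel (count_space UNIV)"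
  unfolding idx_def by (rule measurable_Least) measurable

lemma rho_measurable [measurable]: "(\<lambda>p. rho (fst p) (snd p)) \<in> borel_measurable (borel \<Otimes>\<^sub>M borel)"
  unfolding rho_def
  by (rule measurable_compose_countable[OF _ measurable_compose[OF measurable_fst idx_measurable]])
    (unfold R_def, rule stage.rho_measurable[OF stage_n])

lemma vel_measurable [measurable]: "(\<lambda>p. vel (fst p) (snd p)) \<in> borel_measurable (borel \<Otimes>\<^sub>M borel)"
  unfolding vel_def
  by (rule measurable_compose_countable[OF _ measurable_compose[OF measurable_fst idx_measurable]])
    (unfold V_def, rule stage.vel_measurable'[OF stage_n])

lemma rho_t [measurable]: "rho t \<in> borel_measurable borel"
  unfolding rho_def R_def by (rule stage.rho_t_measurable[OF stage_n])

lemma vel_t [measurable]: "vel t \<in> borel_measurable borel"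
  unfolding vel_def V_def by (rule stage.vel_t_measurable[OF stage_n])

lemma rho_le_1: "\<bar>rho t x\<bar> \<le> 1"
  unfolding rho_def R_def by (rule stage.rho_le_1[OF stage_n])

lemma rho_periodic: "torus_periodic L (rho t)"
  unfolding rho_def R_def by (rule stage.rho_periodic[OF stage_n])

lemma vel_periodic: "torus_periodic L (vel t)"
  unfolding vel_def V_def by (rule stage.vel_periodic[OF stage_n])

lemma rho_L2: "torus_L2 L (rho t)"
proof -
  interpret FT: finite_measure "torus L :: (real^'n) measure" by (rule finite_measure_torus)
  have m: "rho t \<in> borel_measurable (torus L)" by (intro measurable_torusI) measurable
  then have "integrable (torus L) (\<lambda>x. (norm (rho t x))\<^sup>2)"
    using rho_le_1 by (intro FT.integrable_const_bound[of _ 1] AE_I2) (auto simp: abs_square_le_1)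
  then show ?thesis using m rho_periodic by (simp add: torus_L2_def)
qed

lemma energy: "(\<integral>\<^sup>+x. ennreal ((norm (vel t x))\<^sup>2) \<partial>torus L) \<le> ennreal E"
proof -
  let ?n = "idx t"
  have "(\<integral>\<^sup>+x. ennreal ((norm (vel t x))\<^sup>2) \<partial>torus L) \<le> ennreal (L ^ CARD('n) * (len ?n * clock_total (1 / real N) / (tm (Suc ?n) - tm ?n))\<^sup>2)"
    unfolding vel_def V_def by (rule stage.energy[OF stage_n])
  also have "len ?n * clock_total (1 / real N) / (tm (Suc ?n) - tm ?n) = L * clock_total (1 / real N) / (4 * D * (1 - 1 / real N))"
    unfolding tm_diff len_def using N_pow[of ?n] by simp
  also have "ennreal (L ^ CARD('n) * \<dots>\<^sup>2) \<le> ennreal E" by (intro ennreal_leI energy_le)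
  finally show ?thesis .
qed

lemma vel_L2: "torus_L2 L (vel t)" and vel_norm: "L2_norm L (vel t) \<le> sqrt E"
proof -
  have m: "vel t \<in> borel_measurable (torus L)" by (intro measurable_torusI) measurable
  then have i: "integrable (torus L) (\<lambda>x. (norm (vel t x))\<^sup>2)"
    using le_less_trans[OF energy[of t]] by (simp add: integrable_iff_bounded)
  then show "torus_L2 L (vel t)" using m vel_periodic by (simp add: torus_L2_def)
  have "(LINT x|torus L. (norm (vel t x))\<^sup>2) \<le> E" by (rule integral_real_bounded[OF E energy])
  then show "L2_norm L (vel t) \<le> sqrt E" by (simp add: L2_norm_def)
qed

lemma spacetime_Linf_rho: "spacetime_Linf L T rho"
  unfolding spacetime_Linf_def spacetime_def
proof
  have "(\<lambda>(t, x). rho t x) \<in> borel_measurable borel" using rho_measurable by (simp add: borel_prod split_beta')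
  then show "(\<lambda>(t, x). rho t x) \<in> borel_measurable (lebesgue_on ({0<..<T} \<times> torus_cell L))" by (rule measurable_lebesgue_onI)
qed (use rho_le_1 in \<open>auto intro!: exI[of _ 1] AE_I2\<close>)

lemma Linf_L2_vel: "Linf_L2 L T vel"
  unfolding Linf_L2_def spacetime_def
proof (intro conjI)
  have "(\<lambda>(t, x). vel t x) \<in> borel_measurable borel" using vel_measurable by (simp add: borel_prod split_beta')
  then show "(\<lambda>(t, x). vel t x) \<in> borel_measurable (lebesgue_on ({0<..<T} \<times> torus_cell L))" by (rule measurable_lebesgue_onI)
qed (use vel_L2 vel_norm in \<open>auto intro!: exI[of _ "sqrt E"] AE_I2\<close>)

lemma Linf_L2_norm_vel: "Linf_L2_norm L T vel \<le> sqrt E"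
  unfolding Linf_L2_norm_def
  by (rule cInf_lower) (use vel_norm E in \<open>auto intro!: bdd_belowI[of _ 0] AE_I2\<close>)

lemma AE_abs_rho: "AE (t, x) in spacetime L T. \<bar>rho t x\<bar> = 1"
proof (rule AE_spacetimeI)
  have "{p \<in> space (borel \<Otimes>\<^sub>M borel). \<bar>rho (fst p) (snd p)\<bar> = 1} \<in> sets (borel \<Otimes>\<^sub>M borel)" by measurable
  then show "{p. \<bar>rho (fst p) (snd p)\<bar> = 1} \<in> sets (borel \<Otimes>\<^sub>M borel)" by (simp add: space_pair_measure)
  show "AE x in torus L. \<bar>rho t x\<bar> = 1" for t
    unfolding rho_def R_def by (rule stage.AE_abs_rho[OF stage_n])
qed

text \<open>At the end of a stage and at the beginning of the next one the density consists of the same stripes.\<close>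

lemma AE_match: "AE x in torus L. R n (tm (Suc n)) x = R (Suc n) (tm (Suc n)) x"
proof -
  have "AE x in torus L. R n (tm (Suc n)) x = - sgn (zig (x $ axs (Suc n) / len (Suc n)))"
    unfolding R_def by (rule stage.AE_rho_end[OF stage_n])
  moreover have "R (Suc n) (tm (Suc n)) x = - sgn (zig (x $ axs (Suc n) / len (Suc n)))" for x
    unfolding R_def by (rule stage.rho_before[OF stage_n]) simp
  ultimately show ?thesis by simp
qed

lemma rho_before: "t \<le> T - D \<Longrightarrow> rho t x = - sgn (zig (x $ k / (L / 4)))"
proof -
  assume t: "t \<le> T - D"
  then have "idx t = 0" using tm_less[of 0] tm_0 by (intro idx_eq) auto
  then show ?thesis
    using stage.rho_before[OF stage_n[of 0], of t x] t by (simp add: rho_def R_def tm_0 axs_def len_def)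
qed

text \<open>Inside a stage this is continuity of the density of the stage; at a switching time both
adjacent stages have the same value at almost every point.\<close>

lemma rho_tendsto_AE:
  assumes t0: "0 \<le> t0" "t0 < T"
  shows "AE x in torus L. ((\<lambda>t. rho t x) \<longlongrightarrow> rho t0 x) (at t0 within {0..<T})"
proof -
  let ?n = "idx t0"
  have up: "t0 < tm (Suc ?n)" by (rule idx_upper[OF t0(2)])
  have cn: "AE x in torus L. ((\<lambda>t. R m t x) \<longlongrightarrow> R m t0 x) (at t0 within {0..<T})" for m
    unfolding R_def by (rule stage.rho_continuous_AE[OF stage_n])
  show ?thesis
  proof (cases "?n = 0 \<or> tm ?n < t0")
    case True
    have ev: "\<forall>\<^sub>F t in at t0 within {0..<T}. R ?n t x = rho t x" for x
    proof -
      let ?S = "if ?n = 0 then {..<tm (Suc ?n)} else {tm ?n<..<tm (Suc ?n)}"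
      have "open ?S" "t0 \<in> ?S" using up True by auto
      then have "\<forall>\<^sub>F t in at t0. t \<in> ?S" by (rule eventually_at_in_open')
      then have "\<forall>\<^sub>F t in at t0 within {0..<T}. t \<in> ?S" by (rule filter_leD[OF at_le[OF subset_UNIV]])
      then show ?thesis
      proof eventually_elim
        case (elim t)
        then have "idx t = ?n" by (intro idx_eq) (auto split: if_splits)
        then show ?case by (simp add: rho_def)
      qed
    qed
    have tr: "((\<lambda>t. R ?n t x) \<longlongrightarrow> R ?n t0 x) (at t0 within {0..<T}) \<Longrightarrow> ((\<lambda>t. rho t x) \<longlongrightarrow> R ?n t0 x) (at t0 within {0..<T})" for x
      by (rule tendsto_cong[THEN iffD1, OF ev])
    show ?thesis using cn[of ?n] unfolding rho_def[of t0] by eventually_elim (rule tr)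
  next
    case False
    then obtain m where m: "?n = Suc m" by (cases ?n) auto
    have t0n: "t0 = tm (Suc m)" using False idx_lower[OF t0(1)] m by (simp add: start_def)
    have ev: "\<forall>\<^sub>F t in at t0 within {0..<T}. rho t x = R m t x \<or> rho t x = R (Suc m) t x" for x
    proof -
      let ?S = "if m = 0 then {..<tm (Suc ?n)} else {tm m<..<tm (Suc ?n)}"
      have "open ?S" "t0 \<in> ?S" using up tm_less[of m] t0n by auto
      then have "\<forall>\<^sub>F t in at t0. t \<in> ?S" by (rule eventually_at_in_open')
      then have "\<forall>\<^sub>F t in at t0 within {0..<T}. t \<in> ?S" by (rule filter_leD[OF at_le[OF subset_UNIV]])
      then show ?thesis
      proof eventually_elim
        case (elim t)
        show ?case
        proof (cases "t < tm (Suc m)")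
          case True
          then have "idx t = m" using elim by (intro idx_eq) (auto split: if_splits)
          then show ?thesis by (simp add: rho_def)
        next
          case False
          then have "idx t = Suc m" using elim m by (intro idx_eq) (auto split: if_splits)
          then show ?thesis by (simp add: rho_def)
        qed
      qed
    qed
    show ?thesis
      using cn[of m] cn[of "Suc m"] AE_match[of m]
    proof eventually_elim
      case (elim x)
      have r0: "rho t0 x = R (Suc m) t0 x" by (simp add: rho_def m)
      have r1: "R m t0 x = R (Suc m) t0 x" using elim(3) t0n by simp
      show ?case
        unfolding r0
      proof (rule topological_tendstoI)
        fix S assume S: "open S" "R (Suc m) t0 x \<in> S"
        have "\<forall>\<^sub>F t in at t0 within {0..<T}. R m t x \<in> S" "\<forall>\<^sub>F t in at t0 within {0..<T}. R (Suc m) t x \<in> S"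
          using topological_tendstoD[OF elim(1) S(1)] topological_tendstoD[OF elim(2) S(1)] S(2) r1 by simp_all
        with ev[of x] show "\<forall>\<^sub>F t in at t0 within {0..<T}. rho t x \<in> S" by eventually_elim auto
      qed
    qed
  qed
qed

text \<open>Pointwise convergence almost everywhere of densities bounded by one, by dominated convergence.\<close>

lemma weakly_continuous_rho: "weakly_continuous L T rho"
  unfolding weakly_continuous_def
proof (intro conjI ballI allI impI)
  show "torus_L2 L (rho t)" for t by (rule rho_L2)
  fix g :: "real^'n \<Rightarrow> real" assume g: "torus_L2 L g"
  interpret FT: finite_measure "torus L :: (real^'n) measure" by (rule finite_measure_torus)
  have gm: "g \<in> borel_measurable (torus L)" using g by (simp add: torus_L2_def)
  have gi: "integrable (torus L) (\<lambda>x. \<bar>g x\<bar>)"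
  proof (rule Bochner_Integration.integrable_bound)
    show "integrable (torus L) (\<lambda>x. 1 + (norm (g x))\<^sup>2)" using g by (intro Bochner_Integration.integrable_add) (auto simp: torus_L2_def)
    have "\<bar>y\<bar> \<le> 1 + y\<^sup>2" for y :: real
      using sum_squares_bound[of 1 "\<bar>y\<bar>"] by (simp add: power2_abs)
    then show "AE x in torus L. norm \<bar>g x\<bar> \<le> norm (1 + (norm (g x))\<^sup>2)" by (intro AE_I2) simp
  qed (use gm in simp)
  show "continuous_on {0..<T} (\<lambda>t. LINT x|torus L. rho t x * g x)"
    unfolding continuous_on_sequentially o_def
  proof (intro allI ballI impI, elim conjE)
    fix u :: "nat \<Rightarrow> real" and t0 assume t0: "t0 \<in> {0..<T}" and u: "\<forall>n. u n \<in> {0..<T}" "u \<longlonglongrightarrow> t0"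
    show "(\<lambda>n. LINT x|torus L. rho (u n) x * g x) \<longlonglongrightarrow> (LINT x|torus L. rho t0 x * g x)"
    proof (rule integral_dominated_convergence[where w = "\<lambda>x. \<bar>g x\<bar>"])
      have rm: "rho t \<in> borel_measurable (torus L)" for t by (intro measurable_torusI) measurable
      show "(\<lambda>x. rho t0 x * g x) \<in> borel_measurable (torus L)" "(\<lambda>x. rho (u n) x * g x) \<in> borel_measurable (torus L)" for n
        using rm gm by simp_all
      show "AE x in torus L. (\<lambda>n. rho (u n) x * g x) \<longlonglongrightarrow> rho t0 x * g x"
        using rho_tendsto_AE[of t0]
      proof -
        have "AE x in torus L. ((\<lambda>t. rho t x) \<longlongrightarrow> rho t0 x) (at t0 within {0..<T})" using t0 by (intro rho_tendsto_AE) auto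
        then show ?thesis
        proof eventually_elim
          case (elim x)
          have "continuous (at t0 within {0..<T}) (\<lambda>t. rho t x)" using elim by (simp add: continuous_within)
          then have "(\<lambda>n. rho (u n) x) \<longlonglongrightarrow> rho t0 x" using u unfolding continuous_within_sequentially o_def by blast
          then show ?case by (intro tendsto_intros)
        qed
      qed
      show "AE x in torus L. norm (rho (u n) x * g x) \<le> \<bar>g x\<bar>" for n
        using mult_right_mono[OF rho_le_1 abs_ge_zero] by (auto simp: abs_mult)
    qed (rule gi)
  qed
qed

text \<open>Summation over the stages: the boundary terms at the switching times cancel by \<open>AE_match\<close>.\<close>

lemma transport_stagewise:
  assumes td: "test_data L s0 \<psi> D1 D2 B" and s0: "s0 \<le> T"
    and fl: "fl \<Longrightarrow> r = R" "\<not> fl \<Longrightarrow> r = (\<lambda>n t x. 1)"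
  shows "start n \<le> s \<Longrightarrow> s \<le> tm (Suc n) \<Longrightarrow> s \<le> s0 \<Longrightarrow>
    integrable lborel (\<lambda>t. indicator {0<..<s} t * (LINT x|torus L. r (idx t) t x * D1 t x + r (idx t) t x * (vel t x \<bullet> D2 t x))) \<and>
    (LINT t|lborel. indicator {0<..<s} t * (LINT x|torus L. r (idx t) t x * D1 t x + r (idx t) t x * (vel t x \<bullet> D2 t x))) =
      (LINT x|torus L. r n s x * \<psi> s x) - (LINT x|torus L. r 0 0 x * \<psi> 0 x)"
proof (induction n arbitrary: s)
  have rr: "r n = stage_rho (axs n) (axs (Suc n)) (len n) (len (Suc n)) \<phi> (tm n) (tm (Suc n)) \<or> r n = (\<lambda>t x. 1)" for n
    using fl by (cases fl) (auto simp: R_def)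
  note tr = stage.transport[OF stage_n td _ _ _ _ rr, folded V_def]
  let ?F = "\<lambda>t. LINT x|torus L. r (idx t) t x * D1 t x + r (idx t) t x * (vel t x \<bullet> D2 t x)"
  let ?Fn = "\<lambda>n t. LINT x|torus L. r n t x * D1 t x + r n t x * (V n t x \<bullet> D2 t x)"
  have eqF: "(\<lambda>t. indicator {a<..<b} t * ?F t) = (\<lambda>t. indicator {a<..<b} t * ?Fn n t)" if "n = 0 \<or> tm n \<le> a" "b \<le> tm (Suc n)" for n a b
  proof
    fix t
    show "indicator {a<..<b} t * ?F t = indicator {a<..<b} t * ?Fn n t"
    proof (cases "t \<in> {a<..<b}")
      case True
      then have "idx t = n" using that by (intro idx_eq) auto
      then show ?thesis by (simp add: vel_def)
    qed simp
  qed
  {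
    case 0
    then show ?case
      using tr[of 0 s 0] unfolding eqF[of 0 0 s, OF disjI1[OF refl] 0(2)] by (simp add: start_def)
  next
    case (Suc n)
    define a where "a = tm (Suc n)"
    have a: "0 \<le> a" "a \<le> s" "s \<le> tm (Suc (Suc n))" "s \<le> s0" using Suc.prems tm_pos[of n] by (auto simp: a_def start_def)
    have sn: "start n \<le> a" using tm_less[of n] tm_pos[of n] tm_pos[of 0] by (auto simp: a_def start_def)
    have IH: "integrable lborel (\<lambda>t. indicator {0<..<a} t * ?F t)"
      "(LINT t|lborel. indicator {0<..<a} t * ?F t) = (LINT x|torus L. r n a x * \<psi> a x) - (LINT x|torus L. r 0 0 x * \<psi> 0 x)"
      using Suc.IH[OF sn] a by (auto simp: a_def)
    have new: "integrable lborel (\<lambda>t. indicator {a<..<s} t * ?F t)"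
      "(LINT t|lborel. indicator {a<..<s} t * ?F t) = (LINT x|torus L. r (Suc n) s x * \<psi> s x) - (LINT x|torus L. r (Suc n) a x * \<psi> a x)"
      using tr[of a s "Suc n"] a unfolding eqF[of "Suc n" a s, OF disjI2 a(3), unfolded a_def, OF order_refl, folded a_def] by auto
    have pm: "\<psi> a \<in> borel_measurable (torus L)"
    proof -
      interpret test_data L s0 \<psi> D1 D2 B by (rule td)
      have "continuous_on UNIV (\<lambda>x::real^'n. (a, x))" by (intro continuous_on_Pair continuous_on_id continuous_on_const)
      moreover have "range (Pair a) \<subseteq> {0..s0} \<times> (UNIV :: (real^'n) set)" using a by auto
      ultimately have "continuous_on UNIV (\<psi> a)" using continuous_on_compose2[OF psic, of UNIV "Pair a"] by simp
      then show ?thesis by (intro measurable_torusI borel_measurable_continuous_onI)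
    qed
    have rm: "r n t \<in> borel_measurable (torus L)" for n t
    proof (cases fl)
      case True
      have "R n t \<in> borel_measurable borel" unfolding R_def by (rule stage.rho_t_measurable[OF stage_n])
      then show ?thesis using fl(1)[OF True] by (simp add: measurable_torusI)
    qed (use fl in simp)
    have "AE x in torus L. r n a x = r (Suc n) a x"
      using AE_match[of n] fl by (cases fl) (auto simp: a_def)
    then have match: "(LINT x|torus L. r n a x * \<psi> a x) = (LINT x|torus L. r (Suc n) a x * \<psi> a x)"
      using rm pm by (intro integral_cong_AE) (auto elim!: eventually_mono)
    have "AE t in lborel. t \<noteq> a" by (rule AE_lborel_singleton)
    then have ae: "AE t in lborel. indicator {0<..<a} t * ?F t + indicator {a<..<s} t * ?F t = indicator {0<..<s} t * ?F t"
      by eventually_elim (use a in \<open>auto simp: indicator_def\<close>)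
    have sum: "indicator {0<..<s} t * ?F t = indicator {0<..<a} t * ?F t + indicator {a<..<s} t * ?F t + indicator {a} t * indicator {0<..<s} t * ?F t" for t
      using a by (auto simp: indicator_def)
    have null: "integrable lborel (\<lambda>t. indicator {a} t * indicator {0<..<s} t * ?F t)"
      "(LINT t|lborel. indicator {a} t * indicator {0<..<s} t * ?F t) = 0"
    proof -
      have e: "(\<lambda>t. indicator {a} t * indicator {0<..<s} t * ?F t) = (\<lambda>t. indicator {a} t * (indicator {0<..<s} a * ?F a))"
        by (auto simp: indicator_def fun_eq_iff)
      show "integrable lborel (\<lambda>t. indicator {a} t * indicator {0<..<s} t * ?F t)"
        "(LINT t|lborel. indicator {a} t * indicator {0<..<s} t * ?F t) = 0" unfolding e by simp_all
    qed
    show ?case unfolding sum using IH new null match by simp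
  }
qed

lemma transport_identity:
  assumes td: "test_data L s0 \<psi> D1 D2 B" and s0: "s0 \<le> T" and s: "0 \<le> s" "s < T" "s \<le> s0"
    and r: "r = R \<or> r = (\<lambda>n t x. 1)"
  shows "integrable lborel (\<lambda>t. indicator {0<..<s} t * (LINT x|torus L. r (idx t) t x * D1 t x + r (idx t) t x * (vel t x \<bullet> D2 t x)))"
    and "(LINT t|lborel. indicator {0<..<s} t * (LINT x|torus L. r (idx t) t x * D1 t x + r (idx t) t x * (vel t x \<bullet> D2 t x))) =
      (LINT x|torus L. r (idx s) s x * \<psi> s x) - (LINT x|torus L. r 0 0 x * \<psi> 0 x)"
  using transport_stagewise[OF td s0, of "r = R" r "idx s" s] s(3) r idx_lower[OF s(1)] idx_upper[OF s(2)]
  by auto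

text \<open>By the dual estimate the norm during stage \<open>n\<close> is at most a constant times the period \<open>L / N^n\<close>.\<close>

lemma Hminus1_tendsto: "((\<lambda>t. Hminus1_norm L (rho t)) \<longlongrightarrow> 0) (at_left T)"
proof -
  define C where "C n = sqrt (L ^ CARD('n)) * (len n + len (Suc n))" for n
  have len: "len n > 0" for n using L N_pow[of n] by (simp add: len_def)
  have len_le: "len m \<le> len n" if "n \<le> m" for n m
    unfolding len_def using L N that N_pow[of n] by (intro divide_left_mono) (auto simp: power_increasing)
  have bound: "0 \<le> Hminus1_norm L (rho t) \<and> Hminus1_norm L (rho t) \<le> C (idx t)" for t
  proof -
    have "\<bar>LINT x|torus L. rho t x * \<psi> x\<bar> \<le> C (idx t) * L2_norm L (grad \<psi>)" if "torus_smooth L \<psi>" for \<psi>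
      unfolding rho_def R_def C_def by (rule stage.rho_dual_estimate[OF stage_n that])
    moreover have "C (idx t) \<ge> 0" unfolding C_def using L len[of "idx t"] len[of "Suc (idx t)"] by (intro mult_nonneg_nonneg) auto
    ultimately show ?thesis using Hminus1_norm_le[OF L rho_L2, of t "C (idx t)"] by auto
  qed
  show ?thesis
  proof (rule tendstoI)
    fix e :: real assume e: "e > 0"
    define A where "A = sqrt (L ^ CARD('n)) * L"
    have A: "A > 0" using L by (simp add: A_def)
    obtain n where n: "A / e < real N ^ n" using real_arch_pow[of "real N" "A / e"] N by auto
    have Cn: "C m < e" if "n \<le> m" for m
    proof -
      have "len m + len (Suc m) \<le> 2 * len n" using len_le[OF that] len_le[of n "Suc m"] that by simp
      also have "\<dots> \<le> L / real (N ^ n)" using L N_pow[of n] by (simp add: len_def field_simps)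
      finally have "C m \<le> sqrt (L ^ CARD('n)) * (L / real (N ^ n))" unfolding C_def using L by (intro mult_left_mono) auto
      also have "\<dots> = A / real N ^ n" by (simp add: A_def)
      also have "\<dots> < e" using n e N_pow[of n] by (simp add: field_simps)
      finally show ?thesis .
    qed
    have "\<forall>\<^sub>F t in at_left T. t \<in> {tm n<..<T}" by (rule eventually_at_leftI[OF _ tm_less_T]) simp
    then show "\<forall>\<^sub>F t in at_left T. dist (Hminus1_norm L (rho t)) 0 < e"
    proof eventually_elim
      case (elim t)
      then have "n \<le> idx t" by (intro idx_ge) auto
      from Cn[OF this] bound[of t] show ?case by simp
    qed
  qed
qed

end

section \<open>The cascade solves the equations\<close>

lemma LINT_lebesgue_on_interval:
  fixes F G :: "real \<Rightarrow> real"
  assumes m: "(\<lambda>t. indicator {0<..<s} t * G t) \<in> borel_measurable lborel" and s: "s \<le> T"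
    and eq: "\<And>t. 0 < t \<Longrightarrow> t < T \<Longrightarrow> F t = indicator {0<..<s} t * G t"
  shows "(LINT t|lebesgue_on {0<..<T}. F t) = (LINT t|lborel. indicator {0<..<s} t * G t)"
proof -
  have "(LINT t|lebesgue_on {0<..<T}. F t) = (LINT t|lebesgue. indicator {0<..<T} t *\<^sub>R F t)"
    by (rule integral_restrict_space) simp
  also have "\<dots> = (LINT t|lebesgue. indicator {0<..<s} t * G t)"
    by (rule Bochner_Integration.integral_cong) (use eq s in \<open>auto simp: indicator_def\<close>)
  also have "\<dots> = (LINT t|lborel. indicator {0<..<s} t * G t)" by (rule integral_completion) (rule m)
  finally show ?thesis .
qed

context cascade
begin

lemma T_pos: "T > 0" using D by simp

lemma idx_0: "idx 0 = 0" using tm_pos[of 0] by (intro idx_eq) auto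

lemma rho_initial:
  fixes \<rho>\<^sub>0 :: "real^'n \<Rightarrow> real"
  assumes "\<And>x. x $ k \<in> {- L / 2<..<0} \<Longrightarrow> \<rho>\<^sub>0 x = 1" and "\<And>x. x $ k \<in> {0<..<L / 2} \<Longrightarrow> \<rho>\<^sub>0 x = - 1"
  shows "AE x in torus L. rho 0 x = \<rho>\<^sub>0 x"
proof -
  have plane: "AE x in lebesgue. x $ k \<noteq> c" for c :: real
  proof -
    have "negligible {x :: real^'n. x \<bullet> axis k 1 = c}" by (rule negligible_standard_hyperplane) (auto simp: Basis_vec_def)
    then have "{x :: real^'n. x $ k = c} \<in> null_sets lebesgue" by (simp add: negligible_iff_null_sets inner_axis)
    from AE_not_in[OF this] show ?thesis by simp
  qed
  have r: "rho 0 x = - sgn (zig (x $ k / (L / 4)))" for x by (rule rho_before) (use D in simp)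
  show ?thesis
    unfolding AE_torus_iff using plane[of 0] plane[of "L / 2"] plane[of "- L / 2"]
  proof eventually_elim
    case (elim x)
    show ?case
    proof
      assume "x \<in> torus_cell L"
      then have "- L / 2 \<le> x $ k" "x $ k \<le> L / 2" unfolding torus_cell_iff by blast+
      then have "x $ k \<in> {- L / 2<..<0} \<or> x $ k \<in> {0<..<L / 2}" using elim by auto
      then show "rho 0 x = \<rho>\<^sub>0 x"
      proof
        assume x: "x $ k \<in> {- L / 2<..<0}"
        then have "zig (- (x $ k / (L / 4))) > 0" using L by (intro zig_pos) (auto simp: field_simps)
        then show ?thesis using assms(1)[OF x] r[of x] by (simp add: zig_minus)
      next
        assume x: "x $ k \<in> {0<..<L / 2}"
        then have "zig (x $ k / (L / 4)) > 0" using L by (intro zig_pos) (auto simp: field_simps)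
        then show ?thesis using assms(2)[OF x] r[of x] by simp
      qed
    qed
  qed
qed

text \<open>The test function vanishes before the time \<open>T\<close>, where infinitely many stages accumulate; finitely
many of them suffice.\<close>

lemma transport_equation:
  assumes \<psi>: "torus_test_function L T \<psi>"
  shows "(LINT t|lebesgue_on {0<..<T}. LINT x|torus L. rho t x * deriv (\<lambda>s. \<psi> s x) t + rho t x * (vel t x \<bullet> grad (\<psi> t) x))
     = - (LINT x|torus L. rho 0 x * \<psi> 0 x)"
proof -
  obtain s where s: "s < T" "\<And>t x. t \<in> {0..<T} \<Longrightarrow> s < t \<Longrightarrow> \<psi> t x = 0"
    using \<psi> unfolding torus_test_function_def by blast
  \<comment> \<open>A positive time before \<open>T\<close> after which the test function is zero; the \<open>s\<close> provided may be negative.\<close>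
  define s' where "s' = max ((s + T) / 2) (T / 2)"
  have s': "0 < s'" "s' < T" "s < s'" using s(1) T_pos by (auto simp: s'_def max_def)
  have sm: "torus_smooth_on L {0..<T} \<psi>" using \<psi> by (simp add: torus_test_function_def)
  have sub: "{0..s'} \<subseteq> {0..<T}" using s' by auto
  obtain D1 D2 B where td: "test_data L s' \<psi> D1 D2 B"
    and D1: "\<And>t x. t \<in> {0<..<s'} \<Longrightarrow> D1 t x = deriv (\<lambda>s. \<psi> s x) t"
    and D2: "\<And>t x. t \<in> {0<..<s'} \<Longrightarrow> D2 t x = grad (\<psi> t) x"
    by (rule test_data_exists[OF L sm sub s'(1)]) blast
  let ?G = "\<lambda>t. LINT x|torus L. R (idx t) t x * D1 t x + R (idx t) t x * (vel t x \<bullet> D2 t x)"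
  have tr: "integrable lborel (\<lambda>t. indicator {0<..<s'} t * ?G t)"
    "(LINT t|lborel. indicator {0<..<s'} t * ?G t) = (LINT x|torus L. R (idx s') s' x * \<psi> s' x) - (LINT x|torus L. R 0 0 x * \<psi> 0 x)"
    using transport_identity[OF td less_imp_le[OF s'(2)] less_imp_le[OF s'(1)] s'(2) order_refl disjI1[OF refl]] by auto
  have eq: "(LINT x|torus L. rho t x * deriv (\<lambda>s. \<psi> s x) t + rho t x * (vel t x \<bullet> grad (\<psi> t) x)) = indicator {0<..<s'} t * ?G t"
    if t: "0 < t" "t < T" for t
  proof (cases "t < s'")
    case True
    then show ?thesis using t D1[of t] D2[of t] by (simp add: rho_def)
  next
    case False
    have "deriv (\<lambda>s. \<psi> s x) t = 0" for x
    proof -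
      have "\<forall>\<^sub>F u in nhds t. \<psi> u x = 0"
        unfolding eventually_nhds using False t s s' by (intro exI[of _ "{max 0 s<..<T}"]) auto
      then have "deriv (\<lambda>s. \<psi> s x) t = deriv (\<lambda>s. 0) t" by (rule deriv_cong_ev) simp
      then show ?thesis by simp
    qed
    moreover have "grad (\<psi> t) x = 0" for x
    proof (rule grad_eqI)
      have "\<psi> t = (\<lambda>x. 0)" using False t s' s(2)[of t] by auto
      moreover have "(\<bullet>) (0 :: real^'n) = (\<lambda>v. 0)" by auto
      ultimately show "(\<psi> t has_derivative (\<bullet>) 0) (at x)" by simp
    qed
    ultimately show ?thesis using False by simp
  qed
  have "(LINT t|lebesgue_on {0<..<T}. LINT x|torus L. rho t x * deriv (\<lambda>s. \<psi> s x) t + rho t x * (vel t x \<bullet> grad (\<psi> t) x))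
     = (LINT t|lborel. indicator {0<..<s'} t * ?G t)"
    by (rule LINT_lebesgue_on_interval[OF borel_measurable_integrable[OF tr(1)] less_imp_le[OF s'(2)] eq])
  moreover have "\<psi> s' x = 0" for x using s(2)[of s' x] s' by simp
  ultimately show ?thesis using tr(2) by (simp add: rho_def[of 0] idx_0)
qed

text \<open>Here the test function reaches up to the final time. The integral up to every earlier time is zero, and
the remainder is controlled by the energy bound.\<close>

lemma divergence_free:
  assumes \<psi>: "torus_smooth_on L {0..T} \<psi>"
  shows "(LINT t|lebesgue_on {0<..<T}. LINT x|torus L. vel t x \<bullet> grad (\<psi> t) x) = 0"
proof -
  obtain D1 D2 B where td: "test_data L T \<psi> D1 D2 B"
    and D2: "\<And>t x. t \<in> {0<..<T} \<Longrightarrow> D2 t x = grad (\<psi> t) x"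
    by (rule test_data_exists[OF L \<psi> order_refl T_pos]) blast
  interpret test_data L T \<psi> D1 D2 B by (rule td)
  interpret FT: finite_measure "torus L :: (real^'n) measure" by (rule finite_measure_torus)
  let ?H = "\<lambda>t. LINT x|torus L. vel t x \<bullet> D2 t x"
  have D1t: "D1 t \<in> borel_measurable borel" and D2t: "D2 t \<in> borel_measurable borel" for t
    using measurable_compose[OF measurable_Pair[OF measurable_const[of t borel borel] measurable_ident] D1m]
      measurable_compose[OF measurable_Pair[OF measurable_const[of t borel borel] measurable_ident] D2m] by (simp_all add: id_def)
  have iD1: "integrable (torus L) (D1 t)" if "0 < t" "t < T" for t
    using bnd(1)[of t] that by (intro FT.integrable_const_bound[of _ B] AE_I2 measurable_torusI D1t) auto
  have vL: "L2fun (torus L) (vel t)" for t using vel_L2[of t] by (simp add: L2fun_def torus_L2_def)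
  have D2sq: "(norm (D2 t x))\<^sup>2 \<le> B\<^sup>2" if "0 < t" "t < T" for t x
    using bnd(2)[of t x] that by (intro power_mono) auto
  have DL: "L2fun (torus L) (D2 t)" if t: "0 < t" "t < T" for t
    unfolding L2fun_def
  proof
    show m: "D2 t \<in> borel_measurable (torus L)" by (rule measurable_torusI[OF D2t])
    show "integrable (torus L) (\<lambda>x. (norm (D2 t x))\<^sup>2)"
      using D2sq[OF t] m by (intro FT.integrable_const_bound[of _ "B\<^sup>2"] AE_I2) auto
  qed
  have zero: "integrable lborel (\<lambda>t. indicator {0<..<s} t * ?H t)" "(LINT t|lborel. indicator {0<..<s} t * ?H t) = 0"
    if s: "0 \<le> s" "s < T" for s
  proof -
    let ?G = "\<lambda>t. LINT x|torus L. 1 * D1 t x + 1 * (vel t x \<bullet> D2 t x)"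
    note tr = transport_identity[OF td order_refl s less_imp_le[OF s(2)] disjI2[OF refl]]
    note st = static_transport[OF td s(1) less_imp_le[OF s(2)]]
    have e: "indicator {0<..<s} t * ?H t = indicator {0<..<s} t * ?G t - indicator {0<..<s} t * (LINT x|torus L. D1 t x)" for t
    proof (cases "t \<in> {0<..<s}")
      case True
      then have "0 < t" "t < T" using s by auto
      then have "?G t = (LINT x|torus L. D1 t x) + ?H t"
        using iD1[of t] L2fun_integrable_inner[OF vL DL, of t] by simp
      then show ?thesis using True by simp
    qed simp
    show "integrable lborel (\<lambda>t. indicator {0<..<s} t * ?H t)"
      unfolding e by (rule Bochner_Integration.integrable_diff[OF tr(1) st(1)])
    show "(LINT t|lborel. indicator {0<..<s} t * ?H t) = 0"
      unfolding e Bochner_Integration.integral_diff[OF tr(1) st(1)] tr(2) st(2) by simp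
  qed
  define C where "C = sqrt (E * (B\<^sup>2 * L ^ CARD('n)))"
  have HC: "\<bar>?H t\<bar> \<le> C" if t: "0 < t" "t < T" for t
  proof -
    have "(?H t)\<^sup>2 \<le> (LINT x|torus L. (norm (vel t x))\<^sup>2) * (LINT x|torus L. (norm (D2 t x))\<^sup>2)"
      by (rule L2fun_Cauchy_Schwarz[OF vL DL[OF t]])
    also have "\<dots> \<le> E * (B\<^sup>2 * L ^ CARD('n))"
    proof (rule mult_mono)
      show "(LINT x|torus L. (norm (vel t x))\<^sup>2) \<le> E" by (rule integral_real_bounded[OF E energy])
      have "(LINT x|torus L. (norm (D2 t x))\<^sup>2) \<le> (LINT x|(torus L :: (real^'n) measure). B\<^sup>2)"
        using DL[OF t] D2sq[OF t] by (intro integral_mono) (auto simp: L2fun_def)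
      then show "(LINT x|torus L. (norm (D2 t x))\<^sup>2) \<le> B\<^sup>2 * L ^ CARD('n)"
        using L by (simp add: measure_torus_space mult.commute)
    qed (use E in \<open>auto intro!: integral_nonneg_AE\<close>)
    finally show ?thesis unfolding C_def by (intro real_le_rsqrt) simp
  qed
  \<comment> \<open>Times that increase to \<open>T\<close>, starting from \<open>0\<close>.\<close>
  define u where "u n = T * (1 - 1 / real (Suc n))" for n
  have u: "0 \<le> u n" "u n < T" for n using T_pos by (auto simp: u_def field_simps)
  have "u \<longlonglongrightarrow> T * (1 - 0)"
    unfolding u_def by (intro tendsto_intros LIMSEQ_Suc[OF lim_1_over_n])
  then have uT: "u \<longlonglongrightarrow> T" by simp
  have lim: "(\<lambda>n. indicator {0<..<u n} t * ?H t) \<longlonglongrightarrow> indicator {0<..<T} t * ?H t" for t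
  proof (cases "0 < t \<and> t < T")
    case True
    then have "\<forall>\<^sub>F n in sequentially. t < u n" using order_tendstoD(1)[OF uT] by blast
    then have "\<forall>\<^sub>F n in sequentially. indicator {0<..<u n} t * ?H t = indicator {0<..<T} t * ?H t"
      by eventually_elim (use True in simp)
    then show ?thesis by (rule tendsto_eventually)
  next
    case False
    then have "\<not> (0 < t \<and> t < u n)" for n using u(2)[of n] by auto
    then have "indicator {0<..<u n} t = (0::real)" for n by (simp add: indicator_def)
    moreover have "indicator {0<..<T} t = (0::real)" using False by (simp add: indicator_def)
    ultimately show ?thesis by simp
  qed
  have mn: "(\<lambda>t. indicator {0<..<u n} t * ?H t) \<in> borel_measurable lborel" for n
    by (rule borel_measurable_integrable[OF zero(1)[OF u]])
  have mT: "(\<lambda>t. indicator {0<..<T} t * ?H t) \<in> borel_measurable lborel"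
    by (rule borel_measurable_LIMSEQ_real[OF lim mn])
  have "(\<lambda>n. LINT t|lborel. indicator {0<..<u n} t * ?H t) \<longlonglongrightarrow> (LINT t|lborel. indicator {0<..<T} t * ?H t)"
  proof (rule integral_dominated_convergence[where w = "\<lambda>t. indicator {0<..<T} t * C"])
    show "AE t in lborel. norm (indicator {0<..<u n} t * ?H t) \<le> indicator {0<..<T} t * C" for n
    proof (rule AE_I2)
      fix t :: real
      show "norm (indicator {0<..<u n} t * ?H t) \<le> indicator {0<..<T} t * C"
      proof (cases "0 < t \<and> t < u n")
        case True
        then have "0 < t" "t < T" using u(2)[of n] by auto
        then show ?thesis using True HC[of t] by simp
      next
        case False
        then show ?thesis using E L by (simp add: C_def indicator_def)
      qed
    qed
    show "integrable lborel (\<lambda>t. indicator {0<..<T} t * C)"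
      by (intro integrable_mult_left integrable_real_indicator) (use T_pos in auto)
  qed (use mT mn lim in auto)
  then have "(LINT t|lborel. indicator {0<..<T} t * ?H t) = 0"
    unfolding zero(2)[OF u] by (rule LIMSEQ_unique[OF _ tendsto_const])
  moreover have "(LINT t|lebesgue_on {0<..<T}. LINT x|torus L. vel t x \<bullet> grad (\<psi> t) x) = (LINT t|lborel. indicator {0<..<T} t * ?H t)"
    by (rule LINT_lebesgue_on_interval[OF mT order_refl]) (use D2 in simp)
  ultimately show ?thesis by simp
qed

lemma is_solution:
  assumes \<rho>\<^sub>0: "torus_Linf L \<rho>\<^sub>0" and "\<And>x. x $ k \<in> {- L / 2<..<0} \<Longrightarrow> \<rho>\<^sub>0 x = 1" and "\<And>x. x $ k \<in> {0<..<L / 2} \<Longrightarrow> \<rho>\<^sub>0 x = - 1"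
  shows "distributional_solution L T \<rho>\<^sub>0 rho vel"
  unfolding distributional_solution_def
proof (intro conjI allI impI)
  fix \<psi> :: "real \<Rightarrow> real^'n \<Rightarrow> real" assume \<psi>: "torus_test_function L T \<psi>"
  have "Ck_on 0 ({0..<T} \<times> UNIV) (\<lambda>(t, x). \<psi> t x)"
    using \<psi> unfolding torus_test_function_def torus_smooth_on_def smooth_on_def by blast
  then have c: "continuous_on ({0..<T} \<times> UNIV) (\<lambda>(t, x). \<psi> t x)" by simp
  have "continuous_on UNIV (\<lambda>x::real^'n. (0::real, x))" by (intro continuous_on_Pair continuous_on_id continuous_on_const)
  moreover have "range (Pair 0) \<subseteq> {0..<T} \<times> (UNIV :: (real^'n) set)" using T_pos by auto
  ultimately have "continuous_on UNIV (\<psi> 0)" using continuous_on_compose2[OF c, of UNIV "Pair 0"] by simp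
  then have pm: "\<psi> 0 \<in> borel_measurable (torus L)" by (intro measurable_torusI borel_measurable_continuous_onI)
  have rm: "rho 0 \<in> borel_measurable (torus L)" by (intro measurable_torusI) measurable
  have "(LINT x|torus L. rho 0 x * \<psi> 0 x) = (LINT x|torus L. \<rho>\<^sub>0 x * \<psi> 0 x)"
  proof (rule integral_cong_AE)
    have "AE x in torus L. rho 0 x = \<rho>\<^sub>0 x" by (rule rho_initial) (use assms in auto)
    then show "AE x in torus L. rho 0 x * \<psi> 0 x = \<rho>\<^sub>0 x * \<psi> 0 x" by eventually_elim simp
    show "(\<lambda>x. rho 0 x * \<psi> 0 x) \<in> borel_measurable (torus L)" using rm pm by simp
    have "\<rho>\<^sub>0 \<in> borel_measurable (torus L)" using \<rho>\<^sub>0 by (simp add: torus_Linf_def)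
    then show "(\<lambda>x. \<rho>\<^sub>0 x * \<psi> 0 x) \<in> borel_measurable (torus L)" using pm by (rule borel_measurable_times)
  qed
  then show "(LINT t|lebesgue_on {0<..<T}. LINT x|torus L. rho t x * deriv (\<lambda>s. \<psi> s x) t + rho t x * (vel t x \<bullet> grad (\<psi> t) x))
      + (LINT x|torus L. \<rho>\<^sub>0 x * \<psi> 0 x) = 0"
    using transport_equation[OF \<psi>] by simp
qed (fact spacetime_Linf_rho weakly_continuous_rho Linf_L2_vel divergence_free)+

text \<open>As soon as \<open>p > 0\<close>, the interface at height \<open>y = - 1/2\<close> lies at a positive \<open>x\<close>. The phase has changed
at \<open>x = sin\<^sup>2 p / 4\<close> and, as all inequalities there are strict, in a neighbourhood.\<close>

lemma moves_at_once:
  assumes u: "T - D < u"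
  obtains U where "open U" "U \<noteq> {}" "U \<subseteq> {T - D<..<u} \<times> torus_cell L"
    "\<And>t x. (t, x) \<in> U \<Longrightarrow> rho t x \<noteq> - sgn (zig (x $ k / (L / 4)))"
proof
  let ?a = "stage_angle \<phi> (tm 0) (tm (Suc 0))"
  let ?u = "min u (tm 1)"
  let ?cell = "box (\<chi> i. - L / 2) (\<chi> i. L / 2) :: (real^'n) set"
  let ?U = "{p. fst p \<in> {T - D<..<?u} \<and> snd p \<in> ?cell \<and> 0 < zig (snd p $ k / (L / 4)) \<and>
    phase (?a (fst p)) (zig (snd p $ k / (L / 4))) (zig (snd p $ j / len 1)) < 0}"
  interpret S: stage L "1 / real N" "axs 0" "axs (Suc 0)" "N ^ 0" "N ^ Suc 0" "len 0" "len (Suc 0)" \<phi> "tm 0" "tm (Suc 0)"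
    by (rule stage_n)
  have tm1: "T - D < tm 1" using tm_less[of 0] tm_0 by simp
  have len1: "0 < len 1" "len 1 < L" using L N by (auto simp: len_def field_simps)
  show "open ?U"
  proof -
    have "open {p :: real \<times> (real^'n). fst p \<in> {T - D<..<?u}}" by (rule open_vimage_fst[unfolded vimage_def]) simp
    moreover have "open {p :: real \<times> (real^'n). snd p \<in> ?cell}" by (rule open_vimage_snd[unfolded vimage_def]) (rule open_box)
    moreover have "open {p :: real \<times> (real^'n). 0 < zig (snd p $ k / (L / 4))}"
      using L by (intro open_Collect_less continuous_intros) auto
    moreover have "open {p :: real \<times> (real^'n). phase (?a (fst p)) (zig (snd p $ k / (L / 4))) (zig (snd p $ j / len 1)) < 0}"
      using len1(1) L
      by (intro open_Collect_less continuous_intros continuous_on_compose2[OF S.ang_cont, of UNIV]) auto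
    ultimately show ?thesis by (intro open_Collect_conj)
  qed
  show "?U \<noteq> {}"
  proof -
    define t where "t = (T - D + ?u) / 2"
    have t: "T - D < t" "t < ?u" using u tm1 by (auto simp: t_def)
    define s where "s = sin (?a t)"
    have "0 < ?a t" "?a t < pi / 2" using S.ang_inside(1,2)[of t] t tm_0 by auto
    then have s: "0 < s" "s \<le> 1" by (auto simp: s_def intro: sin_gt_zero)
    have s2: "0 < s\<^sup>2" "s\<^sup>2 \<le> 1" using s by (auto simp: power_le_one)
    define x :: "real^'n" where "x = (\<chi> i. if i = k then L * s\<^sup>2 / 16 else if i = j then - (len 1 / 2) else 0)"
    have xk: "x $ k / (L / 4) = s\<^sup>2 / 4" and xj: "x $ j / len 1 = - (1/2)" using kj L len1 by (auto simp: x_def)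
    have zk: "zig (s\<^sup>2 / 4) = s\<^sup>2 / 4" and zj: "zig (- (1/2)) = - (1/2)" using s2 by (intro zig_id; simp)+
    have Ls: "L * s\<^sup>2 \<le> L" using mult_left_mono[OF s2(2), of L] L by simp
    have "x \<in> ?cell"
      unfolding mem_box_cart
    proof
      fix i
      have "x $ i = L * s\<^sup>2 / 16 \<or> x $ i = - (len 1 / 2) \<or> x $ i = 0" by (simp add: x_def)
      moreover have "0 < L * s\<^sup>2" by (rule mult_pos_pos[OF L s2(1)])
      ultimately have "- L / 2 < x $ i \<and> x $ i < L / 2" using L len1 Ls by (elim disjE) linarith+
      then show "(\<chi> i. - L / 2) $ i < x $ i \<and> x $ i < (\<chi> i. L / 2) $ i" by simp
    qed
    moreover have "phase (?a t) (s\<^sup>2 / 4) (- (1/2)) < 0"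
    proof -
      have "(cos (?a t))\<^sup>2 + (- (1/2) * s)\<^sup>2 \<le> (cos (?a t))\<^sup>2 + s\<^sup>2" by (simp add: power_mult_distrib power2_eq_square)
      also have "\<dots> = 1" by (simp add: s_def)
      finally have "sqrt ((cos (?a t))\<^sup>2 + (- (1/2) * s)\<^sup>2) \<le> 1" by simp
      then have "s\<^sup>2 / 4 * sqrt ((cos (?a t))\<^sup>2 + (- (1/2) * s)\<^sup>2) \<le> s\<^sup>2 / 4 * 1" by (intro mult_left_mono) auto
      then show ?thesis using s2 unfolding phase_def s_def[symmetric] by linarith
    qed
    ultimately have "(t, x) \<in> ?U" using t s2 unfolding mem_Collect_eq fst_conv snd_conv xk xj zk zj by auto
    then show ?thesis by blast
  qed
  show "?U \<subseteq> {T - D<..<u} \<times> torus_cell L"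
    using box_subset_cbox[of "\<chi> i. - L / 2" "\<chi> i. L / 2 :: real^'n"] by (auto simp: torus_cell_def)
  fix t x assume "(t, x) \<in> ?U"
  then have h: "t < tm 1" "0 < zig (x $ k / (L / 4))" "phase (?a t) (zig (x $ k / (L / 4))) (zig (x $ j / len 1)) < 0" by auto
  have "idx t = 0" using h(1) by (intro idx_eq) auto
  then have "rho t x = 1" using h(3) by (simp add: rho_def R_def stage_rho_def axs_def len_def)
  then show "rho t x \<noteq> - sgn (zig (x $ k / (L / 4)))" using h(2) by simp
qed

end

section \<open>Infinitely many solutions in nearly minimal time\<close>

text \<open>While one solution still rests the other one already differs from the initial data on an open set.\<close>

lemma waiting_times_distinguish:
  assumes c1: "cascade L E T D1 k j N \<phi>" and c2: "cascade L E T D2 k j N \<phi>" and D: "D2 < D1" "D1 < T"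
  shows "\<not> (AE (t, x) in spacetime L T. cascade.rho L T D1 k j N \<phi> t x = cascade.rho L T D2 k j N \<phi> t x)"
proof
  let ?r1 = "cascade.rho L T D1 k j N \<phi>" and ?r2 = "cascade.rho L T D2 k j N \<phi>"
  assume ae: "AE (t, x) in spacetime L T. ?r1 t x = ?r2 t x"
  have "T - D1 < T - D2" using D by simp
  then obtain U where U: "open U" "U \<noteq> {}" "U \<subseteq> {T - D1<..<T - D2} \<times> torus_cell L"
    and ne: "\<And>t x. (t, x) \<in> U \<Longrightarrow> ?r1 t x \<noteq> - sgn (zig (x $ k / (L / 4)))"
    using cascade.moves_at_once[OF c1] by metis
  have r2: "?r2 t x = - sgn (zig (x $ k / (L / 4)))" if "t < T - D2" for t x
    using that by (intro cascade.rho_before[OF c2]) simp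
  have "{0<..<T} \<times> torus_cell L \<inter> space lebesgue \<in> sets (lebesgue :: (real \<times> (real^'n)) measure)"
  proof -
    have "{0<..<T} \<times> (torus_cell L :: (real^'n) set) \<in> sets (borel \<Otimes>\<^sub>M borel)" by simp
    then show ?thesis unfolding borel_prod by (intro sets_completionI_sets) simp
  qed
  from ae[unfolded spacetime_def AE_restrict_space_iff[OF this]]
  have "AE p in lebesgue. p \<notin> U"
  proof eventually_elim
    case (elim p)
    obtain t x where p: "p = (t, x)" by force
    show ?case
    proof
      assume pU: "p \<in> U"
      then have "t \<in> {T - D1<..<T - D2}" "x \<in> torus_cell L" using U(3) p by auto
      moreover have "D2 > 0" using c2 by (simp add: cascade_def)
      ultimately show False using elim ne[of t x] r2[of t x] pU p D by auto
    qed
  qed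
  moreover have "U \<in> sets lebesgue" using U(1) by simp
  ultimately have "negligible U" unfolding negligible_iff_null_sets by (subst AE_iff_null_sets)
  then show False using open_not_negligible[OF U(1,2)] by simp
qed

lemma clock_total_limit: "(\<lambda>N. A * clock_total (1 / real N) / (4 * (1 - 1 / real N))) \<longlonglongrightarrow> A * (sqrt (2/3) * pi) / 16"
proof -
  have "(\<lambda>N. A * (sqrt (2/3) * pi / 4 + 5 * (1 / real N) * pi) / (4 * (1 - 1 / real N)))
      \<longlonglongrightarrow> A * (sqrt (2/3) * pi / 4 + 5 * 0 * pi) / (4 * (1 - 0))"
    by (intro tendsto_intros lim_1_over_n) auto
  then show ?thesis by (simp add: clock_total_def)
qed

text \<open>The constant of the theorem is the limiting duration of \<open>clock_total_limit\<close> with \<open>A = sqrt (L^d) * L\<close>.\<close>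

lemma T0_hat_eq:
  assumes L: "L > 0" and E: "E > 0"
  shows "sqrt E * T0_hat E L d = sqrt (L ^ d) * L * (sqrt (2/3) * pi) / 16"
proof -
  have e: "sqrt E * E powr (- 1 / 2) = 1"
    using E powr_add[of E "1/2" "- 1 / 2"] by (simp add: powr_half_sqrt[symmetric])
  have l: "L powr ((real d + 2) / 2) = sqrt (L ^ d) * L"
  proof -
    have "L powr ((real d + 2) / 2) = L powr (real d / 2) * L powr 1" using L by (simp add: powr_add add_divide_distrib)
    also have "L powr (real d / 2) = (L powr real d) powr (1/2)" by (simp add: powr_powr)
    also have "\<dots> = sqrt (L ^ d)" using L by (simp add: powr_half_sqrt powr_realpow)
    finally show ?thesis using L by simp
  qed
  have n: "sqrt 2 / 4 / sqrt 48 = sqrt (2/3) / 16"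
  proof -
    have "sqrt 48 = sqrt (4\<^sup>2 * 3)" by simp
    also have "\<dots> = 4 * sqrt 3" unfolding real_sqrt_mult by simp
    finally show ?thesis by (simp add: real_sqrt_divide)
  qed
  have "sqrt E * T0_hat E L d = (sqrt E * E powr (- 1 / 2)) * (sqrt (L ^ d) * L) * pi * (sqrt 2 / 4 / sqrt 48)"
    by (simp add: T0_hat_def H_max_def l mult_ac)
  then show ?thesis unfolding e n by simp
qed

theorem theorem1p7:
  fixes L E \<epsilon> T :: real and k :: "'n::finite" and \<rho>\<^sub>0 :: "real ^ 'n \<Rightarrow> real"
  assumes "CARD('n) \<ge> 2" and "L > 0" and "E > 0" and "\<epsilon> > 0"
    and "torus_Linf L \<rho>\<^sub>0"
    and "\<And>x. x $ k \<in> {- L / 2<..<0} \<Longrightarrow> \<rho>\<^sub>0 x = 1"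
    and "\<And>x. x $ k \<in> {0<..<L / 2} \<Longrightarrow> \<rho>\<^sub>0 x = - 1"
    and "T = T0_hat E L CARD('n) + \<epsilon>"
  shows "\<exists>S :: ((real \<Rightarrow> real ^ 'n \<Rightarrow> real) \<times> (real \<Rightarrow> real ^ 'n \<Rightarrow> real ^ 'n)) set.
    infinite S \<and> pairwise (\<lambda>p q. \<not> same_solution L T p q) S \<and>
    (\<forall>(\<rho>, v)\<in>S.
       distributional_solution L T \<rho>\<^sub>0 \<rho> v \<and>
       Linf_L2_norm L T v \<le> sqrt E \<and>
       (AE (t, x) in spacetime L T. \<bar>\<rho> t x\<bar> = 1) \<and>
       ((\<lambda>t. Hminus1_norm L (\<rho> t)) \<longlongrightarrow> 0) (at_left T))"
proof -
  note L = \<open>L > 0\<close> and E = \<open>E > 0\<close> and \<epsilon> = \<open>\<epsilon> > 0\<close> and T = \<open>T = T0_hat E L CARD('n) + \<epsilon>\<close>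
  have "\<exists>j. j \<noteq> k"
  proof (rule ccontr)
    assume "\<not> ?thesis"
    then have "(UNIV :: 'n set) = {k}" by auto
    then have "CARD('n) = 1" by (metis card_1_singleton_iff One_nat_def)
    then show False using assms(1) by simp
  qed
  then obtain j where j: "k \<noteq> j" by metis
  define T0 where "T0 = T0_hat E L CARD('n)"
  define A where "A = sqrt (L ^ CARD('n)) * L"
  have A: "A > 0" using L by (simp add: A_def)
  have T0: "sqrt E * T0 = A * (sqrt (2/3) * pi) / 16" unfolding T0_def A_def by (rule T0_hat_eq[OF L E])
  have "0 < sqrt E * T0" unfolding T0 using A by simp
  then have T0_pos: "T0 > 0" using E by (simp add: zero_less_mult_iff)
  have "sqrt E * T0 < sqrt E * (T0 + \<epsilon> / 2)" using E \<epsilon> by simp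
  then have "\<forall>\<^sub>F N in sequentially. A * clock_total (1 / real N) / (4 * (1 - 1 / real N)) < sqrt E * (T0 + \<epsilon> / 2)"
    using order_tendstoD(2)[OF clock_total_limit[of A]] unfolding T0 by blast
  \<comment> \<open>In the limit of large \<open>N\<close> the duration \<open>T0\<close> suffices; half of \<open>\<epsilon>\<close> pays for a finite \<open>N\<close>.\<close>
  then obtain N where N: "N \<ge> 2" "A * clock_total (1 / real N) / (4 * (1 - 1 / real N)) < sqrt E * (T0 + \<epsilon> / 2)"
    using eventually_conj[OF _ eventually_ge_at_top[of 2]] eventually_happens'[OF sequentially_bot] by (metis (no_types, lifting))
  define q where "q = 1 / real N"
  have q: "0 < q" "q < 1" using N by (auto simp: q_def)
  have "\<exists>\<phi>. is_clock q \<phi>"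
    by (rule clock_exists[OF q(1)], unfold is_clock_def, rule exI, intro conjI allI impI) (assumption | blast)+
  then obtain \<phi> where \<phi>: "is_clock q \<phi>" by blast
  \<comment> \<open>The waiting times \<open>\<epsilon> / (4 * (m + 1))\<close> leave at least \<open>T0 + \<epsilon> / 2\<close> for the motion.\<close>
  define D where "D m = T - \<epsilon> / (4 * real (Suc m))" for m
  have D_less: "D m < D n" if "m < n" for m n
    using that \<epsilon> unfolding D_def by (simp add: frac_less2)
  have D: "T0 + \<epsilon> / 2 \<le> D m" "D m < T" for m
  proof -
    have "\<epsilon> / (4 * real (Suc m)) \<le> \<epsilon> / 4" using \<epsilon> by (intro divide_left_mono) auto
    then show "T0 + \<epsilon> / 2 \<le> D m" using \<epsilon> unfolding D_def T T0_def by linarith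
    show "D m < T" using \<epsilon> by (simp add: D_def)
  qed
  have cas: "cascade L E T (D m) k j N \<phi>" for m
  proof
    show "0 < D m" "D m \<le> T" using D[of m] T0_pos \<epsilon> by auto
    have "A * clock_total q / (4 * (1 - q)) \<le> sqrt E * D m"
    proof -
      have "sqrt E * (T0 + \<epsilon> / 2) \<le> sqrt E * D m" using D(1) E by (intro mult_left_mono) auto
      then show ?thesis using N(2) unfolding q_def by linarith
    qed
    then have "A * clock_total q / (4 * (1 - q)) / D m \<le> sqrt E" unfolding pos_divide_le_eq[OF \<open>0 < D m\<close>] .
    moreover have "0 \<le> A * clock_total q / (4 * (1 - q)) / D m"
      using A q clock_total_pos[OF q(1)] \<open>0 < D m\<close> by (intro divide_nonneg_pos mult_nonneg_nonneg) auto
    ultimately have "(A * clock_total q / (4 * (1 - q)) / D m)\<^sup>2 \<le> E" using E power_mono[of _ "sqrt E" 2] by fastforce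
    moreover have "A * clock_total q / (4 * (1 - q)) / D m = sqrt (L ^ CARD('n)) * (L * clock_total q / (4 * D m * (1 - q)))"
      by (simp add: A_def mult.assoc mult.left_commute)
    ultimately show "L ^ CARD('n) * (L * clock_total (1 / real N) / (4 * D m * (1 - 1 / real N)))\<^sup>2 \<le> E"
      using L by (simp only: power_mult_distrib q_def[symmetric]) simp
  qed (use L j N \<phi> E in \<open>auto simp: q_def\<close>)
  define sol where "sol m = (cascade.rho L T (D m) k j N \<phi>, cascade.vel L T (D m) k j N \<phi>)" for m
  have distinct: "\<not> same_solution L T (sol m) (sol n) \<and> \<not> same_solution L T (sol n) (sol m)" if "m < n" for m n
  proof -
    have *: "\<not> (AE (t, x) in spacetime L T. fst (sol n) t x = fst (sol m) t x)"
      unfolding sol_def fst_conv by (rule waiting_times_distinguish[OF cas cas D_less[OF that] D(2)])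
    show ?thesis
    proof (intro conjI notI)
      assume "same_solution L T (sol m) (sol n)"
      then have "AE (t, x) in spacetime L T. fst (sol n) t x = fst (sol m) t x"
        unfolding same_solution_def by eventually_elim auto
      then show False using * by blast
    next
      assume "same_solution L T (sol n) (sol m)"
      then have "AE (t, x) in spacetime L T. fst (sol n) t x = fst (sol m) t x"
        unfolding same_solution_def by eventually_elim auto
      then show False using * by blast
    qed
  qed
  have distinct': "\<not> same_solution L T (sol m) (sol n)" if "m \<noteq> n" for m n
    using distinct[of m n] distinct[of n m] that by (meson nat_neq_iff)
  have "inj sol"
  proof (rule injI, rule ccontr)
    fix m n assume "sol m = sol n" "m \<noteq> n"
    then show False using distinct'[of m n] by (simp add: same_solution_def)
  qed
  show ?thesis
  proof (intro exI[of _ "range sol"] conjI)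
    show "infinite (range sol)" using \<open>inj sol\<close> by (rule range_inj_infinite)
    show "pairwise (\<lambda>p q. \<not> same_solution L T p q) (range sol)"
      unfolding pairwise_def using distinct' by (metis imageE)
    have "distributional_solution L T \<rho>\<^sub>0 (fst (sol m)) (snd (sol m)) \<and> Linf_L2_norm L T (snd (sol m)) \<le> sqrt E \<and>
       (AE (t, x) in spacetime L T. \<bar>fst (sol m) t x\<bar> = 1) \<and> ((\<lambda>t. Hminus1_norm L (fst (sol m) t)) \<longlongrightarrow> 0) (at_left T)" for m
      unfolding sol_def fst_conv snd_conv
      using cascade.is_solution[OF cas assms(5,6,7)] cascade.Linf_L2_norm_vel[OF cas] cascade.AE_abs_rho[OF cas] cascade.Hminus1_tendsto[OF cas]
      by blast
    then show "\<forall>(\<rho>, v)\<in>range sol. distributional_solution L T \<rho>\<^sub>0 \<rho> v \<and> Linf_L2_norm L T v \<le> sqrt E \<and>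
       (AE (t, x) in spacetime L T. \<bar>\<rho> t x\<bar> = 1) \<and> ((\<lambda>t. Hminus1_norm L (\<rho> t)) \<longlongrightarrow> 0) (at_left T)"
      by (auto simp: case_prod_beta)
  qed
qed

end
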